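(* As $\delta\to0^+$, the acoustic scattering problem (P) in the structure $D=\bigcup_{j=1}^N D_j$ of $N$ concentric shells admits exactly $2N$ subwavelength resonant frequencies (eigenfrequencies), and they satisfy $$\omega_i^\pm(\delta)=\pm\,\delta^{1/2}\lambda_i^{1/2}v_{\mathrm r}\;-\;2\pi (r_1^+)^2\,\frac{\mathrm i\,\delta\, v_{\mathrm r}^2}{v}\;\mathbf a_i^T\mathbf E_1\mathbf a_i\;+\;O(\delta^{3/2}),\qquad i=1,2,\dots,N.$$
   Context: Geometry: fix $N\ge 1$ and radii $r_1^+>r_1^->r_2^+>r_2^->\dots>r_N^+>r_N^->0$. Let $D_j=\{x\in\mathbb R^3: r_j^-<|x|<r_j^+\}$, $D=\bigcup_{j=1}^N D_j$, $\Gamma_j^\pm=\{|x|=r_j^\pm\}$, and let $\nu=x/|x|$ be the normal on each $\Gamma_j^\pm$. $|D_j|$ is the volume of $D_j$. Parameters: $v>0$ and $v_{\mathrm r}>0$ are wave speeds (in the host medium $\mathbb R^3\setminus D$ and in $D$, respectively), held fixed as $\delta\to0$; $\delta>0$ is the density contrast; $k=\omega/v$, $k_{\mathrm r}=\omega/v_{\mathrm r}$. Scattering problem (P): given an incoming wave $u^{in}$, find $u$ with $\Delta u+\frac{\omega^2}{v^2}u=0$ in $\mathbb R^3\setminus \overline D$; $\Delta u+\frac{\omega^2}{v_{\mathrm r}^2}u=0$ in $D$; $u|_+=u|_-$ on all $\Gamma_j^\pm$; $\delta\,\partial_\nu u|_+=\partial_\nu u|_-$ on $\Gamma_j^+$;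 $\partial_\nu u|_+=\delta\,\partial_\nu u|_-$ on $\Gamma_j^-$ ($j=1,\dots,N$; subscripts $+$, $-$ denote limits from outside and from inside the sphere); and $u-u^{in}$ is outgoing, i.e. satisfies the Sommerfeld radiation condition with wavenumber $k$. For complex $\omega\neq0$, outgoing means that in $|x|>r_1^+$ the function is an expansion in $h_n^{(1)}(k|x|)Y_n^m(x/|x|)$, where $h_n^{(1)}$ are the spherical Hankel functions of the first kind. A subwavelength resonant frequency (eigenfrequency) is $\omega=\omega(\delta)\in\mathbb C$ such that (i) for $u^{in}=0$ problem (P) has a nontrivial solution, and (ii) $\omega$ depends continuously on $\delta$ and $\omega(\delta)\to0$ as $\delta\to0$. Capacitance matrix: $\mathcal C$ is the symmetric tridiagonal $N\times N$ matrix $$\mathcal C_{ij}=-c_{j-1}\delta_{i,j-1}+(c_{j-1}+c_j)\delta_{i,j}-c_j\delta_{i,j+1},\quad c_j=4\pi\frac{r_j^-r_{j+1}^+}{r_j^--r_{j+1}^+}\ (1\le j\le N-1),\ c_0=4\pi r_1^+,\ c_N=0$$ ($\delta_{i,j}$ with subscripts is the Kronecker delta). Put $\mathbf V=\mathrm{diag}(|D_1|,\dots,|D_N|)$, $\mathbf E_1=\mathrm{diag}(1,0,\dots,0)$. The numbers $0<\lambda_1<\dots<\lambda_N$ and vectors $\mathbf a_1,\dots,\mathbf a_N\in\mathbb R^N$ are the eigenvalues and eigenvectors of the generalized problem $\mathcal C\mathbf a_i=\lambda_i\mathbf V\mathbf a_i$, normalized by $\mathbf a_i^T\mathbf V\mathbf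 a_j=\delta_{i,j}$. *)

theory Defs
  imports
    "HOL-Analysis.Analysis"
    "HOL-Library.Landau_Symbols"
    "HOL-Computational_Algebra.Polynomial"
    "Jordan_Normal_Form.Matrix"
begin

no_notation Matrix.vec_index (infixl \<open>$\<close> 100)
no_notation inner (infix \<open>\<bullet>\<close> 70)

section \<open>Geometry\<close>

text \<open>The shells are numbered \<open>1, \<dots>, N\<close> from the outside inwards; \<open>rp j\<close> and \<open>rm j\<close> stand for
  \<open>r\<^sub>j\<^sup>+\<close> and \<open>r\<^sub>j\<^sup>-\<close>. Values of \<open>rp\<close> and \<open>rm\<close> outside \<open>{1..N}\<close> are never used.\<close>

definition nested_radii :: "nat \<Rightarrow> (nat \<Rightarrow> real) \<Rightarrow> (nat \<Rightarrow> real) \<Rightarrow> bool" where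
  "nested_radii N rp rm \<longleftrightarrow>
     (\<forall>j\<in>{1..N}. 0 < rm j \<and> rm j < rp j) \<and> (\<forall>j\<in>{1..<N}. rp (j + 1) < rm j)"

definition shell :: "(nat \<Rightarrow> real) \<Rightarrow> (nat \<Rightarrow> real) \<Rightarrow> nat \<Rightarrow> (real^3) set" where
  "shell rp rm j = {x. rm j < norm x \<and> norm x < rp j}"

definition resonator :: "nat \<Rightarrow> (nat \<Rightarrow> real) \<Rightarrow> (nat \<Rightarrow> real) \<Rightarrow> (real^3) set" where
  "resonator N rp rm = (\<Union>j\<in>{1..N}. shell rp rm j)"


section \<open>The Helmholtz equation and transmission conditions\<close>

definition partial_deriv :: "real^3 \<Rightarrow> (real^3 \<Rightarrow> complex) \<Rightarrow> real^3 \<Rightarrow> complex" where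
  "partial_deriv b u x = frechet_derivative u (at x) b"

definition C2_on :: "(real^3) set \<Rightarrow> (real^3 \<Rightarrow> complex) \<Rightarrow> bool" where
  "C2_on S u \<longleftrightarrow>
     (\<forall>x\<in>S. u differentiable (at x)) \<and>
     (\<forall>b\<in>Basis. \<forall>x\<in>S. partial_deriv b u differentiable (at x)) \<and>
     (\<forall>b\<in>Basis. \<forall>c\<in>Basis. continuous_on S (partial_deriv c (partial_deriv b u)))"

definition laplacian :: "(real^3 \<Rightarrow> complex) \<Rightarrow> real^3 \<Rightarrow> complex" where
  "laplacian u x = (\<Sum>b\<in>Basis. partial_deriv b (partial_deriv b u) x)"

definition helmholtz_on :: "(real^3) set \<Rightarrow> complex \<Rightarrow> (real^3 \<Rightarrow> complex) \<Rightarrow> bool" where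
  "helmholtz_on S k u \<longleftrightarrow> C2_on S u \<and> (\<forall>x\<in>S. laplacian u x + k\<^sup>2 * u x = 0)"

definition normal_deriv :: "(real^3 \<Rightarrow> complex) \<Rightarrow> real^3 \<Rightarrow> complex" where
  "normal_deriv u x = frechet_derivative u (at x) (x /\<^sub>R norm x)"

text \<open>The limits from outside and from inside the sphere of radius \<open>\<rho>\<close> are unrestricted limits
  \<open>x \<rightarrow> y\<close> in \<open>|x| > \<rho>\<close> and in \<open>|x| < \<rho>\<close>, not merely limits along the radius through \<open>y\<close>. As they
  are required at every \<open>y\<close> of the sphere, \<open>u\<close> and its normal derivative extend continuously up
  to the sphere from either side. (Purely radial limits would admit spurious solutions.)\<close>

definition outer_trace :: "real \<Rightarrow> (real^3 \<Rightarrow> complex) \<Rightarrow> real^3 \<Rightarrow> complex \<Rightarrow> bool" where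
  "outer_trace \<rho> f y l \<longleftrightarrow> (f \<longlongrightarrow> l) (at y within {x. \<rho> < norm x})"

definition inner_trace :: "real \<Rightarrow> (real^3 \<Rightarrow> complex) \<Rightarrow> real^3 \<Rightarrow> complex \<Rightarrow> bool" where
  "inner_trace \<rho> f y l \<longleftrightarrow> (f \<longlongrightarrow> l) (at y within {x. norm x < \<rho>})"

text \<open>\<open>transmission \<rho> \<alpha> \<beta> u\<close>: on the sphere of radius \<open>\<rho>\<close>, \<open>u|\<^sub>+ = u|\<^sub>-\<close> and
  \<open>\<alpha> \<partial>\<^sub>\<nu> u|\<^sub>+ = \<beta> \<partial>\<^sub>\<nu> u|\<^sub>-\<close>.\<close>

definition transmission :: "real \<Rightarrow> real \<Rightarrow> real \<Rightarrow> (real^3 \<Rightarrow> complex) \<Rightarrow> bool" where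
  "transmission \<rho> \<alpha> \<beta> u \<longleftrightarrow> (\<forall>y\<in>sphere 0 \<rho>.
     (\<exists>l. outer_trace \<rho> u y l \<and> inner_trace \<rho> u y l) \<and>
     (\<exists>p q. outer_trace \<rho> (normal_deriv u) y p \<and> inner_trace \<rho> (normal_deriv u) y q \<and>
            complex_of_real \<alpha> * p = complex_of_real \<beta> * q))"


section \<open>Outgoing functions\<close>

text \<open>\<open>h\<^sub>n\<^sup>(\<^sup>1\<^sup>)(z) = (-i)\<^sup>n\<^sup>+\<^sup>1 e\<^sup>i\<^sup>z/z \<Sum>\<^sub>l\<^sub>\<le>\<^sub>n (n+l)!/(l! (n-l)!) (i/(2z))\<^sup>l\<close>,
  so that \<open>h\<^sub>0\<^sup>(\<^sup>1\<^sup>)(z) = e\<^sup>i\<^sup>z/(iz)\<close> (DLMF 10.49.6). To be used for \<open>z \<noteq> 0\<close> only.\<close>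

definition spherical_hankel1 :: "nat \<Rightarrow> complex \<Rightarrow> complex" where
  "spherical_hankel1 n z = (- \<i>) ^ (n + 1) * exp (\<i> * z) / z *
     (\<Sum>l\<le>n. fact (n + l) / (fact l * fact (n - l)) * (\<i> / (2 * z)) ^ l)"

text \<open>Rodrigues' formula.\<close>

definition legendre_poly :: "nat \<Rightarrow> real poly" where
  "legendre_poly n = Polynomial.smult (1 / (2 ^ n * fact n)) ((pderiv ^^ n) ([:- 1, 0, 1:] ^ n))"

text \<open>\<open>Y\<^sub>n\<^sup>m\<close>, for \<open>|m| \<le> n\<close>, as a function on the unit sphere. At
  \<open>x = (sin \<theta> cos \<phi>, sin \<theta> sin \<phi>, cos \<theta>)\<close>, the factor \<open>(x\<^sub>1 \<plusminus> i x\<^sub>2)\<^bsup>|m|\<^esup>\<close> equals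
  \<open>(sin \<theta>)\<^bsup>|m|\<^esup> e\<^bsup>im\<phi>\<^esup>\<close>, and its product with the \<open>|m|\<close>-th derivative of the Legendre polynomial is
  the associated Legendre function of \<open>cos \<theta>\<close> times \<open>e\<^bsup>im\<phi>\<^esup>\<close> (without Condon-Shortley phase).
  The first factor makes the family orthonormal in \<open>L\<^sup>2\<close> of the unit sphere.\<close>

definition spherical_harmonic :: "nat \<Rightarrow> int \<Rightarrow> real^3 \<Rightarrow> complex" where
  "spherical_harmonic n m x =
     complex_of_real (sqrt ((2 * real n + 1) / (4 * pi) *
                            (fact (n - nat \<bar>m\<bar>) / fact (n + nat \<bar>m\<bar>)))) *
     Complex (x $ 1) (of_int (sgn m) * x $ 2) ^ nat \<bar>m\<bar> *
     complex_of_real (poly ((pderiv ^^ nat \<bar>m\<bar>) (legendre_poly n)) (x $ 3))"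

text \<open>Outgoing with wavenumber \<open>k \<noteq> 0\<close> outside the ball of radius \<open>R\<close>. The expansion converges
  uniformly on compact sets, as it does for real \<open>k > 0\<close> and Sommerfeld's radiation condition.\<close>

definition outgoing :: "complex \<Rightarrow> real \<Rightarrow> (real^3 \<Rightarrow> complex) \<Rightarrow> bool" where
  "outgoing k R w \<longleftrightarrow> (\<exists>c :: nat \<Rightarrow> int \<Rightarrow> complex.
     \<forall>K. compact K \<and> K \<subseteq> {x. R < norm x} \<longrightarrow>
       uniform_limit K
         (\<lambda>M x. \<Sum>n<M. \<Sum>m\<in>{- int n..int n}.
            c n m * spherical_hankel1 n (k * complex_of_real (norm x)) *
            spherical_harmonic n m (x /\<^sub>R norm x))
         w sequentially)"


section \<open>The scattering problem and its subwavelength resonances\<close>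

text \<open>For the problem with frequency \<open>\<omega>\<close>, contrast \<open>\<delta>\<close> and incoming wave \<open>uin\<close>.\<close>

definition scattering_solution ::
  "nat \<Rightarrow> (nat \<Rightarrow> real) \<Rightarrow> (nat \<Rightarrow> real) \<Rightarrow> real \<Rightarrow> real \<Rightarrow> real \<Rightarrow> complex \<Rightarrow>
   (real^3 \<Rightarrow> complex) \<Rightarrow> (real^3 \<Rightarrow> complex) \<Rightarrow> bool" where
  "scattering_solution N rp rm v vr \<delta> \<omega> uin u \<longleftrightarrow>
     helmholtz_on (- closure (resonator N rp rm)) (\<omega> / complex_of_real v) u \<and>
     helmholtz_on (resonator N rp rm) (\<omega> / complex_of_real vr) u \<and>
     (\<forall>j\<in>{1..N}. transmission (rp j) \<delta> 1 u \<and> transmission (rm j) 1 \<delta> u) \<and>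
     outgoing (\<omega> / complex_of_real v) (rp 1) (\<lambda>x. u x - uin x)"

text \<open>The values of \<open>u\<close> on the interfaces are not constrained by the scattering problem, so that
  nontriviality is only measured off the interfaces.\<close>

definition eigenfrequency ::
  "nat \<Rightarrow> (nat \<Rightarrow> real) \<Rightarrow> (nat \<Rightarrow> real) \<Rightarrow> real \<Rightarrow> real \<Rightarrow> real \<Rightarrow> complex \<Rightarrow> bool" where
  "eigenfrequency N rp rm v vr \<delta> \<omega> \<longleftrightarrow> \<omega> \<noteq> 0 \<and>
     (\<exists>u. scattering_solution N rp rm v vr \<delta> \<omega> (\<lambda>x. 0) u \<and>
          (\<exists>x \<in> resonator N rp rm \<union> - closure (resonator N rp rm). u x \<noteq> 0))"

text \<open>Only the behaviour of \<open>w\<close> near \<open>0\<^sup>+\<close> matters: subwavelength resonant frequencies which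
  coincide for all small \<open>\<delta> > 0\<close> are to be identified.\<close>

definition subwavelength_resonant_frequency ::
  "nat \<Rightarrow> (nat \<Rightarrow> real) \<Rightarrow> (nat \<Rightarrow> real) \<Rightarrow> real \<Rightarrow> real \<Rightarrow> (real \<Rightarrow> complex) \<Rightarrow> bool" where
  "subwavelength_resonant_frequency N rp rm v vr w \<longleftrightarrow>
     (\<exists>\<delta>\<^sub>0>0. continuous_on {0<..<\<delta>\<^sub>0} w \<and>
             (\<forall>\<delta>\<in>{0<..<\<delta>\<^sub>0}. eigenfrequency N rp rm v vr \<delta> (w \<delta>))) \<and>
     (w \<longlongrightarrow> 0) (at_right 0)"


section \<open>The capacitance matrix\<close>

definition capacitance_coeff :: "nat \<Rightarrow> (nat \<Rightarrow> real) \<Rightarrow> (nat \<Rightarrow> real) \<Rightarrow> nat \<Rightarrow> real" where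
  "capacitance_coeff N rp rm j =
     (if j = 0 then 4 * pi * rp 1
      else if j < N then 4 * pi * (rm j * rp (j + 1) / (rm j - rp (j + 1)))
      else 0)"

text \<open>Indices of type \<^typ>\<open>'a mat\<close> start at \<open>0\<close>: row \<open>i\<close> of the following matrices belongs to
  the shell \<open>i + 1\<close>.\<close>

definition capacitance_matrix :: "nat \<Rightarrow> (nat \<Rightarrow> real) \<Rightarrow> (nat \<Rightarrow> real) \<Rightarrow> real Matrix.mat" where
  "capacitance_matrix N rp rm =
     (let c = capacitance_coeff N rp rm;
          entry = (\<lambda>i j. - c (j - 1) * (if i = j - 1 then 1 else 0)
                         + (c (j - 1) + c j) * (if i = j then 1 else 0)
                         - c j * (if i = j + 1 then 1 else 0))
      in Matrix.mat N N (\<lambda>(i, j). entry (i + 1) (j + 1)))"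

definition volume_matrix :: "nat \<Rightarrow> (nat \<Rightarrow> real) \<Rightarrow> (nat \<Rightarrow> real) \<Rightarrow> real Matrix.mat" where
  "volume_matrix N rp rm =
     Matrix.mat N N (\<lambda>(i, j). if i = j then measure lborel (shell rp rm (i + 1)) else 0)"

definition E1_matrix :: "nat \<Rightarrow> real Matrix.mat" where
  "E1_matrix N = Matrix.mat N N (\<lambda>(i, j). if i = 0 \<and> j = 0 then 1 else 0)"

end

theory Submission
  imports Defs
begin

text \<open>A resonance is a frequency with a nontrivial outgoing solution and no incoming wave. For
  small frequencies such a solution must be radial, which turns (P) into one scalar equation; the
  zeros of that equation are then expanded in \<delta>.

  Radial symmetry. Let u be a resonant solution, R a rotation about a coordinate axis, and w = u o R
  - u. Then w is again an outgoing solution, and its integral over every circle about that axis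
  vanishes, so Wirtinger's inequality bounds w on each sphere by its angular derivative. At low
  frequency the angular energy beats the zeroth-order term of the Helmholtz equation. Hence the real
  part of the flux of w, weighted with the density (1 in the shells, \<delta> in the host),
  increases with the radius; it starts from 0 at the centre and is continuous across the interfaces
  by the transmission conditions. Outside the structure |h_n(kr)| decreases in r for small |k| r,
  for all n at once, so the mean square of w decreases and the flux is at most 0. Thus the flux
  vanishes and w = 0 (\<open>wirtinger_sphere\<close>, \<open>energy_rigidity\<close>,
  \<open>hankel_antimono\<close>, \<open>solution_radial\<close>). Only moduli of the wavenumbers
  enter, so complex \<omega> is covered.

  Reduction. For radial u the state (u, r^2 u') is carried from interface to interface by explicit
  2x2 transfer matrices. Matching with e^{ikr}/r at the outermost sphere gives the equation
  \<open>char_fun\<close> = 0, which is necessary for a resonance of small frequency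
  (\<open>eigenfrequency_char\<close>) and sufficient for every nonzero \<omega>
  (\<open>char_eigenfrequency\<close>).

  Asymptotics. Put \<lambda> = \<omega>^2 / (\<delta> vr^2). As \<delta> tends to 0 with \<lambda>
  fixed, a host layer changes the value in proportion to the flux and keeps the flux, while a shell
  keeps the value and lowers the flux by \<lambda> times a multiple of its volume times the value.
  This is the three-term recursion of the capacitance eigenproblem, so the limit equation is a
  polynomial \<open>char_poly0\<close> of degree at most N that vanishes at the N numbers
  \<lambda>_i, hence only there (\<open>eigenvector_limit_polys\<close>). A discrete Wronskian
  identity together with the normalization of a_i shows that these roots are simple and expresses
  the derivative there through a_i^T E_1 a_i (\<open>limit_polys_wronskian\<close>,
  \<open>eigenpair_char_poly0\<close>). In the variables \<mu> = \<omega> / sqrt \<delta> and e =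
  sqrt \<delta> the equation is regular down to e = 0, and every root \<mu> of the limit continues
  as a branch \<mu> + e \<nu> + O(e^2) (\<open>scaled_char_structure\<close>,
  \<open>simple_root_branch\<close>). The coefficient \<nu> comes from the radiation term, and
  multiplication by e yields the expansion.

  Completeness. If w is a subwavelength resonant frequency, then w / sqrt \<delta> cannot be
  unbounded: with \<lambda> large and \<delta> \<lambda> small the flux component dominates
  \<open>char_fun\<close> (\<open>char_fun_nonzero_at_infinity\<close>). By compactness w / sqrt
  \<delta> ends up in small discs about the limit roots (\<open>resonances_trapped\<close>), by
  continuity in a single disc (\<open>connected_in_one_ball\<close>), and the root in that disc is
  unique, so w eventually coincides with one of the 2N branches.\<close>

section \<open>Means over the unit sphere\<close>

definition unit_annulus :: "(real^3) set" where
  "unit_annulus = {y. 1 \<le> norm y \<and> norm y \<le> 2}"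

text \<open>This is \<open>annvol\<close> / (4 pi) times the surface integral over the unit sphere,
  written as a volume integral of the radially constant extension. Integrability, positivity and
  rotation invariance are thereby inherited from Lebesgue measure.\<close>

definition smean :: "(real^3 \<Rightarrow> complex) \<Rightarrow> complex" where
  "smean f = (LINT y|lborel. indicator unit_annulus y *\<^sub>R f (y /\<^sub>R norm y))"

abbreviation S2 :: "(real^3) set" where "S2 \<equiv> sphere 0 1"

lemma compact_unit_annulus: "compact unit_annulus"
proof -
  have "unit_annulus = cball 0 2 - ball 0 1"
    by (auto simp: unit_annulus_def)
  then show ?thesis by (metis compact_cball compact_diff open_ball)
qed

lemma unit_annulus_radial: "y \<in> unit_annulus \<Longrightarrow> y /\<^sub>R norm y \<in> S2"
  by (auto simp: unit_annulus_def)
     (metis left_inverse norm_eq_zero norm_zero not_one_le_zero)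

lemma smean_integrable:
  fixes f :: "real^3 \<Rightarrow> complex"
  assumes "continuous_on S2 f"
  shows "integrable lborel (\<lambda>y. indicator unit_annulus y *\<^sub>R f (y /\<^sub>R norm y))"
proof -
  have "continuous_on unit_annulus (\<lambda>y. f (y /\<^sub>R norm y))"
    by (rule continuous_on_compose2[OF assms])
       (auto intro!: continuous_intros unit_annulus_radial simp: unit_annulus_def simp del: mem_sphere_0)
  from borel_integrable_compact[OF compact_unit_annulus this] show ?thesis .
qed

lemma smean_cong:
  assumes "\<And>y. y \<in> S2 \<Longrightarrow> f y = g y"
  shows "smean f = smean g"
  unfolding smean_def
  by (rule Bochner_Integration.integral_cong) (use assms unit_annulus_radial in \<open>auto simp: indicator_def simp del: mem_sphere_0\<close>)

lemma smean_add:
  assumes "continuous_on S2 f" "continuous_on S2 g"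
  shows "smean (\<lambda>y. f y + g y) = smean f + smean g"
  unfolding smean_def
  by (simp add: scaleR_right_distrib Bochner_Integration.integral_add[OF smean_integrable[OF assms(1)] smean_integrable[OF assms(2)]])

lemma smean_diff:
  assumes "continuous_on S2 f" "continuous_on S2 g"
  shows "smean (\<lambda>y. f y - g y) = smean f - smean g"
  unfolding smean_def
  by (simp add: scaleR_right_diff_distrib Bochner_Integration.integral_diff[OF smean_integrable[OF assms(1)] smean_integrable[OF assms(2)]])

lemma smean_cmult: "smean (\<lambda>y. c * f y) = c * smean f"
proof -
  have "smean (\<lambda>y. c * f y) = (LINT y|lborel. c * (indicator unit_annulus y *\<^sub>R f (y /\<^sub>R norm y)))"
    unfolding smean_def by (rule Bochner_Integration.integral_cong) auto
  also have "\<dots> = c * smean f" unfolding smean_def by (rule Bochner_Integration.integral_mult_right_zero)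
  finally show ?thesis .
qed

lemma smean_sum:
  assumes "\<And>i. i \<in> I \<Longrightarrow> continuous_on S2 (f i)"
  shows "smean (\<lambda>y. \<Sum>i\<in>I. f i y) = (\<Sum>i\<in>I. smean (f i))"
  unfolding smean_def
  by (simp add: scaleR_sum_right Bochner_Integration.integral_sum smean_integrable[OF assms])

definition annvol :: real where "annvol = measure lborel unit_annulus"

lemma annvol_pos: "annvol > 0"
proof -
  have "\<exists>c. ball c (1/4) \<subseteq> unit_annulus"
  proof (intro exI[of _ "(3/2) *\<^sub>R axis 1 1 :: real^3"] subsetI)
    fix y :: "real^3" assume "y \<in> ball ((3/2) *\<^sub>R axis 1 1) (1/4)"
    then have "norm ((3/2) *\<^sub>R axis 1 1 - y) < 1/4" by (simp add: dist_norm)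
    moreover have "norm ((3/2) *\<^sub>R axis 1 1 :: real^3) = 3/2" by (simp add: norm_axis_1)
    moreover have "norm ((3/2) *\<^sub>R axis 1 1 :: real^3) \<le> norm ((3/2) *\<^sub>R axis 1 1 - y) + norm y"
      using norm_triangle_sub[of "(3/2) *\<^sub>R axis 1 1 :: real^3" y] by simp
    moreover have "norm y \<le> norm ((3/2) *\<^sub>R axis 1 1 :: real^3) + norm ((3/2) *\<^sub>R axis 1 1 - y)"
      using norm_triangle_sub[of y "(3/2) *\<^sub>R axis 1 1 :: real^3"] by (simp add: norm_minus_commute)
    ultimately show "y \<in> unit_annulus" by (simp add: unit_annulus_def)
  qed
  then obtain c where c: "ball c (1/4) \<subseteq> unit_annulus" ..
  have "0 < measure lborel (ball c (1/4))"
    using content_ball_pos[of "1/4" c] by simp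
  also have "\<dots> \<le> annvol" unfolding annvol_def
    using c emeasure_compact_finite[OF compact_unit_annulus] compact_unit_annulus
    by (intro measure_mono_fmeasurable) (auto simp: fmeasurable_def borel_compact)
  finally show ?thesis .
qed

lemma smean_const: "smean (\<lambda>_. c) = of_real annvol * c"
proof -
  have "smean (\<lambda>_. c) = measure lborel unit_annulus *\<^sub>R c"
    unfolding smean_def
    using emeasure_compact_finite[OF compact_unit_annulus] compact_unit_annulus
    by (simp add: borel_compact)
  then show ?thesis by (simp add: annvol_def scaleR_conv_of_real)
qed

lemma smean_of_real: "smean (\<lambda>y. of_real (f y)) = of_real (LINT y|lborel. indicator unit_annulus y * f (y /\<^sub>R norm y))"
  unfolding smean_def
  by (subst integral_complex_of_real[symmetric]) (auto intro!: Bochner_Integration.integral_cong simp: scaleR_conv_of_real)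

lemma smean_Re:
  assumes "continuous_on S2 f"
  shows "Re (smean f) = (LINT y|lborel. indicator unit_annulus y * Re (f (y /\<^sub>R norm y)))"
  unfolding smean_def
  using integral_Re[OF smean_integrable[OF assms]] by simp

lemma smean_Re_mono:
  assumes "continuous_on S2 f" "continuous_on S2 g" "\<And>y. y \<in> S2 \<Longrightarrow> Re (f y) \<le> Re (g y)"
  shows "Re (smean f) \<le> Re (smean g)"
  unfolding smean_Re[OF assms(1)] smean_Re[OF assms(2)]
proof (rule integral_mono)
  show "integrable lborel (\<lambda>y. indicator unit_annulus y * Re (f (y /\<^sub>R norm y)))"
    using integrable_Re[OF smean_integrable[OF assms(1)]] by simp
  show "integrable lborel (\<lambda>y. indicator unit_annulus y * Re (g (y /\<^sub>R norm y)))"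
    using integrable_Re[OF smean_integrable[OF assms(2)]] by simp
qed (auto simp: indicator_def intro!: assms(3) unit_annulus_radial)

lemma smean_Re_nonneg:
  assumes "continuous_on S2 f" "\<And>y. y \<in> S2 \<Longrightarrow> 0 \<le> Re (f y)"
  shows "0 \<le> Re (smean f)"
  using smean_Re_mono[of "\<lambda>_. 0" f] assms by (simp add: smean_def)

lemma smean_cnj: "smean (\<lambda>y. cnj (f y)) = cnj (smean f)"
  unfolding smean_def by (subst Bochner_Integration.integral_cnj[symmetric]) simp

lemma smean_norm_le:
  assumes "continuous_on S2 f" "\<And>y. y \<in> S2 \<Longrightarrow> norm (f y) \<le> B"
  shows "norm (smean f) \<le> B * annvol"
proof -
  have "norm (smean f) \<le> (LINT y|lborel. indicator unit_annulus y *\<^sub>R B)"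
    unfolding smean_def
  proof (rule Bochner_Integration.integral_norm_bound_integral[OF smean_integrable[OF assms(1)]])
    show "integrable lborel (\<lambda>y. indicator unit_annulus y *\<^sub>R B)"
      by (rule borel_integrable_compact[OF compact_unit_annulus]) simp
  qed (auto simp: indicator_def intro!: assms(2) unit_annulus_radial)
  also have "\<dots> = annvol *\<^sub>R B" unfolding annvol_def
    using emeasure_compact_finite[OF compact_unit_annulus] compact_unit_annulus
    by (simp add: borel_compact)
  finally show ?thesis by (simp add: mult.commute)
qed

text \<open>If \<open>f y\<close> were nonzero, continuity would keep |f|^2 above half its value
  near \<open>y\<close> on the sphere. The truncated cone over that neighbourhood is open and
  nonempty, hence of positive volume, and the mean would be positive.\<close>

lemma smean_zero_imp:
  assumes f: "continuous_on S2 f" and z: "smean (\<lambda>y. of_real ((norm (f y))\<^sup>2)) = 0" and y: "y \<in> S2"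
  shows "f y = 0"
proof (rule ccontr)
  assume ne: "f y \<noteq> 0"
  define g where "g = (\<lambda>y. (norm (f y))\<^sup>2)"
  have cg: "continuous_on S2 g" unfolding g_def by (intro continuous_intros f)
  have gy: "g y > 0" using ne by (simp add: g_def)
  have "\<exists>d>0. \<forall>x\<in>S2. dist x y < d \<longrightarrow> dist (g x) (g y) < g y / 2"
    using cg[unfolded continuous_on_iff, rule_format, OF y half_gt_zero[OF gy]] by simp
  then obtain d where d: "d > 0" and d': "\<And>x. x \<in> S2 \<Longrightarrow> dist x y < d \<Longrightarrow> dist (g x) (g y) < g y / 2"
    by blast
  have d2: "g x \<ge> g y / 2" if "x \<in> S2" "dist x y < d" for x
    using d'[OF that] by (simp add: dist_real_def abs_if split: if_splits)
  define A where "A = {x. 1 < norm x \<and> norm x < 2 \<and> dist (x /\<^sub>R norm x) y < d}"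
  have "open A"
  proof -
    have "open {x::real^3. 1 < norm x \<and> norm x < 2}"
      by (intro open_Collect_conj open_Collect_less continuous_intros)
    moreover have "continuous_on {x::real^3. 1 < norm x \<and> norm x < 2} (\<lambda>x. x /\<^sub>R norm x)"
      by (auto intro!: continuous_intros)
    ultimately have "open ((\<lambda>x. x /\<^sub>R norm x) -` ball y d \<inter> {x::real^3. 1 < norm x \<and> norm x < 2})"
      by (simp add: continuous_on_open_vimage)
    also have "(\<lambda>x. x /\<^sub>R norm x) -` ball y d \<inter> {x::real^3. 1 < norm x \<and> norm x < 2} = A"
      by (auto simp: A_def dist_commute)
    finally show ?thesis .
  qed
  moreover have "A \<noteq> {}"
  proof -
    have "(3/2) *\<^sub>R y \<in> A" using y d by (auto simp: A_def)
    then show ?thesis by blast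
  qed
  ultimately have pos: "measure lborel A > 0"
  proof -
    assume A: "open A" "A \<noteq> {}"
    then obtain c where "c \<in> A" by blast
    with A obtain e where ce: "e > 0" "ball c e \<subseteq> A" by (meson openE)
    have bA: "bounded A" by (rule boundedI[of _ 2]) (auto simp: A_def)
    have "0 < measure lborel (ball c e)"
      using content_ball_pos[OF ce(1)] by simp
    also have "\<dots> \<le> measure lborel A"
      using ce A emeasure_bounded_finite[OF bA] by (intro measure_mono_fmeasurable) (auto simp: fmeasurable_def)
    finally show ?thesis .
  qed
  have Ab: "A \<in> sets borel" using \<open>open A\<close> by simp
  have bA: "bounded A" by (rule boundedI[of _ 2]) (auto simp: A_def)
  have "measure lborel A * (g y / 2) = (LINT x|lborel. indicator A x *\<^sub>R (g y / 2))"
    using Ab emeasure_bounded_finite[OF bA] by simp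
  also have "\<dots> \<le> (LINT x|lborel. indicator unit_annulus x * g (x /\<^sub>R norm x))"
  proof (rule integral_mono)
    show "integrable lborel (\<lambda>x. indicator A x *\<^sub>R (g y / 2))"
      using Ab emeasure_bounded_finite[OF bA] by auto
    have "continuous_on S2 (\<lambda>x. complex_of_real (g x))" by (intro continuous_intros cg)
    from integrable_Re[OF smean_integrable[OF this]]
    show "integrable lborel (\<lambda>x. indicator unit_annulus x * g (x /\<^sub>R norm x))" by simp
    show "indicator A x *\<^sub>R (g y / 2) \<le> indicator unit_annulus x * g (x /\<^sub>R norm x)" for x
    proof (cases "x \<in> A")
      case True
      then have "x \<in> unit_annulus" by (auto simp: A_def unit_annulus_def)
      with True show ?thesis using d2[OF unit_annulus_radial[of x]] by (auto simp: A_def)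
    next
      case False
      then show ?thesis by (auto simp: indicator_def g_def)
    qed
  qed
  also have "\<dots> = 0"
    using z unfolding smean_of_real of_real_eq_0_iff g_def .
  finally show False using pos gy by (simp add: mult_le_0_iff)
qed

text \<open>Lebesgue measure is determined by its values on boxes, and the preimage of a box is its
  image under the inverse, which is again orthogonal and so preserves volume.\<close>

lemma distr_lborel_orthogonal:
  fixes T :: "real^3 \<Rightarrow> real^3"
  assumes "orthogonal_transformation T"
  shows "distr lborel borel T = lborel"
proof (rule lborel_eqI[symmetric])
  have lin: "linear T" and inj: "inj T" and bij: "bij T"
    using assms by (auto simp: orthogonal_transformation_linear orthogonal_transformation_inj orthogonal_transformation_bij)
  have cont: "continuous_on UNIV T" using lin by (simp add: linear_continuous_on linear_linear)
  then have meas: "T \<in> borel_measurable borel" by (rule borel_measurable_continuous_onI)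
  have oi: "orthogonal_transformation (inv_into UNIV T)" using assms by (rule orthogonal_transformation_inv)
  fix l u :: "real^3"
  assume lu: "\<And>b. b \<in> Basis \<Longrightarrow> inner l b \<le> inner u b"
  have "emeasure (distr lborel borel T) (box l u) = emeasure lborel (T -` box l u)"
    using meas by (subst emeasure_distr) auto
  also have vi: "T -` box l u = inv_into UNIV T ` box l u"
    using bij by (rule bij_vimage_eq_inv_image)
  also have "emeasure lborel (inv_into UNIV T ` box l u) = ennreal (measure lebesgue (inv_into UNIV T ` box l u))"
  proof -
    have b: "inv_into UNIV T ` box l u \<in> sets borel"
      using measurable_sets[OF meas, of "box l u"] vi by simp
    have "inv_into UNIV T ` box l u \<in> lmeasurable"
      using measurable_orthogonal_image[OF oi, of "box l u"] by simp
    then have "emeasure lebesgue (inv_into UNIV T ` box l u) = ennreal (measure lebesgue (inv_into UNIV T ` box l u))"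
      by (simp add: emeasure_eq_measure2)
    then show ?thesis using b by simp
  qed
  also have "measure lebesgue (inv_into UNIV T ` box l u) = measure lebesgue (box l u)"
    using measure_orthogonal_image[OF oi, of "box l u"] by simp
  also have "ennreal \<dots> = ennreal (\<Prod>b\<in>Basis. inner (u - l) b)"
    using lu by (simp add: inner_diff_left measure_lborel_box)
  finally show "emeasure (distr lborel borel T) (box l u) = (\<Prod>b\<in>Basis. inner (u - l) b)" .
qed simp

text \<open>The annulus is invariant under \<open>T\<close>, and \<open>T\<close> commutes with the
  radial projection, so this is a change of variables in Lebesgue measure.\<close>

lemma smean_rotation:
  assumes T: "orthogonal_transformation T" and f: "continuous_on S2 f"
  shows "smean (\<lambda>y. f (T y)) = smean f"
proof -
  have lin: "linear T" using T by (rule orthogonal_transformation_linear)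
  have cont: "continuous_on UNIV T" using lin by (simp add: linear_continuous_on linear_linear)
  then have meas: "T \<in> borel_measurable borel" by (rule borel_measurable_continuous_onI)
  have nT: "norm (T y) = norm y" for y using T by (rule orthogonal_transformation_norm)
  have "smean f = (LINT y|distr lborel borel T. indicator unit_annulus y *\<^sub>R f (y /\<^sub>R norm y))"
    unfolding distr_lborel_orthogonal[OF T] smean_def ..
  also have "\<dots> = (LINT y|lborel. indicator unit_annulus (T y) *\<^sub>R f (T y /\<^sub>R norm (T y)))"
  proof (rule integral_distr)
    show "T \<in> lborel \<rightarrow>\<^sub>M borel" using meas by simp
    show "(\<lambda>y. indicator unit_annulus y *\<^sub>R f (y /\<^sub>R norm y)) \<in> borel_measurable borel"
      using borel_measurable_integrable[OF smean_integrable[OF f]] by simp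
  qed
  also have "\<dots> = smean (\<lambda>y. f (T y))"
    unfolding smean_def by (simp add: nT unit_annulus_def linear_scale[OF lin, symmetric] indicator_def)
  finally show ?thesis by simp
qed

lemma smean_uniform_limit:
  assumes u: "uniform_limit S2 f l F" and c: "\<And>n. continuous_on S2 (f n)" and l: "continuous_on S2 l"
  shows "((\<lambda>n. smean (f n)) \<longlongrightarrow> smean l) F"
proof (rule tendstoI)
  fix e :: real assume e: "e > 0"
  define e' where "e' = e / (2 * annvol)"
  have e': "e' > 0" using e annvol_pos by (simp add: e'_def)
  have "\<forall>\<^sub>F n in F. \<forall>y\<in>S2. dist (f n y) (l y) < e'"
    using u e' by (rule uniform_limitD)
  then show "\<forall>\<^sub>F n in F. dist (smean (f n)) (smean l) < e"
  proof eventually_elim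
    case (elim n)
    have "norm (smean (\<lambda>y. f n y - l y)) \<le> e' * annvol"
      by (rule smean_norm_le) (use elim in \<open>auto intro!: continuous_intros c l less_imp_le simp: dist_norm simp del: mem_sphere_0\<close>)
    then show ?case
      using e annvol_pos unfolding smean_diff[OF c l] by (simp add: e'_def dist_norm field_simps)
  qed
qed

lemma continuous_on_slice:
  assumes c: "continuous_on (I \<times> S) (\<lambda>(r,y). f r y)" and r: "r \<in> I"
  shows "continuous_on S (f r)"
proof -
  have "continuous_on S (\<lambda>y. (\<lambda>(r,y). f r y) (r, y))"
    by (rule continuous_on_compose2[OF c]) (use r in \<open>auto intro!: continuous_intros\<close>)
  then show ?thesis by simp
qed

lemma continuous_on_slice2:
  assumes c: "continuous_on (I \<times> S) (\<lambda>(r,y). f r y)" and y: "y \<in> S"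
  shows "continuous_on I (\<lambda>r. f r y)"
proof -
  have "continuous_on I (\<lambda>r. (\<lambda>(r,y). f r y) (r, y))"
    by (rule continuous_on_compose2[OF c]) (use y in \<open>auto intro!: continuous_intros\<close>)
  then show ?thesis by simp
qed

lemma smean_continuous_on:
  fixes f :: "real \<Rightarrow> real^3 \<Rightarrow> complex"
  assumes c: "continuous_on (I \<times> S2) (\<lambda>(r,y). f r y)" and I: "compact I"
  shows "continuous_on I (\<lambda>r. smean (f r))"
proof -
  have cs: "continuous_on S2 (f r)" if "r \<in> I" for r
    using continuous_on_slice[where f=f, OF c that] .
  have uc: "uniformly_continuous_on (I \<times> S2) (\<lambda>(r,y). f r y)"
    using compact_uniformly_continuous[OF c compact_Times[OF I compact_sphere]] .
  show ?thesis unfolding continuous_on_iff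
  proof (intro ballI allI impI)
    fix r e :: real assume r: "r \<in> I" and e: "e > 0"
    define e' where "e' = e / (2 * annvol)"
    have e': "e' > 0" using e annvol_pos by (simp add: e'_def)
    from uc[unfolded uniformly_continuous_on_def, rule_format, OF e']
    obtain d where d0: "d > 0" and d00: "\<forall>p\<in>I \<times> S2. \<forall>q\<in>I \<times> S2. dist q p < d \<longrightarrow> dist ((\<lambda>(r,y). f r y) q) ((\<lambda>(r,y). f r y) p) < e'"
      by (elim exE conjE)
    have d1:
      "\<And>p q. p \<in> I \<times> S2 \<Longrightarrow> q \<in> I \<times> S2 \<Longrightarrow> dist q p < d \<Longrightarrow> dist ((\<lambda>(r,y). f r y) q) ((\<lambda>(r,y). f r y) p) < e'"
      by (rule d00[rule_format])
    have "dist (smean (f s)) (smean (f r)) < e" if s: "s \<in> I" "dist s r < d" for s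
    proof -
      have "norm (smean (\<lambda>y. f s y - f r y)) \<le> e' * annvol"
      proof (rule smean_norm_le)
        show "continuous_on S2 (\<lambda>y. f s y - f r y)" using cs s r by (intro continuous_intros)
        fix y :: "real^3" assume "y \<in> S2"
        then have "dist (f s y) (f r y) < e'" using d1[of "(r,y)" "(s,y)"] s r by (auto simp: dist_Pair_Pair)
        then show "norm (f s y - f r y) \<le> e'" by (simp add: dist_norm)
      qed
      then show ?thesis
        using e annvol_pos unfolding smean_diff[OF cs[OF s(1)] cs[OF r]] by (simp add: e'_def dist_norm field_simps)
    qed
    then show "\<exists>d>0. \<forall>s\<in>I. dist s r < d \<longrightarrow> dist (smean (f s)) (smean (f r)) < e"
      using d0 by blast
  qed
qed

text \<open>Differentiation under the integral sign: on a compact interval around \<open>r\<close>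
  the derivative is uniformly continuous in both arguments, so the error of the linearization is
  small uniformly over the sphere and survives averaging.\<close>

lemma smean_has_vector_derivative:
  fixes f f' :: "real \<Rightarrow> real^3 \<Rightarrow> complex"
  assumes d: "\<And>s y. s \<in> {a<..<b} \<Longrightarrow> y \<in> S2 \<Longrightarrow> ((\<lambda>s. f s y) has_vector_derivative f' s y) (at s)"
    and cf: "\<And>s. s \<in> {a<..<b} \<Longrightarrow> continuous_on S2 (f s)"
    and cf': "continuous_on ({a<..<b} \<times> S2) (\<lambda>(s,y). f' s y)"
    and r: "r \<in> {a<..<b}"
  shows "((\<lambda>s. smean (f s)) has_vector_derivative smean (f' r)) (at r)"
proof -
  define \<epsilon> where "\<epsilon> = min (r - a) (b - r) / 2"
  have \<epsilon>: "\<epsilon> > 0" using r by (auto simp: \<epsilon>_def)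
  define I where "I = {r-\<epsilon>..r+\<epsilon>}"
  have "\<epsilon> < r - a" "\<epsilon> < b - r" using r \<epsilon> unfolding \<epsilon>_def by auto
  then have sub: "I \<subseteq> {a<..<b}" unfolding I_def by auto
  have cI: "continuous_on (I \<times> S2) (\<lambda>(s,y). f' s y)"
    by (rule continuous_on_subset[OF cf']) (use sub in auto)
  have uc: "uniformly_continuous_on (I \<times> S2) (\<lambda>(s,y). f' s y)"
    using compact_uniformly_continuous[OF cI compact_Times[OF _ compact_sphere]] by (simp add: I_def)
  have cs: "continuous_on S2 (f' r)"
    using continuous_on_slice[where f=f', OF cf' r] .
  show ?thesis unfolding has_vector_derivative_def has_derivative_at_alt
  proof (intro conjI allI impI)
    show "bounded_linear (\<lambda>x. x *\<^sub>R smean (f' r))" by (rule bounded_linear_scaleR_left)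
    fix e :: real assume e: "e > 0"
    define e' where "e' = e / annvol"
    have e': "e' > 0" using e annvol_pos by (simp add: e'_def)
    from uc[unfolded uniformly_continuous_on_def, rule_format, OF e']
    obtain d where d0: "d > 0" and d00: "\<forall>p\<in>I \<times> S2. \<forall>q\<in>I \<times> S2. dist q p < d \<longrightarrow> dist ((\<lambda>(s,y). f' s y) q) ((\<lambda>(s,y). f' s y) p) < e'"
      by (elim exE conjE)
    have d1: "\<And>p q. p \<in> I \<times> S2 \<Longrightarrow> q \<in> I \<times> S2 \<Longrightarrow> dist q p < d \<Longrightarrow> dist ((\<lambda>(s,y). f' s y) q) ((\<lambda>(s,y). f' s y) p) < e'"
      by (rule d00[rule_format])
    define d' where "d' = min d \<epsilon> / 2"
    have d': "d' > 0" "d' < d" "d' < \<epsilon>" using d0 \<epsilon> by (auto simp: d'_def)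
    have "norm (smean (f s) - smean (f r) - (s - r) *\<^sub>R smean (f' r)) \<le> e * norm (s - r)" if s: "norm (s - r) < d'" for s
    proof -
      have sI: "{r-d'..r+d'} \<subseteq> I" using d' by (auto simp: I_def)
      have sI2: "s \<in> {r-d'..r+d'}" using s by auto
      have pt: "norm (f s y - f r y - (s - r) *\<^sub>R f' r y) \<le> e' * norm (s - r)" if y: "y \<in> S2" for y
      proof -
        have "norm (f s y - f r y - (s - r) *\<^sub>R f' r y) \<le> norm (s - r) * e'"
        proof (rule vector_differentiable_bound_linearization[where S="{r-d'..r+d'}" and f = "\<lambda>s. f s y" and f' = "\<lambda>s. f' s y"])
          show "((\<lambda>s. f s y) has_vector_derivative f' x y) (at x within {r-d'..r+d'})" if "x \<in> {r-d'..r+d'}" for x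
          proof -
            have "x \<in> {a<..<b}" using that sI sub by blast
            from has_vector_derivative_at_within[OF d[OF this y]] show ?thesis .
          qed
          show "closed_segment r s \<subseteq> {r-d'..r+d'}" using sI2 d' by (auto simp: closed_segment_eq_real_ivl split: if_splits)
          show "r \<in> {r-d'..r+d'}" using d' by auto
          show "norm (f' x y - f' r y) \<le> e'" if "x \<in> {r-d'..r+d'}" for x
          proof -
            have "dist (f' x y) (f' r y) < e'"
              using d1[of "(r,y)" "(x,y)"] that sI y d' \<epsilon> by (auto simp: dist_Pair_Pair dist_real_def I_def abs_if)
            then show ?thesis by (simp add: dist_norm)
          qed
        qed
        then show ?thesis by (simp add: mult.commute)
      qed
      have sab: "s \<in> {a<..<b}" using sI2 sI sub by blast
      have c1: "continuous_on S2 (\<lambda>y. f s y - f r y)" by (intro continuous_intros cf sab r)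
      have c2: "continuous_on S2 (\<lambda>y. of_real (s - r) * f' r y)" by (intro continuous_intros cs)
      have "norm (smean (\<lambda>y. (f s y - f r y) - of_real (s - r) * f' r y)) \<le> e' * norm (s - r) * annvol"
      proof (rule smean_norm_le)
        show "continuous_on S2 (\<lambda>y. f s y - f r y - of_real (s - r) * f' r y)" by (intro continuous_on_diff c1 c2)
        show "norm (f s y - f r y - of_real (s - r) * f' r y) \<le> e' * norm (s - r)" if "y \<in> S2" for y
          using pt[OF that] by (simp add: scaleR_conv_of_real)
      qed
      also have "smean (\<lambda>y. (f s y - f r y) - of_real (s - r) * f' r y) = smean (f s) - smean (f r) - (s - r) *\<^sub>R smean (f' r)"
        unfolding smean_diff[OF c1 c2] smean_diff[OF cf[OF sab] cf[OF r]] smean_cmult by (simp add: scaleR_conv_of_real)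
      also have "e' * norm (s - r) * annvol = e * norm (s - r)" using annvol_pos by (simp add: e'_def)
      finally show ?thesis .
    qed
    then show "\<exists>d>0. \<forall>y. norm (y - r) < d \<longrightarrow> norm (smean (f y) - smean (f r) - (y - r) *\<^sub>R smean (f' r)) \<le> e * norm (y - r)"
      using d'(1) by blast
  qed
qed

section \<open>Wirtinger's inequality on circles, and rotations about the coordinate axes\<close>

text \<open>Because the mean vanishes, \<phi>(0) is the average of \<phi>(0) - \<phi>(s), and each
  difference is at most the integral of |\<phi>'|. Cauchy-Schwarz then gives the square. The
  constant is not sharp; it only enters the smallness condition on the frequency.\<close>

lemma wirtinger_pointwise:
  fixes \<phi> \<phi>' :: "real \<Rightarrow> complex"
  assumes d: "\<And>s. (\<phi> has_vector_derivative \<phi>' s) (at s)" and c: "continuous_on UNIV \<phi>'"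
    and m: "integral {0..2*pi} \<phi> = 0"
  shows "(norm (\<phi> 0))\<^sup>2 \<le> 2 * pi * integral {0..2*pi} (\<lambda>s. (norm (\<phi>' s))\<^sup>2)"
proof -
  have c\<phi>: "continuous_on UNIV \<phi>" 
    using d by (meson continuous_at_imp_continuous_on has_vector_derivative_continuous)
  have cn: "continuous_on A (\<lambda>s. norm (\<phi>' s))" for A
    by (intro continuous_intros continuous_on_subset[OF c]) auto
  define I where "I = integral {0..2*pi} (\<lambda>s. norm (\<phi>' s))"
  have b: "norm (\<phi> 0 - \<phi> s) \<le> I" if s: "s \<in> {0..2*pi}" for s
  proof -
    have "(\<phi>' has_integral (\<phi> s - \<phi> 0)) {0..s}"
      using s by (intro fundamental_theorem_of_calculus) (auto intro: has_vector_derivative_at_within d)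
    then have "\<phi> s - \<phi> 0 = integral {0..s} \<phi>'" by (simp add: integral_unique)
    then have "norm (\<phi> s - \<phi> 0) \<le> integral {0..s} (\<lambda>s. norm (\<phi>' s))"
      using Henstock_Kurzweil_Integration.integral_norm_bound_integral[of \<phi>' "{0..s}" "\<lambda>s. norm (\<phi>' s)"]
      by (simp add: integrable_continuous_interval cn continuous_on_subset[OF c])
    also have "\<dots> \<le> I" unfolding I_def
      using s by (intro integral_subset_le) (auto intro!: integrable_continuous_interval cn)
    finally show ?thesis by (simp add: norm_minus_commute)
  qed
  have "norm (integral {0..2*pi} (\<lambda>s. \<phi> 0 - \<phi> s)) \<le> integral {0..2*pi} (\<lambda>s. I)"
    by (rule Henstock_Kurzweil_Integration.integral_norm_bound_integral)
       (auto intro!: integrable_continuous_interval continuous_intros continuous_on_subset[OF c\<phi>] b)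
  moreover have "integral {0..2*pi} (\<lambda>s. \<phi> 0 - \<phi> s) = 2 * pi * \<phi> 0"
    using m by (subst Henstock_Kurzweil_Integration.integral_diff)
      (auto intro!: integrable_continuous_interval continuous_on_subset[OF c\<phi>] simp: scaleR_conv_of_real)
  ultimately have "2 * pi * norm (\<phi> 0) \<le> 2 * pi * I" by (simp add: norm_mult)
  then have 1: "norm (\<phi> 0) \<le> I" using pi_gt_zero by simp
  have I0: "I \<ge> 0" using 1 norm_ge_zero order_trans by blast
  \<comment> \<open>The average of |\<phi>'|. Expanding the integral of (|\<phi>'| - k)^2, which is
    nonnegative, with this \<open>k\<close> is Cauchy-Schwarz.\<close>
  define k where "k = I / (2*pi)"
  have k0: "0 \<le> integral {0..2*pi} (\<lambda>s. (norm (\<phi>' s) - k)\<^sup>2)"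
    by (intro Henstock_Kurzweil_Integration.integral_nonneg integrable_continuous_interval continuous_intros cn) auto
  have k1: "(\<lambda>s. (norm (\<phi>' s) - k)\<^sup>2) = (\<lambda>s. ((norm (\<phi>' s))\<^sup>2 - 2 * k * norm (\<phi>' s)) + k\<^sup>2)"
    by (rule ext) (simp add: power2_diff)
  have "((\<lambda>s. ((norm (\<phi>' s))\<^sup>2 - 2 * k * norm (\<phi>' s)) + k\<^sup>2) has_integral
      ((integral {0..2*pi} (\<lambda>s. (norm (\<phi>' s))\<^sup>2) - 2 * k * I) + (2*pi - 0) *\<^sub>R k\<^sup>2)) {0..2*pi}"
    unfolding I_def
    by (intro has_integral_add has_integral_diff has_integral_mult_right integrable_integral
        integrable_continuous_interval continuous_intros cn) (use has_integral_const_real[of "k\<^sup>2" 0 "2*pi"] in auto)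
  with k0 have "0 \<le> (integral {0..2*pi} (\<lambda>s. (norm (\<phi>' s))\<^sup>2) - 2 * k * I) + (2*pi - 0) *\<^sub>R k\<^sup>2"
    unfolding k1 by (simp add: integral_unique)
  then have "2 * k * I - 2 * pi * k\<^sup>2 \<le> integral {0..2*pi} (\<lambda>s. (norm (\<phi>' s))\<^sup>2)" by simp
  moreover have "2 * k * I - 2 * pi * k\<^sup>2 = I\<^sup>2 / (2*pi)" by (simp add: k_def power2_eq_square field_simps)
  ultimately have "I\<^sup>2 / (2*pi) \<le> integral {0..2*pi} (\<lambda>s. (norm (\<phi>' s))\<^sup>2)" by simp
  then have "I\<^sup>2 \<le> 2 * pi * integral {0..2*pi} (\<lambda>s. (norm (\<phi>' s))\<^sup>2)" by (simp add: pos_divide_le_eq mult.commute)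
  then show ?thesis using 1 I0 by (smt (verit) norm_ge_zero power_mono)
qed

text \<open>With an antiderivative \<Phi>, the function \<Phi>(x + 2 pi) - \<Phi>(x) has zero
  derivative by periodicity, so the integral over a full period does not depend on where the period
  starts.\<close>

lemma periodic_shift_integral:
  fixes \<phi> :: "real \<Rightarrow> complex"
  assumes c: "continuous_on UNIV \<phi>" and p: "\<And>s. \<phi> (s + 2 * pi) = \<phi> s" and t: "t \<in> {0..2*pi}"
  shows "integral {0..2*pi} (\<lambda>s. \<phi> (s + t)) = integral {0..2*pi} \<phi>"
proof -
  \<comment> \<open>The base point -1 lies strictly to the left of 0, so that \<Phi> has a two-sided
    derivative on the whole period, its left end included.\<close>
  define \<Phi> where "\<Phi> = (\<lambda>x. integral {-1..x} \<phi>)"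
  have d: "(\<Phi> has_vector_derivative \<phi> x) (at x)" if "x > -1" for x
  proof -
    have "((\<lambda>u. integral {-1..u} \<phi>) has_vector_derivative \<phi> x) (at x within {-1..x+1})"
      using that by (intro integral_has_vector_derivative continuous_on_subset[OF c]) auto
    then show ?thesis unfolding \<Phi>_def using that by (simp add: at_within_Icc_at)
  qed
  have sh: "((\<lambda>x. \<Phi> (x + c)) has_vector_derivative \<phi> (x + c)) (at x)" if "x + c > -1" for x c
  proof -
    have "((\<lambda>x. x + c) has_vector_derivative 1) (at x)" by (auto intro!: derivative_eq_intros)
    from vector_diff_chain_at[OF this d[OF that]] show ?thesis by (simp add: o_def)
  qed
  have "((\<lambda>s. \<phi> (s + t)) has_integral (\<Phi> (2*pi + t) - \<Phi> (0 + t))) {0..2*pi}"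
  proof (rule fundamental_theorem_of_calculus)
    show "((\<lambda>s. \<Phi> (s + t)) has_vector_derivative \<phi> (x + t)) (at x within {0..2*pi})" if "x \<in> {0..2*pi}" for x
      using sh[of x t] that t by (simp add: has_vector_derivative_at_within)
  qed simp
  then have 1: "integral {0..2*pi} (\<lambda>s. \<phi> (s + t)) = \<Phi> (t + 2*pi) - \<Phi> t"
    by (simp add: integral_unique add.commute)
  have "(\<phi> has_integral (\<Phi> (2*pi) - \<Phi> 0)) {0..2*pi}"
  proof (rule fundamental_theorem_of_calculus)
    show "(\<Phi> has_vector_derivative \<phi> x) (at x within {0..2*pi})" if "x \<in> {0..2*pi}" for x
      using d[of x] that by (simp add: has_vector_derivative_at_within)
  qed simp
  then have 2: "integral {0..2*pi} \<phi> = \<Phi> (2*pi) - \<Phi> 0"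
    by (simp add: integral_unique)
  have "\<exists>c. \<forall>x\<in>{0..2*pi}. \<Phi> (x + 2*pi) - \<Phi> x = c"
  proof (rule has_vector_derivative_zero_constant[of "{0..2*pi}" "\<lambda>x. \<Phi> (x + 2*pi) - \<Phi> x"])
    fix x assume x: "x \<in> {0..2*pi}"
    have "((\<lambda>x. \<Phi> (x + 2*pi) - \<Phi> x) has_vector_derivative (\<phi> (x + 2*pi) - \<phi> x)) (at x)"
      using x has_vector_derivative_diff[OF sh[of x "2*pi"] d[of x]] by simp
    then show "((\<lambda>x. \<Phi> (x + 2*pi) - \<Phi> x) has_vector_derivative 0) (at x within {0..2*pi})"
      by (simp add: p has_vector_derivative_at_within)
  qed auto
  then obtain c where "\<And>x. x \<in> {0..2*pi} \<Longrightarrow> \<Phi> (x + 2*pi) - \<Phi> x = c" by blast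
  from this[OF t] this[of 0] have "\<Phi> (t + 2*pi) - \<Phi> t = \<Phi> (0 + 2*pi) - \<Phi> 0" by simp
  then show ?thesis using 1 2 by simp
qed

text \<open>Rotation by the angle \<open>s\<close> about the axis \<open>j\<close>. Arithmetic in
  the index type is modulo 3, so \<open>j\<close>, \<open>j + 1\<close>, \<open>j + 2\<close> is a
  cyclic labelling and one formula serves all three axes.\<close>

definition rot :: "3 \<Rightarrow> real \<Rightarrow> real^3 \<Rightarrow> real^3" where
  "rot j s x = (\<chi> i. if i = j then x $ j
                 else if i = j + 1 then cos s * x $ (j+1) - sin s * x $ (j+2)
                 else sin s * x $ (j+1) + cos s * x $ (j+2))"

text \<open>The infinitesimal rotation: the cross product of the \<open>j\<close>-th unit vector
  with \<open>x\<close>.\<close>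

definition gen :: "3 \<Rightarrow> real^3 \<Rightarrow> real^3" where
  "gen j x = (\<chi> i. if i = j then 0 else if i = j + 1 then - x $ (j+2) else x $ (j+1))"

lemma three_simps: "(5::3) = 2" "(4::3) = 1" "(0::3) = 3" "(1::3) + 1 = 2" "(1::3) + 2 = 3" "(2::3) + 1 = 3" "(2::3) + 2 = 1" "(3::3) + 1 = 1" "(3::3) + 2 = 2"
   "(1::3) \<noteq> 2" "(1::3) \<noteq> 3" "(2::3) \<noteq> 3"  "(2::3) \<noteq> 1" "(3::3) \<noteq> 1" "(3::3) \<noteq> 2"
  by simp_all

lemma rot_add: "rot j s (rot j t x) = rot j (s + t) x"
proof -
  have "j = 1 \<or> j = 2 \<or> j = 3" by (rule exhaust_3)
  then show ?thesis
    by (auto simp: Finite_Cartesian_Product.vec_eq_iff forall_3 rot_def three_simps cos_add sin_add algebra_simps)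
qed

lemma rot_0 [simp]: "rot j 0 x = x"
proof -
  have "j = 1 \<or> j = 2 \<or> j = 3" by (rule exhaust_3)
  then show ?thesis
    by (auto simp: Finite_Cartesian_Product.vec_eq_iff forall_3 rot_def three_simps)
qed

lemma rot_2pi: "rot j (s + 2 * pi) x = rot j s x"
  by (auto simp: rot_def sin_add cos_add fun_eq_iff)

lemma norm_rot [simp]: "norm (rot j s x) = norm x"
proof -
  have "j = 1 \<or> j = 2 \<or> j = 3" by (rule exhaust_3)
  moreover have key: "(cos s * a - sin s * b)\<^sup>2 + (sin s * a + cos s * b)\<^sup>2 = a\<^sup>2 + b\<^sup>2" for a b
    proof -
    have "(cos s * a - sin s * b)\<^sup>2 + (sin s * a + cos s * b)\<^sup>2 = ((sin s)\<^sup>2 + (cos s)\<^sup>2) * (a\<^sup>2 + b\<^sup>2)"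
      by (simp only: power2_eq_square) (simp add: algebra_simps del: sin_cos_squared_add3)
    then show ?thesis by simp
  qed
  ultimately have "(norm (rot j s x))\<^sup>2 = (norm x)\<^sup>2"
    unfolding power2_norm_eq_inner inner_vec_def sum_3
    using key[of "x $ (j+1)" "x $ (j+2)"]
    by (elim disjE) (simp_all add: rot_def three_simps power2_eq_square[symmetric] add.commute)
  then show ?thesis by (simp add: power2_eq_iff_nonneg)
qed

lemma linear_rot: "linear (rot j s)"
  by (rule linearI) (auto simp: rot_def Finite_Cartesian_Product.vec_eq_iff algebra_simps)

lemma orth_rot: "orthogonal_transformation (rot j s)"
  by (simp add: orthogonal_transformation linear_rot)

lemma rot_has_vector_derivative: "((\<lambda>s. rot j s x) has_vector_derivative gen j (rot j s x)) (at s)"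
proof -
  have j: "j = 1 \<or> j = 2 \<or> j = 3" by (rule exhaust_3)
  have e: "rot j s x = cos s *\<^sub>R (x - (x$j) *\<^sub>R axis j 1) + sin s *\<^sub>R gen j x + (x $ j) *\<^sub>R axis j 1" for s
    using j by (auto simp: Finite_Cartesian_Product.vec_eq_iff forall_3 rot_def gen_def three_simps axis_def)
  have g: "gen j (rot j s x) = (- sin s) *\<^sub>R (x - (x$j) *\<^sub>R axis j 1) + cos s *\<^sub>R gen j x"
    using j by (auto simp: Finite_Cartesian_Product.vec_eq_iff forall_3 rot_def gen_def three_simps axis_def)
  show ?thesis unfolding g unfolding e
    by (auto intro!: derivative_eq_intros)
qed

lemma continuous_on_rot: "continuous_on A (rot j s)"
  by (simp add: linear_rot linear_continuous_on linear_linear)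

lemma continuous_rot2: "continuous_on A (\<lambda>(s,x). rot j s x)"
  unfolding rot_def case_prod_beta
proof (rule continuous_on_vec_lambda)
  fix i show "continuous_on A (\<lambda>x. if i = j then snd x $ j else if i = j + 1 then cos (fst x) * snd x $ (j + 1) - sin (fst x) * snd x $ (j + 2)
                else sin (fst x) * snd x $ (j + 1) + cos (fst x) * snd x $ (j + 2))"
    by (cases "i = j"; cases "i = j + 1") (auto intro!: continuous_intros)
qed

text \<open>Mean and circle integral are interchanged by differentiation: by rotation invariance the
  mean of the integral up to angle s has the constant derivative \<open>smean g\<close> in s, so it
  grows linearly.\<close>

lemma smean_circle:
  assumes g: "continuous_on S2 g"
  shows "smean (\<lambda>y. integral {0..2*pi} (\<lambda>s. g (rot j s y))) = 2 * pi * smean g"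
proof -
  define f where "f = (\<lambda>s y. integral {-1..s} (\<lambda>a. g (rot j a y)))"
  have cg: "continuous_on (A \<times> S2) (\<lambda>(s,y). g (rot j s y))" for A
    unfolding case_prod_beta
    by (rule continuous_on_compose2[OF g]) (use continuous_rot2[of "A \<times> S2" j] in \<open>auto simp: case_prod_beta\<close>)
  have cgs: "continuous_on A (\<lambda>s. g (rot j s y))" if "y \<in> S2" for A y
    using continuous_on_slice2[where f="\<lambda>s y. g (rot j s y)", OF cg that] .
  have cf: "continuous_on S2 (f s)" for s
  proof -
    have "continuous_on S2 (\<lambda>y. integral (cbox (-1) s) (\<lambda>a. g (rot j a y)))"
    proof (rule integral_continuous_on_param)
      show "continuous_on (S2 \<times> cbox (-1) s) (\<lambda>(y,a). g (rot j a y))"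
        unfolding case_prod_beta
        by (rule continuous_on_compose2[OF cg[of "cbox (-1) s"], unfolded case_prod_beta, of "S2 \<times> cbox (-1) s" "\<lambda>x. (snd x, fst x)", unfolded fst_conv snd_conv])
           (auto intro!: continuous_intros)
    qed
    then show ?thesis by (simp add: f_def)
  qed
  \<comment> \<open>The interval from -1 to 8 is an open neighbourhood of the full period, since pi
    < 4.\<close>
  have D: "((\<lambda>s. smean (f s)) has_vector_derivative smean g) (at r)" if r: "r \<in> {-1<..<8}" for r
  proof -
    have "((\<lambda>s. smean (f s)) has_vector_derivative smean (\<lambda>y. g (rot j r y))) (at r)"
    proof (rule smean_has_vector_derivative[where a = "-1" and b = 8 and f'="\<lambda>s y. g (rot j s y)"])
      fix s y assume s: "s \<in> {-1<..<8::real}" and y: "y \<in> S2"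
      have "((\<lambda>u. integral {-1..u} (\<lambda>a. g (rot j a y))) has_vector_derivative g (rot j s y)) (at s within {-1..8})"
        using s by (intro integral_has_vector_derivative cgs y) auto
      then show "((\<lambda>s. f s y) has_vector_derivative g (rot j s y)) (at s)"
        unfolding f_def using s by (simp add: at_within_Icc_at)
    qed (use cf cg r in auto)
    then show ?thesis by (simp add: smean_rotation[OF orth_rot g])
  qed
  have "2*pi < 8" using pi_less_4 by simp
  have "\<exists>c. \<forall>x\<in>{0..2*pi}. smean (f x) - of_real x * smean g = c"
  proof (rule has_vector_derivative_zero_constant)
    fix x assume "x \<in> {0..2*pi}"
    then have "((\<lambda>s. smean (f s)) has_vector_derivative smean g) (at x)" using D[of x] \<open>2*pi < 8\<close> by simp
    then have "((\<lambda>x. smean (f x) - of_real x * smean g) has_vector_derivative (smean g - of_real 1 * smean g)) (at x)"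
      by (intro has_vector_derivative_diff has_vector_derivative_mult_left has_vector_derivative_of_real) (auto intro!: derivative_eq_intros)
    then show "((\<lambda>x. smean (f x) - of_real x * smean g) has_vector_derivative 0) (at x within {0..2*pi})"
      by (simp add: has_vector_derivative_at_within)
  qed auto
  then obtain c where c: "\<And>x. x \<in> {0..2*pi} \<Longrightarrow> smean (f x) - of_real x * smean g = c" by blast
  have "smean (f (2*pi)) - smean (f 0) = 2 * pi * smean g"
    using c[of 0] c[of "2*pi"] by (simp add: algebra_simps)
  moreover have "smean (f (2*pi)) - smean (f 0) = smean (\<lambda>y. f (2*pi) y - f 0 y)"
    by (rule smean_diff[symmetric]) (rule cf)+
  moreover have "smean (\<lambda>y. f (2*pi) y - f 0 y) = smean (\<lambda>y. integral {0..2*pi} (\<lambda>s. g (rot j s y)))"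
  proof (rule smean_cong)
    fix y assume y: "y \<in> S2"
    have "f 0 y + integral {0..2*pi} (\<lambda>s. g (rot j s y)) = f (2*pi) y"
      unfolding f_def using y
      by (intro Henstock_Kurzweil_Integration.integral_combine integrable_continuous_interval cgs) auto
    then show "f (2*pi) y - f 0 y = integral {0..2*pi} (\<lambda>s. g (rot j s y))" by (simp add: algebra_simps)
  qed
  ultimately show ?thesis by simp
qed

text \<open>Wirtinger's inequality on the circles about the axis \<open>j\<close>.\<close>

lemma wirtinger_sphere:
  fixes w v :: "real^3 \<Rightarrow> complex"
  assumes w: "continuous_on S2 w" and v: "continuous_on S2 v"
    and d: "\<And>y s. y \<in> S2 \<Longrightarrow> ((\<lambda>s. w (rot j s y)) has_vector_derivative v (rot j s y)) (at s)"
    and m: "\<And>y. y \<in> S2 \<Longrightarrow> integral {0..2*pi} (\<lambda>s. w (rot j s y)) = 0"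
  shows "Re (smean (\<lambda>y. of_real ((norm (w y))\<^sup>2))) \<le> 4 * pi\<^sup>2 * Re (smean (\<lambda>y. of_real ((norm (v y))\<^sup>2)))"
proof -
  have cv: "continuous_on A (\<lambda>s. v (rot j s y))" if "y \<in> S2" for A y
  proof (rule continuous_on_compose2[OF v])
    show "continuous_on A (\<lambda>s. rot j s y)"
      using continuous_on_slice2[OF continuous_rot2[of "A \<times> UNIV"]] by blast
  qed (use that in auto)
  have cv2: "continuous_on S2 (\<lambda>y. complex_of_real ((norm (v y))\<^sup>2))" by (intro continuous_intros v)
  have pt: "(norm (w y))\<^sup>2 \<le> Re (2 * pi * integral {0..2*pi} (\<lambda>s. complex_of_real ((norm (v (rot j s y)))\<^sup>2)))" if y: "y \<in> S2" for y
  proof -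
    have "(norm (w (rot j 0 y)))\<^sup>2 \<le> 2 * pi * integral {0..2*pi} (\<lambda>s. (norm (v (rot j s y)))\<^sup>2)"
      using wirtinger_pointwise[of "\<lambda>s. w (rot j s y)" "\<lambda>s. v (rot j s y)"] d[OF y] m[OF y] cv[OF y] by blast
    moreover have "integral {0..2*pi} (\<lambda>s. complex_of_real ((norm (v (rot j s y)))\<^sup>2)) 
       = of_real (integral {0..2*pi} (\<lambda>s. (norm (v (rot j s y)))\<^sup>2))"
      using has_integral_of_real[OF integrable_integral[OF integrable_continuous_interval, of 0 "2*pi" "\<lambda>s. (norm (v (rot j s y)))\<^sup>2"]]
        cv[OF y, of "{0..2*pi}"] by (intro integral_unique) (simp add: continuous_intros)
    ultimately show ?thesis by simp
  qed
  have ci: "continuous_on S2 (\<lambda>y. integral {0..2*pi} (\<lambda>s. complex_of_real ((norm (v (rot j s y)))\<^sup>2)))"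
  proof -
    have "continuous_on S2 (\<lambda>y. integral (cbox 0 (2*pi)) (\<lambda>s. complex_of_real ((norm (v (rot j s y)))\<^sup>2)))"
    proof (rule integral_continuous_on_param)
      have "continuous_on (S2 \<times> cbox 0 (2*pi)) (\<lambda>x. v (rot j (snd x) (fst x)))"
      proof (rule continuous_on_compose2[OF v])
        show "continuous_on (S2 \<times> cbox 0 (2*pi)) (\<lambda>x. rot j (snd x) (fst x))"
          using continuous_on_compose2[OF continuous_rot2[of UNIV j], of "S2 \<times> cbox 0 (2*pi)" "\<lambda>x. (snd x, fst x)"]
          by (auto simp: continuous_intros)
      qed auto
      then show "continuous_on (S2 \<times> cbox 0 (2*pi)) (\<lambda>(y,s). complex_of_real ((norm (v (rot j s y)))\<^sup>2))"
        unfolding case_prod_beta by (intro continuous_intros)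
    qed
    then show ?thesis by simp
  qed
  have "Re (smean (\<lambda>y. of_real ((norm (w y))\<^sup>2))) \<le> Re (smean (\<lambda>y. 2 * pi * integral {0..2*pi} (\<lambda>s. complex_of_real ((norm (v (rot j s y)))\<^sup>2))))"
    by (intro smean_Re_mono continuous_intros w ci) (use pt in auto)
  also have "smean (\<lambda>y. 2 * pi * integral {0..2*pi} (\<lambda>s. complex_of_real ((norm (v (rot j s y)))\<^sup>2)))
     = 2 * pi * (2 * pi * smean (\<lambda>y. of_real ((norm (v y))\<^sup>2)))"
    unfolding smean_cmult smean_circle[OF cv2, of j] ..
  finally show ?thesis by (simp add: power2_eq_square)
qed

section \<open>Calculus with explicit derivatives, and the Laplace-Beltrami operator\<close>

abbreviation grad_form :: "(3 \<Rightarrow> 'a::real_vector) \<Rightarrow> real^3 \<Rightarrow> 'a" where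
  "grad_form a \<equiv> (\<lambda>h. \<Sum>i\<in>UNIV. h $ i *\<^sub>R a i)"

text \<open>Gradient \<open>g\<close> and Hessian \<open>H\<close> are carried along as explicit
  functions, with \<open>H i j\<close> the \<open>j\<close>-th partial derivative of
  \<open>g i\<close>. Second-order identities then become algebra in finitely many
  components.\<close>

definition has_C2 :: "(real^3) set \<Rightarrow> (real^3 \<Rightarrow> complex) \<Rightarrow> (3 \<Rightarrow> real^3 \<Rightarrow> complex) \<Rightarrow> (3 \<Rightarrow> 3 \<Rightarrow> real^3 \<Rightarrow> complex) \<Rightarrow> bool" where
  "has_C2 S u g H \<longleftrightarrow>
     (\<forall>x\<in>S. (u has_derivative (grad_form (\<lambda>i. g i x))) (at x)) \<and>
     (\<forall>i. \<forall>x\<in>S. (g i has_derivative (grad_form (\<lambda>j. H i j x))) (at x)) \<and>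
     (\<forall>i j. continuous_on S (H i j))"

lemma Basis_real3: "(Basis :: (real^3) set) = (\<lambda>i. axis i 1) ` UNIV"
  by (auto simp: Basis_vec_def)

lemma inj_axis1: "inj (\<lambda>i. axis i 1 :: real^3)"
  by (rule injI) (simp add: axis_eq_axis)

lemma linear_axis_expansion:
  fixes f :: "real^3 \<Rightarrow> complex"
  assumes "linear f"
  shows "f h = (\<Sum>i\<in>UNIV. h $ i *\<^sub>R f (axis i 1))"
proof -
  have "f h = f (\<Sum>i\<in>UNIV. h $ i *s axis i 1)" by (simp only: basis_expansion)
  also have "\<dots> = (\<Sum>i\<in>UNIV. h $ i *\<^sub>R f (axis i 1))"
    by (simp add: linear_sum[OF assms] linear_scale[OF assms] scalar_mult_eq_scaleR)
  finally show ?thesis .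
qed

lemma partial_deriv_eq:
  assumes "(u has_derivative (grad_form (\<lambda>i. g i x))) (at x)"
  shows "partial_deriv (axis i 1) u x = g i x"
proof -
  have "frechet_derivative u (at x) = (grad_form (\<lambda>i. g i x))"
    using frechet_derivative_at[OF assms] by simp
  then show ?thesis
    by (simp add: partial_deriv_def axis_def if_distrib[of "\<lambda>t. t *\<^sub>R _"] cong: if_cong)
qed

lemma differentiable_partial:
  assumes "u differentiable (at x)"
  shows "(u has_derivative (grad_form (\<lambda>i. partial_deriv (axis i 1) u x))) (at x)"
proof -
  have d: "(u has_derivative frechet_derivative u (at x)) (at x)"
    using assms frechet_derivative_works by blast
  have "frechet_derivative u (at x) = (grad_form (\<lambda>i. partial_deriv (axis i 1) u x))"
    unfolding partial_deriv_def using linear_axis_expansion[OF has_derivative_linear[OF d]] by blast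
  then show ?thesis using d by metis
qed

lemma laplacian_eq: "laplacian u x = (\<Sum>i\<in>UNIV. partial_deriv (axis i 1) (partial_deriv (axis i 1) u) x)"
  unfolding laplacian_def Basis_real3 by (simp add: sum.reindex[OF inj_axis1])

lemma helmholtz_onD:
  assumes "helmholtz_on S k u"
  shows "has_C2 S u (\<lambda>i. partial_deriv (axis i 1) u) (\<lambda>i j. partial_deriv (axis j 1) (partial_deriv (axis i 1) u))"
    and "x \<in> S \<Longrightarrow> (\<Sum>i\<in>UNIV. partial_deriv (axis i 1) (partial_deriv (axis i 1) u) x) + k\<^sup>2 * u x = 0"
proof -
  from assms have c: "C2_on S u" and l: "\<And>x. x \<in> S \<Longrightarrow> laplacian u x + k\<^sup>2 * u x = 0" by (auto simp: helmholtz_on_def)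
  show "has_C2 S u (\<lambda>i. partial_deriv (axis i 1) u) (\<lambda>i j. partial_deriv (axis j 1) (partial_deriv (axis i 1) u))"
    using c unfolding has_C2_def C2_on_def Basis_real3 by (auto intro!: differentiable_partial)
  show "(\<Sum>i\<in>UNIV. partial_deriv (axis i 1) (partial_deriv (axis i 1) u) x) + k\<^sup>2 * u x = 0" if "x \<in> S"
    using l[OF that] by (simp add: laplacian_eq)
qed

lemma helmholtz_onI:
  assumes S: "open S" and c: "has_C2 S u g H" and l: "\<And>x. x \<in> S \<Longrightarrow> (\<Sum>i\<in>UNIV. H i i x) + k\<^sup>2 * u x = 0"
  shows "helmholtz_on S k u"
proof -
  have 1: "partial_deriv (axis i 1) u x = g i x" if "x \<in> S" for i x
    using c that by (intro partial_deriv_eq) (auto simp: has_C2_def)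
  have d: "(partial_deriv (axis i 1) u has_derivative (grad_form (\<lambda>j. H i j x))) (at x)" if x: "x \<in> S" for i x
  proof -
    have "(g i has_derivative (grad_form (\<lambda>j. H i j x))) (at x)"
      using c x unfolding has_C2_def by blast
    then show ?thesis
      by (rule has_derivative_transform_within_open[OF _ S x]) (simp add: 1)
  qed
  have 2: "partial_deriv (axis j 1) (partial_deriv (axis i 1) u) x = H i j x" if "x \<in> S" for i j x
    using partial_deriv_eq[where g="\<lambda>j. H i j", OF d[OF that]] .
  have "C2_on S u" unfolding C2_on_def Basis_real3
  proof (intro conjI ballI; (elim imageE)?; hypsubst?)
    show "u differentiable at x" if "x \<in> S" for x using c that unfolding has_C2_def differentiable_def by blast
    show "partial_deriv (axis i 1) u differentiable at x" if "x \<in> S" for i x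
      using d[OF that] unfolding differentiable_def by blast
    show "continuous_on S (partial_deriv (axis j 1) (partial_deriv (axis i 1) u))" for i j
    proof -
      have "continuous_on S (H i j)" using c by (auto simp: has_C2_def)
      then show ?thesis using 2 by (simp cong: continuous_on_cong)
    qed
  qed
  then show ?thesis using l 2 by (simp add: helmholtz_on_def laplacian_eq)
qed

lemma has_C2_continuous:
  assumes "has_C2 S u g H"
  shows "continuous_on S u" "continuous_on S (g i)" "continuous_on S (H i j)"
proof -
  have "\<forall>x\<in>S. isCont u x" "\<forall>x\<in>S. isCont (g i) x"
    using assms unfolding has_C2_def by (blast dest: has_derivative_continuous)+
  then show "continuous_on S u" "continuous_on S (g i)" by (simp_all add: continuous_at_imp_continuous_on)
  show "continuous_on S (H i j)" using assms unfolding has_C2_def by blast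
qed

lemma has_C2_diff:
  assumes "has_C2 S u g H" "has_C2 S u' g' H'"
  shows "has_C2 S (\<lambda>x. u x - u' x) (\<lambda>i x. g i x - g' i x) (\<lambda>i j x. H i j x - H' i j x)"
proof -
  have *: "((\<lambda>x. u x - u' x) has_derivative (grad_form (\<lambda>i. a i - b i))) (at x)"
    if "(u has_derivative (grad_form a)) (at x)" "(u' has_derivative (grad_form b)) (at x)"
    for u u' :: "real^3 \<Rightarrow> complex" and a b :: "3 \<Rightarrow> complex" and x
    using has_derivative_diff[OF that] by (simp add: scaleR_diff_right sum_subtractf)
  show ?thesis using assms unfolding has_C2_def by (auto intro!: continuous_on_diff *)
qed

lemma has_C2_add:
  assumes "has_C2 S u g H" "has_C2 S u' g' H'"
  shows "has_C2 S (\<lambda>x. u x + u' x) (\<lambda>i x. g i x + g' i x) (\<lambda>i j x. H i j x + H' i j x)"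
proof -
  have *: "((\<lambda>x. u x + u' x) has_derivative (grad_form (\<lambda>i. a i + b i))) (at x)"
    if "(u has_derivative (grad_form a)) (at x)" "(u' has_derivative (grad_form b)) (at x)"
    for u u' :: "real^3 \<Rightarrow> complex" and a b :: "3 \<Rightarrow> complex" and x
    using has_derivative_add[OF that] by (simp add: scaleR_add_right sum.distrib)
  show ?thesis using assms unfolding has_C2_def by (auto intro!: continuous_on_add *)
qed

lemma has_C2_cmult:
  assumes "has_C2 S u g H"
  shows "has_C2 S (\<lambda>x. c * u x) (\<lambda>i x. c * g i x) (\<lambda>i j x. c * H i j x)"
proof -
  have *: "((\<lambda>x. c * u x) has_derivative (grad_form (\<lambda>i. c * a i))) (at x)"
    if "(u has_derivative (grad_form a)) (at x)"
    for u :: "real^3 \<Rightarrow> complex" and a :: "3 \<Rightarrow> complex" and x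
    using has_derivative_mult_right[OF that, of c] by (simp add: sum_distrib_left)
  show ?thesis using assms unfolding has_C2_def by (auto intro!: continuous_on_mult_left *)
qed

lemma has_C2_const: "has_C2 S (\<lambda>x. c) (\<lambda>i x. 0) (\<lambda>i j x. 0)"
  unfolding has_C2_def by auto

lemma has_C2_cnj:
  assumes "has_C2 S u g H"
  shows "has_C2 S (\<lambda>x. cnj (u x)) (\<lambda>i x. cnj (g i x)) (\<lambda>i j x. cnj (H i j x))"
proof -
  have *: "((\<lambda>x. cnj (u x)) has_derivative (grad_form (\<lambda>i. (cnj (a i))))) (at x)"
    if "(u has_derivative (grad_form a)) (at x)"
    for u :: "real^3 \<Rightarrow> complex" and a :: "3 \<Rightarrow> complex" and x
    using has_derivative_cnj[OF that] by simp
  show ?thesis using assms unfolding has_C2_def by (auto intro!: continuous_on_cnj *)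
qed

text \<open>Composition with a linear map of matrix \<open>q\<close>; for \<open>rot\<close> the matrix is orthogonal.\<close>

lemma has_C2_linear_comp:
  assumes c: "has_C2 S u g H" and T: "linear T" and S: "\<And>x. x \<in> S' \<Longrightarrow> T x \<in> S"
  shows "has_C2 S' (\<lambda>x. u (T x)) (\<lambda>i x. \<Sum>k\<in>UNIV. (T (axis i 1) $ k) *\<^sub>R g k (T x))
           (\<lambda>i j x. \<Sum>k\<in>UNIV. \<Sum>l\<in>UNIV. (T (axis i 1) $ k * T (axis j 1) $ l) *\<^sub>R H k l (T x))"
proof -
  have Tk: "T h $ k = (\<Sum>i\<in>UNIV. h $ i * T (axis i 1) $ k)" for h k
  proof -
    have "T h = T (\<Sum>i\<in>UNIV. h $ i *s axis i 1)" by (simp only: basis_expansion)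
    also have "\<dots> = (\<Sum>i\<in>UNIV. h $ i *\<^sub>R T (axis i 1))"
      by (simp add: linear_sum[OF T] linear_scale[OF T] scalar_mult_eq_scaleR)
    finally show ?thesis by simp
  qed
  have dT: "(T has_derivative T) (at x)" for x using T by (rule linear_imp_has_derivative)
  have e: "(\<lambda>h. \<Sum>k\<in>UNIV. T h $ k *\<^sub>R a k) = (grad_form (\<lambda>i. (\<Sum>k\<in>UNIV. (T (axis i 1) $ k) *\<^sub>R a k)))" for a :: "3 \<Rightarrow> complex"
  proof
    fix h show "(\<Sum>k\<in>UNIV. T h $ k *\<^sub>R a k) = (\<Sum>i\<in>UNIV. h $ i *\<^sub>R (\<Sum>k\<in>UNIV. (T (axis i 1) $ k) *\<^sub>R a k))"
      unfolding Tk[of h] scaleR_sum_left scaleR_sum_right by (subst sum.swap) simp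
  qed
  have 1: "((\<lambda>x. u (T x)) has_derivative (grad_form (\<lambda>i. (\<Sum>k\<in>UNIV. (T (axis i 1) $ k) *\<^sub>R g k (T x))))) (at x)" if "x \<in> S'" for x
    unfolding e[symmetric]
    using c S[OF that] has_derivative_compose[OF dT, of u] by (auto simp: has_C2_def)
  have 2: "((\<lambda>x. g k (T x)) has_derivative (grad_form (\<lambda>j. (\<Sum>l\<in>UNIV. (T (axis j 1) $ l) *\<^sub>R H k l (T x))))) (at x)" if "x \<in> S'" for x k
  proof -
    have "(g k has_derivative (grad_form (\<lambda>l. H k l (T x)))) (at (T x))"
      using c S[OF that] by (auto simp: has_C2_def)
    from has_derivative_compose[OF dT this] show ?thesis unfolding e[symmetric] .
  qed
  have 3: "((\<lambda>x. \<Sum>k\<in>UNIV. (T (axis i 1) $ k) *\<^sub>R g k (T x)) has_derivative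
      (grad_form (\<lambda>j. (\<Sum>k\<in>UNIV. \<Sum>l\<in>UNIV. (T (axis i 1) $ k * T (axis j 1) $ l) *\<^sub>R H k l (T x))))) (at x)" if "x \<in> S'" for i x
  proof -
    have "((\<lambda>x. \<Sum>k\<in>UNIV. (T (axis i 1) $ k) *\<^sub>R g k (T x)) has_derivative
      (\<lambda>h. \<Sum>k\<in>UNIV. (T (axis i 1) $ k) *\<^sub>R (\<Sum>j\<in>UNIV. h $ j *\<^sub>R (\<Sum>l\<in>UNIV. (T (axis j 1) $ l) *\<^sub>R H k l (T x))))) (at x)"
      by (intro has_derivative_sum has_derivative_scaleR_right 2 that)
    moreover have "(\<lambda>h. \<Sum>k\<in>UNIV. (T (axis i 1) $ k) *\<^sub>R (\<Sum>j\<in>UNIV. h $ j *\<^sub>R (\<Sum>l\<in>UNIV. (T (axis j 1) $ l) *\<^sub>R H k l (T x))))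
      = (grad_form (\<lambda>j. (\<Sum>k\<in>UNIV. \<Sum>l\<in>UNIV. (T (axis i 1) $ k * T (axis j 1) $ l) *\<^sub>R H k l (T x))))"
      unfolding scaleR_sum_right by (rule ext, subst sum.swap) (simp add: mult_ac)
    ultimately show ?thesis by simp
  qed
  have cT: "continuous_on A T" for A using T by (simp add: linear_continuous_on linear_linear)
  have 4: "continuous_on S' (\<lambda>x. H k l (T x))" for k l
    by (rule continuous_on_compose2[OF has_C2_continuous(3)[OF c] cT]) (use S in auto)
  show ?thesis unfolding has_C2_def
    using 1 3 by (auto intro!: continuous_intros 4)
qed

text \<open>The Laplace-Beltrami operator of the unit sphere acting in the angular variables: |x|^2
  times the Laplacian minus its radial part r^2 \<partial>_r^2 + 2 r \<partial>_r, expressed through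
  gradient and Hessian.\<close>

definition Lam :: "(3 \<Rightarrow> real^3 \<Rightarrow> complex) \<Rightarrow> (3 \<Rightarrow> 3 \<Rightarrow> real^3 \<Rightarrow> complex) \<Rightarrow> real^3 \<Rightarrow> complex" where
  "Lam g H x = (norm x)\<^sup>2 *\<^sub>R (\<Sum>i\<in>UNIV. H i i x) - (\<Sum>i\<in>UNIV. \<Sum>j\<in>UNIV. (x $ i * x $ j) *\<^sub>R H i j x) - 2 * (\<Sum>i\<in>UNIV. x $ i *\<^sub>R g i x)"

lemma rot_axis_orthonormal: "(\<Sum>i\<in>UNIV. rot a s (axis i 1) $ k * rot a s (axis i 1) $ l) = (if k = l then 1 else 0)"
proof -
  have a: "a = 1 \<or> a = 2 \<or> a = 3" and k: "k = 1 \<or> k = 2 \<or> k = 3" and l: "l = 1 \<or> l = 2 \<or> l = 3" by (rule exhaust_3)+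
  have "cos s * cos s + sin s * sin s = 1" "sin s * sin s + cos s * cos s = 1"
    using sin_cos_squared_add[of s] by (simp_all add: power2_eq_square)
  with a k l show ?thesis
    unfolding sum_3 by (elim disjE) (simp_all add: rot_def axis_def three_simps)
qed

lemma lap_rot:
  fixes H :: "3 \<Rightarrow> 3 \<Rightarrow> complex"
  shows "(\<Sum>i\<in>UNIV. \<Sum>k\<in>UNIV. \<Sum>l\<in>UNIV. (rot a s (axis i 1) $ k * rot a s (axis i 1) $ l) *\<^sub>R H k l) = (\<Sum>i\<in>UNIV. H i i)"
proof -
  have "(\<Sum>i\<in>UNIV. \<Sum>k\<in>UNIV. \<Sum>l\<in>UNIV. (rot a s (axis i 1) $ k * rot a s (axis i 1) $ l) *\<^sub>R H k l)
    = (\<Sum>k\<in>UNIV. \<Sum>l\<in>UNIV. (\<Sum>i\<in>UNIV. rot a s (axis i 1) $ k * rot a s (axis i 1) $ l) *\<^sub>R H k l)"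
    unfolding scaleR_sum_left by (subst sum.swap) (rule sum.cong[OF refl], rule sum.swap)
  also have "\<dots> = (\<Sum>k\<in>UNIV. H k k)"
    unfolding rot_axis_orthonormal by (simp add: if_distrib[of "\<lambda>t. t *\<^sub>R _"] cong: if_cong)
  finally show ?thesis .
qed

lemma rot_expand: "rot a s x $ k = (\<Sum>i\<in>UNIV. x $ i * rot a s (axis i 1) $ k)"
proof -
  have "rot a s x = rot a s (\<Sum>i\<in>UNIV. x $ i *s axis i 1)" by (simp only: basis_expansion)
  also have "\<dots> = (\<Sum>i\<in>UNIV. x $ i *\<^sub>R rot a s (axis i 1))"
    by (simp add: linear_sum[OF linear_rot] linear_scale[OF linear_rot] scalar_mult_eq_scaleR)
  finally show ?thesis by simp
qed

lemma rad_rot: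
  fixes g :: "3 \<Rightarrow> complex"
  shows "(\<Sum>i\<in>UNIV. x $ i *\<^sub>R (\<Sum>k\<in>UNIV. (rot a s (axis i 1) $ k) *\<^sub>R g k)) = (\<Sum>k\<in>UNIV. rot a s x $ k *\<^sub>R g k)"
  unfolding rot_expand[of a s x] scaleR_sum_left scaleR_sum_right by (subst sum.swap) simp

lemma rad2_rot:
  fixes H :: "3 \<Rightarrow> 3 \<Rightarrow> complex"
  shows "(\<Sum>i\<in>UNIV. \<Sum>j\<in>UNIV. (x $ i * x $ j) *\<^sub>R (\<Sum>k\<in>UNIV. \<Sum>l\<in>UNIV. (rot a s (axis i 1) $ k * rot a s (axis j 1) $ l) *\<^sub>R H k l))
     = (\<Sum>k\<in>UNIV. \<Sum>l\<in>UNIV. (rot a s x $ k * rot a s x $ l) *\<^sub>R H k l)"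
proof -
  have "(\<Sum>i\<in>UNIV. \<Sum>j\<in>UNIV. (x $ i * x $ j) *\<^sub>R (\<Sum>k\<in>UNIV. \<Sum>l\<in>UNIV. (rot a s (axis i 1) $ k * rot a s (axis j 1) $ l) *\<^sub>R H k l))
    = (\<Sum>i\<in>UNIV. x $ i *\<^sub>R (\<Sum>k\<in>UNIV. rot a s (axis i 1) $ k *\<^sub>R (\<Sum>j\<in>UNIV. x $ j *\<^sub>R (\<Sum>l\<in>UNIV. rot a s (axis j 1) $ l *\<^sub>R H k l))))"
    unfolding scaleR_sum_right
    by (rule sum.cong[OF refl], rule trans[OF sum.swap], intro sum.cong[OF refl]) (simp add: mult_ac)
  also have "\<dots> = (\<Sum>k\<in>UNIV. rot a s x $ k *\<^sub>R (\<Sum>l\<in>UNIV. rot a s x $ l *\<^sub>R H k l))"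
    unfolding rad_rot ..
  finally show ?thesis by (simp add: scaleR_sum_right)
qed

text \<open>Each of the three terms of \<open>Lam\<close> is invariant by itself: the Laplacian
  because the rotation matrix is orthogonal, the radial derivatives because the rotation maps rays
  to rays.\<close>

lemma Lam_rot:
  "Lam (\<lambda>i x. \<Sum>k\<in>UNIV. (rot a s (axis i 1) $ k) *\<^sub>R g k (rot a s x))
       (\<lambda>i j x. \<Sum>k\<in>UNIV. \<Sum>l\<in>UNIV. (rot a s (axis i 1) $ k * rot a s (axis j 1) $ l) *\<^sub>R H k l (rot a s x)) x
   = Lam g H (rot a s x)"
  unfolding Lam_def lap_rot rad_rot rad2_rot by simp

text \<open>\<open>angL j\<close> and \<open>angL2 j\<close> are the first and second derivative
  along the rotation flow about axis \<open>j\<close>, that is, the angular momentum operators up to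
  factors of i.\<close>

definition angL :: "3 \<Rightarrow> (3 \<Rightarrow> real^3 \<Rightarrow> complex) \<Rightarrow> real^3 \<Rightarrow> complex" where
  "angL j g x = (\<Sum>i\<in>UNIV. gen j x $ i *\<^sub>R g i x)"

definition angL2 :: "3 \<Rightarrow> (3 \<Rightarrow> real^3 \<Rightarrow> complex) \<Rightarrow> (3 \<Rightarrow> 3 \<Rightarrow> real^3 \<Rightarrow> complex) \<Rightarrow> real^3 \<Rightarrow> complex" where
  "angL2 j g H x = (\<Sum>i\<in>UNIV. \<Sum>k\<in>UNIV. (gen j x $ i * gen j x $ k) *\<^sub>R H i k x) + (\<Sum>i\<in>UNIV. gen j (gen j x) $ i *\<^sub>R g i x)"

text \<open>The Casimir identity: the Laplace-Beltrami operator is the sum of the squares of the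
  three rotation derivatives. It reduces integration by parts on the sphere to the rotation
  invariance of \<open>smean\<close>.\<close>

lemma Lam_eq_sum_angL2: "Lam g H x = (\<Sum>j\<in>UNIV. angL2 j g H x)"
  unfolding Lam_def angL2_def sum_3 power2_norm_eq_inner inner_vec_def
  by (simp add: gen_def three_simps scaleR_conv_of_real algebra_simps)

lemma linear_gen: "linear (gen j)"
  by (rule linearI) (auto simp: gen_def Finite_Cartesian_Product.vec_eq_iff algebra_simps)

lemma gen_has_derivative: "((\<lambda>x. gen j x $ i) has_derivative (\<lambda>h. gen j h $ i)) (at x)"
  using bounded_linear.has_derivative[OF bounded_linear_vec_nth linear_imp_has_derivative[OF linear_gen]] .

lemma u_rot_derivative:
  assumes c: "has_C2 S u g H" and x: "rot j s x \<in> S"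
  shows "((\<lambda>s. u (rot j s x)) has_vector_derivative angL j g (rot j s x)) (at s)"
proof -
  have "(u has_derivative (grad_form (\<lambda>i. g i (rot j s x)))) (at (rot j s x))"
    using c x by (auto simp: has_C2_def)
  from has_derivative_compose[OF rot_has_vector_derivative[unfolded has_vector_derivative_def] this]
  show ?thesis by (simp add: has_vector_derivative_def angL_def scaleR_sum_right)
qed

lemma angL_rot_derivative:
  assumes c: "has_C2 S u g H" and x: "rot j s x \<in> S"
  shows "((\<lambda>s. angL j g (rot j s x)) has_vector_derivative angL2 j g H (rot j s x)) (at s)"
proof -
  let ?y = "rot j s x"
  have "((\<lambda>x. gen j x $ i *\<^sub>R g i x) has_derivative (\<lambda>h. gen j ?y $ i *\<^sub>R (\<Sum>k\<in>UNIV. h $ k *\<^sub>R H i k ?y) + gen j h $ i *\<^sub>R g i ?y)) (at ?y)" for i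
    using c x by (intro has_derivative_scaleR gen_has_derivative) (auto simp: has_C2_def)
  then have "(angL j g has_derivative (\<lambda>h. \<Sum>i\<in>UNIV. gen j ?y $ i *\<^sub>R (\<Sum>k\<in>UNIV. h $ k *\<^sub>R H i k ?y) + gen j h $ i *\<^sub>R g i ?y)) (at ?y)"
    unfolding angL_def by (intro has_derivative_sum)
  from has_derivative_compose[OF rot_has_vector_derivative[unfolded has_vector_derivative_def] this]
  show ?thesis
    by (simp add: has_vector_derivative_def angL2_def scaleR_sum_right linear_scale[OF linear_gen] scaleR_add_right sum.distrib mult_ac)
qed

lemma continuous_on_gen: "continuous_on A (\<lambda>x. gen j x $ i)"
  by (rule has_derivative_continuous_on[OF has_derivative_at_withinI[OF gen_has_derivative]])

lemma continuous_on_angL: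
  assumes "has_C2 S u g H" shows "continuous_on S (angL j g)" 
  unfolding angL_def
  by (intro continuous_on_sum continuous_on_scaleR continuous_on_gen has_C2_continuous[OF assms])

lemma continuous_on_angL2:
  assumes "has_C2 S u g H" shows "continuous_on S (angL2 j g H)" 
proof -
  have "continuous_on S (\<lambda>x. gen j (gen j x) $ i)" for i
    by (rule continuous_on_compose2[OF continuous_on_gen[of UNIV]]) (auto simp: linear_gen linear_continuous_on linear_linear)
  then show ?thesis
  unfolding angL2_def
  by (intro continuous_on_add continuous_on_sum continuous_on_scaleR continuous_on_mult continuous_on_gen has_C2_continuous[OF assms])
qed

lemma continuous_on_Lam:
  assumes "has_C2 S u g H" shows "continuous_on S (Lam g H)" 
  unfolding Lam_eq_sum_angL2 by (intro continuous_intros continuous_on_angL2[OF assms])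

lemma continuous_on_dilated_sphere:
  assumes "continuous_on (sphere 0 r) f" "0 \<le> r"
  shows "continuous_on S2 (\<lambda>y. f (r *\<^sub>R y))"
  by (rule continuous_on_compose2[OF assms(1)]) (use assms(2) in \<open>auto intro!: continuous_intros\<close>)

text \<open>The mean of f over a rotated sphere does not depend on the angle, and its derivative at
  angle 0 is the mean of \<open>f'\<close>. This plays the part of the divergence theorem on a
  closed surface.\<close>

lemma smean_derivative_zero:
  assumes c: "continuous_on (sphere 0 r) f" and c': "continuous_on (sphere 0 r) f'" and r: "0 \<le> r"
    and d: "\<And>x s. x \<in> sphere 0 r \<Longrightarrow> ((\<lambda>s. f (rot j s x)) has_vector_derivative f' (rot j s x)) (at s)"
  shows "smean (\<lambda>y. f' (r *\<^sub>R y)) = 0"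
proof -
  have s: "rot j s (r *\<^sub>R y) = r *\<^sub>R rot j s y" for s y by (simp add: linear_scale[OF linear_rot])
  have const: "smean (\<lambda>y. f (rot j s (r *\<^sub>R y))) = smean (\<lambda>y. f (r *\<^sub>R y))" for s
    unfolding s using smean_rotation[OF orth_rot continuous_on_dilated_sphere[OF c r]] .
  have cr: "continuous_on S2 (\<lambda>y. h (rot j s (r *\<^sub>R y)))" if "continuous_on (sphere 0 r) h" for h :: "real^3 \<Rightarrow> complex" and s
    by (rule continuous_on_compose2[OF that])
       (use r continuous_on_compose2[OF continuous_on_rot[of UNIV j s], of S2 "\<lambda>y. r *\<^sub>R y"] in \<open>auto simp: continuous_intros\<close>)
  have cr2: "continuous_on ({-1<..<1} \<times> S2) (\<lambda>(s,y). f' (rot j s (r *\<^sub>R y)))"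
    unfolding case_prod_beta
  proof (rule continuous_on_compose2[OF c'])
    have "continuous_on ({-1<..<1} \<times> S2) (\<lambda>p. (\<lambda>(s,x). rot j s x) (fst p, r *\<^sub>R snd p))"
      by (rule continuous_on_compose2[OF continuous_rot2[of UNIV j]]) (auto intro!: continuous_intros)
    then show "continuous_on ({-1<..<1} \<times> S2) (\<lambda>p. rot j (fst p) (r *\<^sub>R snd p))" by simp
  qed (use r in auto)
  have "((\<lambda>s. smean (\<lambda>y. f (rot j s (r *\<^sub>R y)))) has_vector_derivative smean (\<lambda>y. f' (rot j 0 (r *\<^sub>R y)))) (at 0)"
  proof (rule smean_has_vector_derivative[where a = "-1" and b = 1])
    show "((\<lambda>s. f (rot j s (r *\<^sub>R y))) has_vector_derivative f' (rot j s (r *\<^sub>R y))) (at s)" if "y \<in> S2" for s y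
      using d[of "r *\<^sub>R y" s] that r by simp
  qed (use cr[OF c] cr2 in auto)
  then have "((\<lambda>s. smean (\<lambda>y. f (r *\<^sub>R y))) has_vector_derivative smean (\<lambda>y. f' (r *\<^sub>R y))) (at (0::real))"
    unfolding const by simp
  then show ?thesis
    using vector_derivative_unique_at has_vector_derivative_const by metis
qed

text \<open>Apply the preceding fact to the rotation derivative of the product of
  \<open>angL j g\<close> and \<open>v\<close>.\<close>

lemma smean_angL_parts:
  assumes u: "has_C2 S u g H" and v: "has_C2 S v g' H'" and S: "sphere 0 r \<subseteq> S" and r: "0 \<le> r"
  shows "smean (\<lambda>y. angL2 j g H (r *\<^sub>R y) * v (r *\<^sub>R y)) = - smean (\<lambda>y. angL j g (r *\<^sub>R y) * angL j g' (r *\<^sub>R y))"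
proof -
  note [continuous_intros] = continuous_on_subset[OF continuous_on_angL[OF u] S] continuous_on_subset[OF continuous_on_angL[OF v] S]
    continuous_on_subset[OF continuous_on_angL2[OF u] S] continuous_on_subset[OF has_C2_continuous(1)[OF v] S]
  have "smean (\<lambda>y. (\<lambda>x. angL j g x * angL j g' x + angL2 j g H x * v x) (r *\<^sub>R y)) = 0"
  proof (rule smean_derivative_zero[where f="\<lambda>x. angL j g x * v x", OF _ _ r])
    fix x :: "real^3" and s assume "x \<in> sphere 0 r"
    then have x: "rot j s x \<in> S" using S by (auto simp: subset_iff)
    show "((\<lambda>s. angL j g (rot j s x) * v (rot j s x)) has_vector_derivative angL j g (rot j s x) * angL j g' (rot j s x) + angL2 j g H (rot j s x) * v (rot j s x)) (at s)"
      by (rule has_vector_derivative_mult[OF angL_rot_derivative[OF u x] u_rot_derivative[OF v x]])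
  qed (intro continuous_intros)+
  moreover have "smean (\<lambda>y. angL j g (r *\<^sub>R y) * angL j g' (r *\<^sub>R y) + angL2 j g H (r *\<^sub>R y) * v (r *\<^sub>R y))
    = smean (\<lambda>y. angL j g (r *\<^sub>R y) * angL j g' (r *\<^sub>R y)) + smean (\<lambda>y. angL2 j g H (r *\<^sub>R y) * v (r *\<^sub>R y))"
  proof (rule smean_add)
    show "continuous_on S2 (\<lambda>y. angL j g (r *\<^sub>R y) * angL j g' (r *\<^sub>R y))"
      by (rule continuous_on_dilated_sphere[OF _ r]) (intro continuous_intros)
    show "continuous_on S2 (\<lambda>y. angL2 j g H (r *\<^sub>R y) * v (r *\<^sub>R y))"
      by (rule continuous_on_dilated_sphere[OF _ r]) (intro continuous_intros)
  qed
  ultimately show ?thesis by (simp add: eq_neg_iff_add_eq_0 add.commute)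
qed

lemma smean_Lam_parts:
  assumes u: "has_C2 S u g H" and v: "has_C2 S v g' H'" and S: "sphere 0 r \<subseteq> S" and r: "0 \<le> r"
  shows "smean (\<lambda>y. Lam g H (r *\<^sub>R y) * v (r *\<^sub>R y)) = - (\<Sum>j\<in>UNIV. smean (\<lambda>y. angL j g (r *\<^sub>R y) * angL j g' (r *\<^sub>R y)))"
proof -
  have "smean (\<lambda>y. Lam g H (r *\<^sub>R y) * v (r *\<^sub>R y)) = smean (\<lambda>y. \<Sum>j\<in>UNIV. angL2 j g H (r *\<^sub>R y) * v (r *\<^sub>R y))"
    by (simp add: Lam_eq_sum_angL2 sum_distrib_right)
  also have "\<dots> = (\<Sum>j\<in>UNIV. smean (\<lambda>y. angL2 j g H (r *\<^sub>R y) * v (r *\<^sub>R y)))"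
  proof (rule smean_sum)
    fix j show "continuous_on S2 (\<lambda>y. angL2 j g H (r *\<^sub>R y) * v (r *\<^sub>R y))"
      by (rule continuous_on_dilated_sphere[OF _ r])
         (intro continuous_on_mult continuous_on_subset[OF continuous_on_angL2[OF u] S] continuous_on_subset[OF has_C2_continuous(1)[OF v] S])
  qed
  finally show ?thesis by (simp add: smean_angL_parts[OF u v S r] sum_negf)
qed

text \<open>Both sides equal minus the same sum of products of first angular derivatives, which is
  symmetric in the two functions.\<close>

lemma smean_Lam_symmetric:
  assumes u: "has_C2 S u g H" and v: "has_C2 S v g' H'" and S: "sphere 0 r \<subseteq> S" and r: "0 \<le> r"
  shows "smean (\<lambda>y. Lam g H (r *\<^sub>R y) * v (r *\<^sub>R y)) = smean (\<lambda>y. u (r *\<^sub>R y) * Lam g' H' (r *\<^sub>R y))"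
  using smean_Lam_parts[OF u v S r] smean_Lam_parts[OF v u S r] by (simp add: mult.commute)

section \<open>Radial derivatives and the energy flux\<close>

text \<open>\<open>rad1\<close> is r \<partial>_r u and \<open>rad2\<close> is r^2 \<partial>_r^2 u;
  in this form no division by |x| occurs.\<close>

definition rad1 :: "(3 \<Rightarrow> real^3 \<Rightarrow> complex) \<Rightarrow> real^3 \<Rightarrow> complex" where
  "rad1 g x = (\<Sum>i\<in>UNIV. x $ i *\<^sub>R g i x)"

definition rad2 :: "(3 \<Rightarrow> 3 \<Rightarrow> real^3 \<Rightarrow> complex) \<Rightarrow> real^3 \<Rightarrow> complex" where
  "rad2 H x = (\<Sum>i\<in>UNIV. \<Sum>j\<in>UNIV. (x $ i * x $ j) *\<^sub>R H i j x)"

lemma rad_eq: "Lam g H x + rad2 H x + 2 * rad1 g x = (norm x)\<^sup>2 *\<^sub>R (\<Sum>i\<in>UNIV. H i i x)"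
  by (simp add: Lam_def rad1_def rad2_def)

lemma continuous_on_rad1:
  assumes "has_C2 S u g H" shows "continuous_on S (rad1 g)"
  unfolding rad1_def by (intro continuous_intros has_C2_continuous[OF assms])

lemma dilation_has_derivative: "((\<lambda>r. r *\<^sub>R y) has_derivative (\<lambda>h. h *\<^sub>R y)) (at r)"
  by (auto intro!: derivative_eq_intros)

lemma divide_of_real_scaleR: "z / of_real r = (1 / r) *\<^sub>R (z :: complex)"
  by (simp add: scaleR_conv_of_real)

lemma u_radial_derivative:
  assumes c: "has_C2 S u g H" and x: "r *\<^sub>R y \<in> S" and r: "r \<noteq> 0"
  shows "((\<lambda>r. u (r *\<^sub>R y)) has_vector_derivative rad1 g (r *\<^sub>R y) / of_real r) (at r)"
proof -
  have "(u has_derivative (grad_form (\<lambda>i. g i (r *\<^sub>R y)))) (at (r *\<^sub>R y))"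
    using c x by (auto simp: has_C2_def)
  from has_derivative_compose[OF dilation_has_derivative this]
  show ?thesis using r
    by (simp add: has_vector_derivative_def rad1_def divide_of_real_scaleR scaleR_sum_right)
qed

lemma rad1_radial_derivative:
  assumes c: "has_C2 S u g H" and x: "r *\<^sub>R y \<in> S" and r: "r \<noteq> 0"
  shows "((\<lambda>r. rad1 g (r *\<^sub>R y)) has_vector_derivative (rad2 H (r *\<^sub>R y) + rad1 g (r *\<^sub>R y)) / of_real r) (at r)"
proof -
  let ?y = "r *\<^sub>R y"
  have "((\<lambda>x. x $ i *\<^sub>R g i x) has_derivative (\<lambda>h. ?y $ i *\<^sub>R (\<Sum>k\<in>UNIV. h $ k *\<^sub>R H i k ?y) + h $ i *\<^sub>R g i ?y)) (at ?y)" for i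
  proof (rule has_derivative_scaleR)
    show "((\<lambda>x. x $ i) has_derivative (\<lambda>h. h $ i)) (at ?y)" by (rule bounded_linear_imp_has_derivative[OF bounded_linear_vec_nth])
    show "(g i has_derivative (grad_form (\<lambda>k. H i k ?y))) (at ?y)" using c x by (auto simp: has_C2_def)
  qed
  then have "(rad1 g has_derivative (\<lambda>h. \<Sum>i\<in>UNIV. ?y $ i *\<^sub>R (\<Sum>k\<in>UNIV. h $ k *\<^sub>R H i k ?y) + h $ i *\<^sub>R g i ?y)) (at ?y)"
    unfolding rad1_def by (intro has_derivative_sum)
  from has_derivative_compose[OF dilation_has_derivative this]
  have "((\<lambda>r. rad1 g (r *\<^sub>R y)) has_derivative (\<lambda>h. \<Sum>i\<in>UNIV. ?y $ i *\<^sub>R (\<Sum>k\<in>UNIV. (h *\<^sub>R y) $ k *\<^sub>R H i k ?y) + (h *\<^sub>R y) $ i *\<^sub>R g i ?y)) (at r)" .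
  moreover have "(\<Sum>i\<in>UNIV. ?y $ i *\<^sub>R (\<Sum>k\<in>UNIV. (h *\<^sub>R y) $ k *\<^sub>R H i k ?y) + (h *\<^sub>R y) $ i *\<^sub>R g i ?y) = h *\<^sub>R ((rad2 H ?y + rad1 g ?y) / of_real r)" for h
    unfolding rad1_def rad2_def sum_3 divide_of_real_scaleR using r
    by (simp add: scaleR_add_right mult_ac)
  ultimately show ?thesis by (simp add: has_vector_derivative_def)
qed

definition sq_mean :: "(real^3 \<Rightarrow> complex) \<Rightarrow> real \<Rightarrow> real" where
  "sq_mean f r = Re (smean (\<lambda>y. of_real ((norm (f (r *\<^sub>R y)))\<^sup>2)))"

lemma sq_mean_nonneg:
  assumes "continuous_on (sphere 0 r) f" "0 \<le> r"
  shows "0 \<le> sq_mean f r"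
  unfolding sq_mean_def
  by (rule smean_Re_nonneg) (auto intro!: continuous_intros continuous_on_dilated_sphere[OF assms])

lemma sq_mean_eq: "smean (\<lambda>y. f (r *\<^sub>R y) * cnj (f (r *\<^sub>R y))) = of_real (sq_mean f r)"
  unfolding sq_mean_def smean_of_real complex_norm_square[symmetric] by simp

text \<open>The flux \<open>r\<^sup>2 \<integral> \<partial>\<^sub>r u * cnj u\<close> over the unit sphere.\<close>

definition flux :: "(real^3 \<Rightarrow> complex) \<Rightarrow> (3 \<Rightarrow> real^3 \<Rightarrow> complex) \<Rightarrow> real \<Rightarrow> complex" where
  "flux u g r = smean (\<lambda>y. of_real r * (rad1 g (r *\<^sub>R y) * cnj (u (r *\<^sub>R y))))"

text \<open>Green's identity in radial form. Differentiating the flux produces \<open>rad2\<close>,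
  which the Helmholtz equation replaces by \<open>Lam\<close>, \<open>rad1\<close> and the
  zeroth-order term; the \<open>Lam\<close> term is then integrated by parts over the
  sphere.\<close>

lemma flux_derivative:
  assumes c: "has_C2 S u g H" and ab: "0 < a" "r \<in> {a<..<b}" and S: "\<And>x. a < norm x \<Longrightarrow> norm x < b \<Longrightarrow> x \<in> S"
    and q: "\<And>x. a < norm x \<Longrightarrow> norm x < b \<Longrightarrow> (\<Sum>i\<in>UNIV. H i i x) + q * u x = 0"
  shows "(flux u g has_vector_derivative
           (of_real (sq_mean (rad1 g) r) + (\<Sum>j\<in>UNIV. of_real (sq_mean (angL j g) r)) - q * of_real r ^ 2 * of_real (sq_mean u r))) (at r)"
proof -
  define A where "A = {x::real^3. a < norm x \<and> norm x < b}"
  have AS: "A \<subseteq> S" using S by (auto simp: A_def)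
  \<comment> \<open>The radial derivative of the integrand of the flux after \<open>rad2\<close> has
    been eliminated.\<close>
  define f' where "f' = (\<lambda>x. (rad1 g x * cnj (rad1 g x) - Lam g H x * cnj (u x)) - q * of_real (norm x) ^ 2 * (u x * cnj (u x)))"
  have cA: "continuous_on A u" "continuous_on A (rad1 g)" "continuous_on A (Lam g H)"
    using continuous_on_subset[OF _ AS] has_C2_continuous(1)[OF c] continuous_on_rad1[OF c] continuous_on_Lam[OF c] by blast+
  note [continuous_intros] = cA
  have cf': "continuous_on A f'" unfolding f'_def by (intro continuous_intros)
  have yA: "s *\<^sub>R y \<in> A" if "s \<in> {a<..<b}" "y \<in> S2" for s y using that ab by (auto simp: A_def)
  have "(flux u g has_vector_derivative smean (\<lambda>y. f' (r *\<^sub>R y))) (at r)"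
    unfolding flux_def
  proof (rule smean_has_vector_derivative[where a=a and b=b and f' = "\<lambda>s y. f' (s *\<^sub>R y)"])
    fix s y assume s: "s \<in> {a<..<b}" and y: "y \<in> S2"
    have s0: "s \<noteq> 0" using s ab by auto
    have x: "s *\<^sub>R y \<in> S" using yA[OF s y] AS by blast
    have ns: "norm (s *\<^sub>R y) = s" using s ab y by simp
    have 1: "((\<lambda>r. cnj (u (r *\<^sub>R y))) has_vector_derivative cnj (rad1 g (s *\<^sub>R y) / of_real s)) (at s)"
      by (rule has_vector_derivative_cnj[OF u_radial_derivative[OF c x s0]])
    have 2: "((\<lambda>r. of_real r) has_vector_derivative 1) (at s)"
      by (auto intro!: derivative_eq_intros)
    have lap: "(norm (s *\<^sub>R y))\<^sup>2 *\<^sub>R (\<Sum>i\<in>UNIV. H i i (s *\<^sub>R y)) = - q * of_real s ^ 2 * u (s *\<^sub>R y)"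
      using q[of "s *\<^sub>R y"] yA[OF s y] ns by (simp add: A_def eq_neg_iff_add_eq_0[symmetric] scaleR_conv_of_real)
    have r2: "rad2 H (s *\<^sub>R y) = - q * of_real s ^ 2 * u (s *\<^sub>R y) - Lam g H (s *\<^sub>R y) - 2 * rad1 g (s *\<^sub>R y)"
      using rad_eq[of g H "s *\<^sub>R y"] unfolding lap by (simp add: algebra_simps eq_neg_iff_add_eq_0)
    have "of_real s * (rad1 g (s *\<^sub>R y) * cnj (rad1 g (s *\<^sub>R y) / of_real s) + (rad2 H (s *\<^sub>R y) + rad1 g (s *\<^sub>R y)) / of_real s * cnj (u (s *\<^sub>R y)))
        + 1 * (rad1 g (s *\<^sub>R y) * cnj (u (s *\<^sub>R y))) = f' (s *\<^sub>R y)"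
      unfolding r2 f'_def ns using s0 by (simp add: field_simps)
    with has_vector_derivative_mult[OF 2 has_vector_derivative_mult[OF rad1_radial_derivative[OF c x s0] 1]]
    show "((\<lambda>r. of_real r * (rad1 g (r *\<^sub>R y) * cnj (u (r *\<^sub>R y)))) has_vector_derivative f' (s *\<^sub>R y)) (at s)"
      by simp
  next
    fix s assume s: "s \<in> {a<..<b}"
    show "continuous_on S2 (\<lambda>y. of_real s * (rad1 g (s *\<^sub>R y) * cnj (u (s *\<^sub>R y))))"
      by (rule continuous_on_compose2[of A "\<lambda>x. of_real s * (rad1 g x * cnj (u x))" S2 "\<lambda>y. s *\<^sub>R y"])
         (use yA[OF s] in \<open>auto intro!: continuous_intros\<close>)
  next
    show "continuous_on ({a<..<b} \<times> S2) (\<lambda>(s, y). f' (s *\<^sub>R y))"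
      unfolding case_prod_beta
      by (rule continuous_on_compose2[OF cf']) (use yA in \<open>auto intro!: continuous_intros\<close>)
  qed (use ab in auto)
  moreover have "smean (\<lambda>y. f' (r *\<^sub>R y)) = (of_real (sq_mean (rad1 g) r) + (\<Sum>j\<in>UNIV. of_real (sq_mean (angL j g) r)) - q * of_real r ^ 2 * of_real (sq_mean u r))"
  proof -
    have r0: "0 \<le> r" using ab by auto
    have sp: "sphere 0 r \<subseteq> A" using ab by (auto simp: A_def)
    note sp' = subset_trans[OF sp AS]
    note [continuous_intros] = cA[THEN continuous_on_subset, OF sp]
    have "smean (\<lambda>y. f' (r *\<^sub>R y)) = smean (\<lambda>y. (rad1 g (r *\<^sub>R y) * cnj (rad1 g (r *\<^sub>R y)) - Lam g H (r *\<^sub>R y) * cnj (u (r *\<^sub>R y))) - (q * of_real r ^ 2) * (u (r *\<^sub>R y) * cnj (u (r *\<^sub>R y))))"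
      by (rule smean_cong) (use r0 in \<open>simp add: f'_def\<close>)
    also have "\<dots> = (smean (\<lambda>y. rad1 g (r *\<^sub>R y) * cnj (rad1 g (r *\<^sub>R y))) - smean (\<lambda>y. Lam g H (r *\<^sub>R y) * cnj (u (r *\<^sub>R y)))) - (q * of_real r ^ 2) * smean (\<lambda>y. u (r *\<^sub>R y) * cnj (u (r *\<^sub>R y)))"
    proof -
      have c1: "continuous_on S2 (\<lambda>y. rad1 g (r *\<^sub>R y) * cnj (rad1 g (r *\<^sub>R y)))"
        by (rule continuous_on_dilated_sphere[OF _ r0]) (intro continuous_intros)
      have c2: "continuous_on S2 (\<lambda>y. Lam g H (r *\<^sub>R y) * cnj (u (r *\<^sub>R y)))"
        by (rule continuous_on_dilated_sphere[OF _ r0]) (intro continuous_intros)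
      have c3: "continuous_on S2 (\<lambda>y. (q * of_real r ^ 2) * (u (r *\<^sub>R y) * cnj (u (r *\<^sub>R y))))"
        by (rule continuous_on_dilated_sphere[OF _ r0]) (intro continuous_intros)
      show ?thesis
        using smean_diff[OF continuous_on_diff[OF c1 c2] c3] smean_diff[OF c1 c2]
        by (simp add: smean_cmult)
    qed
    also have "smean (\<lambda>y. Lam g H (r *\<^sub>R y) * cnj (u (r *\<^sub>R y))) = - (\<Sum>j\<in>UNIV. smean (\<lambda>y. angL j g (r *\<^sub>R y) * cnj (angL j g (r *\<^sub>R y))))"
      using smean_Lam_parts[OF c has_C2_cnj[OF c] sp' r0] by (simp add: angL_def)
    finally show ?thesis unfolding sq_mean_eq by simp
  qed
  ultimately show ?thesis by simp
qed

text \<open>Vanishing circle integrals about the axis \<open>j\<close> make Wirtinger's inequality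
  available: a single angular term already controls the mean square with the constant 1 / (4 pi^2),
  while the zeroth-order term costs at most |q| r^2 of it.\<close>

lemma flux_Re_derivative_ge:
  assumes c: "has_C2 S u g H" and ab: "0 < a" "r \<in> {a<..<b}" and S: "\<And>x. a < norm x \<Longrightarrow> norm x < b \<Longrightarrow> x \<in> S"
    and q: "\<And>x. a < norm x \<Longrightarrow> norm x < b \<Longrightarrow> (\<Sum>i\<in>UNIV. H i i x) + q * u x = 0"
    and m: "\<And>x. x \<in> sphere 0 r \<Longrightarrow> integral {0..2*pi} (\<lambda>s. u (rot j s x)) = 0"
  shows "\<exists>D. ((\<lambda>r. Re (flux u g r)) has_real_derivative D) (at r) \<and> D \<ge> (1 / (4 * pi\<^sup>2) - norm q * r\<^sup>2) * sq_mean u r"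
proof -
  have r0: "0 \<le> r" using ab by auto
  have sp: "sphere 0 r \<subseteq> S" using S ab by auto
  note cs = continuous_on_subset[OF _ sp]
  have cA: "continuous_on (sphere 0 r) u" "continuous_on (sphere 0 r) (rad1 g)" "\<And>j. continuous_on (sphere 0 r) (angL j g)"
    using cs has_C2_continuous(1)[OF c] continuous_on_rad1[OF c] continuous_on_angL[OF c] by blast+
  let ?D = "of_real (sq_mean (rad1 g) r) + (\<Sum>j\<in>UNIV. of_real (sq_mean (angL j g) r)) - q * of_real r ^ 2 * of_real (sq_mean u r)"
  have "(flux u g has_vector_derivative ?D) (at r)" by (rule flux_derivative[OF c ab S q])
  then have d: "((\<lambda>r. Re (flux u g r)) has_real_derivative (Re ?D)) (at r)"
    unfolding has_real_derivative_iff_has_vector_derivative by (rule bounded_linear.has_vector_derivative[OF bounded_linear_Re])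
  have w: "sq_mean u r \<le> 4 * pi\<^sup>2 * sq_mean (angL j g) r"
    unfolding sq_mean_def
  proof (rule wirtinger_sphere[where j=j])
    have s: "r *\<^sub>R rot j s y = rot j s (r *\<^sub>R y)" for s y by (simp add: linear_scale[OF linear_rot])
    show "continuous_on S2 (\<lambda>y. u (r *\<^sub>R y))" "continuous_on S2 (\<lambda>y. angL j g (r *\<^sub>R y))"
      by (rule continuous_on_dilated_sphere[OF _ r0], fact cA)+
    fix y :: "real^3" assume y: "y \<in> S2"
    have x: "rot j s (r *\<^sub>R y) \<in> S" for s using sp y r0 by (auto simp: subset_iff)
    show "((\<lambda>s. u (r *\<^sub>R rot j s y)) has_vector_derivative angL j g (r *\<^sub>R rot j s y)) (at s)" for s
      unfolding s by (rule u_rot_derivative[OF c x])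
    show "integral {0..2*pi} (\<lambda>s. u (r *\<^sub>R rot j s y)) = 0"
      unfolding s using m[of "r *\<^sub>R y"] y r0 by simp
  qed
  have "sq_mean (angL j g) r \<le> (\<Sum>j\<in>UNIV. sq_mean (angL j g) r)"
    by (rule member_le_sum) (auto intro!: sq_mean_nonneg cA r0)
  moreover have "0 \<le> sq_mean (rad1 g) r" by (rule sq_mean_nonneg[OF cA(2) r0])
  moreover have "Re (q * of_real r ^ 2 * of_real (sq_mean u r)) \<le> norm q * r\<^sup>2 * sq_mean u r"
  proof -
    have "Re (q * of_real r ^ 2 * of_real (sq_mean u r)) \<le> norm (q * of_real r ^ 2 * of_real (sq_mean u r))" by (rule complex_Re_le_cmod)
    also have "\<dots> = norm q * r\<^sup>2 * sq_mean u r" using sq_mean_nonneg[OF cA(1) r0] by (simp add: norm_mult norm_power)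
    finally show ?thesis .
  qed
  moreover have "1 / (4 * pi\<^sup>2) * sq_mean u r \<le> sq_mean (angL j g) r"
    using w by (simp add: field_simps)
  ultimately have "(1 / (4 * pi\<^sup>2) - norm q * r\<^sup>2) * sq_mean u r \<le> Re ?D" by (simp add: left_diff_distrib)
  with d show ?thesis by blast
qed

section \<open>Monotonicity across interfaces, and limits of means at spheres\<close>

text \<open>Limits at the exceptional points turn \<open>G\<close> into a continuous function, and
  the fundamental theorem of calculus tolerates finitely many points without derivative. The value 0
  at the left end then gives the sign.\<close>

lemma mono_except_finite:
  fixes G :: "real \<Rightarrow> real"
  assumes P: "finite P" "0 \<notin> P"
    and d: "\<And>r. r \<in> {0<..<R} - P \<Longrightarrow> \<exists>D\<ge>0. (G has_real_derivative D) (at r)"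
    and l: "\<And>r. r \<in> P \<Longrightarrow> \<exists>L. (G \<longlongrightarrow> L) (at r)"
    and z: "(G \<longlongrightarrow> 0) (at_right 0)"
    and rs: "r \<in> {0<..<R} - P" "s \<in> {0<..<R} - P" "r \<le> s"
  shows "0 \<le> G r" "G r \<le> G s"
proof -
  \<comment> \<open>The continuous extension of \<open>G\<close> to the exceptional points and to 0;
    despite its name it is not a derivative, which is called \<open>D\<close> below.\<close>
  define G' where "G' = (\<lambda>x. if x \<in> P then Lim (at x) G else if x = 0 then 0 else G x)"
  obtain D where D: "\<And>r. r \<in> {0<..<R} - P \<Longrightarrow> D r \<ge> 0 \<and> (G has_real_derivative D r) (at r)"
    using d by metis
  have near: "\<forall>\<^sub>F y in at x. y \<notin> insert 0 P" for x
  proof -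
    have "open (- (insert 0 P - {x}))" using finite_imp_closed[of "insert 0 P - {x}"] P(1) open_Compl by blast
    then show ?thesis unfolding eventually_at_topological by (intro exI[of _ "- (insert 0 P - {x})"]) auto
  qed
  have ev: "\<forall>\<^sub>F y in at x. G' y = G y" for x
    using near[of x] by eventually_elim (auto simp: G'_def)
  have iscont: "isCont G' x" if x: "x \<in> {0<..<R}" for x
  proof (cases "x \<in> P")
    case True
    then obtain L where L: "(G \<longlongrightarrow> L) (at x)" using l by blast
    then have "G' x = L" using True by (simp add: G'_def tendsto_Lim)
    then show ?thesis unfolding isCont_def using L ev[of x] by (simp add: tendsto_cong)
  next
    case False
    then have "isCont G x" using D[of x] x by (auto intro: DERIV_isCont)
    then show ?thesis unfolding isCont_def using ev[of x] False x by (simp add: tendsto_cong G'_def)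
  qed
  have c0: "(G' \<longlongrightarrow> G' 0) (at_right 0)"
  proof -
    have "\<forall>\<^sub>F y in at_right 0. G' y = G y" using ev[of 0] by (simp add: eventually_at_split)
    then show ?thesis using z P(2) by (simp add: tendsto_cong G'_def)
  qed
  have cont: "continuous_on {0..t} G'" if "t < R" for t
    unfolding continuous_on_def
  proof
    fix x assume x: "x \<in> {0..t}"
    show "(G' \<longlongrightarrow> G' x) (at x within {0..t})"
    proof (cases "x = 0")
      case True
      have "at 0 within {0..t} \<le> at_right 0" unfolding at_within_def by (rule inf_mono) auto
      then show ?thesis using c0 True tendsto_mono by blast
    next
      case False
      then show ?thesis using iscont[of x] x that by (auto simp: isCont_def intro: tendsto_within_subset)
    qed
  qed
  have der: "(G' has_vector_derivative D x) (at x)" if x: "x \<in> {0<..<R} - P" for x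
  proof -
    have "(G has_vector_derivative D x) (at x)" using D[OF x] by (simp add: has_real_derivative_iff_has_vector_derivative)
    moreover have "\<forall>\<^sub>F y in at x. G y = G' y" using ev[of x] by eventually_elim simp
    moreover have "G x = G' x" using x by (simp add: G'_def)
    ultimately show ?thesis
      using has_vector_derivative_transform_within_open has_derivative_transform_eventually[of G _ x UNIV G'] 
      unfolding has_vector_derivative_def by auto
  qed
  have mono: "G' x \<le> G' y" if xy: "0 \<le> x" "x \<le> y" "y < R" for x y
  proof -
    have "((\<lambda>x. if x \<in> {0<..<R} - P then D x else 0) has_integral (G' y - G' x)) {x..y}"
    proof (rule fundamental_theorem_of_calculus_interior_strong[OF P(1) xy(2)])
      show "(G' has_vector_derivative (if z \<in> {0<..<R} - P then D z else 0)) (at z)" if "z \<in> {x<..<y} - P" for z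
        using der[of z] that xy by auto
      show "continuous_on {x..y} G'" by (rule continuous_on_subset[OF cont[OF xy(3)]]) (use xy in auto)
    qed
    then have "0 \<le> G' y - G' x" by (rule has_integral_nonneg) (use D in auto)
    then show ?thesis by simp
  qed
  have e: "G' r = G r" "G' s = G s" using rs by (auto simp: G'_def)
  show "0 \<le> G r" using mono[of 0 r] rs e P(2) by (auto simp: G'_def)
  show "G r \<le> G s" using mono[of r s] rs e by auto
qed

text \<open>At a point of \<open>Y\<close> continuity must also be checked along \<open>Y\<close>
  itself. There every \<open>l z\<close> is a limit of values of \<phi> taken in \<open>A\<close>,
  and those are already within e / 2 of \<open>l x\<close>.\<close>

lemma continuous_on_extend_by_limits:
  fixes \<phi> :: "real^3 \<Rightarrow> complex"
  assumes A: "open A" and c: "continuous_on A \<phi>" and AY: "A \<inter> Y = {}"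
    and l: "\<And>y. y \<in> Y \<Longrightarrow> (\<phi> \<longlongrightarrow> l y) (at y within A)" and nb: "\<And>y. y \<in> Y \<Longrightarrow> at y within A \<noteq> bot"
  shows "continuous_on (A \<union> Y) (\<lambda>x. if x \<in> A then \<phi> x else l x)" (is "continuous_on _ ?f")
  unfolding continuous_on_eq_continuous_within
proof
  fix x assume x: "x \<in> A \<union> Y"
  show "continuous (at x within A \<union> Y) ?f"
  proof (cases "x \<in> A")
    case True
    then have "isCont \<phi> x" using A c by (simp add: continuous_on_eq_continuous_at)
    moreover have "\<forall>\<^sub>F y in nhds x. ?f y = \<phi> y"
      using eventually_nhds_in_open[OF A True] by eventually_elim simp
    ultimately have "isCont ?f x" by (simp add: isCont_cong)
    then show ?thesis by (rule continuous_at_imp_continuous_at_within)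
  next
    case False
    then have xY: "x \<in> Y" using x by auto
    show ?thesis unfolding continuous_within_eps_delta
    proof (intro allI impI)
      fix e :: real assume e: "e > 0"
      then have "\<forall>\<^sub>F z in at x within A. dist (\<phi> z) (l x) < e / 2"
        using tendstoD[OF l[OF xY], of "e/2"] by simp
      then obtain d where d: "d > 0" "\<And>z. z \<in> A \<Longrightarrow> z \<noteq> x \<Longrightarrow> dist z x < d \<Longrightarrow> dist (\<phi> z) (l x) < e / 2"
        unfolding eventually_at by blast
      have "dist (?f z) (?f x) < e" if z: "z \<in> A \<union> Y" "dist z x < d" for z
      proof (cases "z \<in> A")
        case zA: True
        then have "z \<noteq> x" using False by auto
        then show ?thesis using d(2)[OF zA] z(2) e False zA by simp
      next
        case zA: False
        then have zY: "z \<in> Y" using z by auto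
        have "\<forall>\<^sub>F t in at z within A. dist (\<phi> t) (l x) \<le> e / 2"
          unfolding eventually_at
        proof (intro exI[of _ "d - dist z x"] conjI ballI impI)
          show "0 < d - dist z x" using z by simp
          fix t assume t: "t \<in> A" "t \<noteq> z \<and> dist t z < d - dist z x"
          have "dist t x < d" using t dist_triangle[of t x z] by simp
          moreover have "t \<noteq> x" using t False by auto
          ultimately show "dist (\<phi> t) (l x) \<le> e / 2" using d(2)[OF t(1)] by simp
        qed
        moreover have "((\<lambda>t. dist (\<phi> t) (l x)) \<longlongrightarrow> dist (l z) (l x)) (at z within A)"
          by (intro tendsto_intros l zY)
        ultimately have "dist (l z) (l x) \<le> e / 2"
          using tendsto_upperbound nb[OF zY] by blast
        then show ?thesis using zA False e by simp
      qed
      then show "\<exists>d>0. \<forall>z\<in>A \<union> Y. dist z x < d \<longrightarrow> dist (?f z) (?f x) < e"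
        using d(1) by blast
    qed
  qed
qed

text \<open>The ray through \<open>y\<close> approaches \<open>y\<close> from both sides of the
  sphere.\<close>

lemma at_within_shell_nonbot:
  fixes y :: "real^3"
  assumes "norm y = \<rho>" "0 < \<rho>" "a < \<rho>" "\<rho> < b"
  shows "at y within {x. \<rho> < norm x \<and> norm x < b} \<noteq> bot" "at y within {x. a < norm x \<and> norm x < \<rho>} \<noteq> bot"
proof -
  have y0: "y \<noteq> 0" using assms by auto
  have *: "at y within A \<noteq> bot" if ev: "\<forall>\<^sub>F t in F. t *\<^sub>R y \<in> A" and F: "F \<le> at 1" "F \<noteq> bot" for A F
  proof -
    have "((\<lambda>t. t *\<^sub>R y) \<longlongrightarrow> 1 *\<^sub>R y) F" by (intro tendsto_intros tendsto_mono[OF F(1) tendsto_ident_at])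
    moreover have "\<forall>\<^sub>F t in F. t *\<^sub>R y \<in> A \<and> t *\<^sub>R y \<noteq> y"
      using ev filter_leD[OF F(1) eventually_neq_at_within] by eventually_elim (use scaleR_cancel_right[of _ y 1] y0 in auto)
    ultimately have "filterlim (\<lambda>t. t *\<^sub>R y) (at y within A) F" by (simp add: filterlim_at)
    then show ?thesis using F(2) by (auto simp: filterlim_def filtermap_bot_iff bot_unique)
  qed
  have "\<forall>\<^sub>F t in at_right 1. t \<in> {1<..<b / \<rho>}" by (rule eventually_at_right_real) (use assms in simp)
  then have "\<forall>\<^sub>F t in at_right 1. t *\<^sub>R y \<in> {x. \<rho> < norm x \<and> norm x < b}"
    by eventually_elim (use assms in \<open>simp add: pos_less_divide_eq\<close>)
  then show "at y within {x. \<rho> < norm x \<and> norm x < b} \<noteq> bot" by (rule *) (auto simp: at_le)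
  have "\<forall>\<^sub>F t in at_left 1. t \<in> {max 0 (a / \<rho>)<..<1}" by (rule eventually_at_left_real) (use assms in simp)
  then have "\<forall>\<^sub>F t in at_left 1. t *\<^sub>R y \<in> {x. a < norm x \<and> norm x < \<rho>}"
    by eventually_elim (use assms in \<open>simp add: pos_divide_less_eq\<close>)
  then show "at y within {x. a < norm x \<and> norm x < \<rho>} \<noteq> bot" by (rule *) (auto simp: at_le)
qed

lemma open_shell: "open {x::real^3. a < norm x \<and> norm x < b}"
  by (intro open_Collect_conj open_Collect_less continuous_intros)

text \<open>Extended by its boundary limits, \<open>f\<close> is continuous up to the sphere of
  radius \<rho>; on the compact product of \<open>I\<close> and the unit sphere the mean is then
  continuous in the radius. This is where unrestricted, not merely radial, traces are used.\<close>

lemma smean_tendsto_boundary: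
  assumes A: "open A" "continuous_on A f" "A \<inter> sphere 0 \<rho> = {}" and \<rho>: "0 < \<rho>"
    and l: "\<And>y. y \<in> sphere 0 \<rho> \<Longrightarrow> (f \<longlongrightarrow> F y) (at y within A)" "\<And>y. y \<in> sphere 0 \<rho> \<Longrightarrow> at y within A \<noteq> bot"
    and I: "compact I" "\<rho> \<in> I" "\<And>r y. r \<in> I \<Longrightarrow> r \<noteq> \<rho> \<Longrightarrow> y \<in> S2 \<Longrightarrow> r *\<^sub>R y \<in> A"
  shows "((\<lambda>r. smean (\<lambda>y. f (r *\<^sub>R y))) \<longlongrightarrow> smean (\<lambda>y. F (\<rho> *\<^sub>R y))) (at \<rho> within I)"
proof -
  define ff where "ff = (\<lambda>x. if x \<in> A then f x else F x)"
  have ce: "continuous_on (A \<union> sphere 0 \<rho>) ff" unfolding ff_def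
    by (rule continuous_on_extend_by_limits[OF A l])
  have in_A: "r *\<^sub>R y \<in> A \<union> sphere 0 \<rho>" if "r \<in> I" "y \<in> S2" for r y
    using I(3)[OF that(1) _ that(2)] that \<rho> by (cases "r = \<rho>") auto
  have "continuous_on (I \<times> S2) (\<lambda>(r,y). ff (r *\<^sub>R y))"
    unfolding case_prod_beta
  proof (rule continuous_on_compose2[OF ce])
    show "(\<lambda>x. fst x *\<^sub>R snd x) ` (I \<times> S2) \<subseteq> A \<union> sphere 0 \<rho>" by (intro image_subsetI in_A) auto
  qed (intro continuous_intros)
  then have "continuous_on I (\<lambda>r. smean (\<lambda>y. ff (r *\<^sub>R y)))" by (rule smean_continuous_on) (rule I)
  then have "((\<lambda>r. smean (\<lambda>y. ff (r *\<^sub>R y))) \<longlongrightarrow> smean (\<lambda>y. ff (\<rho> *\<^sub>R y))) (at \<rho> within I)"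
    using I(2) by (simp add: continuous_on_def)
  moreover have "smean (\<lambda>y. ff (\<rho> *\<^sub>R y)) = smean (\<lambda>y. F (\<rho> *\<^sub>R y))"
    by (rule smean_cong) (use \<rho> A(3) in \<open>auto simp: ff_def disjoint_iff\<close>)
  moreover have "\<forall>\<^sub>F r in at \<rho> within I. smean (\<lambda>y. ff (r *\<^sub>R y)) = smean (\<lambda>y. f (r *\<^sub>R y))"
    unfolding eventually_at_filter by (intro always_eventually allI impI smean_cong) (use I(3) in \<open>simp add: ff_def\<close>)
  ultimately show ?thesis by (simp add: tendsto_cong)
qed

lemma smean_tendsto_outer:
  assumes c: "continuous_on {x. \<rho> < norm x \<and> norm x < b} f" and \<rho>: "0 < \<rho>" "\<rho> < b"
    and l: "\<And>y. y \<in> sphere 0 \<rho> \<Longrightarrow> (f \<longlongrightarrow> F y) (at y within {x. \<rho> < norm x})"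
  shows "((\<lambda>r. smean (\<lambda>y. f (r *\<^sub>R y))) \<longlongrightarrow> smean (\<lambda>y. F (\<rho> *\<^sub>R y))) (at_right \<rho>)"
proof -
  obtain d where d: "\<rho> < d" "d < b" using dense[OF \<rho>(2)] by blast
  have "((\<lambda>r. smean (\<lambda>y. f (r *\<^sub>R y))) \<longlongrightarrow> smean (\<lambda>y. F (\<rho> *\<^sub>R y))) (at \<rho> within {\<rho>..d})"
    by (rule smean_tendsto_boundary[OF open_shell c _ \<rho>(1) tendsto_within_subset[OF l] at_within_shell_nonbot(1)]) (use \<rho> d in auto)
  then show ?thesis using d by (simp add: at_within_Icc_at_right)
qed

lemma smean_tendsto_inner:
  assumes c: "continuous_on {x. a < norm x \<and> norm x < \<rho>} f" and \<rho>: "0 < a" "a < \<rho>"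
    and l: "\<And>y. y \<in> sphere 0 \<rho> \<Longrightarrow> (f \<longlongrightarrow> F y) (at y within {x. norm x < \<rho>})"
  shows "((\<lambda>r. smean (\<lambda>y. f (r *\<^sub>R y))) \<longlongrightarrow> smean (\<lambda>y. F (\<rho> *\<^sub>R y))) (at_left \<rho>)"
proof -
  obtain d where d: "a < d" "d < \<rho>" using dense[OF \<rho>(2)] by blast
  have \<rho>0: "0 < \<rho>" "\<rho> < \<rho> + 1" using \<rho> by auto
  have "((\<lambda>r. smean (\<lambda>y. f (r *\<^sub>R y))) \<longlongrightarrow> smean (\<lambda>y. F (\<rho> *\<^sub>R y))) (at \<rho> within {d..\<rho>})"
    by (rule smean_tendsto_boundary[OF open_shell c _ \<rho>0(1) tendsto_within_subset[OF l] at_within_shell_nonbot(2)[OF _ \<rho>0(1) \<rho>(2) \<rho>0(2)]]) (use \<rho> d in auto)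
  then show ?thesis using d by (simp add: at_within_Icc_at_left)
qed

lemma normal_deriv_eq:
  assumes "has_C2 S u g H" "x \<in> S" "x \<noteq> 0"
  shows "rad1 g x = of_real (norm x) * normal_deriv u x"
proof -
  have "(u has_derivative (grad_form (\<lambda>i. g i x))) (at x)" using assms by (auto simp: has_C2_def)
  from frechet_derivative_at[OF this, symmetric] show ?thesis using assms(3)
    unfolding normal_deriv_def rad1_def scaleR_conv_of_real[where 'a=complex, symmetric] by (simp add: scaleR_sum_right mult.assoc[symmetric])
qed

text \<open>The derivative of |u|^2 along a ray is 2 Re (\<partial>_r u cnj u), and the flux carries
  an additional factor r^2. The sign of the flux is thus tied to the monotonicity of the mean
  square.\<close>

lemma sq_mean_derivative:
  assumes c: "has_C2 S u g H" and ab: "0 < a" "r \<in> {a<..<b}" and S: "\<And>x. a < norm x \<Longrightarrow> norm x < b \<Longrightarrow> x \<in> S"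
  shows "(sq_mean u has_real_derivative 2 * Re (flux u g r) / r\<^sup>2) (at r)"
proof -
  define A where "A = {x::real^3. a < norm x \<and> norm x < b}"
  have AS: "A \<subseteq> S" using S by (auto simp: A_def)
  have cA: "continuous_on A u" "continuous_on A (rad1 g)"
    using continuous_on_subset[OF _ AS] has_C2_continuous(1)[OF c] continuous_on_rad1[OF c] by blast+
  note [continuous_intros] = cA
  have yA: "s *\<^sub>R y \<in> A" if "s \<in> {a<..<b}" "y \<in> S2" for s y using that ab by (auto simp: A_def)
  define f' where "f' = (\<lambda>x. u x * cnj (rad1 g x / of_real (norm x)) + rad1 g x / of_real (norm x) * cnj (u x))"
  have nz: "norm x \<noteq> 0" if "x \<in> A" for x using that ab by (auto simp: A_def)
  have cf': "continuous_on A f'" unfolding f'_def by (intro continuous_intros) (use nz in auto)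
  have "((\<lambda>r. smean (\<lambda>y. u (r *\<^sub>R y) * cnj (u (r *\<^sub>R y)))) has_vector_derivative smean (\<lambda>y. f' (r *\<^sub>R y))) (at r)"
  proof (rule smean_has_vector_derivative[where a=a and b=b and f' = "\<lambda>s y. f' (s *\<^sub>R y)"])
    fix s y assume s: "s \<in> {a<..<b}" and y: "y \<in> S2"
    have s0: "s \<noteq> 0" using s ab by auto
    have x: "s *\<^sub>R y \<in> S" using yA[OF s y] AS by blast
    have ns: "norm (s *\<^sub>R y) = s" using s ab y by simp
    note 1 = u_radial_derivative[OF c x s0]
    show "((\<lambda>r. u (r *\<^sub>R y) * cnj (u (r *\<^sub>R y))) has_vector_derivative f' (s *\<^sub>R y)) (at s)"
      using has_vector_derivative_mult[OF 1 has_vector_derivative_cnj[OF 1]] unfolding f'_def ns .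
  next
    fix s assume s: "s \<in> {a<..<b}"
    show "continuous_on S2 (\<lambda>y. u (s *\<^sub>R y) * cnj (u (s *\<^sub>R y)))"
      by (rule continuous_on_compose2[of A "\<lambda>x. (u x * cnj (u x))" S2 "\<lambda>y. s *\<^sub>R y"])
         (use yA[OF s] in \<open>auto intro!: continuous_intros\<close>)
  next
    show "continuous_on ({a<..<b} \<times> S2) (\<lambda>(s, y). f' (s *\<^sub>R y))"
      unfolding case_prod_beta
      by (rule continuous_on_compose2[OF cf']) (use yA in \<open>auto intro!: continuous_intros\<close>)
  qed (use ab in auto)
  then have "(sq_mean u has_real_derivative Re (smean (\<lambda>y. f' (r *\<^sub>R y)))) (at r)"
    unfolding sq_mean_eq has_real_derivative_iff_has_vector_derivative
    using bounded_linear.has_vector_derivative[OF bounded_linear_Re] by fastforce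
  moreover have "Re (smean (\<lambda>y. f' (r *\<^sub>R y))) = 2 * Re (flux u g r) / r\<^sup>2"
  proof -
    have r0: "0 < r" using ab by auto
    have sp: "sphere 0 r \<subseteq> A" using ab by (auto simp: A_def)
    note [continuous_intros] = cA[THEN continuous_on_subset, OF sp]
    have ch: "continuous_on S2 (\<lambda>y. of_real r * (rad1 g (r *\<^sub>R y) * cnj (u (r *\<^sub>R y))))"
      by (rule continuous_on_dilated_sphere[where f="\<lambda>x. of_real r * (rad1 g x * cnj (u x))"]) (use r0 in \<open>auto intro!: continuous_intros\<close>)
    define h where "h = (\<lambda>y. of_real r * (rad1 g (r *\<^sub>R y) * cnj (u (r *\<^sub>R y))))"
    have ch1: "continuous_on S2 h" using ch by (simp add: h_def)
    have ch2: "continuous_on S2 (\<lambda>y. cnj (h y))" by (intro continuous_intros ch1)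
    have "smean (\<lambda>y. f' (r *\<^sub>R y)) = smean (\<lambda>y. of_real (1 / r\<^sup>2) * (h y + cnj (h y)))"
      by (rule smean_cong) (use r0 in \<open>simp add: f'_def h_def field_simps power2_eq_square\<close>)
    also have "\<dots> = of_real (1 / r\<^sup>2) * (smean h + cnj (smean h))"
      unfolding smean_cmult smean_add[OF ch1 ch2] smean_cnj ..
    also have "smean h = flux u g r" by (simp add: h_def flux_def)
    finally show ?thesis by (simp add: complex_add_cnj)
  qed
  ultimately show ?thesis by simp
qed

lemma antimono_imp_derivative_nonpos:
  fixes f :: "real \<Rightarrow> real"
  assumes d: "(f has_real_derivative D) (at r)" and m: "\<And>s. r \<le> s \<Longrightarrow> s < b \<Longrightarrow> f s \<le> f r" and r: "r < b"
  shows "D \<le> 0"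
proof (rule ccontr)
  assume "\<not> D \<le> 0"
  then obtain e where e: "e > 0" "\<And>h. 0 < h \<Longrightarrow> h < e \<Longrightarrow> f r < f (r + h)"
    using DERIV_pos_inc_right[OF d] by auto
  define h where "h = min e (b - r) / 2"
  have "0 < h" "h < e" "r + h < b" using e r by (auto simp: h_def min_def field_simps)
  then show False using e(2)[of h] m[of "r + h"] by simp
qed

section \<open>Geometry of the shells in terms of the radius\<close>

locale nested_shells =
  fixes N :: nat and rp rm :: "nat \<Rightarrow> real"
  assumes N: "1 \<le> N" and nested: "nested_radii N rp rm"
begin

lemma radii: "j \<in> {1..N} \<Longrightarrow> 0 < rm j" "j \<in> {1..N} \<Longrightarrow> rm j < rp j"
  using nested by (auto simp: nested_radii_def)

lemma radii_order:
  assumes "i < j" "i \<in> {1..N}" "j \<in> {1..N}"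
  shows "rp j < rm i"
proof -
  have "i \<in> {1..N} \<Longrightarrow> j \<in> {1..N} \<Longrightarrow> rp j < rm i"
    using assms(1)
  proof (induction rule: strict_inc_induct)
    case (base k)
    then have "k + 1 = j" "k \<in> {1..<N}" by auto
    then show ?case using nested by (auto simp: nested_radii_def)
  next
    case (step k)
    then have "k \<in> {1..<N}" "Suc k \<in> {1..N}" by auto
    then have "rp (Suc k) < rm k" "rm (Suc k) < rp (Suc k)" "rp j < rm (Suc k)"
      using nested step by (auto simp: nested_radii_def)
    then show ?case by simp
  qed
  then show ?thesis using assms by blast
qed

definition interfaces :: "real set" where "interfaces = rp ` {1..N} \<union> rm ` {1..N}"

definition in_shell :: "real \<Rightarrow> bool" where "in_shell r \<longleftrightarrow> (\<exists>j\<in>{1..N}. rm j < r \<and> r < rp j)"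

definition off :: "(real^3) set" where "off = {x. norm x \<notin> interfaces}"

lemma finite_interfaces: "finite interfaces" by (simp add: interfaces_def)

lemma interfaces_pos: "r \<in> interfaces \<Longrightarrow> 0 < r"
  using radii by (fastforce simp: interfaces_def)

lemma rp1_max: "r \<in> interfaces \<Longrightarrow> r \<le> rp 1"
proof -
  have *: "rp j \<le> rp 1" if "j \<in> {1..N}" for j
  proof (cases "j = 1")
    case False
    then have "rp j < rm 1" using radii_order[of 1 j] that N by auto
    then show ?thesis using radii(2)[of 1] N by auto
  qed simp
  show "r \<in> interfaces \<Longrightarrow> r \<le> rp 1"
    using * radii(2) unfolding interfaces_def by fastforce
qed

lemma rp1: "rp 1 \<in> interfaces" "0 < rp 1"
  using N interfaces_pos[of "rp 1"] by (auto simp: interfaces_def)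

lemma in_shell_less_rp1: "in_shell r \<Longrightarrow> r < rp 1"
  using rp1_max by (fastforce simp: in_shell_def interfaces_def)

lemma in_shell_const:
  assumes "{a<..<b} \<inter> interfaces = {}" "r \<in> {a<..<b}" "s \<in> {a<..<b}"
  shows "in_shell r \<longleftrightarrow> in_shell s"
proof -
  have "in_shell s" if "in_shell r" "r \<in> {a<..<b}" "s \<in> {a<..<b}" for r s
  proof -
    from that obtain j where j: "j \<in> {1..N}" "rm j < r" "r < rp j" by (auto simp: in_shell_def)
    then have "rm j \<notin> {a<..<b}" "rp j \<notin> {a<..<b}" using assms(1) by (auto simp: interfaces_def)
    then show ?thesis using j that by (auto simp: in_shell_def intro!: bexI[of _ j])
  qed
  then show ?thesis using assms by blast
qed

text \<open>There are finitely many interfaces, so the others keep a positive distance from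
  \<open>r\<close>; the left end is taken at least r / 2 to stay positive.\<close>

lemma punctured_gap:
  assumes "0 < r"
  obtains a b where "0 < a" "a < r" "r < b" "{a<..<b} \<inter> interfaces \<subseteq> {r}"
proof -
  have "\<exists>e>0. \<forall>x\<in>interfaces. x \<noteq> r \<longrightarrow> e \<le> dist r x"
    using finite_set_avoid[OF finite_interfaces, of r] by blast
  then obtain e where e: "e > 0" "\<And>x. x \<in> interfaces \<Longrightarrow> x \<noteq> r \<Longrightarrow> e \<le> dist r x" by blast
  define a where "a = max (r / 2) (r - e)"
  have "x = r" if "x \<in> {a<..<r+e}" "x \<in> interfaces" for x
    using e(2)[of x] that by (cases "x < r"; cases "x = r") (auto simp: a_def dist_real_def)
  then have "{a<..<r + e} \<inter> interfaces \<subseteq> {r}" by blast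
  moreover have "0 < a" "a < r" "r < r + e" using assms e(1) by (auto simp: a_def)
  ultimately show ?thesis using that by blast
qed

lemma gap:
  assumes "0 < r" "r \<notin> interfaces"
  obtains a b where "0 < a" "a < r" "r < b" "{a<..<b} \<inter> interfaces = {}"
  using punctured_gap[OF assms(1)] assms(2) by (metis Int_insert_right_if0 disjoint_iff inf.idem insert_absorb insert_not_empty subset_singletonD singletonD IntE insertI1)

lemma open_off: "open off"
proof -
  have "open (norm -` (- interfaces) :: (real^3) set)"
    by (intro open_vimage finite_imp_closed finite_interfaces open_Compl) (auto intro!: continuous_intros)
  also have "norm -` (- interfaces) = off" by (auto simp: off_def)
  finally show ?thesis .
qed

lemma resonator_eq: "resonator N rp rm = {x. in_shell (norm x)}"
  by (auto simp: resonator_def shell_def in_shell_def)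

lemma closure_resonator: "closure (resonator N rp rm) = {x. \<exists>j\<in>{1..N}. rm j \<le> norm x \<and> norm x \<le> rp j}"
proof
  have "closed (\<Union>j\<in>{1..N}. {x::real^3. rm j \<le> norm x \<and> norm x \<le> rp j})"
    by (intro closed_UN ballI closed_Collect_conj closed_Collect_le continuous_intros) auto
  moreover have "resonator N rp rm \<subseteq> (\<Union>j\<in>{1..N}. {x. rm j \<le> norm x \<and> norm x \<le> rp j})"
    by (force simp: resonator_def shell_def)
  ultimately have "closure (resonator N rp rm) \<subseteq> (\<Union>j\<in>{1..N}. {x. rm j \<le> norm x \<and> norm x \<le> rp j})"
    by (rule closure_minimal[rotated])
  then show "closure (resonator N rp rm) \<subseteq> {x. \<exists>j\<in>{1..N}. rm j \<le> norm x \<and> norm x \<le> rp j}" by auto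
next
  show "{x. \<exists>j\<in>{1..N}. rm j \<le> norm x \<and> norm x \<le> rp j} \<subseteq> closure (resonator N rp rm)"
  proof safe
    fix x :: "real^3" and j assume j: "j \<in> {1..N}" and x: "rm j \<le> norm x" "norm x \<le> rp j"
    have lim: "x \<in> closure (shell rp rm j)" if l: "at x within A \<noteq> bot" "A \<subseteq> shell rp rm j" for A
    proof -
      have "x islimpt A" using l(1) by (simp add: trivial_limit_within)
      then have "x islimpt shell rp rm j" using l(2) by (rule islimpt_subset)
      then show ?thesis by (simp add: closure_def)
    qed
    have "x \<in> closure (shell rp rm j)"
    proof (cases "norm x = rm j \<or> norm x = rp j")
      case True
      then show ?thesis
      proof
        assume e: "norm x = rm j"
        show ?thesis
          by (rule lim[OF at_within_shell_nonbot(1)[of x "rm j" 0 "rp j"]]) (use e radii[OF j] in \<open>auto simp: shell_def\<close>)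
      next
        assume e: "norm x = rp j"
        show ?thesis
          by (rule lim[OF at_within_shell_nonbot(2)[of x "rp j" "rm j" "rp j + 1"]]) (use e radii[OF j] in \<open>auto simp: shell_def\<close>)
      qed
    next
      case False
      then have "x \<in> shell rp rm j" using x by (simp add: shell_def)
      then show ?thesis using closure_subset by blast
    qed
    then show "x \<in> closure (resonator N rp rm)"
    proof -
      have "shell rp rm j \<subseteq> resonator N rp rm" using j by (auto simp: resonator_def)
      from closure_mono[OF this] show "x \<in> closure (shell rp rm j) \<Longrightarrow> ?thesis" by blast
    qed
  qed
qed

text \<open>Like \<open>resonator_eq\<close>, this translates a domain of (P) into a condition on
  the norm alone.\<close>

lemma host_eq: "- closure (resonator N rp rm) = {x \<in> off. \<not> in_shell (norm x)}"
proof -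
  have "(\<exists>j\<in>{1..N}. rm j \<le> t \<and> t \<le> rp j) \<longleftrightarrow> t \<in> interfaces \<or> in_shell t" for t
  proof
    assume "\<exists>j\<in>{1..N}. rm j \<le> t \<and> t \<le> rp j"
    then obtain j where j: "j \<in> {1..N}" "rm j \<le> t" "t \<le> rp j" by blast
    then show "t \<in> interfaces \<or> in_shell t"
      by (cases "t = rm j"; cases "t = rp j") (auto simp: interfaces_def in_shell_def intro!: bexI[of _ j])
  next
    assume "t \<in> interfaces \<or> in_shell t"
    then show "\<exists>j\<in>{1..N}. rm j \<le> t \<and> t \<le> rp j"
    proof
      assume "t \<in> interfaces"
      then obtain j where "j \<in> {1..N}" "t = rp j \<or> t = rm j" unfolding interfaces_def by blast
      then show ?thesis using radii[of j] by (intro bexI[of _ j]) auto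
    next
      assume "in_shell t"
      then obtain j where "j \<in> {1..N}" "rm j < t" "t < rp j" unfolding in_shell_def by blast
      then show ?thesis by (intro bexI[of _ j]) auto
    qed
  qed
  then show ?thesis unfolding closure_resonator off_def by blast
qed

lemma not_interface_in_shell: "in_shell r \<Longrightarrow> r \<notin> interfaces"
proof
  assume "in_shell r" "r \<in> interfaces"
  then obtain j i where j: "j \<in> {1..N}" "rm j < r" "r < rp j" and i: "i \<in> {1..N}" "r = rp i \<or> r = rm i"
    by (auto simp: in_shell_def interfaces_def)
  then show False
    using radii_order[of i j] radii_order[of j i] radii[of i] radii[of j] by (cases "i < j"; cases "j < i") auto
qed

lemma domain_eq: "resonator N rp rm \<union> - closure (resonator N rp rm) = off"
  unfolding host_eq unfolding resonator_eq using not_interface_in_shell by (auto simp: off_def)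

lemma near_rp:
  assumes j: "j \<in> {1..N}"
  obtains a b where "0 < a" "a < rp j" "rp j < b" "{a<..<b} \<inter> interfaces \<subseteq> {rp j}"
     "\<And>r. r \<in> {a<..<rp j} \<Longrightarrow> in_shell r" "\<And>r. r \<in> {rp j<..<b} \<Longrightarrow> \<not> in_shell r"
proof -
  have "0 < rp j" using radii[OF j] by simp
  then obtain a b where ab: "0 < a" "a < rp j" "rp j < b" "{a<..<b} \<inter> interfaces \<subseteq> {rp j}" by (rule punctured_gap)
  have "\<not> in_shell r" if r: "r \<in> {rp j<..<b}" for r
  proof
    assume "in_shell r"
    then obtain i where i: "i \<in> {1..N}" "rm i < r" "r < rp i" by (auto simp: in_shell_def)
    have "rm i \<in> interfaces" using i(1) by (simp add: interfaces_def)
    then have "\<not> (rm i \<in> {a<..<b} \<and> rm i \<noteq> rp j)" using ab(4) by blast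
    then have "rm i \<notin> {rp j<..<b}" using ab(1-3) by auto
    then have "rm i \<le> rp j" using i r by auto
    moreover have "i \<noteq> j" using i r by auto
    ultimately show False using radii_order[of i j] radii_order[of j i] radii[of i] radii[of j] i j r by (cases "i < j") auto
  qed
  moreover have "in_shell r" if "r \<in> {max a (rm j)<..<rp j}" for r
    using that j by (auto simp: in_shell_def)
  moreover have "{max a (rm j)<..<b} \<inter> interfaces \<subseteq> {rp j}" using ab(4) by auto
  ultimately show ?thesis using that[of "max a (rm j)" b] ab(1-3) radii[OF j] by simp
qed

lemma near_rm:
  assumes j: "j \<in> {1..N}"
  obtains a b where "0 < a" "a < rm j" "rm j < b" "{a<..<b} \<inter> interfaces \<subseteq> {rm j}"
     "\<And>r. r \<in> {a<..<rm j} \<Longrightarrow> \<not> in_shell r" "\<And>r. r \<in> {rm j<..<b} \<Longrightarrow> in_shell r"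
proof -
  have "0 < rm j" using radii[OF j] by simp
  then obtain a b where ab: "0 < a" "a < rm j" "rm j < b" "{a<..<b} \<inter> interfaces \<subseteq> {rm j}" by (rule punctured_gap)
  have "\<not> in_shell r" if r: "r \<in> {a<..<rm j}" for r
  proof
    assume "in_shell r"
    then obtain i where i: "i \<in> {1..N}" "rm i < r" "r < rp i" by (auto simp: in_shell_def)
    have "rp i \<in> interfaces" using i(1) by (simp add: interfaces_def)
    then have "\<not> (rp i \<in> {a<..<b} \<and> rp i \<noteq> rm j)" using ab(4) by blast
    then have "rp i \<notin> {a<..<rm j}" using ab(1-3) by auto
    then have "rm j \<le> rp i" using i r by auto
    moreover have "i \<noteq> j" using i r by auto
    ultimately show False using radii_order[of i j] radii_order[of j i] radii[of i] radii[of j] i j r by (cases "i < j") auto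
  qed
  moreover have "in_shell r" if "r \<in> {rm j<..<min b (rp j)}" for r
    using that j by (auto simp: in_shell_def)
  moreover have "{a<..<min b (rp j)} \<inter> interfaces \<subseteq> {rm j}" using ab(4) by auto
  ultimately show ?thesis using that[of a "min b (rp j)"] ab(1-3) radii[OF j] by simp
qed

end

section \<open>Energy argument: solutions with vanishing circle integrals are zero\<close>

context nested_shells
begin

text \<open>The density weight. Both transmission conditions say that \<open>sig\<close> times the
  normal derivative is continuous across the interface.\<close>

definition sig :: "real \<Rightarrow> real \<Rightarrow> real" where "sig \<delta> r = (if in_shell r then 1 else \<delta>)"

text \<open>Problem (P) without incoming wave and without radiation condition, with explicit
  derivatives and with both Helmholtz equations merged into one on \<open>off\<close>. The
  wavenumbers are \<open>kh\<close> in the host and \<open>kd\<close> in the shells.\<close>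

definition piecewise_solution :: "real \<Rightarrow> complex \<Rightarrow> complex \<Rightarrow> (real^3 \<Rightarrow> complex) \<Rightarrow> (3 \<Rightarrow> real^3 \<Rightarrow> complex) \<Rightarrow> (3 \<Rightarrow> 3 \<Rightarrow> real^3 \<Rightarrow> complex) \<Rightarrow> bool" where
  "piecewise_solution \<delta> kh kd w g H \<longleftrightarrow> has_C2 off w g H \<and>
     (\<forall>x\<in>off. (\<Sum>i\<in>UNIV. H i i x) + (if in_shell (norm x) then kd else kh)\<^sup>2 * w x = 0) \<and>
     (\<forall>j\<in>{1..N}. transmission (rp j) \<delta> 1 w \<and> transmission (rm j) 1 \<delta> w)"

lemma flux_alt:
  assumes "0 \<le> r"
  shows "flux w g r = smean (\<lambda>y. (\<lambda>x. of_real (norm x) * (rad1 g x * cnj (w x))) (r *\<^sub>R y))"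
  unfolding flux_def by (rule smean_cong) (use assms in simp)

text \<open>The traces give one-sided limits of the flux. They agree after weighting because the
  traces of \<open>w\<close> coincide and the conormal derivatives satisfy \<alpha> p = \<beta> q
  pointwise.\<close>

lemma flux_tendsto_aux:
  assumes c: "has_C2 off w g H" and ab: "0 < a" "a < \<rho>" "\<rho> < b" "{a<..<b} \<inter> interfaces \<subseteq> {\<rho>}"
    and s1: "\<And>r. r \<in> {a<..<\<rho>} \<Longrightarrow> sig \<delta> r = \<beta>" and s2: "\<And>r. r \<in> {\<rho><..<b} \<Longrightarrow> sig \<delta> r = \<alpha>"
    and t: "transmission \<rho> \<alpha> \<beta> w"
  shows "\<exists>L. ((\<lambda>r. sig \<delta> r * Re (flux w g r)) \<longlongrightarrow> L) (at \<rho>)"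
proof -
  define f where "f = (\<lambda>x. of_real (norm x) * (rad1 g x * cnj (w x)))"
  have "\<forall>y\<in>sphere 0 \<rho>. \<exists>l p q. outer_trace \<rho> w y l \<and> inner_trace \<rho> w y l \<and> outer_trace \<rho> (normal_deriv w) y p 
      \<and> inner_trace \<rho> (normal_deriv w) y q \<and> complex_of_real \<alpha> * p = complex_of_real \<beta> * q"
    using t unfolding transmission_def by blast
  then obtain l p q where tr: "\<And>y. y \<in> sphere 0 \<rho> \<Longrightarrow> outer_trace \<rho> w y (l y) \<and> inner_trace \<rho> w y (l y) \<and> outer_trace \<rho> (normal_deriv w) y (p y) 
      \<and> inner_trace \<rho> (normal_deriv w) y (q y) \<and> complex_of_real \<alpha> * p y = complex_of_real \<beta> * q y"
    by metis
  have offI: "x \<in> off" if "a < norm x" "norm x < b" "norm x \<noteq> \<rho>" for x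
    using ab(4) that by (auto simp: off_def)
  have fe: "f x = of_real (norm x) * ((of_real (norm x) * normal_deriv w x) * cnj (w x))" if "a < norm x" "norm x < b" "norm x \<noteq> \<rho>" for x
  proof -
    have "x \<noteq> 0" using that ab(1) by auto
    then show ?thesis unfolding f_def using normal_deriv_eq[OF c offI[OF that]] by simp
  qed
  have cf: "continuous_on A f" if "A \<subseteq> off" for A unfolding f_def
    by (intro continuous_intros continuous_on_subset[OF has_C2_continuous(1)[OF c] that] continuous_on_subset[OF continuous_on_rad1[OF c] that])
  define F where "F = (\<lambda>p y. complex_of_real \<rho> * ((complex_of_real \<rho> * p y) * cnj (l y)))"
  have near: "\<forall>\<^sub>F x in at y within A. a < norm x \<and> norm x < b" if "y \<in> sphere 0 \<rho>" for y :: "real^3" and A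
  proof -
    have "\<forall>\<^sub>F x in nhds y. x \<in> {x. a < norm x \<and> norm x < b}"
      by (rule eventually_nhds_in_open[OF open_shell]) (use that ab in auto)
    then show ?thesis by (simp add: eventually_at_filter eventually_mono)
  qed
  have lim: "(f \<longlongrightarrow> F p y) (at y within A)"
    if y: "y \<in> sphere 0 \<rho>" and A: "\<And>x. x \<in> A \<Longrightarrow> norm x \<noteq> \<rho>"
      and l: "(w \<longlongrightarrow> l y) (at y within A)" "(normal_deriv w \<longlongrightarrow> p y) (at y within A)" for p y A
  proof (rule Lim_transform_eventually)
    have "((\<lambda>x. complex_of_real (norm x)) \<longlongrightarrow> complex_of_real (norm y)) (at y within A)" by (intro tendsto_intros)
    then have n: "((\<lambda>x. complex_of_real (norm x)) \<longlongrightarrow> complex_of_real \<rho>) (at y within A)" using y by simp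
    show "((\<lambda>x. of_real (norm x) * ((of_real (norm x) * normal_deriv w x) * cnj (w x))) \<longlongrightarrow> F p y) (at y within A)"
      unfolding F_def by (intro tendsto_mult tendsto_cnj n l)
    have "\<forall>\<^sub>F x in at y within A. x \<in> A" by (simp add: eventually_at_filter)
    then show "\<forall>\<^sub>F x in at y within A. of_real (norm x) * ((of_real (norm x) * normal_deriv w x) * cnj (w x)) = f x"
      using near[OF y] by eventually_elim (use fe A in auto)
  qed
  have out: "(f \<longlongrightarrow> F p y) (at y within {x. \<rho> < norm x})" and inn: "(f \<longlongrightarrow> F q y) (at y within {x. norm x < \<rho>})"
    if "y \<in> sphere 0 \<rho>" for y
    using tr[OF that] unfolding outer_trace_def inner_trace_def by (auto intro!: lim[OF that])
  have L1: "((\<lambda>r. smean (\<lambda>y. f (r *\<^sub>R y))) \<longlongrightarrow> smean (\<lambda>y. F p (\<rho> *\<^sub>R y))) (at_right \<rho>)"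
    by (rule smean_tendsto_outer[OF cf]) (use offI ab out in auto)
  have L2: "((\<lambda>r. smean (\<lambda>y. f (r *\<^sub>R y))) \<longlongrightarrow> smean (\<lambda>y. F q (\<rho> *\<^sub>R y))) (at_left \<rho>)"
    by (rule smean_tendsto_inner[where a=a, OF cf]) (use offI ab inn in auto)
  have r: "((\<lambda>r. sig \<delta> r * Re (flux w g r)) \<longlongrightarrow> \<alpha> * Re (smean (\<lambda>y. F p (\<rho> *\<^sub>R y)))) (at_right \<rho>)"
  proof (rule Lim_transform_eventually)
    show "((\<lambda>r. \<alpha> * Re (smean (\<lambda>y. f (r *\<^sub>R y)))) \<longlongrightarrow> \<alpha> * Re (smean (\<lambda>y. F p (\<rho> *\<^sub>R y)))) (at_right \<rho>)"
      by (intro tendsto_intros L1)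
    have "\<forall>\<^sub>F r in at_right \<rho>. r \<in> {\<rho><..<b}" using ab by (simp add: eventually_at_right_field) blast
    then show "\<forall>\<^sub>F r in at_right \<rho>. \<alpha> * Re (smean (\<lambda>y. f (r *\<^sub>R y))) = sig \<delta> r * Re (flux w g r)"
    proof eventually_elim
      case (elim r)
      then have "0 \<le> r" using ab by auto
      from flux_alt[OF this] s2[OF elim] show ?case by (simp add: f_def)
    qed
  qed
  have e: "\<alpha> * Re (smean (\<lambda>y. F p (\<rho> *\<^sub>R y))) = \<beta> * Re (smean (\<lambda>y. F q (\<rho> *\<^sub>R y)))"
  proof -
    have "complex_of_real \<alpha> * smean (\<lambda>y. F p (\<rho> *\<^sub>R y)) = smean (\<lambda>y. complex_of_real \<alpha> * F p (\<rho> *\<^sub>R y))" by (simp add: smean_cmult)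
    also have "\<dots> = smean (\<lambda>y. complex_of_real \<beta> * F q (\<rho> *\<^sub>R y))"
    proof (rule smean_cong)
      fix y :: "real^3" assume y: "y \<in> S2"
      have "\<rho> *\<^sub>R y \<in> sphere 0 \<rho>" using y ab by simp
      then have e: "complex_of_real \<alpha> * p (\<rho> *\<^sub>R y) = complex_of_real \<beta> * q (\<rho> *\<^sub>R y)" using tr by blast
      have "z * F p' (\<rho> *\<^sub>R y) = \<rho> * \<rho> * cnj (l (\<rho> *\<^sub>R y)) * (z * p' (\<rho> *\<^sub>R y))" for z p' by (simp add: F_def mult_ac)
      then show "complex_of_real \<alpha> * F p (\<rho> *\<^sub>R y) = complex_of_real \<beta> * F q (\<rho> *\<^sub>R y)"
        by (simp only: e)
    qed
    also have "\<dots> = complex_of_real \<beta> * smean (\<lambda>y. F q (\<rho> *\<^sub>R y))" by (simp add: smean_cmult)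
    finally have "Re (complex_of_real \<alpha> * smean (\<lambda>y. F p (\<rho> *\<^sub>R y))) = Re (complex_of_real \<beta> * smean (\<lambda>y. F q (\<rho> *\<^sub>R y)))" by simp
    then show ?thesis by simp
  qed
  have l: "((\<lambda>r. sig \<delta> r * Re (flux w g r)) \<longlongrightarrow> \<alpha> * Re (smean (\<lambda>y. F p (\<rho> *\<^sub>R y)))) (at_left \<rho>)"
    unfolding e
  proof (rule Lim_transform_eventually)
    show "((\<lambda>r. \<beta> * Re (smean (\<lambda>y. f (r *\<^sub>R y)))) \<longlongrightarrow> \<beta> * Re (smean (\<lambda>y. F q (\<rho> *\<^sub>R y)))) (at_left \<rho>)"
      by (intro tendsto_intros L2)
    have "\<forall>\<^sub>F r in at_left \<rho>. r \<in> {a<..<\<rho>}" using ab by (simp add: eventually_at_left_field) blast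
    then show "\<forall>\<^sub>F r in at_left \<rho>. \<beta> * Re (smean (\<lambda>y. f (r *\<^sub>R y))) = sig \<delta> r * Re (flux w g r)"
    proof eventually_elim
      case (elim r)
      then have "0 \<le> r" using ab by auto
      from flux_alt[OF this] s1[OF elim] show ?case by (simp add: f_def)
    qed
  qed
  from l r show ?thesis by (metis filterlim_split_at)
qed

lemma flux_tendsto:
  assumes w: "piecewise_solution \<delta> kh kd w g H" and \<rho>: "\<rho> \<in> interfaces"
  shows "\<exists>L. ((\<lambda>r. sig \<delta> r * Re (flux w g r)) \<longlongrightarrow> L) (at \<rho>)"
proof -
  from \<rho> obtain j where j: "j \<in> {1..N}" and "\<rho> = rp j \<or> \<rho> = rm j" by (auto simp: interfaces_def)
  from this(2) show ?thesis
  proof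
    assume e: "\<rho> = rp j"
    obtain a b where ab: "0 < a" "a < rp j" "rp j < b" "{a<..<b} \<inter> interfaces \<subseteq> {rp j}"
     "\<And>r. r \<in> {a<..<rp j} \<Longrightarrow> in_shell r" "\<And>r. r \<in> {rp j<..<b} \<Longrightarrow> \<not> in_shell r"
      by (rule near_rp[OF j]) blast
    show ?thesis unfolding e
      by (rule flux_tendsto_aux[OF _ ab(1-4), where \<alpha>=\<delta> and \<beta>=1 and H=H])
         (use w j ab in \<open>auto simp: sig_def piecewise_solution_def\<close>)
  next
    assume e: "\<rho> = rm j"
    obtain a b where ab: "0 < a" "a < rm j" "rm j < b" "{a<..<b} \<inter> interfaces \<subseteq> {rm j}"
     "\<And>r. r \<in> {a<..<rm j} \<Longrightarrow> \<not> in_shell r" "\<And>r. r \<in> {rm j<..<b} \<Longrightarrow> in_shell r"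
      by (rule near_rm[OF j]) blast
    show ?thesis unfolding e
      by (rule flux_tendsto_aux[OF _ ab(1-4), where \<alpha>=1 and \<beta>=\<delta> and H=H])
         (use w j ab in \<open>auto simp: sig_def piecewise_solution_def\<close>)
  qed
qed

lemma min_interface:
  obtains \<rho> where "0 < \<rho>" "\<And>x. norm x \<le> \<rho> \<Longrightarrow> x \<in> off"
proof -
  have ne: "interfaces \<noteq> {}" using rp1 by blast
  define \<rho> where "\<rho> = Min interfaces / 2"
  have m: "0 < Min interfaces" using ne finite_interfaces interfaces_pos by simp
  have 0: "Min interfaces \<le> r" if "r \<in> interfaces" for r using that finite_interfaces by simp
  have 1: "r \<notin> interfaces" if "r \<le> \<rho>" for r using 0[of r] that m by (auto simp: \<rho>_def)
  show ?thesis by (rule that[of \<rho>]) (use m 1 in \<open>auto simp: \<rho>_def off_def\<close>)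
qed

text \<open>Near the centre the function is C^2, so the product under the mean is bounded, and the
  flux has a further factor r.\<close>

lemma flux_tendsto_0:
  assumes c: "has_C2 off w g H"
  shows "(flux w g \<longlongrightarrow> 0) (at_right 0)"
proof -
  obtain \<rho> where \<rho>: "0 < \<rho>" "\<And>x. norm x \<le> \<rho> \<Longrightarrow> x \<in> off" using min_interface by blast
  have sub: "cball 0 \<rho> \<subseteq> off" using \<rho> by auto
  have ch: "continuous_on (cball 0 \<rho>) (\<lambda>x. rad1 g x * cnj (w x))"
    by (intro continuous_intros continuous_on_subset[OF has_C2_continuous(1)[OF c] sub] continuous_on_subset[OF continuous_on_rad1[OF c] sub])
  then have "bounded ((\<lambda>x. rad1 g x * cnj (w x)) ` cball 0 \<rho>)"
    by (intro compact_imp_bounded compact_continuous_image) auto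
  then obtain B where B: "\<And>x. x \<in> cball 0 \<rho> \<Longrightarrow> norm (rad1 g x * cnj (w x)) \<le> B"
    unfolding bounded_iff by blast
  have bd: "norm (flux w g r) \<le> r * (B * annvol)" if r: "r \<in> {0<..<\<rho>}" for r
  proof -
    have "continuous_on (sphere 0 r) (\<lambda>x. rad1 g x * cnj (w x))"
      by (rule continuous_on_subset[OF ch]) (use r in auto)
    then have c1: "continuous_on S2 (\<lambda>y. (\<lambda>x. rad1 g x * cnj (w x)) (r *\<^sub>R y))"
      by (rule continuous_on_dilated_sphere) (use r in auto)
    have "norm (smean (\<lambda>y. rad1 g (r *\<^sub>R y) * cnj (w (r *\<^sub>R y)))) \<le> B * annvol"
      by (rule smean_norm_le) (use c1 B r in auto)
    then show ?thesis unfolding flux_def smean_cmult using r by (simp add: norm_mult mult_left_mono)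
  qed
  show ?thesis
  proof (rule tendsto_0_le[where K=1 and f = "\<lambda>r. r * (B * annvol)"])
    have "((\<lambda>r. r * (B * annvol)) \<longlongrightarrow> 0 * (B * annvol)) (at_right 0)" by (intro tendsto_intros)
    then show "((\<lambda>r. r * (B * annvol)) \<longlongrightarrow> 0) (at_right 0)" by simp
    have "\<forall>\<^sub>F r in at_right 0. r \<in> {0<..<\<rho>}" using \<rho>(1) by (simp add: eventually_at_right_field) blast
    then show "\<forall>\<^sub>F r in at_right 0. norm (flux w g r) \<le> norm (r * (B * annvol)) * 1"
    proof eventually_elim
      case (elim r)
      then show ?case using bd[of r] by (smt (verit) real_norm_def norm_ge_zero mult.right_neutral)
    qed
  qed
qed

lemma sq_mean_zeroD:
  assumes c: "continuous_on (sphere 0 r) w" and r: "0 < r" and z: "sq_mean w r = 0" and x: "norm x = r"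
  shows "w x = 0"
proof -
  have "smean (\<lambda>y. of_real ((norm (w (r *\<^sub>R y)))\<^sup>2)) = of_real (sq_mean w r)"
    unfolding sq_mean_def smean_of_real by simp
  then have "w (r *\<^sub>R (x /\<^sub>R r)) = 0"
    using smean_zero_imp[of "\<lambda>y. w (r *\<^sub>R y)" "x /\<^sub>R r"] continuous_on_dilated_sphere[OF c] r x z by simp
  then show ?thesis using r by simp
qed

lemma outside_off: "rp 1 < norm x \<Longrightarrow> x \<in> off"
  using rp1_max[of "norm x"] by (auto simp: off_def)

text \<open>The weighted flux G is 0 at the centre, increases on every gap by
  \<open>flux_Re_derivative_ge\<close> and does not jump at the interfaces, so G is nonnegative and
  increasing. A decreasing mean square outside makes it nonpositive there. Hence G vanishes
  identically, and so does the mean square that bounds its derivative from below.\<close>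

lemma energy_rigidity:
  assumes w: "piecewise_solution \<delta> kh kd w g H" and \<delta>: "0 < \<delta>" and R: "rp 1 < R"
    and m: "\<And>x. x \<in> off \<Longrightarrow> integral {0..2*pi} (\<lambda>s. w (rot j s x)) = 0"
    and kh: "norm kh ^ 2 * R\<^sup>2 < 1 / (4 * pi\<^sup>2)" and kd: "norm kd ^ 2 * R\<^sup>2 < 1 / (4 * pi\<^sup>2)"
    and dec: "\<And>r s. rp 1 < r \<Longrightarrow> r \<le> s \<Longrightarrow> s < R \<Longrightarrow> sq_mean w s \<le> sq_mean w r"
    and x: "x \<in> off" "x \<noteq> 0" "norm x < R"
  shows "w x = 0"
proof -
  have c: "has_C2 off w g H" using w by (simp add: piecewise_solution_def)
  define G where "G = (\<lambda>r. sig \<delta> r * Re (flux w g r))"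
  have sig: "sig \<delta> r > 0" for r using \<delta> by (simp add: sig_def)
  \<comment> \<open>The constant \<open>e\<close> is \<open>sig\<close> times the excess of the
    Wirtinger constant over the zeroth-order term; it is positive because of the smallness
    hypotheses on \<open>kh\<close> and \<open>kd\<close>.\<close>
  have key: "\<exists>D e. (G has_real_derivative D) (at r) \<and> e > 0 \<and> e * sq_mean w r \<le> D" if r: "r \<in> {0<..<R} - interfaces" for r
  proof -
    obtain a b where ab: "0 < a" "a < r" "r < b" "{a<..<b} \<inter> interfaces = {}" using gap[of r] r by auto
    define q where "q = (if in_shell r then kd else kh)\<^sup>2"
    have S: "x \<in> off" if "a < norm x" "norm x < b" for x using ab that by (auto simp: off_def)
    have isr: "in_shell s = in_shell r" if "s \<in> {a<..<b}" for s using in_shell_const[OF ab(4) that, of r] ab by simp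
    have q: "(\<Sum>i\<in>UNIV. H i i x) + q * w x = 0" if "a < norm x" "norm x < b" for x
      using w S[OF that] isr[of "norm x"] that by (auto simp: piecewise_solution_def q_def)
    have "\<exists>D. ((\<lambda>r. Re (flux w g r)) has_real_derivative D) (at r) \<and> D \<ge> (1 / (4 * pi\<^sup>2) - norm q * r\<^sup>2) * sq_mean w r"
      by (rule flux_Re_derivative_ge[OF c ab(1) _ S q m]) (use ab S in auto)
    then obtain D where D: "((\<lambda>r. Re (flux w g r)) has_real_derivative D) (at r)" "D \<ge> (1 / (4 * pi\<^sup>2) - norm q * r\<^sup>2) * sq_mean w r" by blast
    have "norm q * r\<^sup>2 \<le> norm q * R\<^sup>2" using r by (intro mult_left_mono power_mono) auto
    also have "\<dots> < 1 / (4 * pi\<^sup>2)" using kh kd by (simp add: q_def norm_power)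
    finally have e: "1 / (4 * pi\<^sup>2) - norm q * r\<^sup>2 > 0" by simp
    have "((\<lambda>s. sig \<delta> r * Re (flux w g s)) has_real_derivative sig \<delta> r * D) (at r)" by (rule DERIV_cmult[OF D(1)])
    then have "(G has_real_derivative sig \<delta> r * D) (at r)"
    proof (rule DERIV_cong_ev[OF refl _ refl, THEN iffD1, rotated])
      have "\<forall>\<^sub>F s in nhds r. s \<in> {a<..<b}" using ab by (intro eventually_nhds_in_open) auto
      then show "\<forall>\<^sub>F s in nhds r. sig \<delta> r * Re (flux w g s) = G s"
        by eventually_elim (use isr in \<open>auto simp: G_def sig_def\<close>)
    qed
    moreover have "sig \<delta> r * (1 / (4 * pi\<^sup>2) - norm q * r\<^sup>2) * sq_mean w r \<le> sig \<delta> r * D"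
      using mult_left_mono[OF D(2), of "sig \<delta> r"] sig[of r] by (simp add: mult.assoc)
    ultimately show ?thesis using e sig[of r] by (metis mult_pos_pos)
  qed
  have spo: "sphere 0 r \<subseteq> off" if "r \<notin> interfaces" for r using that by (auto simp: off_def)
  have cw: "continuous_on (sphere 0 r) w" if "r \<notin> interfaces" for r
    by (rule continuous_on_subset[OF has_C2_continuous(1)[OF c] spo[OF that]])
  have nn: "0 \<le> sq_mean w r" if "r \<in> {0<..<R} - interfaces" for r
    by (rule sq_mean_nonneg[OF cw]) (use that in auto)
  have z0: "(G \<longlongrightarrow> 0) (at_right 0)"
  proof -
    have "((\<lambda>r. \<delta> * Re (flux w g r)) \<longlongrightarrow> \<delta> * Re 0) (at_right 0)" by (intro tendsto_intros flux_tendsto_0[OF c])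
    moreover obtain \<rho> where \<rho>: "0 < \<rho>" "\<And>x. norm x \<le> \<rho> \<Longrightarrow> x \<in> off" using min_interface by blast
    have "\<not> in_shell r" if "r \<in> {0<..<\<rho>}" for r
    proof
      assume "in_shell r"
      then obtain i where i: "i \<in> {1..N}" "rm i < r" by (auto simp: in_shell_def)
      have "norm (rm i *\<^sub>R axis 1 1 :: real^3) = rm i" using radii[OF i(1)] by simp
      then have "rm i \<notin> interfaces" using \<rho>(2)[of "rm i *\<^sub>R axis 1 1"] i that by (auto simp: off_def)
      then show False using i by (auto simp: interfaces_def)
    qed
    then have "\<forall>\<^sub>F r in at_right 0. \<delta> * Re (flux w g r) = G r"
      using \<rho>(1) unfolding eventually_at_right_field by (intro exI[of _ \<rho>]) (auto simp: G_def sig_def)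
    ultimately show ?thesis by (simp add: tendsto_cong)
  qed
  have dpos: "\<exists>D\<ge>0. (G has_real_derivative D) (at r)" if r: "r \<in> {0<..<R} - interfaces" for r
    using key[OF r] nn[OF r] by (metis less_imp_le mult_nonneg_nonneg order_trans)
  have "0 \<notin> interfaces" using interfaces_pos by blast
  note mono0 = mono_except_finite[where G=G and R=R, OF finite_interfaces this _ _ z0]
  have mono: "0 \<le> G r" "G r \<le> G s" if "r \<in> {0<..<R} - interfaces" "s \<in> {0<..<R} - interfaces" "r \<le> s" for r s
    by (rule mono0[OF dpos flux_tendsto[OF w, folded G_def] that]; assumption)+
  \<comment> \<open>The radiation condition enters only here, in the form of
    \<open>dec\<close>.\<close>
  have np: "G s \<le> 0" if s: "rp 1 < s" "s < R" for s
  proof -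
    have "(sq_mean w has_real_derivative 2 * Re (flux w g s) / s\<^sup>2) (at s)"
      by (rule sq_mean_derivative[OF c rp1(2), of s "s + 1"]) (use s in \<open>auto intro: outside_off\<close>)
    then have "2 * Re (flux w g s) / s\<^sup>2 \<le> 0"
      by (rule antimono_imp_derivative_nonpos) (use dec s in auto)
    then have "Re (flux w g s) \<le> 0" using s rp1(2) by (simp add: divide_le_0_iff)
    then show ?thesis using sig[of s] by (simp add: G_def mult_nonneg_nonpos)
  qed
  have Gz: "G r = 0" if r: "r \<in> {0<..<R} - interfaces" for r
  proof -
    \<comment> \<open>A radius that is not below \<open>r\<close>, lies beyond all interfaces and
      below \<open>R\<close>; there the two sign conditions on G meet.\<close>
    define s where "s = (max r (rp 1) + R) / 2"
    have s: "r \<le> s" "rp 1 < s" "s < R" using r R by (auto simp: s_def max_def)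
    then have s': "s \<in> {0<..<R} - interfaces" using rp1 rp1_max[of s] by auto
    show ?thesis using mono[OF r s' s(1)] np[OF s(2,3)] by auto
  qed
  have r: "norm x \<in> {0<..<R} - interfaces" using x by (auto simp: off_def)
  obtain D e where D: "(G has_real_derivative D) (at (norm x))" "e > 0" "e * sq_mean w (norm x) \<le> D" using key[OF r] by blast
  have "(G has_real_derivative 0) (at (norm x))"
  proof (rule DERIV_cong_ev[OF refl _ refl, THEN iffD1, OF _ DERIV_const[of 0]])
    have "open ({0<..<R} - interfaces)" using finite_interfaces by (intro open_Diff finite_imp_closed) auto
    from eventually_nhds_in_open[OF this r] show "\<forall>\<^sub>F s in nhds (norm x). 0 = G s"
      by eventually_elim (use Gz in auto)
  qed
  with D(1) have "D = 0" using DERIV_unique by blast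
  with D(2,3) nn[OF r] have "sq_mean w (norm x) = 0" by (simp add: mult_le_0_iff)
  then show ?thesis
    by (intro sq_mean_zeroD[OF cw]) (use r in auto)
qed

end

section \<open>Legendre polynomials and spherical harmonics\<close>

text \<open>W = (x^2 - 1)^n satisfies (x^2 - 1) W' = 2 n x W; the identity is this equation
  differentiated j + 1 times. The base case differentiates once, and every induction step once
  more.\<close>

lemma legendre_rodrigues_ode:
  fixes n :: nat
  defines "D \<equiv> \<lambda>j. (pderiv ^^ j) ([:- 1, 0, 1:] ^ n :: real poly)"
  shows "[:- 1, 0, 1:] * D (j + 2) + Polynomial.smult (2 + 2 * of_nat j - 2 * of_nat n) ([:0, 1:] * D (j + 1)) 
     + Polynomial.smult (of_nat j * (of_nat j + 1) - 2 * of_nat n - 2 * of_nat n * of_nat j) (D j) = 0"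
proof (induction j)
  case 0
  have "[:- 1, 0, 1:] * pderiv ([:- 1, 0, 1:] ^ n :: real poly) = Polynomial.smult (2 * of_nat n) ([:0,1:] * [:- 1, 0, 1:] ^ n)"
  proof (cases n)
    case (Suc m)
    have "pderiv [:- 1, 0, 1:] = ([:0, 2:] :: real poly)" by (simp add: pderiv_pCons)
    then show ?thesis unfolding Suc pderiv_power_Suc by (simp add: algebra_simps smult_add_left)
  qed simp
  then have "pderiv ([:- 1, 0, 1:] * D 1) = pderiv (Polynomial.smult (2 * of_nat n) ([:0,1:] * D 0))"
    by (simp add: D_def)
  moreover have "pderiv (D 0) = D 1" "pderiv (D 1) = D 2" by (simp_all add: D_def numeral_2_eq_2)
  ultimately have "[:- 1, 0, 1:] * D 2 + [:0, 2:] * D 1 = Polynomial.smult (2 * of_nat n) ([:0,1:] * D 1 + D 0)"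
  proof -
    assume *: "pderiv ([:- 1, 0, 1:] * D 1) = pderiv (Polynomial.smult (2 * of_nat n) ([:0,1:] * D 0))"
      and d: "pderiv (D 0) = D 1" "pderiv (D 1) = D 2"
    have "poly ([:- 1, 0, 1:] * D 2 + [:0, 2:] * D 1) x = poly (Polynomial.smult (2 * of_nat n) ([:0,1:] * D 1 + D 0)) x" for x
      using arg_cong[OF *, of "\<lambda>p. poly p x"] unfolding pderiv_mult pderiv_smult d
      by (simp add: pderiv_pCons algebra_simps)
    then show ?thesis by (simp add: poly_eq_poly_eq_iff[symmetric] fun_eq_iff)
  qed
  then have "poly ([:- 1, 0, 1:] * D 2 + [:0, 2:] * D 1) x = poly (Polynomial.smult (2 * of_nat n) ([:0,1:] * D 1 + D 0)) x" for x
    by simp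
  then show ?case unfolding poly_eq_poly_eq_iff[symmetric] fun_eq_iff by (simp add: algebra_simps flip: numeral_2_eq_2)
next
  case (Suc j)
  have d: "pderiv (D i) = D (Suc i)" for i by (simp add: D_def)
  have "poly (pderiv ([:- 1, 0, 1:] * D (j + 2) + Polynomial.smult (2 + 2 * of_nat j - 2 * of_nat n) ([:0, 1:] * D (j + 1)) 
     + Polynomial.smult (of_nat j * (of_nat j + 1) - 2 * of_nat n - 2 * of_nat n * of_nat j) (D j))) x = 0" for x
    unfolding Suc.IH by simp
  then show ?case
    unfolding poly_eq_poly_eq_iff[symmetric] fun_eq_iff pderiv_mult pderiv_smult pderiv_add d
    by (simp add: pderiv_pCons algebra_simps)
qed

text \<open>The preceding identity at index n + m, where Rodrigues' formula turns the derivatives of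
  (x^2 - 1)^n into those of the Legendre polynomial.\<close>

lemma legendre_deriv_ode:
  fixes n m :: nat
  defines "P \<equiv> \<lambda>j. (pderiv ^^ j) (legendre_poly n)"
  shows "(1 - t\<^sup>2) * poly (P (m + 2)) t - 2 * (real m + 1) * t * poly (P (m + 1)) t 
     + (real n * (real n + 1) - real m * (real m + 1)) * poly (P m) t = 0"
proof -
  define D where "D = (\<lambda>j. (pderiv ^^ j) ([:- 1, 0, 1:] ^ n :: real poly))"
  define c where "c = 1 / (2 ^ n * fact n :: real)"
  have "(pderiv ^^ j) (Polynomial.smult c p) = Polynomial.smult c ((pderiv ^^ j) p)" for j and p :: "real poly"
    by (induction j) (simp_all add: pderiv_smult)
  then have P: "P j = Polynomial.smult c (D (n + j))" for j
    unfolding P_def legendre_poly_def D_def c_def by (simp add: funpow_add add.commute[of n])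
  have "poly ([:- 1, 0, 1:] * D ((n + m) + 2) + Polynomial.smult (2 + 2 * of_nat (n + m) - 2 * of_nat n) ([:0, 1:] * D ((n + m) + 1)) 
     + Polynomial.smult (of_nat (n + m) * (of_nat (n + m) + 1) - 2 * of_nat n - 2 * of_nat n * of_nat (n + m)) (D (n + m))) t = 0"
    unfolding D_def legendre_rodrigues_ode by simp
  then have "c * ((t\<^sup>2 - 1) * poly (D (n + m + 2)) t + 2 * (real m + 1) * t * poly (D (n + m + 1)) t 
    + (real m * (real m + 1) - real n * (real n + 1)) * poly (D (n + m)) t) = 0"
    by (simp add: algebra_simps power2_eq_square)
  then show ?thesis unfolding P by (simp add: algebra_simps)
qed

text \<open>The defining formula extends Y_n^m to all of space as z^k times a derivative of the
  Legendre polynomial in x_3, with z = x_1 + i sgn(m) x_2. The power z^k is harmonic, and on the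
  unit sphere the Legendre equation turns the remaining terms of \<open>Lam\<close> into the
  eigenvalue.\<close>

lemma spherical_harmonic_C2:
  fixes n :: nat and m :: int
  obtains g H where "has_C2 UNIV (spherical_harmonic n m) g H"
    "\<And>x. x \<in> S2 \<Longrightarrow> Lam g H x = - of_nat (n * (n + 1)) * spherical_harmonic n m x"
proof -
  define k where "k = nat \<bar>m\<bar>"
  define s :: complex where "s = \<i> * of_int (sgn m)"
  define c where "c = complex_of_real (sqrt ((2 * real n + 1) / (4 * pi) * (fact (n - k) / fact (n + k))))"
  define P where "P = (\<lambda>j. (pderiv ^^ j) (legendre_poly n))"
  \<comment> \<open>\<open>e\<close> and \<open>f\<close> are the gradients of the linear functions
    z and x_3. For m = 0 the function z degenerates to x_1, but then k = 0 and only its zeroth power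
    occurs.\<close>
  define e :: "3 \<Rightarrow> complex" where "e = (\<lambda>i. if i = 1 then 1 else if i = 2 then s else 0)"
  define f :: "3 \<Rightarrow> complex" where "f = (\<lambda>i. if i = 3 then 1 else 0)"
  define z where "z = (\<lambda>x::real^3. \<Sum>i\<in>UNIV. x $ i *\<^sub>R e i)"
  define a0 where "a0 = (\<lambda>x. c * z x ^ k)"
  define a1 where "a1 = (\<lambda>x. c * (of_nat k * z x ^ (k - 1)))"
  define a2 where "a2 = (\<lambda>x. c * (of_nat k * (of_nat (k - 1) * z x ^ (k - 2))))"
  define b where "b = (\<lambda>j (x::real^3). complex_of_real (poly (P (k + j)) (x $ 3)))"
  define g where "g = (\<lambda>i x. a1 x * e i * b 0 x + a0 x * (f i * b 1 x))"
  define H where "H = (\<lambda>i j x. (a2 x * e j * e i * b 0 x + a1 x * e i * (f j * b 1 x)) + (a1 x * e j * (f i * b 1 x) + a0 x * (f i * (f j * b 2 x))))"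
  have Y: "spherical_harmonic n m x = a0 x * b 0 x" for x
  proof -
    have "Complex (x $ 1) (of_int (sgn m) * x $ 2) = z x"
      by (simp add: z_def e_def s_def sum_3 complex_eq_iff)
    then show ?thesis by (simp add: spherical_harmonic_def a0_def b_def P_def c_def k_def)
  qed
  have dz: "(z has_derivative (grad_form e)) (at x)" for x
    unfolding z_def by (intro has_derivative_sum has_derivative_scaleR_left bounded_linear_imp_has_derivative bounded_linear_vec_nth)
  have fsum: "(\<Sum>i\<in>UNIV. h $ i *\<^sub>R f i) = of_real (h $ 3)" for h :: "real^3"
    by (simp add: f_def sum_3 scaleR_conv_of_real)
  have da0: "(a0 has_derivative (grad_form (\<lambda>i. a1 x * e i))) (at x)" for x
  proof -
    have "(a0 has_derivative (\<lambda>h. c * (of_nat k * (\<Sum>i\<in>UNIV. h $ i *\<^sub>R e i) * z x ^ (k - 1)))) (at x)"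
      unfolding a0_def by (intro has_derivative_mult_right has_derivative_power dz)
    then show ?thesis by (simp add: a1_def sum_distrib_left sum_distrib_right mult_ac)
  qed
  have da1: "(a1 has_derivative (grad_form (\<lambda>i. a2 x * e i))) (at x)" for x
  proof -
    have "(a1 has_derivative (\<lambda>h. c * (of_nat k * (of_nat (k - 1) * (\<Sum>i\<in>UNIV. h $ i *\<^sub>R e i) * z x ^ (k - 1 - 1))))) (at x)"
      unfolding a1_def by (intro has_derivative_mult_right has_derivative_power dz)
    moreover have "k - 1 - 1 = k - 2" by simp
    ultimately show ?thesis by (simp add: a2_def sum_distrib_left sum_distrib_right mult_ac)
  qed
  have db: "(b j has_derivative (grad_form (\<lambda>i. (f i * b (Suc j) x)))) (at x)" for j x
  proof -
    have 1: "(poly (P (k + j)) has_real_derivative poly (P (k + Suc j)) (x $ 3)) (at (x $ 3))"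
      using poly_DERIV[of "P (k + j)" "x $ 3"] by (simp add: P_def)
    have "((\<lambda>x. poly (P (k + j)) (x $ 3)) has_derivative (\<lambda>h. poly (P (k + Suc j)) (x $ 3) * h $ 3)) (at x)"
      using has_derivative_compose[OF bounded_linear_imp_has_derivative[OF bounded_linear_vec_nth] 1[unfolded has_field_derivative_def]] .
    from has_derivative_of_real[OF this, where 'a=complex]
    have "(b j has_derivative (\<lambda>h. of_real (h $ 3) * b (Suc j) x)) (at x)" unfolding b_def by (simp add: mult.commute)
    moreover have "of_real (h $ 3) * b (Suc j) x = (\<Sum>i\<in>UNIV. h $ i *\<^sub>R (f i * b (Suc j) x))" for h :: "real^3"
      unfolding fsum[symmetric] by (simp add: sum_distrib_right)
    ultimately show ?thesis by simp
  qed
  have dmul: "((\<lambda>x. A x * B x) has_derivative (grad_form (\<lambda>i. A' i * B x + A x * B' i))) (at x)"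
    if "(A has_derivative (grad_form A')) (at x)" "(B has_derivative (grad_form B')) (at x)"
    for A B :: "real^3 \<Rightarrow> complex" and A' B' x
    by (rule has_derivative_eq_rhs[OF has_derivative_mult[OF that]])
       (simp add: fun_eq_iff sum_distrib_left sum_distrib_right sum.distrib[symmetric] algebra_simps)
  have dcm: "((\<lambda>x. A x * q) has_derivative (grad_form (\<lambda>i. A' i * q))) (at x)"
    if "(A has_derivative (grad_form A')) (at x)"
    for A :: "real^3 \<Rightarrow> complex" and A' x q
    by (rule has_derivative_eq_rhs[OF has_derivative_mult_left[OF that]])
       (simp add: fun_eq_iff sum_distrib_left sum_distrib_right algebra_simps)
  have dcm2: "((\<lambda>x. q * A x) has_derivative (grad_form (\<lambda>i. q * A' i))) (at x)"
    if "(A has_derivative (grad_form A')) (at x)"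
    for A :: "real^3 \<Rightarrow> complex" and A' x q
    using dcm[OF that, of q] by (simp add: mult.commute)
  have dadd: "((\<lambda>x. A x + B x) has_derivative (grad_form (\<lambda>i. A' i + B' i))) (at x)"
    if "(A has_derivative (grad_form A')) (at x)" "(B has_derivative (grad_form B')) (at x)"
    for A B :: "real^3 \<Rightarrow> complex" and A' B' x
    by (rule has_derivative_eq_rhs[OF has_derivative_add[OF that]]) (simp add: fun_eq_iff sum.distrib scaleR_add_right)
  have C2: "has_C2 UNIV (spherical_harmonic n m) g H"
    unfolding has_C2_def
  proof (intro conjI ballI allI)
    fix x :: "real^3"
    show "(spherical_harmonic n m has_derivative (grad_form (\<lambda>i. g i x))) (at x)"
      using dmul[OF da0[of x] db[of 0 x]] unfolding Y[abs_def] g_def by simp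
    show "(g i has_derivative (grad_form (\<lambda>j. H i j x))) (at x)" for i
      using dadd[OF dmul[OF dcm[OF da1[of x], of "e i"] db[of 0 x]] dmul[OF da0[of x] dcm2[OF db[of 1 x], of "f i"]]]
      unfolding g_def H_def by (simp add: numeral_2_eq_2)
  next
    have cont: "continuous_on UNIV z" "continuous_on UNIV (b j)" for j
      using dz db by (meson continuous_at_imp_continuous_on has_derivative_continuous)+
    show "continuous_on UNIV (H i j)" for i j
      unfolding H_def a0_def a1_def a2_def by (intro continuous_intros cont)
  qed
  have L: "Lam g H x = - of_nat (n * (n + 1)) * spherical_harmonic n m x" if x: "x \<in> S2" for x
  proof -
    have ze: "z x = of_real (x $ 1) + of_real (x $ 2) * s" by (simp add: z_def sum_3 e_def scaleR_conv_of_real)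
    have za1: "a1 x * z x = of_nat k * a0 x" unfolding a1_def a0_def by (cases k) auto
    have za2: "a2 x * (z x * z x) = of_nat k * (of_nat k - 1) * a0 x"
    proof (cases "k \<le> 1")
      case True
      then have "k = 0 \<or> k = 1" by auto
      then show ?thesis unfolding a2_def by auto
    next
      case False
      then obtain q where "k = Suc (Suc q)" by (metis One_nat_def Suc_le_eq le_0_eq nat_le_linear not_less_eq_eq old.nat.exhaust)
      then show ?thesis unfolding a2_def a0_def by (simp add: algebra_simps)
    qed
    \<comment> \<open>The vector (1, s, 0) is null for nonzero m, which makes the powers of z
      harmonic; for m = 0 the factor \<open>a2\<close> vanishes instead.\<close>
    have as: "a2 x * (1 + s * s) = 0"
    proof (cases "m = 0")
      case True then show ?thesis by (simp add: a2_def k_def)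
    next
      case False
      then have "sgn m * sgn m = 1" by (simp add: sgn_if)
      then have "(of_int (sgn m) * of_int (sgn m) :: complex) = 1" by (metis of_int_1 of_int_mult)
      moreover have "(\<i> * a) * (\<i> * a) = - (a * a)" for a :: complex by (simp add: algebra_simps)
      ultimately have "s * s = -1" by (simp only: s_def)
      then show ?thesis by simp
    qed
    define t where "t = x $ 3"
    have nx: "(norm x)\<^sup>2 = 1" using x by simp
    have lap: "(\<Sum>i\<in>UNIV. H i i x) = a0 x * b 2 x"
    proof -
      have "(\<Sum>i\<in>UNIV. H i i x) = (a2 x * (1 + s * s)) * b 0 x + a0 x * b 2 x"
        by (simp add: sum_3 H_def e_def f_def algebra_simps)
      then show ?thesis by (simp only: as) simp
    qed
    have r1: "(\<Sum>i\<in>UNIV. x $ i *\<^sub>R g i x) = (a1 x * z x) * b 0 x + t * a0 x * b 1 x"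
      unfolding ze by (simp add: sum_3 g_def e_def f_def t_def scaleR_conv_of_real algebra_simps)
    have r2: "(\<Sum>i\<in>UNIV. \<Sum>j\<in>UNIV. (x $ i * x $ j) *\<^sub>R H i j x) = (a2 x * (z x * z x)) * b 0 x + 2 * t * ((a1 x * z x) * b 1 x) + t * t * a0 x * b 2 x"
      unfolding ze by (simp add: sum_3 H_def e_def f_def t_def scaleR_conv_of_real algebra_simps)
    have ode: "complex_of_real ((1 - t\<^sup>2) * poly (P (k + 2)) t - 2 * (real k + 1) * t * poly (P (k + 1)) t 
     + (real n * (real n + 1) - real k * (real k + 1)) * poly (P k) t) = 0"
      unfolding P_def legendre_deriv_ode by simp
    then have ode': "(1 - t * t) * b 2 x - 2 * (of_nat k + 1) * t * b 1 x + (of_nat n * (of_nat n + 1) - of_nat k * (of_nat k + 1)) * b 0 x = 0"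
      by (simp add: b_def t_def power2_eq_square)
    have "Lam g H x = a0 x * ((1 - t * t) * b 2 x - 2 * (of_nat k + 1) * t * b 1 x - of_nat k * (of_nat k + 1) * b 0 x)"
      unfolding Lam_def nx lap r1 r2 za1 za2 by (simp add: algebra_simps)
    also have "(1 - t * t) * b 2 x - 2 * (of_nat k + 1) * t * b 1 x - of_nat k * (of_nat k + 1) * b 0 x = - (of_nat n * (of_nat n + 1)) * b 0 x"
      using ode' by (simp add: algebra_simps)
    finally show ?thesis unfolding Y by (simp add: algebra_simps)
  qed
  show ?thesis by (rule that[OF C2 L])
qed

text \<open>Membership in the whole eigenspace of degree \<open>n\<close>, detached from the basis
  Y_n^m: unlike a single basis function, this property is invariant under rotations.\<close>

definition harmonic :: "nat \<Rightarrow> (real^3 \<Rightarrow> complex) \<Rightarrow> bool" where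
  "harmonic n f \<longleftrightarrow> (\<exists>g H. has_C2 UNIV f g H \<and> (\<forall>x\<in>S2. Lam g H x = - of_nat (n * (n + 1)) * f x))"

lemma harmonic_spherical_harmonic: "harmonic n (spherical_harmonic n m)"
  unfolding harmonic_def by (rule spherical_harmonic_C2[of n m]) blast

lemma harmonic_continuous: "harmonic n f \<Longrightarrow> continuous_on A f"
  unfolding harmonic_def by (meson continuous_on_subset has_C2_continuous(1) subset_UNIV)

lemma harmonic_cmult:
  assumes "harmonic n f" shows "harmonic n (\<lambda>x. c * f x)"
proof -
  obtain g H where gH: "has_C2 UNIV f g H" "\<And>x. x \<in> S2 \<Longrightarrow> Lam g H x = - of_nat (n * (n + 1)) * f x"
    using assms unfolding harmonic_def by blast
  have "Lam (\<lambda>i x. c * g i x) (\<lambda>i j x. c * H i j x) x = c * Lam g H x" for x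
    by (simp add: Lam_def sum_distrib_left algebra_simps)
  then show ?thesis unfolding harmonic_def using has_C2_cmult[OF gH(1), of c] gH(2)
    by (intro exI conjI) auto
qed

lemma harmonic_add:
  assumes "harmonic n f" "harmonic n f'" shows "harmonic n (\<lambda>x. f x + f' x)"
proof -
  obtain g H where gH: "has_C2 UNIV f g H" "\<And>x. x \<in> S2 \<Longrightarrow> Lam g H x = - of_nat (n * (n + 1)) * f x"
    using assms(1) unfolding harmonic_def by blast
  obtain g' H' where gH': "has_C2 UNIV f' g' H'" "\<And>x. x \<in> S2 \<Longrightarrow> Lam g' H' x = - of_nat (n * (n + 1)) * f' x"
    using assms(2) unfolding harmonic_def by blast
  have "Lam (\<lambda>i x. g i x + g' i x) (\<lambda>i j x. H i j x + H' i j x) x = Lam g H x + Lam g' H' x" for x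
    by (simp add: Lam_def sum.distrib scaleR_add_right algebra_simps)
  then have "Lam (\<lambda>i x. g i x + g' i x) (\<lambda>i j x. H i j x + H' i j x) x = - of_nat (n * (n + 1)) * (f x + f' x)" if "x \<in> S2" for x
    by (simp only: gH(2)[OF that] gH'(2)[OF that] distrib_left)
  then show ?thesis unfolding harmonic_def using has_C2_add[OF gH(1) gH'(1)] by blast
qed

lemma harmonic_diff:
  assumes "harmonic n f" "harmonic n f'" shows "harmonic n (\<lambda>x. f x - f' x)"
  using harmonic_add[OF assms(1) harmonic_cmult[OF assms(2), of "-1"]] by simp

lemma harmonic_zero: "harmonic n (\<lambda>x. 0)"
  using harmonic_cmult[OF harmonic_spherical_harmonic[of n 0], of 0] by simp

lemma harmonic_sum:
  assumes "\<And>i. i \<in> I \<Longrightarrow> harmonic n (f i)" shows "harmonic n (\<lambda>x. \<Sum>i\<in>I. f i x)"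
  using assms by (induction I rule: infinite_finite_induct) (auto simp: harmonic_zero intro: harmonic_add)

lemma harmonic_rot:
  assumes "harmonic n f" shows "harmonic n (\<lambda>x. f (rot j s x))"
proof -
  obtain g H where gH: "has_C2 UNIV f g H" "\<And>x. x \<in> S2 \<Longrightarrow> Lam g H x = - of_nat (n * (n + 1)) * f x"
    using assms unfolding harmonic_def by blast
  show ?thesis unfolding harmonic_def
    using has_C2_linear_comp[OF gH(1) linear_rot[of j s], of UNIV] Lam_rot[of j s g H] gH(2) norm_rot[of j s]
    by (intro exI conjI) (auto simp: gH(2))
qed

text \<open>Eigenfunctions of a symmetric operator for different eigenvalues are orthogonal, and n
  (n + 1) is strictly increasing in n.\<close>

lemma harmonic_orthogonal:
  assumes f: "harmonic n f" and f': "harmonic n' f'" and ne: "n \<noteq> n'"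
  shows "smean (\<lambda>y. f y * cnj (f' y)) = 0"
proof -
  obtain g H where gH: "has_C2 UNIV f g H" "\<And>x. x \<in> S2 \<Longrightarrow> Lam g H x = - of_nat (n * (n + 1)) * f x"
    using f unfolding harmonic_def by blast
  obtain g' H' where gH': "has_C2 UNIV f' g' H'" "\<And>x. x \<in> S2 \<Longrightarrow> Lam g' H' x = - of_nat (n' * (n' + 1)) * f' x"
    using f' unfolding harmonic_def by blast
  have L: "Lam (\<lambda>i x. cnj (g' i x)) (\<lambda>i j x. cnj (H' i j x)) x = cnj (Lam g' H' x)" for x
    by (simp add: Lam_def)
  have "smean (\<lambda>y. Lam g H y * cnj (f' y)) = smean (\<lambda>y. f y * cnj (Lam g' H' y))"
    using smean_Lam_symmetric[OF gH(1) has_C2_cnj[OF gH'(1)], of 1] unfolding L by simp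
  moreover have "smean (\<lambda>y. Lam g H y * cnj (f' y)) = smean (\<lambda>y. - of_nat (n * (n + 1)) * (f y * cnj (f' y)))"
    by (rule smean_cong) (simp add: gH(2) del: mem_sphere_0)
  moreover have "smean (\<lambda>y. f y * cnj (Lam g' H' y)) = smean (\<lambda>y. - of_nat (n' * (n' + 1)) * (f y * cnj (f' y)))"
    by (rule smean_cong) (simp add: gH'(2) del: mem_sphere_0)
  ultimately have eq: "- of_nat (n * (n + 1)) * smean (\<lambda>y. f y * cnj (f' y)) = - of_nat (n' * (n' + 1)) * smean (\<lambda>y. f y * cnj (f' y))"
    by (simp only: smean_cmult)
  then have eq: "of_nat (n * (n + 1)) * smean (\<lambda>y. f y * cnj (f' y)) = of_nat (n' * (n' + 1)) * smean (\<lambda>y. f y * cnj (f' y))"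
    by (simp only: minus_mult_left[symmetric] neg_equal_iff_equal)
  have "(- of_nat (n * (n + 1)) + of_nat (n' * (n' + 1))) * smean (\<lambda>y. f y * cnj (f' y)) = 0"
    unfolding distrib_right minus_mult_left[symmetric] eq by (rule left_minus)
  moreover have "n * (n + 1) \<noteq> n' * (n' + 1)"
  proof
    assume e: "n * (n + 1) = n' * (n' + 1)"
    show False
    proof (cases "n < n'")
      case True
      then have "n * (n + 1) < n' * (n' + 1)" by (intro mult_strict_mono) auto
      with e show False by simp
    next
      case False
      then have "n' * (n' + 1) < n * (n + 1)" using ne by (intro mult_strict_mono) auto
      with e show False by simp
    qed
  qed
  then have "- of_nat (n * (n + 1)) + of_nat (n' * (n' + 1)) \<noteq> (0::complex)"
    by (metis add.commute add_uminus_conv_diff eq_iff_diff_eq_0 of_nat_eq_iff)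
  ultimately show ?thesis by simp
qed


section \<open>Spherical Hankel functions and outgoing expansions\<close>

text \<open>\<open>h\<^sub>n\<^sup>(\<^sup>1\<^sup>)(z) = c e\<^sup>i\<^sup>z z\<^sup>-\<^sup>n\<^sup>-\<^sup>1 p(z)\<close>, where the polynomial \<open>p\<close> has constant term \<open>1\<close> and coefficients in the
  closed unit disc, so that near \<open>0\<close> the factor \<open>z\<^sup>-\<^sup>n\<^sup>-\<^sup>1\<close> dominates uniformly in \<open>n\<close>.\<close>

lemma hankel_form:
  obtains K :: complex and c :: "nat \<Rightarrow> complex" where "K \<noteq> 0" "c 0 = 1" "\<And>j. norm (c j) \<le> 1"
    "\<And>z. z \<noteq> 0 \<Longrightarrow> spherical_hankel1 n z = K * exp (\<i> * z) / z ^ (n + 1) * (\<Sum>j\<le>n. c j * z ^ j)"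
proof -
  define a where "a = (\<lambda>l. fact (n + l) / (fact l * fact (n - l)) :: real)"
  have ap: "a l > 0" for l by (simp add: a_def)
  \<comment> \<open>The quotient of consecutive coefficients is (n + l + 1) (n - l) / (l + 1), which
    is at least 2 for l < n. The resulting factor 2^j compensates the powers of i / 2 and gives
    coefficients of modulus at most 1.\<close>
  have step: "2 * a l \<le> a (Suc l)" if "l < n" for l
  proof -
    have e: "fact (n - l) = (real n - real l) * fact (n - Suc l)"
      using that by (metis Suc_diff_Suc fact_Suc of_nat_diff less_imp_le_nat of_nat_mult of_nat_fact)
    define X where "X = real (n + l + 1) * (real n - real l) / (real l + 1)"
    have "a (Suc l) = a l * ((real (n + l + 1)) * (real n - real l) / (real l + 1))"
    proof -
      have gen: "(A * X) / ((B * Y) * F) = X / (Y * (d * F)) * (A * d / B)" if "d \<noteq> 0" for A X B Y F d :: real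
        using that by (cases "B = 0"; cases "Y = 0"; cases "F = 0") (simp_all add: field_simps)
      have "real n - real l \<noteq> 0" using that by simp
      from gen[OF this, of "real (n + l + 1)" "fact (n + l)" "real l + 1" "fact l" "fact (n - Suc l)"]
      show ?thesis unfolding a_def e by (simp add: add_ac)
    qed
    moreover have "2 * (real l + 1) \<le> real (n + l + 1) * (real n - real l)"
    proof -
      have "2 * (real l + 1) * 1 \<le> real (n + l + 1) * (real n - real l)" using that by (intro mult_mono) auto
      then show ?thesis by simp
    qed
    then have "2 \<le> real (n + l + 1) * (real n - real l) / (real l + 1)" by (simp add: pos_le_divide_eq)
    ultimately have "a (Suc l) = a l * X" "2 \<le> X" by (simp_all only: X_def)
    then show ?thesis using mult_left_mono[of 2 X "a l"] ap[of l] by simp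
  qed
  have bd: "2 ^ j * a (n - j) \<le> a n" if "j \<le> n" for j
    using that
  proof (induction j)
    case (Suc j)
    have "2 * a (n - Suc j) \<le> a (n - j)" using step[of "n - Suc j"] Suc.prems by (simp add: Suc_diff_Suc)
    then have "2 ^ j * (2 * a (n - Suc j)) \<le> 2 ^ j * a (n - j)" by (intro mult_left_mono) auto
    also have "2 ^ j * a (n - j) \<le> a n" using Suc by simp
    finally show ?case by (simp add: mult_ac)
  qed simp
  define c where "c = (\<lambda>j. if j \<le> n then of_real (a (n - j) / a n) * (\<i> / 2) ^ (n - j) / (\<i> / 2) ^ n else 0)"
  define K where "K = (- \<i>) ^ (n + 1) * of_real (a n) * (\<i> / 2) ^ n"
  show ?thesis
  proof (rule that[of K c])
    show "K \<noteq> 0" using ap[of n] by (simp add: K_def)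
    show "c 0 = 1" using ap[of n] by (simp add: c_def)
    show "norm (c j) \<le> 1" for j
    proof (cases "j \<le> n")
      case True
      then have "norm (c j) = 2 ^ j * a (n - j) / a n"
        using ap[of n] ap[of "n - j"] by (simp add: c_def norm_mult norm_divide norm_power power_diff field_simps)
      then show ?thesis using bd[OF True] ap[of n] by simp
    qed (simp add: c_def)
    fix z :: complex assume z: "z \<noteq> 0"
    have t: "of_real (a (n - j)) * (\<i> / (2 * z)) ^ (n - j) = of_real (a n) * (\<i> / 2) ^ n / z ^ n * (c j * z ^ j)" if "j \<le> n" for j
    proof -
      have "(\<i> / (2 * z)) ^ (n - j) = (\<i> / 2) ^ (n - j) * (z ^ j / z ^ n)"
        using z that by (simp add: power_diff power_divide power_mult_distrib field_simps)
      then show ?thesis using that ap[of n] by (simp add: c_def)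
    qed
    have "(\<Sum>l\<le>n. fact (n + l) / (fact l * fact (n - l)) * (\<i> / (2 * z)) ^ l) = (\<Sum>l\<le>n. of_real (a l) * (\<i> / (2 * z)) ^ l)"
      by (simp add: a_def)
    also have "\<dots> = (\<Sum>j\<le>n. of_real (a (n - j)) * (\<i> / (2 * z)) ^ (n - j))"
      by (rule sum.reindex_bij_witness[of _ "\<lambda>j. n - j" "\<lambda>j. n - j"]) auto
    also have "\<dots> = of_real (a n) * (\<i> / 2) ^ n / z ^ n * (\<Sum>j\<le>n. c j * z ^ j)"
      unfolding sum_distrib_left by (intro sum.cong refl t) auto
    finally show "spherical_hankel1 n z = K * exp (\<i> * z) / z ^ (n + 1) * (\<Sum>j\<le>n. c j * z ^ j)"
      unfolding spherical_hankel1_def K_def by (simp add: mult_ac)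
  qed
qed

lemma power_diff_le:
  fixes r s :: real
  assumes "0 \<le> r" "r \<le> s"
  shows "s ^ Suc j - r ^ Suc j \<le> real (Suc j) * s ^ j * (s - r)"
proof (induction j)
  case (Suc j)
  have "s ^ Suc (Suc j) - r ^ Suc (Suc j) = s * (s ^ Suc j - r ^ Suc j) + r ^ Suc j * (s - r)" by (simp add: algebra_simps)
  also have "\<dots> \<le> s * (real (Suc j) * s ^ j * (s - r)) + s ^ Suc j * (s - r)"
    using assms Suc.IH by (intro add_mono mult_left_mono mult_right_mono power_mono) auto
  also have "\<dots> = real (Suc (Suc j)) * s ^ Suc j * (s - r)" by (simp add: algebra_simps)
  finally show ?case .
qed simp

lemma geometric_le:
  fixes x :: real assumes "0 \<le> x" "x < 1" shows "(\<Sum>j<n. x ^ j) \<le> 1 / (1 - x)"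
proof -
  have "(\<Sum>j<n. x ^ j) = (1 - x ^ n) / (1 - x)" using assms by (simp add: sum_gp_strict)
  also have "\<dots> \<le> 1 / (1 - x)" using assms by (intro divide_right_mono) auto
  finally show ?thesis .
qed

text \<open>In the factorization of \<open>hankel_form\<close> the exponential and the polynomial
  together grow from r to s at most by exp (3 |k| (s - r)). For |k| s at most 1/8, a single factor r
  / s out of the n + 1 available ones already outweighs this, so the bound is uniform in
  \<open>n\<close>, as termwise comparison of expansions requires.\<close>

lemma hankel_antimono:
  assumes k: "k \<noteq> 0" and r: "0 < r" "r \<le> s" and small: "norm k * s \<le> 1/8"
  shows "spherical_hankel1 n (k * of_real r) \<noteq> 0"
    and "norm (spherical_hankel1 n (k * of_real s)) \<le> norm (spherical_hankel1 n (k * of_real r))"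
proof -
  obtain K :: complex and c :: "nat \<Rightarrow> complex" where K: "K \<noteq> 0" and c: "c 0 = 1" "\<And>j. norm (c j) \<le> 1"
    and h: "\<And>z. z \<noteq> 0 \<Longrightarrow> spherical_hankel1 n z = K * exp (\<i> * z) / z ^ (n + 1) * (\<Sum>j\<le>n. c j * z ^ j)"
    by (rule hankel_form[of n]) blast
  define zr zs where z: "zr = k * of_real r" "zs = k * of_real s"
  define p where "p = (\<lambda>z. \<Sum>j\<le>n. c j * z ^ j)"
  have p_def': "(\<Sum>j\<le>n. c j * z ^ j) = p z" for z by (simp add: p_def)
  define \<kappa> where "\<kappa> = norm k"
  have \<kappa>: "\<kappa> > 0" using k by (simp add: \<kappa>_def)
  have ks: "\<kappa> * s \<le> 1/8" using small by (simp add: \<kappa>_def)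
  have kr: "\<kappa> * r \<le> 1/8" using ks r \<kappa> by (meson mult_left_mono less_imp_le order_trans)
  \<comment> \<open>A geometric series with ratio 1/8; the bound 1/7 keeps the polynomial at modulus
    at least 6/7.\<close>
  have p1: "norm (p zr - 1) \<le> 1/7"
  proof -
    have "p zr - 1 = (\<Sum>j<n. c (Suc j) * (k * of_real r) ^ Suc j)"
      unfolding p_def z by (simp add: sum.atMost_shift c)
    then have "norm (p zr - 1) \<le> (\<Sum>j<n. norm (c (Suc j) * (k * of_real r) ^ Suc j))" by (simp add: norm_sum)
    also have "\<dots> \<le> (\<Sum>j<n. (1/8) * (1/8) ^ j)"
    proof (rule sum_mono)
      fix j
      have "norm (c (Suc j) * (k * of_real r) ^ Suc j) = norm (c (Suc j)) * (\<kappa> * r) ^ Suc j" using r by (simp add: norm_mult norm_power \<kappa>_def)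
      also have "\<dots> \<le> 1 * (1/8) ^ Suc j" using c(2) kr \<kappa> r by (intro mult_mono power_mono) auto
      finally show "norm (c (Suc j) * (k * of_real r) ^ Suc j) \<le> (1/8) * (1/8) ^ j" by simp
    qed
    also have "\<dots> = (1/8) * (\<Sum>j<n. (1/8) ^ j)" by (simp add: sum_distrib_left)
    also have "\<dots> \<le> (1/8) * (1 / (1 - 1/8))" by (intro mult_left_mono geometric_le) auto
    finally show ?thesis by simp
  qed
  have pr: "norm (p zr) \<ge> 6/7"
    using p1 norm_triangle_sub[of 1 "p zr"] by (simp add: norm_minus_commute)
  have kz: "k * of_real r \<noteq> 0" "k * of_real s \<noteq> 0" using k r by auto
  show "spherical_hankel1 n (k * of_real r) \<noteq> 0"
    unfolding h[OF kz(1)] p_def' using K kz pr[unfolded z] by auto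
  \<comment> \<open>Differences of powers cost a factor j + 1, at most 2^j, which leaves a geometric
    series with ratio 1/4. Its sum 4/3 is below 2 times 6/7.\<close>
  have pd: "norm (p zs - p zr) \<le> 2 * (\<kappa> * (s - r)) * norm (p zr)"
  proof -
    have "p zs - p zr = (\<Sum>j<n. c (Suc j) * k ^ Suc j * of_real (s ^ Suc j - r ^ Suc j))"
      unfolding p_def z by (simp add: sum.atMost_shift sum_subtractf[symmetric] power_mult_distrib algebra_simps)
    then have "norm (p zs - p zr) \<le> (\<Sum>j<n. norm (c (Suc j) * k ^ Suc j * of_real (s ^ Suc j - r ^ Suc j)))" by (simp add: norm_sum)
    also have "\<dots> \<le> (\<Sum>j<n. \<kappa> * (s - r) * (1/4) ^ j)"
    proof (rule sum_mono)
      fix j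
      have nn: "0 \<le> s ^ Suc j - r ^ Suc j" using r by (simp add: power_mono del: power_Suc)
      have "norm (c (Suc j) * k ^ Suc j * of_real (s ^ Suc j - r ^ Suc j)) = norm (c (Suc j)) * (\<kappa> ^ Suc j * (s ^ Suc j - r ^ Suc j))"
        using nn by (simp add: norm_mult norm_power \<kappa>_def del: power_Suc of_real_diff)
      also have "\<dots> \<le> 1 * (\<kappa> ^ Suc j * (real (Suc j) * s ^ j * (s - r)))"
        using c(2) \<kappa> nn power_diff_le[of r s j] r by (intro mult_mono mult_left_mono mult_nonneg_nonneg) auto
      also have "\<dots> = \<kappa> * (s - r) * (real (Suc j) * (\<kappa> * s) ^ j)" by (simp add: power_mult_distrib)
      also have "\<dots> \<le> \<kappa> * (s - r) * (2 ^ j * (1/8) ^ j)"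
      proof (intro mult_left_mono mult_mono power_mono ks)
        have "Suc j \<le> 2 ^ j" by (induction j) auto
        then show "real (Suc j) \<le> 2 ^ j" by (metis of_nat_le_iff of_nat_numeral of_nat_power)
      qed (use \<kappa> r in auto)
      also have "\<dots> = \<kappa> * (s - r) * (1/4) ^ j" by (simp add: power_mult_distrib[symmetric])
      finally show "norm (c (Suc j) * k ^ Suc j * of_real (s ^ Suc j - r ^ Suc j)) \<le> \<kappa> * (s - r) * (1/4) ^ j" .
    qed
    also have "\<dots> = \<kappa> * (s - r) * (\<Sum>j<n. (1/4) ^ j)" by (simp add: sum_distrib_left)
    also have "\<dots> \<le> \<kappa> * (s - r) * (1 / (1 - 1/4))" using \<kappa> r by (intro mult_left_mono geometric_le) auto
    also have "\<dots> \<le> 2 * (\<kappa> * (s - r)) * (6/7)" using \<kappa> r by (simp add: mult_left_mono)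
    also have "\<dots> \<le> 2 * (\<kappa> * (s - r)) * norm (p zr)" using \<kappa> r pr by (intro mult_left_mono) auto
    finally show ?thesis .
  qed
  have ps: "norm (p zs) \<le> exp (2 * (\<kappa> * (s - r))) * norm (p zr)"
  proof -
    have "norm (p zs) \<le> norm (p zr) + norm (p zs - p zr)" by (rule norm_triangle_sub)
    also have "\<dots> \<le> (1 + 2 * (\<kappa> * (s - r))) * norm (p zr)" using pd by (simp add: algebra_simps)
    also have "\<dots> \<le> exp (2 * (\<kappa> * (s - r))) * norm (p zr)" by (intro mult_right_mono exp_ge_add_one_self) auto
    finally show ?thesis .
  qed
  have es: "norm (exp (\<i> * zs)) \<le> exp (\<kappa> * (s - r)) * norm (exp (\<i> * zr))"
  proof -
    have "- (Im k * (s - r)) \<le> \<kappa> * (s - r)"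
    proof -
      have "- Im k \<le> \<kappa>" using abs_Im_le_cmod[of k] by (simp add: \<kappa>_def)
      from mult_right_mono[OF this, of "s - r"] show ?thesis using r by simp
    qed
    then have "- (Im k * s) \<le> \<kappa> * (s - r) + - (Im k * r)" by (simp add: algebra_simps)
    then show ?thesis by (simp add: z norm_exp_eq_Re exp_add[symmetric])
  qed
  \<comment> \<open>With x = (s - r) / s one has r / s = 1 - x, at most exp (-x), while 3 |k| (s -
    r) is at most (3/8) x.\<close>
  have rs: "exp (3 * (\<kappa> * (s - r))) * (1 / s) ^ (n + 1) \<le> (1 / r) ^ (n + 1)"
  proof -
    define x where "x = (s - r) / s"
    have s0: "s > 0" using r by simp
    have x: "0 \<le> x" "x < 1" "r = s * (1 - x)" using r s0 by (auto simp: x_def field_simps)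
    have "\<kappa> * (s - r) = (\<kappa> * s) * x" using s0 by (simp add: x_def)
    also have "\<dots> \<le> (1/8) * x" using ks x by (intro mult_right_mono) auto
    finally have e1: "exp (3 * (\<kappa> * (s - r))) \<le> exp x" using x by simp
    have e2: "exp x * (1 - x) \<le> 1"
    proof -
      have "1 - x \<le> exp (- x)" using exp_ge_add_one_self[of "-x"] by simp
      then have "exp x * (1 - x) \<le> exp x * exp (-x)" by (intro mult_left_mono) auto
      then show ?thesis by (simp add: exp_minus)
    qed
    have e3: "exp x * (1 / s) \<le> 1 / r" 
    proof -
      have "exp x \<le> 1 / (1 - x)" using e2 x by (simp add: pos_le_divide_eq)
      then have "exp x * (1 / s) \<le> (1 / (1 - x)) * (1 / s)" using s0 by (intro mult_right_mono) auto
      also have "\<dots> = 1 / r" unfolding x(3) by simp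
      finally show ?thesis .
    qed
    have le: "1 / s \<le> 1 / r" using r s0 by (simp add: frac_le)
    have "exp (3 * (\<kappa> * (s - r))) * (1 / s) ^ (n + 1) = (exp (3 * (\<kappa> * (s - r))) * (1 / s)) * (1 / s) ^ n" by simp
    also have "\<dots> \<le> (1 / r) * (1 / r) ^ n"
    proof (intro mult_mono power_mono le)
      show "exp (3 * (\<kappa> * (s - r))) * (1 / s) \<le> 1 / r"
        using mult_right_mono[OF e1, of "1 / s"] e3 s0 by simp
    qed (use r s0 in auto)
    finally show ?thesis by simp
  qed
  have "norm (spherical_hankel1 n (k * of_real s)) = norm K / \<kappa> ^ (n+1) * (norm (exp (\<i> * zs)) * (1 / s) ^ (n + 1) * norm (p zs))"
    unfolding h[OF kz(2)] p_def' z using r by (simp add: norm_mult norm_divide norm_power \<kappa>_def power_mult_distrib power_divide mult_ac)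
  also have "\<dots> \<le> norm K / \<kappa> ^ (n+1) * ((exp (\<kappa> * (s - r)) * norm (exp (\<i> * zr))) * (1 / s) ^ (n + 1) * (exp (2 * (\<kappa> * (s - r))) * norm (p zr)))"
    using r \<kappa> by (intro mult_left_mono mult_mono es ps) auto
  also have "\<dots> = norm K / \<kappa> ^ (n+1) * (norm (exp (\<i> * zr)) * (exp (3 * (\<kappa> * (s - r))) * (1 / s) ^ (n + 1)) * norm (p zr))"
  proof -
    have "exp (3 * (\<kappa> * (s - r))) = exp (\<kappa> * (s - r)) * exp (2 * (\<kappa> * (s - r)))" by (simp add: exp_add[symmetric])
    then show ?thesis by (simp add: mult_ac)
  qed
  also have "\<dots> \<le> norm K / \<kappa> ^ (n+1) * (norm (exp (\<i> * zr)) * (1 / r) ^ (n + 1) * norm (p zr))"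
    using r \<kappa> by (intro mult_left_mono mult_right_mono rs) auto
  also have "\<dots> = norm (spherical_hankel1 n (k * of_real r))"
    unfolding h[OF kz(1)] p_def' z using r by (simp add: norm_mult norm_divide norm_power \<kappa>_def power_mult_distrib power_divide mult_ac)
  finally show "norm (spherical_hankel1 n (k * of_real s)) \<le> norm (spherical_hankel1 n (k * of_real r))" .
qed

text \<open>Pythagoras: the cross terms vanish by \<open>harmonic_orthogonal\<close>.\<close>

lemma sq_mean_harmonic_sum:
  assumes Q: "\<And>n. harmonic n (Q n)"
  shows "smean (\<lambda>y. (\<Sum>n<M. a n * Q n y) * cnj (\<Sum>n<M. a n * Q n y)) = (\<Sum>n<M. of_real ((norm (a n))\<^sup>2) * smean (\<lambda>y. Q n y * cnj (Q n y)))"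
proof -
  have cQ: "continuous_on S2 (Q n)" for n using Q by (rule harmonic_continuous)
  have "smean (\<lambda>y. (\<Sum>n<M. a n * Q n y) * cnj (\<Sum>n<M. a n * Q n y)) = smean (\<lambda>y. \<Sum>n<M. \<Sum>m<M. (a n * cnj (a m)) * (Q n y * cnj (Q m y)))"
    by (rule smean_cong) (simp add: sum_product mult_ac)
  also have "\<dots> = (\<Sum>n<M. \<Sum>m<M. (a n * cnj (a m)) * smean (\<lambda>y. Q n y * cnj (Q m y)))"
    by (subst smean_sum, (intro continuous_intros cQ)[1], intro sum.cong refl, subst smean_sum, (intro continuous_intros cQ)[1], simp add: smean_cmult)
  also have "\<dots> = (\<Sum>n<M. \<Sum>m<M. if m = n then (a n * cnj (a n)) * smean (\<lambda>y. Q n y * cnj (Q n y)) else 0)"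
    by (intro sum.cong refl) (use harmonic_orthogonal[OF Q Q] in auto)
  also have "\<dots> = (\<Sum>n<M. of_real ((norm (a n))\<^sup>2) * smean (\<lambda>y. Q n y * cnj (Q n y)))"
    by (simp add: complex_norm_square[symmetric])
  finally show ?thesis .
qed

text \<open>The outgoing condition with all orders of one degree collected into a single harmonic
  \<open>P n\<close>, and with uniform convergence kept on each sphere separately, which suffices
  for taking means.\<close>

definition outgoing_expansion :: "complex \<Rightarrow> real \<Rightarrow> (nat \<Rightarrow> real^3 \<Rightarrow> complex) \<Rightarrow> (real^3 \<Rightarrow> complex) \<Rightarrow> bool" where
  "outgoing_expansion k R P w \<longleftrightarrow> (\<forall>n. harmonic n (P n)) \<and>
     (\<forall>r>R. uniform_limit S2 (\<lambda>M y. \<Sum>n<M. spherical_hankel1 n (k * of_real r) * P n y) (\<lambda>y. w (r *\<^sub>R y)) sequentially)"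

lemma outgoing_expansionI:
  assumes "outgoing k R w" "0 < R"
  shows "\<exists>P. outgoing_expansion k R P w"
proof -
  from assms obtain c where c: "\<And>K. compact K \<Longrightarrow> K \<subseteq> {x. R < norm x} \<Longrightarrow>
       uniform_limit K (\<lambda>M x. \<Sum>n<M. \<Sum>m\<in>{- int n..int n}.
            c n m * spherical_hankel1 n (k * complex_of_real (norm x)) * spherical_harmonic n m (x /\<^sub>R norm x)) w sequentially"
    unfolding outgoing_def by blast
  define P where "P = (\<lambda>n x. \<Sum>m\<in>{- int n..int n}. c n m * spherical_harmonic n m x)"
  have "uniform_limit S2 (\<lambda>M y. \<Sum>n<M. spherical_hankel1 n (k * of_real r) * P n y) (\<lambda>y. w (r *\<^sub>R y)) sequentially" if r: "r > R" for r
  proof (rule uniform_limitI)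
    fix e :: real assume e: "e > 0"
    have sub: "sphere 0 r \<subseteq> {x::real^3. R < norm x}" using r by auto
    have "\<forall>\<^sub>F M in sequentially. \<forall>x\<in>sphere 0 r. dist (\<Sum>n<M. \<Sum>m\<in>{- int n..int n}.
            c n m * spherical_hankel1 n (k * complex_of_real (norm x)) * spherical_harmonic n m (x /\<^sub>R norm x)) (w x) < e"
      by (rule uniform_limitD[OF c[OF compact_sphere sub] e])
    then show "\<forall>\<^sub>F M in sequentially. \<forall>y\<in>S2. dist (\<Sum>n<M. spherical_hankel1 n (k * of_real r) * P n y) (w (r *\<^sub>R y)) < e"
    proof eventually_elim
      case (elim M)
      show ?case
      proof
        fix y :: "real^3" assume y: "y \<in> S2"
        have "r *\<^sub>R y \<in> sphere 0 r" using y r assms(2) by simp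
        from elim[rule_format, OF this] show "dist (\<Sum>n<M. spherical_hankel1 n (k * of_real r) * P n y) (w (r *\<^sub>R y)) < e"
          using y r assms(2) by (simp add: P_def sum_distrib_left mult_ac)
      qed
    qed
  qed
  moreover have "harmonic n (P n)" for n
    unfolding P_def by (intro harmonic_sum harmonic_cmult harmonic_spherical_harmonic)
  ultimately show ?thesis unfolding outgoing_expansion_def by blast
qed

text \<open>A rotation preserves each degree and each sphere, so it acts on the expansion term by
  term and leaves the Hankel factors untouched.\<close>

lemma outgoing_expansion_rot_diff:
  assumes e: "outgoing_expansion k R P w"
  shows "outgoing_expansion k R (\<lambda>n x. P n (rot j s x) - P n x) (\<lambda>x. w (rot j s x) - w x)"
  unfolding outgoing_expansion_def
proof (intro conjI allI impI)
  show "harmonic n (\<lambda>x. P n (rot j s x) - P n x)" for n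
    using e unfolding outgoing_expansion_def by (intro harmonic_diff harmonic_rot) auto
  fix r assume r: "R < r"
  let ?S = "\<lambda>M y. \<Sum>n<M. spherical_hankel1 n (k * of_real r) * P n y"
  have u: "uniform_limit S2 ?S (\<lambda>y. w (r *\<^sub>R y)) sequentially" using e r unfolding outgoing_expansion_def by blast
  have "uniform_limit S2 (\<lambda>M y. ?S M (rot j s y)) (\<lambda>y. w (r *\<^sub>R rot j s y)) sequentially"
    by (rule uniform_limitI, drule uniform_limitD[OF u], erule eventually_mono) auto
  from uniform_limit_minus[OF this u]
  show "uniform_limit S2 (\<lambda>M y. \<Sum>n<M. spherical_hankel1 n (k * of_real r) * (P n (rot j s y) - P n y)) (\<lambda>y. w (rot j s (r *\<^sub>R y)) - w (r *\<^sub>R y)) sequentially"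
    by (simp add: sum_subtractf[symmetric] right_diff_distrib linear_scale[OF linear_rot])
qed

text \<open>Parseval's identity on the sphere of radius \<open>r\<close>: uniform convergence allows
  the limit to be taken under the mean.\<close>

lemma outgoing_sq_mean:
  assumes e: "outgoing_expansion k R P w" and r: "R < r" "0 \<le> r" and c: "continuous_on (sphere 0 r) w"
  shows "(\<lambda>M. \<Sum>n<M. (norm (spherical_hankel1 n (k * of_real r)))\<^sup>2 * Re (smean (\<lambda>y. P n y * cnj (P n y)))) \<longlonglongrightarrow> sq_mean w r"
proof -
  let ?S = "\<lambda>M y. \<Sum>n<M. spherical_hankel1 n (k * of_real r) * P n y"
  have u: "uniform_limit S2 ?S (\<lambda>y. w (r *\<^sub>R y)) sequentially" and h: "\<And>n. harmonic n (P n)" using e r unfolding outgoing_expansion_def by blast+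
  have cw: "continuous_on S2 (\<lambda>y. w (r *\<^sub>R y))" using continuous_on_dilated_sphere[OF c r(2)] .
  have cS: "continuous_on S2 (?S M)" for M by (intro continuous_intros harmonic_continuous[OF h])
  have b: "bounded ((\<lambda>y. w (r *\<^sub>R y)) ` S2)"
    by (intro compact_imp_bounded compact_continuous_image cw) simp
  have u2: "uniform_limit S2 (\<lambda>M y. cnj (?S M y)) (\<lambda>y. cnj (w (r *\<^sub>R y))) sequentially"
    by (rule bounded_linear.uniform_limit[OF bounded_linear_cnj u])
  have b2: "bounded ((\<lambda>y. cnj (w (r *\<^sub>R y))) ` S2)"
    by (intro compact_imp_bounded compact_continuous_image continuous_intros cw) simp
  have "uniform_limit S2 (\<lambda>M y. ?S M y * cnj (?S M y)) (\<lambda>y. w (r *\<^sub>R y) * cnj (w (r *\<^sub>R y))) sequentially"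
    by (rule uniform_lim_mult[OF u u2 b b2])
  then have "(\<lambda>M. smean (\<lambda>y. ?S M y * cnj (?S M y))) \<longlonglongrightarrow> smean (\<lambda>y. w (r *\<^sub>R y) * cnj (w (r *\<^sub>R y)))"
  proof (rule smean_uniform_limit)
    show "continuous_on S2 (\<lambda>y. ?S M y * cnj (?S M y))" for M by (intro continuous_on_mult continuous_on_cnj cS)
    show "continuous_on S2 (\<lambda>y. w (r *\<^sub>R y) * cnj (w (r *\<^sub>R y)))" by (intro continuous_intros cw)
  qed
  then have "(\<lambda>M. Re (smean (\<lambda>y. ?S M y * cnj (?S M y)))) \<longlonglongrightarrow> Re (of_real (sq_mean w r))"
    unfolding sq_mean_eq by (intro tendsto_Re)
  then show ?thesis
    unfolding sq_mean_harmonic_sum[of P, OF h] by simp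
qed

lemma harmonic_sq_nonneg:
  assumes "harmonic n P"
  shows "0 \<le> Re (smean (\<lambda>y. P y * cnj (P y)))"
  by (rule smean_Re_nonneg) (auto intro!: continuous_intros harmonic_continuous[OF assms] simp: complex_norm_square[symmetric])

text \<open>Termwise comparison of the two Parseval series, using the monotonicity of |h_n| for
  every n.\<close>

lemma outgoing_sq_mean_antimono:
  assumes e: "outgoing_expansion k R P w" and k: "k \<noteq> 0" and R: "0 < R" "R < r" "r \<le> s" "norm k * s \<le> 1/8"
    and c: "continuous_on (sphere 0 r) w" "continuous_on (sphere 0 s) w"
  shows "sq_mean w s \<le> sq_mean w r"
proof (rule LIMSEQ_le)
  have h: "\<And>n. harmonic n (P n)" using e unfolding outgoing_expansion_def by blast
  show "(\<lambda>M. \<Sum>n<M. (norm (spherical_hankel1 n (k * of_real r)))\<^sup>2 * Re (smean (\<lambda>y. P n y * cnj (P n y)))) \<longlonglongrightarrow> sq_mean w r"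
    by (rule outgoing_sq_mean[OF e]) (use R c in auto)
  show "(\<lambda>M. \<Sum>n<M. (norm (spherical_hankel1 n (k * of_real s)))\<^sup>2 * Re (smean (\<lambda>y. P n y * cnj (P n y)))) \<longlonglongrightarrow> sq_mean w s"
    by (rule outgoing_sq_mean[OF e]) (use R c in auto)
  show "\<exists>N. \<forall>M\<ge>N. (\<Sum>n<M. (norm (spherical_hankel1 n (k * of_real s)))\<^sup>2 * Re (smean (\<lambda>y. P n y * cnj (P n y))))
      \<le> (\<Sum>n<M. (norm (spherical_hankel1 n (k * of_real r)))\<^sup>2 * Re (smean (\<lambda>y. P n y * cnj (P n y))))"
  proof (intro exI allI impI sum_mono mult_right_mono power_mono harmonic_sq_nonneg[OF h])
    fix n show "norm (spherical_hankel1 n (k * of_real s)) \<le> norm (spherical_hankel1 n (k * of_real r))"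
      by (rule hankel_antimono(2)[OF k]) (use R in auto)
  qed auto
qed

text \<open>If the Parseval sum vanishes at one radius, so does each of its nonnegative terms. As
  h_n is nonzero there, every \<open>P n\<close> vanishes on the sphere, and with it the expansion
  at all radii.\<close>

lemma outgoing_unique_continuation:
  assumes e: "outgoing_expansion k R P w" and k: "k \<noteq> 0" and R: "0 < R" "R < r" "norm k * r \<le> 1/8"
    and c: "continuous_on (sphere 0 r) w" and z: "sq_mean w r = 0" and x: "R < norm x"
  shows "w x = 0"
proof -
  have h: "\<And>n. harmonic n (P n)" using e unfolding outgoing_expansion_def by blast
  let ?t = "\<lambda>n. (norm (spherical_hankel1 n (k * of_real r)))\<^sup>2 * Re (smean (\<lambda>y. P n y * cnj (P n y)))"
  have nn: "0 \<le> ?t n" for n by (intro mult_nonneg_nonneg harmonic_sq_nonneg[OF h]) auto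
  have "(\<lambda>M. \<Sum>n<M. ?t n) \<longlonglongrightarrow> 0"
    using outgoing_sq_mean[OF e _ _ c] R z by simp
  then have s: "?t sums 0" by (simp add: sums_def)
  have t0: "?t n = 0" for n
    using suminf_eq_zero_iff[of ?t] s nn by (auto simp: sums_iff)
  have P0: "P n y = 0" if y: "y \<in> S2" for n y
  proof -
    have "spherical_hankel1 n (k * of_real r) \<noteq> 0" by (rule hankel_antimono(1)[OF k, of r r]) (use R in auto)
    then have "Re (smean (\<lambda>y. P n y * cnj (P n y))) = 0" using t0[of n] by simp
    then have "sq_mean (P n) 1 = 0" using sq_mean_eq[of "P n" 1] by simp
    have "smean (\<lambda>y. complex_of_real ((norm (P n y))\<^sup>2)) = of_real (sq_mean (P n) 1)"
      unfolding sq_mean_def smean_of_real by simp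
    with \<open>sq_mean (P n) 1 = 0\<close> have "smean (\<lambda>y. complex_of_real ((norm (P n y))\<^sup>2)) = 0" by simp
    from smean_zero_imp[OF harmonic_continuous[OF h] this y] show ?thesis .
  qed
  have "uniform_limit S2 (\<lambda>M y. \<Sum>n<M. spherical_hankel1 n (k * of_real (norm x)) * P n y) (\<lambda>y. w (norm x *\<^sub>R y)) sequentially"
    using e x unfolding outgoing_expansion_def by blast
  moreover have nx: "norm x \<noteq> 0" using x R by linarith
  then have xs: "x /\<^sub>R norm x \<in> S2" by simp
  ultimately have "(\<lambda>M. \<Sum>n<M. spherical_hankel1 n (k * of_real (norm x)) * P n (x /\<^sub>R norm x)) \<longlonglongrightarrow> w (norm x *\<^sub>R (x /\<^sub>R norm x))"
    by (rule tendsto_uniform_limitI)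
  then have "(\<lambda>M::nat. 0) \<longlonglongrightarrow> w x" using P0[OF xs] nx by simp
  then show ?thesis by (simp add: LIMSEQ_const_iff)
qed

lemma harmonic_mean_zero:
  assumes "harmonic n P" "n \<noteq> 0" shows "smean P = 0"
proof -
  have "harmonic 0 (\<lambda>x. 1)" unfolding harmonic_def
    by (intro exI[of _ "\<lambda>i x. 0"] exI[of _ "\<lambda>i j x. 0"]) (auto simp: has_C2_const Lam_def)
  from harmonic_orthogonal[OF assms(1) this assms(2)] show ?thesis by simp
qed

text \<open>Averaging over the sphere reproduces a radial function and annihilates every degree
  except 0.\<close>

lemma outgoing_radial:
  assumes e: "outgoing_expansion k R P w" and R: "0 < R" and rad: "\<And>x y. R < norm x \<Longrightarrow> norm x = norm y \<Longrightarrow> w x = w y"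
  shows "\<exists>C. \<forall>x. R < norm x \<longrightarrow> w x = C * spherical_hankel1 0 (k * of_real (norm x))"
proof (intro exI allI impI)
  fix x :: "real^3" assume x: "R < norm x"
  have h: "\<And>n. harmonic n (P n)" using e unfolding outgoing_expansion_def by blast
  let ?h = "\<lambda>n. spherical_hankel1 n (k * of_real (norm x))"
  have u: "uniform_limit S2 (\<lambda>M y. \<Sum>n<M. ?h n * P n y) (\<lambda>y. w (norm x *\<^sub>R y)) sequentially"
    using e x unfolding outgoing_expansion_def by blast
  have cst: "w (norm x *\<^sub>R y) = w x" if "y \<in> S2" for y by (rule rad) (use that x R in auto)
  have "(\<lambda>M. smean (\<lambda>y. \<Sum>n<M. ?h n * P n y)) \<longlonglongrightarrow> smean (\<lambda>y. w (norm x *\<^sub>R y))"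
  proof (rule smean_uniform_limit[OF u])
    show "continuous_on S2 (\<lambda>y. \<Sum>n<M. ?h n * P n y)" for M by (intro continuous_intros harmonic_continuous[OF h])
    show "continuous_on S2 (\<lambda>y. w (norm x *\<^sub>R y))" by (rule continuous_on_eq[OF continuous_on_const[of S2 "w x"]]) (use cst in simp)
  qed
  moreover have "smean (\<lambda>y. w (norm x *\<^sub>R y)) = of_real annvol * w x"
    using smean_cong[of "\<lambda>y. w (norm x *\<^sub>R y)" "\<lambda>y. w x"] cst by (simp add: smean_const)
  moreover have "smean (\<lambda>y. \<Sum>n<M. ?h n * P n y) = (\<Sum>n<M. ?h n * smean (P n))" for M
    by (subst smean_sum) (auto intro!: continuous_intros harmonic_continuous[OF h] simp: smean_cmult)
  moreover have "(\<Sum>n<M. ?h n * smean (P n)) = ?h 0 * smean (P 0)" if "M \<ge> 1" for M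
  proof -
    have "(\<Sum>n<M. ?h n * smean (P n)) = (\<Sum>n<M. if n = 0 then ?h 0 * smean (P 0) else 0)"
      by (intro sum.cong refl) (use harmonic_mean_zero[OF h] in auto)
    then show ?thesis using that by simp
  qed
  ultimately have "(\<lambda>M. \<Sum>n<M. ?h n * smean (P n)) \<longlonglongrightarrow> of_real annvol * w x" "\<forall>\<^sub>F M in sequentially. (\<Sum>n<M. ?h n * smean (P n)) = ?h 0 * smean (P 0)"
    by (auto simp: eventually_sequentially)
  then have "of_real annvol * w x = ?h 0 * smean (P 0)"
    using LIMSEQ_unique[OF _ tendsto_eventually] by blast
  then show "w x = (smean (P 0) / of_real annvol) * ?h 0" using annvol_pos by (simp add: field_simps)
qed

text \<open>A rotation about the first axis removes the third coordinate, then one about the third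
  axis removes the second and makes the first nonnegative. Hence invariance under rotations about
  coordinate axes implies radial symmetry.\<close>

lemma rotate_to_axis:
  shows "\<exists>s t. rot 3 t (rot 1 s x) = norm x *\<^sub>R axis 1 1"
proof -
  have key: "\<exists>s. cos s * a - sin s * b \<ge> 0 \<and> sin s * a + cos s * b = 0" for a b :: real
  proof (cases "a = 0 \<and> b = 0")
    case False
    define q where "q = sqrt (a\<^sup>2 + b\<^sup>2)"
    have "a\<^sup>2 + b\<^sup>2 > 0" using False unfolding sum_power2_gt_zero_iff by blast
    then have q: "q > 0" unfolding q_def by (rule real_sqrt_gt_zero)
    have "(a / q)\<^sup>2 + (b / q)\<^sup>2 = (a\<^sup>2 + b\<^sup>2) / q\<^sup>2" by (simp add: power_divide add_divide_distrib)
    moreover have "q\<^sup>2 = a\<^sup>2 + b\<^sup>2" unfolding q_def by (rule real_sqrt_pow2) simp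
    ultimately have "(a / q)\<^sup>2 + (b / q)\<^sup>2 = 1" using q by (metis divide_self zero_less_power less_irrefl)
    then obtain t where t: "a / q = cos t" "b / q = sin t" using sincos_total_2pi by metis
    then have "a = q * cos t" "b = q * sin t" using q by (simp_all add: field_simps)
    then have "cos (-t) * a - sin (-t) * b = q * ((sin t)\<^sup>2 + (cos t)\<^sup>2)" "sin (-t) * a + cos (-t) * b = 0"
      by (simp_all add: power2_eq_square algebra_simps del: sin_cos_squared_add sin_cos_squared_add2 sin_cos_squared_add3)
    then show ?thesis using q by (metis less_imp_le mult.right_neutral sin_cos_squared_add)
  qed auto
  obtain s where s: "sin s * x $ 2 + cos s * x $ 3 = 0" using key by blast
  define y where "y = rot 1 s x"
  have y3: "y $ 3 = 0" using s by (simp add: y_def rot_def three_simps)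
  obtain t where t: "cos t * y $ 1 - sin t * y $ 2 \<ge> 0" "sin t * y $ 1 + cos t * y $ 2 = 0" using key by blast
  define z where "z = rot 3 t y"
  have z: "z $ 1 \<ge> 0" "z $ 2 = 0" "z $ 3 = 0" using t y3 by (simp_all add: z_def rot_def three_simps)
  then have ze: "z = z $ 1 *\<^sub>R axis 1 1" by (simp add: Finite_Cartesian_Product.vec_eq_iff forall_3 axis_def)
  have "norm z = norm x" by (simp add: z_def y_def)
  moreover have "norm z = z $ 1" by (subst ze) (use z(1) in simp)
  ultimately show ?thesis using ze by (metis z_def y_def)
qed

lemma rot_trace:
  assumes "(f \<longlongrightarrow> l) (at (rot j s y) within {x. norm x \<in> A})"
  shows "((\<lambda>x. f (rot j s x)) \<longlongrightarrow> l) (at y within {x. norm x \<in> A})"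
proof (rule filterlim_compose[OF assms])
  have c: "(rot j s \<longlongrightarrow> rot j s y) (at y within {x. norm x \<in> A})"
    using continuous_on_rot[of UNIV j s] by (metis UNIV_I continuous_on_def tendsto_within_subset subset_UNIV)
  have inj: "rot j s x \<noteq> rot j s y" if "x \<noteq> y" for x
    using that rot_add[of j "-s" s] by (metis add.left_inverse rot_0)
  show "filterlim (rot j s) (at (rot j s y) within {x. norm x \<in> A}) (at y within {x. norm x \<in> A})"
    unfolding filterlim_at using c inj by (auto simp: eventually_at_filter)
qed

section \<open>Radial symmetry of resonant states\<close>

context nested_shells
begin

text \<open>\<open>off\<close> is the union of the two open regions where the respective Helmholtz
  equation holds, so the two pieces of C^2 information glue.\<close>

lemma piecewise_of_scattering:
  assumes sc: "scattering_solution N rp rm v vr \<delta> \<omega> (\<lambda>x. 0) u"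
  obtains g H where "piecewise_solution \<delta> (\<omega> / of_real v) (\<omega> / of_real vr) u g H"
proof -
  have h1: "helmholtz_on {x \<in> off. \<not> in_shell (norm x)} (\<omega> / of_real v) u" and h2: "helmholtz_on {x. in_shell (norm x)} (\<omega> / of_real vr) u"
    and t: "\<forall>j\<in>{1..N}. transmission (rp j) \<delta> 1 u \<and> transmission (rm j) 1 \<delta> u"
    using sc unfolding scattering_solution_def unfolding host_eq unfolding resonator_eq by auto
  define g where "g = (\<lambda>i. partial_deriv (axis i 1) u)"
  define H where "H = (\<lambda>i j. partial_deriv (axis j 1) (partial_deriv (axis i 1) u))"
  have o1: "open {x \<in> off. \<not> in_shell (norm x)}" unfolding host_eq[symmetric] by (simp add: open_Compl)
  have "open (resonator N rp rm)" unfolding resonator_def shell_def by (intro open_UN ballI open_shell)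
  then have o2: "open {x::real^3. in_shell (norm x)}" unfolding resonator_eq .
  have un: "off = {x \<in> off. \<not> in_shell (norm x)} \<union> {x. in_shell (norm x)}"
    using not_interface_in_shell by (auto simp: off_def)
  note c1 = helmholtz_onD(1)[OF h1, folded g_def H_def] and c2 = helmholtz_onD(1)[OF h2, folded g_def H_def]
  have "has_C2 off u g H" unfolding has_C2_def
  proof (intro conjI allI ballI)
    fix i j show "continuous_on off (H i j)"
      by (subst un, rule continuous_on_open_Un[OF o1 o2]) (use c1 c2 in \<open>auto simp: has_C2_def\<close>)
  next
    fix x assume x: "x \<in> off"
    show "(u has_derivative (grad_form (\<lambda>i. g i x))) (at x)"
      by (cases "in_shell (norm x)") (use c1 c2 x in \<open>simp_all add: has_C2_def\<close>)
    show "(g i has_derivative (grad_form (\<lambda>j. H i j x))) (at x)" for i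
      by (cases "in_shell (norm x)") (use c1 c2 x in \<open>simp_all add: has_C2_def\<close>)
  qed
  moreover have "(\<Sum>i\<in>UNIV. H i i x) + (if in_shell (norm x) then \<omega> / of_real vr else \<omega> / of_real v)\<^sup>2 * u x = 0" if "x \<in> off" for x
    using helmholtz_onD(2)[OF h1, of x] helmholtz_onD(2)[OF h2, of x] that by (auto simp: H_def)
  ultimately have "piecewise_solution \<delta> (\<omega> / of_real v) (\<omega> / of_real vr) u g H"
    using t by (simp add: piecewise_solution_def)
  then show ?thesis by (rule that)
qed

lemma near_interface_off:
  assumes "\<rho> \<in> interfaces" "y \<in> sphere 0 \<rho>"
  shows "\<forall>\<^sub>F x in at y within A. norm x \<noteq> \<rho> \<longrightarrow> x \<in> off \<and> x \<noteq> 0"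
proof -
  have "0 < \<rho>" using assms interfaces_pos by blast
  then obtain a b where ab: "0 < a" "a < \<rho>" "\<rho> < b" "{a<..<b} \<inter> interfaces \<subseteq> {\<rho>}" by (rule punctured_gap)
  have "\<forall>\<^sub>F x in nhds y. x \<in> {x. a < norm x \<and> norm x < b}"
    by (rule eventually_nhds_in_open[OF open_shell]) (use assms ab in auto)
  then have "\<forall>\<^sub>F x in at y within A. x \<in> {x. a < norm x \<and> norm x < b}" by (simp add: eventually_at_filter eventually_mono)
  then show ?thesis by eventually_elim (use ab in \<open>auto simp: off_def\<close>)
qed

text \<open>Rotations map each sphere to itself and commute with the radial derivative, so the
  traces of the difference at \<open>y\<close> are differences of traces at the rotated point and at
  \<open>y\<close>.\<close>

lemma transmission_rot_diff:
  assumes c: "has_C2 off u g H" and \<rho>: "\<rho> \<in> interfaces" and t: "transmission \<rho> \<alpha> \<beta> u"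
  shows "transmission \<rho> \<alpha> \<beta> (\<lambda>x. u (rot j s x) - u x)"
proof -
  let ?w = "\<lambda>x. u (rot j s x) - u x"
  have ro: "x \<in> off \<Longrightarrow> rot j s x \<in> off" for x by (simp add: off_def)
  have nd: "normal_deriv u (rot j s x) - normal_deriv u x = normal_deriv ?w x" if x: "x \<in> off" "x \<noteq> 0" for x
  proof -
    note cr = has_C2_linear_comp[OF c linear_rot[of j s] ro]
    have "rot j s x \<noteq> 0" using x(2) norm_rot[of j s x] by (metis norm_eq_zero)
    from normal_deriv_eq[OF c ro[OF x(1)] this] normal_deriv_eq[OF c x] normal_deriv_eq[OF has_C2_diff[OF cr c] x]
    have "of_real (norm x) * normal_deriv ?w x = of_real (norm x) * (normal_deriv u (rot j s x) - normal_deriv u x)"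
      unfolding rad1_def by (simp add: rad_rot scaleR_diff_right sum_subtractf right_diff_distrib)
    then show ?thesis using x(2) by simp
  qed
  show ?thesis unfolding transmission_def
  proof (intro ballI)
    fix y :: "real^3" assume y: "y \<in> sphere 0 \<rho>"
    then have ry: "rot j s y \<in> sphere 0 \<rho>" by simp
    obtain l p q where 1: "outer_trace \<rho> u y l" "inner_trace \<rho> u y l" "outer_trace \<rho> (normal_deriv u) y p" "inner_trace \<rho> (normal_deriv u) y q"
      "complex_of_real \<alpha> * p = complex_of_real \<beta> * q" using t y unfolding transmission_def by blast
    obtain l' p' q' where 2: "outer_trace \<rho> u (rot j s y) l'" "inner_trace \<rho> u (rot j s y) l'" "outer_trace \<rho> (normal_deriv u) (rot j s y) p'" "inner_trace \<rho> (normal_deriv u) (rot j s y) q'"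
      "complex_of_real \<alpha> * p' = complex_of_real \<beta> * q'" using t ry unfolding transmission_def by blast
    have ro: "((\<lambda>x. f (rot j s x)) \<longlongrightarrow> L) (at y within {x. \<rho> < norm x})" if "outer_trace \<rho> f (rot j s y) L" for f L
      using rot_trace[of f L j s y "{\<rho><..}"] that by (simp add: outer_trace_def)
    have ri: "((\<lambda>x. f (rot j s x)) \<longlongrightarrow> L) (at y within {x. norm x < \<rho>})" if "inner_trace \<rho> f (rot j s y) L" for f L
      using rot_trace[of f L j s y "{..<\<rho>}"] that by (simp add: inner_trace_def)
    have a: "outer_trace \<rho> ?w y (l' - l)" "inner_trace \<rho> ?w y (l' - l)"
      using tendsto_diff[OF ro[OF 2(1)] 1(1)[unfolded outer_trace_def]] tendsto_diff[OF ri[OF 2(2)] 1(2)[unfolded inner_trace_def]]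
      by (simp_all add: outer_trace_def inner_trace_def)
    have b: "outer_trace \<rho> (normal_deriv ?w) y (p' - p)" unfolding outer_trace_def
    proof (rule Lim_transform_eventually[OF tendsto_diff[OF ro[OF 2(3)] 1(3)[unfolded outer_trace_def]]])
      have "\<forall>\<^sub>F x in at y within {x. \<rho> < norm x}. \<rho> < norm x" by (simp add: eventually_at_filter)
      then show "\<forall>\<^sub>F x in at y within {x. \<rho> < norm x}. normal_deriv u (rot j s x) - normal_deriv u x = normal_deriv ?w x"
        using near_interface_off[OF \<rho> y, of "{x. \<rho> < norm x}"] by eventually_elim (use nd in auto)
    qed
    have d: "inner_trace \<rho> (normal_deriv ?w) y (q' - q)" unfolding inner_trace_def
    proof (rule Lim_transform_eventually[OF tendsto_diff[OF ri[OF 2(4)] 1(4)[unfolded inner_trace_def]]])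
      have "\<forall>\<^sub>F x in at y within {x. norm x < \<rho>}. norm x < \<rho>" by (simp add: eventually_at_filter)
      then show "\<forall>\<^sub>F x in at y within {x. norm x < \<rho>}. normal_deriv u (rot j s x) - normal_deriv u x = normal_deriv ?w x"
        using near_interface_off[OF \<rho> y, of "{x. norm x < \<rho>}"] by eventually_elim (use nd in auto)
    qed
    have "complex_of_real \<alpha> * (p' - p) = complex_of_real \<beta> * (q' - q)" using 1(5) 2(5) by (simp add: right_diff_distrib)
    with a b d show "(\<exists>l. outer_trace \<rho> ?w y l \<and> inner_trace \<rho> ?w y l) \<and>
     (\<exists>p q. outer_trace \<rho> (normal_deriv ?w) y p \<and> inner_trace \<rho> (normal_deriv ?w) y q \<and> complex_of_real \<alpha> * p = complex_of_real \<beta> * q)"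
      by blast
  qed
qed

lemma piecewise_rot_diff:
  assumes u: "piecewise_solution \<delta> kh kd u g H"
  obtains g' H' where "piecewise_solution \<delta> kh kd (\<lambda>x. u (rot j s x) - u x) g' H'"
proof -
  have c: "has_C2 off u g H" and t: "\<forall>j\<in>{1..N}. transmission (rp j) \<delta> 1 u \<and> transmission (rm j) 1 \<delta> u"
    and eq: "\<And>x. x \<in> off \<Longrightarrow> (\<Sum>i\<in>UNIV. H i i x) + (if in_shell (norm x) then kd else kh)\<^sup>2 * u x = 0"
    using u by (auto simp: piecewise_solution_def)
  have ro: "x \<in> off \<Longrightarrow> rot j s x \<in> off" for x by (simp add: off_def)
  note cr = has_C2_diff[OF has_C2_linear_comp[OF c linear_rot[of j s] ro] c]
  have "piecewise_solution \<delta> kh kd (\<lambda>x. u (rot j s x) - u x) (\<lambda>i x. (\<Sum>k\<in>UNIV. rot j s (axis i 1) $ k *\<^sub>R g k (rot j s x)) - g i x)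
        (\<lambda>i ja x. (\<Sum>k\<in>UNIV. \<Sum>l\<in>UNIV. (rot j s (axis i 1) $ k * rot j s (axis ja 1) $ l) *\<^sub>R H k l (rot j s x)) - H i ja x)"
    unfolding piecewise_solution_def
  proof (intro conjI ballI)
    show "has_C2 off (\<lambda>x. u (rot j s x) - u x) (\<lambda>i x. (\<Sum>k\<in>UNIV. rot j s (axis i 1) $ k *\<^sub>R g k (rot j s x)) - g i x)
        (\<lambda>i ja x. (\<Sum>k\<in>UNIV. \<Sum>l\<in>UNIV. (rot j s (axis i 1) $ k * rot j s (axis ja 1) $ l) *\<^sub>R H k l (rot j s x)) - H i ja x)"
      by (rule cr)
    fix x assume x: "x \<in> off"
    have "(\<Sum>i\<in>UNIV. (\<Sum>k\<in>UNIV. \<Sum>l\<in>UNIV. (rot j s (axis i 1) $ k * rot j s (axis i 1) $ l) *\<^sub>R H k l (rot j s x)) - H i i x)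
      = (\<Sum>i\<in>UNIV. H i i (rot j s x)) - (\<Sum>i\<in>UNIV. H i i x)" by (simp add: sum_subtractf lap_rot)
    then show "(\<Sum>i\<in>UNIV. (\<Sum>k\<in>UNIV. \<Sum>l\<in>UNIV. (rot j s (axis i 1) $ k * rot j s (axis i 1) $ l) *\<^sub>R H k l (rot j s x)) - H i i x)
        + (if in_shell (norm x) then kd else kh)\<^sup>2 * (u (rot j s x) - u x) = 0"
      using eq[OF x] eq[OF ro[OF x]] by (simp add: algebra_simps add_eq_0_iff2)
  next
    fix i assume i: "i \<in> {1..N}"
    show "transmission (rp i) \<delta> 1 (\<lambda>x. u (rot j s x) - u x)" "transmission (rm i) 1 \<delta> (\<lambda>x. u (rot j s x) - u x)"
      using t i by (auto intro!: transmission_rot_diff[OF c] simp: interfaces_def)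
  qed
  then show ?thesis by (rule that)
qed

text \<open>For a rotation about an axis the difference of the rotated solution and \<open>u\<close>
  meets all hypotheses of \<open>energy_rigidity\<close>, so it vanishes near the structure, and by
  its expansion everywhere outside. Invariance under all axis rotations makes \<open>u\<close>
  radial, and a radial outgoing field is a monopole.\<close>

theorem solution_radial:
  assumes sc: "scattering_solution N rp rm v vr \<delta> \<omega> (\<lambda>x. 0) u" and pos: "0 < v" "0 < vr" "0 < \<delta>" and \<omega>: "\<omega> \<noteq> 0"
    and small: "norm \<omega> * (2 * rp 1) \<le> v / 8" "norm \<omega> * (2 * rp 1) \<le> vr / 8"
  shows "\<And>x y. x \<in> off \<Longrightarrow> norm x = norm y \<Longrightarrow> u x = u y"
    and "\<exists>C. \<forall>x. rp 1 < norm x \<longrightarrow> u x = C * spherical_hankel1 0 (\<omega> / of_real v * of_real (norm x))"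
proof -
  define kh where "kh = \<omega> / of_real v"
  define kd where "kd = \<omega> / of_real vr"
  obtain g H where u: "piecewise_solution \<delta> kh kd u g H" using piecewise_of_scattering[OF sc] unfolding kh_def kd_def by blast
  have cu: "continuous_on off u" using u has_C2_continuous(1) unfolding piecewise_solution_def by blast
  have kh0: "kh \<noteq> 0" using \<omega> pos by (simp add: kh_def)
  \<comment> \<open>A radius beyond the structure; twice \<open>rp 1\<close> is what the smallness
    hypotheses are calibrated for.\<close>
  define R where "R = 2 * rp 1"
  have R: "rp 1 < R" "0 < R" using rp1(2) by (auto simp: R_def)
  have kR: "norm kh * R \<le> 1/8" "norm kd * R \<le> 1/8"
    using small pos by (simp_all add: kh_def kd_def R_def norm_divide field_simps)
  \<comment> \<open>The square of 1/8 is 1/64, which is below 1 / (4 pi^2) because pi < 4.\<close>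
  have sqb: "t ^ 2 * R\<^sup>2 < 1 / (4 * pi\<^sup>2)" if t: "0 \<le> t" "t * R \<le> 1/8" for t
  proof -
    have "t ^ 2 * R\<^sup>2 = (t * R)\<^sup>2" by (simp add: power_mult_distrib)
    also have "\<dots> \<le> (1/8)\<^sup>2" using t R by (intro power_mono) auto
    also have "\<dots> < 1 / (4 * pi\<^sup>2)"
    proof -
      have "pi\<^sup>2 < 4\<^sup>2" using pi_less_4 by (intro power_strict_mono) auto
      then show ?thesis by (simp add: field_simps)
    qed
    finally show ?thesis .
  qed
  have "outgoing kh (rp 1) u" using sc by (simp add: scattering_solution_def kh_def)
  then obtain P where P: "outgoing_expansion kh (rp 1) P u" using outgoing_expansionI rp1(2) by blast
  have sp: "sphere 0 r \<subseteq> off" if "rp 1 < r" for r using outside_off that by auto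
  have w0: "u (rot j t x) = u x" if x: "x \<in> off" and t: "t \<in> {0..2*pi}" for j t x
  proof -
    define w where "w = (\<lambda>x. u (rot j t x) - u x)"
    obtain g' H' where w: "piecewise_solution \<delta> kh kd w g' H'" using piecewise_rot_diff[OF u] unfolding w_def by blast
    have cw: "continuous_on off w" using w has_C2_continuous(1) unfolding piecewise_solution_def by blast
    have P': "outgoing_expansion kh (rp 1) (\<lambda>n x. P n (rot j t x) - P n x) w"
      unfolding w_def by (rule outgoing_expansion_rot_diff[OF P])
    \<comment> \<open>Along a circle about the axis the difference is a shift by the angle
      \<open>t\<close> minus the original, and a shift does not change the integral over a
      period.\<close>
    have m: "integral {0..2*pi} (\<lambda>s. w (rot j s x)) = 0" if x: "x \<in> off" for x
    proof -
      have cr: "continuous_on A (\<lambda>s. rot j s x)" for A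
        using continuous_on_slice2[where f="\<lambda>s x. rot j s x" and y=x, OF continuous_rot2[of "A \<times> UNIV"]] by simp
      have c1: "continuous_on UNIV (\<lambda>s. u (rot j s x))"
        by (rule continuous_on_compose2[OF cu cr]) (use x in \<open>auto simp: off_def\<close>)
      have c2: "continuous_on UNIV (\<lambda>s. u (rot j (s + t) x))"
        by (rule continuous_on_compose2[OF c1, of UNIV "\<lambda>s. s + t"]) (auto intro!: continuous_intros)
      have "integral {0..2*pi} (\<lambda>s. w (rot j s x)) = integral {0..2*pi} (\<lambda>s. u (rot j (s + t) x)) - integral {0..2*pi} (\<lambda>s. u (rot j s x))"
        unfolding w_def by (subst Henstock_Kurzweil_Integration.integral_diff[symmetric])
          (auto intro!: integrable_continuous_interval continuous_on_subset[OF c1] continuous_on_subset[OF c2] simp: rot_add add.commute)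
      also have "\<dots> = 0" using periodic_shift_integral[OF c1 _ t] by (simp add: rot_2pi)
      finally show ?thesis .
    qed
    have dec: "sq_mean w s \<le> sq_mean w r" if "rp 1 < r" "r \<le> s" "s < R" for r s
    proof (rule outgoing_sq_mean_antimono[OF P' kh0 rp1(2) that(1,2)])
      have "norm kh * s \<le> norm kh * R" using that by (intro mult_left_mono) auto
      then show "norm kh * s \<le> 1/8" using kR by simp
      show "continuous_on (sphere 0 r) w" "continuous_on (sphere 0 s) w"
        using continuous_on_subset[OF cw sp] that by auto
    qed
    have in0: "w x = 0" if "x \<in> off" "x \<noteq> 0" "norm x < R" for x
      by (rule energy_rigidity[OF w pos(3) R(1) m sqb sqb dec that]) (use kR in auto)
    have "w x = 0"
    proof (cases "x = 0 \<or> norm x < R")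
      case True
      have "rot j t 0 = 0" using linear_0[OF linear_rot] .
      then show ?thesis using in0[OF x] True by (cases "x = 0") (auto simp: w_def)
    next
      case False
      \<comment> \<open>Any radius strictly between \<open>rp 1\<close> and \<open>R\<close> serves:
        the difference is already known to vanish on that sphere, and unique continuation carries
        this outwards.\<close>
      define r where "r = 3/2 * rp 1"
      have r: "rp 1 < r" "r < R" using rp1(2) by (auto simp: r_def R_def)
      have "smean (\<lambda>y. of_real ((norm (w (r *\<^sub>R y)))\<^sup>2)) = smean (\<lambda>y. 0)"
      proof (rule smean_cong)
        fix y :: "real^3" assume y: "y \<in> S2"
        then have "norm (r *\<^sub>R y) = r" using r rp1(2) by simp
        then have "w (r *\<^sub>R y) = 0" using in0[of "r *\<^sub>R y"] outside_off[of "r *\<^sub>R y"] r rp1(2) by fastforce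
        then show "complex_of_real ((norm (w (r *\<^sub>R y)))\<^sup>2) = 0" by simp
      qed
      then have z: "sq_mean w r = 0" by (simp add: sq_mean_def smean_def)
      show ?thesis
      proof (rule outgoing_unique_continuation[OF P' kh0 rp1(2) r(1) _ _ z])
        have "norm kh * r \<le> norm kh * R" using r by (intro mult_left_mono) auto
        then show "norm kh * r \<le> 1/8" using kR by simp
        show "continuous_on (sphere 0 r) w" by (rule continuous_on_subset[OF cw sp[OF r(1)]])
      qed (use False R in auto)
    qed
    then show ?thesis by (simp add: w_def)
  qed
  \<comment> \<open>Angles are reduced modulo 2 pi, as the shift argument was carried out for angles
    within one period.\<close>
  have w1: "u (rot j t x) = u x" if x: "x \<in> off" for j t x
  proof -
    obtain n :: int and t0 where t0: "0 \<le> t0" "t0 < 2 * pi" "t = t0 + 2 * pi * n"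
    proof
      define n where "n = \<lfloor>t / (2*pi)\<rfloor>"
      show "0 \<le> t - 2 * pi * n" "t - 2 * pi * n < 2 * pi" "t = (t - 2 * pi * n) + 2 * pi * n"
        using floor_divide_lower[of "2*pi" t] floor_divide_upper[of "2*pi" t] by (simp_all add: n_def algebra_simps)
    qed
    have "rot j t x = rot j t0 x" 
    proof -
      have "sin t = sin t0 \<and> cos t = cos t0" unfolding sin_cos_eq_iff using t0(3) by blast
      then have "sin t = sin t0" "cos t = cos t0" by auto
      then show ?thesis unfolding rot_def by (simp only:)
    qed
    then show ?thesis using w0[OF x, of t0 j] t0 by simp
  qed
  show rad: "u x = u y" if x: "x \<in> off" "norm x = norm y" for x y
  proof -
    have *: "u x = u (norm x *\<^sub>R axis 1 1)" if x: "x \<in> off" for x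
    proof -
      obtain s t where st: "rot 3 t (rot 1 s x) = norm x *\<^sub>R axis 1 1" using rotate_to_axis by blast
      have "rot 1 s x \<in> off" using x by (simp add: off_def)
      then show ?thesis using w1[OF x, of 1 s] w1[of "rot 1 s x" 3 t] st by simp
    qed
    have "y \<in> off" using x by (simp add: off_def)
    then show ?thesis using *[OF x(1)] *[of y] x(2) by simp
  qed
  show "\<exists>C. \<forall>x. rp 1 < norm x \<longrightarrow> u x = C * spherical_hankel1 0 (\<omega> / of_real v * of_real (norm x))"
    using outgoing_radial[OF P rp1(2) rad[OF outside_off]] by (simp add: kh_def)
qed

end

section \<open>Entire solution functions and radial transfer matrices\<close>

definition sinc_coeff :: "nat \<Rightarrow> complex" where "sinc_coeff n = (-1) ^ n / fact (2 * n + 1)"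
definition cosq_coeff :: "nat \<Rightarrow> complex" where "cosq_coeff n = (-1) ^ n / fact (2 * n)"

text \<open>\<open>Sz (w\<^sup>2) = sin w / w\<close> and \<open>Cz (w\<^sup>2) = cos w\<close>; as functions of the squared wave number they are entire.\<close>

definition Sz :: "complex \<Rightarrow> complex" where "Sz z = (\<Sum>n. sinc_coeff n * z ^ n)"
definition S1 :: "complex \<Rightarrow> complex" where "S1 z = (\<Sum>n. diffs sinc_coeff n * z ^ n)"
text \<open>The second derivative of \<open>Sz\<close>, as \<open>S1\<close> is the first; the prime
  distinguishes it from the sphere \<open>S2\<close>.\<close>

definition S2' :: "complex \<Rightarrow> complex" where "S2' z = (\<Sum>n. diffs (diffs sinc_coeff) n * z ^ n)"
definition Cz :: "complex \<Rightarrow> complex" where "Cz z = (\<Sum>n. cosq_coeff n * z ^ n)"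

lemma summable_fact_dominated:
  fixes c :: "nat \<Rightarrow> complex"
  assumes "\<And>n. norm (c n) \<le> 1 / fact n"
  shows "summable (\<lambda>n. c n * z ^ n)"
proof (rule summable_comparison_test')
  show "summable (\<lambda>n. inverse (fact n) * norm z ^ n)" by (rule summable_exp)
  show "norm (c n * z ^ n) \<le> inverse (fact n) * norm z ^ n" if "n \<ge> 0" for n
    using assms[of n] by (simp add: norm_mult norm_power mult_right_mono divide_inverse)
qed

lemma summable_sinc: "summable (\<lambda>n. sinc_coeff n * z ^ n)"
  by (rule summable_fact_dominated)
     (simp add: sinc_coeff_def norm_divide norm_power frac_le fact_mono del: fact_Suc)

lemma summable_cosq: "summable (\<lambda>n. cosq_coeff n * z ^ n)"
  by (rule summable_fact_dominated)
     (simp add: cosq_coeff_def norm_divide norm_power frac_le fact_mono)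

lemma summable_sinc1: "summable (\<lambda>n. diffs sinc_coeff n * z ^ n)"
  by (rule termdiff_converges_all) (rule summable_sinc)

lemma summable_sinc2: "summable (\<lambda>n. diffs (diffs sinc_coeff) n * z ^ n)"
  by (rule termdiff_converges_all) (rule summable_sinc1)

lemma Sz_derivative: "(Sz has_field_derivative S1 z) (at z)"
  unfolding Sz_def[abs_def] S1_def by (rule termdiffs_strong_converges_everywhere) (rule summable_sinc)

lemma S1_derivative: "(S1 has_field_derivative S2' z) (at z)"
  unfolding S1_def[abs_def] S2'_def by (rule termdiffs_strong_converges_everywhere) (rule summable_sinc1)

lemma S2'_continuous: "isCont S2' z"
proof -
  have "(S2' has_field_derivative (\<Sum>n. diffs (diffs (diffs sinc_coeff)) n * z ^ n)) (at z)"
    unfolding S2'_def[abs_def] by (rule termdiffs_strong_converges_everywhere) (rule summable_sinc2)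
  then show ?thesis by (rule DERIV_isCont)
qed

lemma Cz_derivative: "(Cz has_field_derivative (- Sz z / 2)) (at z)"
proof -
  have "diffs cosq_coeff n = - (1/2) * sinc_coeff n" for n
  proof -
    have "fact (2 * Suc n) = (2 * of_nat (Suc n)) * (fact (2 * n + 1) :: complex)"
      by (simp add: fact_reduce[of "2 * Suc n"] algebra_simps)
    moreover have "of_nat (Suc n) \<noteq> (0::complex)" by (simp del: of_nat_Suc)
    ultimately show ?thesis
      by (simp add: diffs_def cosq_coeff_def sinc_coeff_def del: fact_Suc of_nat_Suc)
  qed
  then have "(\<Sum>n. diffs cosq_coeff n * z ^ n) = (\<Sum>n. - (1/2) * (sinc_coeff n * z ^ n))" by (simp add: mult.assoc)
  also have "\<dots> = - Sz z / 2" unfolding Sz_def by (subst suminf_mult[OF summable_sinc]) simp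
  finally have "(\<Sum>n. diffs cosq_coeff n * z ^ n) = - Sz z / 2" .
  moreover have "(Cz has_field_derivative (\<Sum>n. diffs cosq_coeff n * z ^ n)) (at z)"
    unfolding Cz_def[abs_def] by (rule termdiffs_strong_converges_everywhere) (rule summable_cosq)
  ultimately show ?thesis by simp
qed

text \<open>With z = w^2 this says that the derivative of w \<open>Sz\<close> (w^2), which is sin w,
  is cos w.\<close>

lemma Sz_Cz: "2 * z * S1 z + Sz z = Cz z"
proof -
  have "(\<lambda>n. of_nat n * sinc_coeff n * z ^ (n - Suc 0)) sums S1 z"
    unfolding S1_def by (rule diffs_equiv) (rule summable_sinc1)
  then have "(\<lambda>n. (2 * z) * (of_nat n * sinc_coeff n * z ^ (n - Suc 0)) + sinc_coeff n * z ^ n) sums (2 * z * S1 z + Sz z)"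
    by (intro sums_add sums_mult) (auto simp: Sz_def intro: summable_sums summable_sinc)
  moreover have "(2 * z) * (of_nat n * sinc_coeff n * z ^ (n - Suc 0)) + sinc_coeff n * z ^ n = cosq_coeff n * z ^ n" for n
  proof -
    have 1: "(2 * z) * (of_nat n * sinc_coeff n * z ^ (n - Suc 0)) = 2 * of_nat n * sinc_coeff n * z ^ n"
      by (cases n) simp_all
    have "fact (2 * n + 1) = (2 * of_nat n + 1) * (fact (2 * n) :: complex)" by simp
    moreover have "2 * of_nat n + 1 \<noteq> (0::complex)"
      by (metis of_nat_1 of_nat_add of_nat_eq_0_iff of_nat_mult of_nat_numeral add_is_0 one_neq_zero)
    ultimately have "(2 * of_nat n + 1) * sinc_coeff n = cosq_coeff n"
      by (simp add: sinc_coeff_def cosq_coeff_def del: fact_Suc)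
    then show ?thesis unfolding 1 by (metis distrib_right mult_1)
  qed
  ultimately have "(\<lambda>n. cosq_coeff n * z ^ n) sums (2 * z * S1 z + Sz z)" by simp
  then show ?thesis unfolding Cz_def by (simp add: sums_iff)
qed

text \<open>Differentiate \<open>Sz_Cz\<close> and compare with \<open>Cz_derivative\<close>. For z
  = q |x|^2 this is the Helmholtz equation of sin (k r) / (k r), in a form that is regular at the
  centre.\<close>

lemma Sz_ode: "6 * S1 z + 4 * z * S2' z + Sz z = 0"
proof -
  have "((\<lambda>z. 2 * z * S1 z + Sz z) has_field_derivative (2 * S1 z + 2 * z * S2' z + S1 z)) (at z)"
    by (auto intro!: derivative_eq_intros S1_derivative Sz_derivative)
  then have "(Cz has_field_derivative (2 * S1 z + 2 * z * S2' z + S1 z)) (at z)"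
    by (simp add: Sz_Cz)
  from DERIV_unique[OF this Cz_derivative] have h: "2 * S1 z + 2 * z * S2' z + S1 z = - Sz z / 2" .
  have "6 * S1 z + 4 * z * S2' z + Sz z = 2 * (2 * S1 z + 2 * z * S2' z + S1 z) + Sz z" by (simp add: algebra_simps)
  also have "\<dots> = 0" unfolding h by simp
  finally show ?thesis .
qed

lemma S_at_0: "Sz 0 = 1" "S1 0 = - 1 / 6" "Cz 0 = 1"
proof -
  show "Sz 0 = 1" unfolding Sz_def by (subst powser_zero) (simp add: sinc_coeff_def)
  show "Cz 0 = 1" unfolding Cz_def by (subst powser_zero) (simp add: cosq_coeff_def)
  show "S1 0 = - 1 / 6" unfolding S1_def by (subst powser_zero) (simp add: diffs_def sinc_coeff_def fact_numeral)
qed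

lemma isCont_S [continuous_intros]: "isCont Sz z" "isCont S1 z" "isCont Cz z"
  using Sz_derivative S1_derivative Cz_derivative DERIV_isCont by blast+

lemma continuous_on_S: "continuous_on A Sz" "continuous_on A S1" "continuous_on A Cz" "continuous_on A S2'"
  by (simp_all add: continuous_at_imp_continuous_on isCont_S S2'_continuous)

text \<open>\<open>cc q t\<close> and \<open>ss q t\<close> are cos (sqrt q t) and sin (sqrt q t) /
  sqrt q, the solutions of y'' = - q y with data (1, 0) and (0, 1). They are entire in
  \<open>q\<close>, so no branch of the root is chosen and q = 0 is included.\<close>

definition cc :: "complex \<Rightarrow> real \<Rightarrow> complex" where "cc q t = Cz (q * of_real t ^ 2)"
definition ss :: "complex \<Rightarrow> real \<Rightarrow> complex" where "ss q t = of_real t * Sz (q * of_real t ^ 2)"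

lemma of_real_square_derivative: "((\<lambda>t. q * of_real t ^ 2 :: complex) has_vector_derivative (2 * q * of_real t)) (at t)"
proof -
  have "((\<lambda>t. t ^ 2) has_real_derivative 2 * t) (at t)" by (auto intro!: derivative_eq_intros)
  from bounded_linear.has_vector_derivative[OF bounded_linear_mult_right has_vector_derivative_of_real[OF this], of q]
  show ?thesis by (simp add: mult_ac)
qed

lemma cc_derivative: "(cc q has_vector_derivative (- q * ss q t)) (at t)"
proof -
  from field_vector_diff_chain_at[OF of_real_square_derivative Cz_derivative]
  show ?thesis by (simp add: cc_def[abs_def] ss_def o_def)
qed

lemma ss_derivative: "(ss q has_vector_derivative cc q t) (at t)"
proof -
  note 1 = of_real_square_derivative[of q t]
  have 2: "((\<lambda>t. Sz (q * of_real t ^ 2)) has_vector_derivative (2 * q * of_real t) * S1 (q * of_real t ^ 2)) (at t)"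
    using field_vector_diff_chain_at[OF 1 Sz_derivative] by (simp add: o_def)
  have 3: "((\<lambda>t. complex_of_real t) has_vector_derivative 1) (at t)" by (auto intro!: derivative_eq_intros)
  have "(ss q has_vector_derivative of_real t * ((2 * q * of_real t) * S1 (q * of_real t ^ 2)) + 1 * Sz (q * of_real t ^ 2)) (at t)"
    unfolding ss_def[abs_def] by (rule has_vector_derivative_mult[OF 3 2])
  moreover have "of_real t * ((2 * q * of_real t) * S1 (q * of_real t ^ 2)) + 1 * Sz (q * of_real t ^ 2) = cc q t"
    unfolding cc_def Sz_Cz[symmetric] by (simp add: power2_eq_square)
  ultimately show ?thesis by simp
qed

lemma cc_0 [simp]: "cc q 0 = 1" and ss_0 [simp]: "ss q 0 = 0"
  by (simp_all add: cc_def ss_def S_at_0)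

text \<open>The transfer matrix of the state (U, r^2 U') from radius \<open>a\<close> to radius
  \<open>b\<close> has the rows (\<open>t11\<close>, \<open>t12\<close>) and (- q
  \<open>tau\<close>, \<open>t22\<close>). In \<open>tau\<close> the factor q is divided out by
  means of \<open>S1\<close>, so that it keeps a limit at q = 0. For a = 0 the quotients by
  \<open>a\<close> take the value 0, which is consistent because the flux vanishes at the
  centre.\<close>

definition t11 :: "real \<Rightarrow> real \<Rightarrow> complex \<Rightarrow> complex" where
  "t11 a b q = (of_real a * cc q (b - a) + ss q (b - a)) / of_real b"
definition t12 :: "real \<Rightarrow> real \<Rightarrow> complex \<Rightarrow> complex" where
  "t12 a b q = ss q (b - a) / (of_real a * of_real b)"
definition tau :: "real \<Rightarrow> real \<Rightarrow> complex \<Rightarrow> complex" where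
  "tau a b q = - 2 * of_real (b - a) ^ 3 * S1 (q * of_real (b - a) ^ 2) + of_real a * of_real b * ss q (b - a)"
definition t22 :: "real \<Rightarrow> real \<Rightarrow> complex \<Rightarrow> complex" where
  "t22 a b q = (of_real b * cc q (b - a) - ss q (b - a)) / of_real a"

lemma tau_eq: "- q * tau a b q = of_real (b - a) * cc q (b - a) - ss q (b - a) - of_real a * of_real b * q * ss q (b - a)"
proof -
  let ?L = "of_real (b - a) :: complex"
  have "?L * cc q (b - a) - ss q (b - a) = ?L * (2 * (q * ?L ^ 2) * S1 (q * ?L ^ 2))"
    unfolding cc_def ss_def Sz_Cz[symmetric] by (simp only: distrib_left) simp
  then show ?thesis unfolding tau_def by (simp only:) (simp add: algebra_simps power2_eq_square power3_eq_cube)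
qed

text \<open>The radial Helmholtz equation U'' + 2 U' / r + q U = 0 as a first-order system for U and
  \<Theta> = r^2 U'.\<close>

definition radial_ode :: "real \<Rightarrow> real \<Rightarrow> complex \<Rightarrow> (real \<Rightarrow> complex) \<Rightarrow> (real \<Rightarrow> complex) \<Rightarrow> bool" where
  "radial_ode a b q U \<Theta> \<longleftrightarrow> (\<forall>r\<in>{a<..<b}. (U has_vector_derivative \<Theta> r / of_real r ^ 2) (at r) \<and>
      (\<Theta> has_vector_derivative (- q * of_real r ^ 2 * U r)) (at r))"

text \<open>V = r U satisfies V'' = - q V with V' = U + \<Theta> / r. Propagating V and V' from r to
  the fixed radius s gives expressions \<open>X\<close> and \<open>Y\<close> whose derivatives in r
  vanish; comparing r with s yields the formulas.\<close>

lemma radial_ode_transfer_aux: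
  assumes o: "radial_ode a b q U \<Theta>" and a: "0 \<le> a" and rs: "r \<in> {a<..<b}" "s \<in> {a<..<b}"
  shows "of_real s * U s = of_real r * U r * cc q (s - r) + (U r + \<Theta> r / of_real r) * ss q (s - r)"
    and "U s + \<Theta> s / of_real s = - q * of_real r * U r * ss q (s - r) + (U r + \<Theta> r / of_real r) * cc q (s - r)"
proof -
  define V where "V = (\<lambda>r. of_real r * U r)"
  define W where "W = (\<lambda>r. U r + \<Theta> r / of_real r)"
  have dU: "(U has_vector_derivative \<Theta> r / of_real r ^ 2) (at r)" and d\<Theta>: "(\<Theta> has_vector_derivative (- q * of_real r ^ 2 * U r)) (at r)"
    if "r \<in> {a<..<b}" for r using o that by (auto simp: radial_ode_def)
  have did: "((\<lambda>r. complex_of_real r) has_vector_derivative 1) (at r)" for r by (auto intro!: derivative_eq_intros)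
  have dV: "(V has_vector_derivative W r) (at r)" if r: "r \<in> {a<..<b}" for r
  proof -
    have "(V has_vector_derivative of_real r * (\<Theta> r / of_real r ^ 2) + 1 * U r) (at r)"
      unfolding V_def by (rule has_vector_derivative_mult[OF did dU[OF r]])
    moreover have "of_real r * (\<Theta> r / of_real r ^ 2) + 1 * U r = W r" using r a by (simp add: W_def power2_eq_square)
    ultimately show ?thesis by simp
  qed
  have dW: "(W has_vector_derivative (- q * V r)) (at r)" if r: "r \<in> {a<..<b}" for r
  proof -
    have r0: "r \<noteq> 0" using r a by auto
    have "((\<lambda>r. inverse r) has_real_derivative - inverse (r ^ 2)) (at r)"
      using DERIV_inverse[OF r0] by (simp add: numeral_2_eq_2)
    then have di: "((\<lambda>r. complex_of_real (inverse r)) has_vector_derivative of_real (- inverse (r ^ 2))) (at r)"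
      by (intro has_vector_derivative_of_real) 
    have "(W has_vector_derivative \<Theta> r / of_real r ^ 2 + (\<Theta> r * of_real (- inverse (r ^ 2)) + (- q * of_real r ^ 2 * U r) * of_real (inverse r))) (at r)"
      unfolding W_def divide_inverse of_real_inverse[symmetric]
      using has_vector_derivative_add[OF dU[OF r] has_vector_derivative_mult[OF d\<Theta>[OF r] di]] by (simp add: divide_inverse)
    moreover have "\<Theta> r / of_real r ^ 2 + (\<Theta> r * of_real (- inverse (r ^ 2)) + (- q * of_real r ^ 2 * U r) * of_real (inverse r)) = - q * V r"
      using r0 by (simp add: V_def divide_inverse power2_eq_square)
    ultimately show ?thesis by simp
  qed
  have dcs: "((\<lambda>r. cc q (s - r)) has_vector_derivative q * ss q (s - r)) (at r)" "((\<lambda>r. ss q (s - r)) has_vector_derivative - cc q (s - r)) (at r)" for r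
  proof -
    have d: "((\<lambda>r. s - r) has_vector_derivative (-1)) (at r)" by (auto intro!: derivative_eq_intros)
    show "((\<lambda>r. cc q (s - r)) has_vector_derivative q * ss q (s - r)) (at r)"
      using vector_diff_chain_at[OF d cc_derivative[of q "s - r"]] by (simp add: o_def)
    show "((\<lambda>r. ss q (s - r)) has_vector_derivative - cc q (s - r)) (at r)"
      using vector_diff_chain_at[OF d ss_derivative[of q "s - r"]] by (simp add: o_def)
  qed
  define X where "X = (\<lambda>r. V r * cc q (s - r) + W r * ss q (s - r))"
  define Y where "Y = (\<lambda>r. - q * V r * ss q (s - r) + W r * cc q (s - r))"
  have dX: "(X has_vector_derivative 0) (at r within {a<..<b})" if r: "r \<in> {a<..<b}" for r
  proof -
    have "(X has_vector_derivative (V r * (q * ss q (s - r)) + W r * cc q (s - r)) + (W r * (- cc q (s - r)) + (- q * V r) * ss q (s - r))) (at r)"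
      unfolding X_def by (intro has_vector_derivative_add has_vector_derivative_mult dV dW dcs r)
    then show ?thesis by (simp add: has_vector_derivative_at_within algebra_simps)
  qed
  have dY: "(Y has_vector_derivative 0) (at r within {a<..<b})" if r: "r \<in> {a<..<b}" for r
  proof -
    have "((\<lambda>r. - q * V r) has_vector_derivative (- q * W r)) (at r)"
      by (rule bounded_linear.has_vector_derivative[OF bounded_linear_mult_right dV[OF r]])
    then have "(Y has_vector_derivative ((- q * V r) * (- cc q (s - r)) + (- q * W r) * ss q (s - r)) + (W r * (q * ss q (s - r)) + (- q * V r) * cc q (s - r))) (at r)"
      unfolding Y_def by (intro has_vector_derivative_add has_vector_derivative_mult dV dW dcs r)
    then show ?thesis by (simp add: has_vector_derivative_at_within algebra_simps)
  qed
  obtain c where "\<And>r. r \<in> {a<..<b} \<Longrightarrow> X r = c" by (rule has_vector_derivative_zero_constant[OF _ dX]) auto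
  then have "X s = X r" using rs by simp
  then show "of_real s * U s = of_real r * U r * cc q (s - r) + (U r + \<Theta> r / of_real r) * ss q (s - r)"
    by (simp add: X_def V_def W_def)
  obtain c where "\<And>r. r \<in> {a<..<b} \<Longrightarrow> Y r = c" by (rule has_vector_derivative_zero_constant[OF _ dY]) auto
  then have "Y s = Y r" using rs by simp
  then show "U s + \<Theta> s / of_real s = - q * of_real r * U r * ss q (s - r) + (U r + \<Theta> r / of_real r) * cc q (s - r)"
    by (simp add: Y_def V_def W_def)
qed

lemma isCont_cc_ss: "isCont (cc q) t" "isCont (ss q) t"
  using cc_derivative ss_derivative has_vector_derivative_continuous by blast+

text \<open>Pure algebra: passage from the variables (r U, (r U)') back to (U, \<Theta>). The last
  hypothesis covers a = 0, where the quotient by \<open>a\<close> would lose a nonzero flux.\<close>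

lemma transfer_identity:
  assumes "b \<noteq> (0::real)"
    and 1: "of_real b * Ub = of_real a * Ua * cc q (b - a) + (Ua + \<Theta>a / of_real a) * ss q (b - a)"
    and 2: "Ub + \<Theta>b / of_real b = - q * of_real a * Ua * ss q (b - a) + (Ua + \<Theta>a / of_real a) * cc q (b - a)"
    and az: "a = 0 \<Longrightarrow> \<Theta>a = 0"
  shows "Ub = t11 a b q * Ua + t12 a b q * \<Theta>a" "\<Theta>b = - q * tau a b q * Ua + t22 a b q * \<Theta>a"
proof -
  let ?c = "cc q (b - a)" and ?s = "ss q (b - a)"
  show Ub: "Ub = t11 a b q * Ua + t12 a b q * \<Theta>a"
  proof -
    have "Ub = (of_real a * Ua * ?c + (Ua + \<Theta>a / of_real a) * ?s) / of_real b" using 1 assms(1) by (simp add: field_simps)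
    then show ?thesis using assms(1) by (simp add: t11_def t12_def add_divide_distrib algebra_simps)
  qed
  have "\<Theta>b = of_real b * (Ub + \<Theta>b / of_real b) - of_real b * Ub" using assms(1) by (simp add: algebra_simps)
  also have "\<dots> = of_real b * (- q * of_real a * Ua * ?s + (Ua + \<Theta>a / of_real a) * ?c) - (of_real a * Ua * ?c + (Ua + \<Theta>a / of_real a) * ?s)"
    unfolding 1 2 ..
  also have "\<dots> = (of_real (b - a) * ?c - ?s - of_real a * of_real b * q * ?s) * Ua + (of_real b * ?c - ?s) * (\<Theta>a / of_real a)"
    by (simp add: algebra_simps diff_divide_distrib)
  finally show "\<Theta>b = - q * tau a b q * Ua + t22 a b q * \<Theta>a"
    unfolding tau_eq t22_def by (simp add: mult.commute)
qed

text \<open>The transfer formula with its starting point moved to the end of the interval. For a = 0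
  the limit of \<Theta> / r does not follow from that of \<Theta> and is an extra
  hypothesis.\<close>

lemma radial_ode_transfer:
  assumes o: "radial_ode a b q U \<Theta>" and ab: "0 \<le> a" "a < b"
    and lim: "(U \<longlongrightarrow> Ua) (at_right a)" "(\<Theta> \<longlongrightarrow> \<Theta>a) (at_right a)"
    and a0: "a = 0 \<Longrightarrow> \<Theta>a = 0 \<and> ((\<lambda>r. \<Theta> r / of_real r) \<longlongrightarrow> 0) (at_right 0)"
    and s: "s \<in> {a<..<b}"
  shows "U s = t11 a s q * Ua + t12 a s q * \<Theta>a" "\<Theta> s = - q * tau a s q * Ua + t22 a s q * \<Theta>a"
proof -
  have ev: "\<forall>\<^sub>F r in at_right a. r \<in> {a<..<b}" using ab by (simp add: eventually_at_right_field) blast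
  have nt: "at_right a \<noteq> bot" by simp
  have lr: "((\<lambda>r. complex_of_real r) \<longlongrightarrow> of_real a) (at_right a)" by (intro tendsto_intros)
  have ltr: "((\<lambda>r. \<Theta> r / of_real r) \<longlongrightarrow> \<Theta>a / of_real a) (at_right a)"
  proof (cases "a = 0")
    case False
    then show ?thesis by (intro tendsto_divide lim lr) simp
  qed (use a0 in simp)
  have lc: "((\<lambda>r. cc q (s - r)) \<longlongrightarrow> cc q (s - a)) (at_right a)" "((\<lambda>r. ss q (s - r)) \<longlongrightarrow> ss q (s - a)) (at_right a)"
    by (rule isCont_tendsto_compose[OF isCont_cc_ss(1)], intro tendsto_intros, rule isCont_tendsto_compose[OF isCont_cc_ss(2)], intro tendsto_intros)
  have l1: "((\<lambda>r. of_real r * U r * cc q (s - r) + (U r + \<Theta> r / of_real r) * ss q (s - r)) \<longlongrightarrow>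
      of_real a * Ua * cc q (s - a) + (Ua + \<Theta>a / of_real a) * ss q (s - a)) (at_right a)"
    by (intro tendsto_add tendsto_mult lr lim lc ltr)
  have e1: "\<forall>\<^sub>F r in at_right a. of_real r * U r * cc q (s - r) + (U r + \<Theta> r / of_real r) * ss q (s - r) = of_real s * U s"
    using ev by eventually_elim (rule radial_ode_transfer_aux(1)[OF o ab(1) _ s, symmetric])
  have 1: "of_real s * U s = of_real a * Ua * cc q (s - a) + (Ua + \<Theta>a / of_real a) * ss q (s - a)"
    by (rule tendsto_unique[OF nt tendsto_eventually[OF e1] l1])
  have l2: "((\<lambda>r. - q * of_real r * U r * ss q (s - r) + (U r + \<Theta> r / of_real r) * cc q (s - r)) \<longlongrightarrow>
      - q * of_real a * Ua * ss q (s - a) + (Ua + \<Theta>a / of_real a) * cc q (s - a)) (at_right a)"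
    by (intro tendsto_add tendsto_mult tendsto_const lr lim lc ltr)
  have e2: "\<forall>\<^sub>F r in at_right a. - q * of_real r * U r * ss q (s - r) + (U r + \<Theta> r / of_real r) * cc q (s - r) = U s + \<Theta> s / of_real s"
    using ev by eventually_elim (rule radial_ode_transfer_aux(2)[OF o ab(1) _ s, symmetric])
  have 2: "U s + \<Theta> s / of_real s = - q * of_real a * Ua * ss q (s - a) + (Ua + \<Theta>a / of_real a) * cc q (s - a)"
    by (rule tendsto_unique[OF nt tendsto_eventually[OF e2] l2])
  have "s \<noteq> 0" using s ab by auto
  from transfer_identity[OF this 1 2] a0
  show "U s = t11 a s q * Ua + t12 a s q * \<Theta>a" "\<Theta> s = - q * tau a s q * Ua + t22 a s q * \<Theta>a" by blast+
qed

lemma transfer_tendsto_end: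
  assumes "0 < b"
  shows "((\<lambda>s. t11 a s q) \<longlongrightarrow> t11 a b q) (at b within A)" "((\<lambda>s. t12 a s q) \<longlongrightarrow> t12 a b q) (at b within A)"
    "((\<lambda>s. tau a s q) \<longlongrightarrow> tau a b q) (at b within A)" "((\<lambda>s. t22 a s q) \<longlongrightarrow> t22 a b q) (at b within A)"
proof -
  have lc: "((\<lambda>s. cc q (s - a)) \<longlongrightarrow> cc q (b - a)) (at b within A)" "((\<lambda>s. ss q (s - a)) \<longlongrightarrow> ss q (b - a)) (at b within A)"
    by (rule isCont_tendsto_compose[OF isCont_cc_ss(1)], intro tendsto_intros, rule isCont_tendsto_compose[OF isCont_cc_ss(2)], intro tendsto_intros)
  have l1: "((\<lambda>s. S1 (q * of_real (s - a) ^ 2)) \<longlongrightarrow> S1 (q * of_real (b - a) ^ 2)) (at b within A)"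
    by (rule isCont_tendsto_compose[OF isCont_S(2)], intro tendsto_intros)
  have lr: "((\<lambda>r. complex_of_real r) \<longlongrightarrow> of_real b) (at b within A)" by (intro tendsto_intros)
  show "((\<lambda>s. t11 a s q) \<longlongrightarrow> t11 a b q) (at b within A)"
    unfolding t11_def using assms by (intro tendsto_intros lc lr) auto
  show "((\<lambda>s. t12 a s q) \<longlongrightarrow> t12 a b q) (at b within A)"
  proof -
    have "((\<lambda>s. ss q (s - a) / of_real s / of_real a) \<longlongrightarrow> ss q (b - a) / of_real b / of_real a) (at b within A)"
      unfolding divide_inverse[of _ "of_real a"] using assms by (intro tendsto_intros lc lr) auto
    then show ?thesis unfolding t12_def by (simp add: mult.commute)
  qed
  show "((\<lambda>s. tau a s q) \<longlongrightarrow> tau a b q) (at b within A)"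
    unfolding tau_def by (intro tendsto_intros lc lr l1)
  show "((\<lambda>s. t22 a s q) \<longlongrightarrow> t22 a b q) (at b within A)"
    unfolding t22_def divide_inverse[of _ "of_real a"] by (intro tendsto_intros lc lr)
qed

lemma transfer_start:
  assumes "0 < a"
  shows "t11 a a q = 1" "t12 a a q = 0" "tau a a q = 0" "t22 a a q = 1"
  using assms by (simp_all add: t11_def t12_def tau_def t22_def)

lemma transfer_solution_tendsto:
  assumes "0 < b"
  shows "((\<lambda>s. t11 a s q * x + t12 a s q * y) \<longlongrightarrow> t11 a b q * x + t12 a b q * y) (at b within A)"
    and "((\<lambda>s. - q * tau a s q * x + t22 a s q * y) \<longlongrightarrow> - q * tau a b q * x + t22 a b q * y) (at b within A)"
    and "((\<lambda>s. t11 b s q * x + t12 b s q * y) \<longlongrightarrow> x) (at b within A)"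
    and "((\<lambda>s. - q * tau b s q * x + t22 b s q * y) \<longlongrightarrow> y) (at b within A)"
proof -
  show l: "((\<lambda>s. t11 a s q * x + t12 a s q * y) \<longlongrightarrow> t11 a b q * x + t12 a b q * y) (at b within A)"
    "((\<lambda>s. - q * tau a s q * x + t22 a s q * y) \<longlongrightarrow> - q * tau a b q * x + t22 a b q * y) (at b within A)" for a
    by (intro tendsto_intros transfer_tendsto_end assms)+
  show "((\<lambda>s. t11 b s q * x + t12 b s q * y) \<longlongrightarrow> x) (at b within A)"
    "((\<lambda>s. - q * tau b s q * x + t22 b s q * y) \<longlongrightarrow> y) (at b within A)"
    using l[of b] by (simp_all add: transfer_start[OF assms])
qed

lemma radial_ode_transfer_end:
  assumes o: "radial_ode a b q U \<Theta>" and ab: "0 \<le> a" "a < b"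
    and lim: "(U \<longlongrightarrow> Ua) (at_right a)" "(\<Theta> \<longlongrightarrow> \<Theta>a) (at_right a)"
    and a0: "a = 0 \<Longrightarrow> \<Theta>a = 0 \<and> ((\<lambda>r. \<Theta> r / of_real r) \<longlongrightarrow> 0) (at_right 0)"
  shows "(U \<longlongrightarrow> t11 a b q * Ua + t12 a b q * \<Theta>a) (at_left b)" "(\<Theta> \<longlongrightarrow> - q * tau a b q * Ua + t22 a b q * \<Theta>a) (at_left b)"
proof -
  have b: "0 < b" using ab by simp
  have ev: "\<forall>\<^sub>F r in at_left b. r \<in> {a<..<b}" using ab by (simp add: eventually_at_left_field) blast
  note t = radial_ode_transfer[OF o ab lim a0]
  show "(U \<longlongrightarrow> t11 a b q * Ua + t12 a b q * \<Theta>a) (at_left b)"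
    by (rule Lim_transform_eventually[OF transfer_solution_tendsto(1)[OF b]]) (use ev in eventually_elim, rule t(1)[symmetric]; assumption)
  show "(\<Theta> \<longlongrightarrow> - q * tau a b q * Ua + t22 a b q * \<Theta>a) (at_left b)"
    by (rule Lim_transform_eventually[OF transfer_solution_tendsto(2)[OF b]]) (use ev in eventually_elim, rule t(2)[symmetric]; assumption)
qed

text \<open>Conversely, the transfer formulas define a solution, because r U is by construction a
  combination of \<open>cc\<close> and \<open>ss\<close>.\<close>

lemma transfer_solves:
  assumes b: "0 \<le> a"  "a = 0 \<Longrightarrow> \<Theta>a = 0" "a < b"
  shows "radial_ode a b q (\<lambda>s. t11 a s q * Ua + t12 a s q * \<Theta>a) (\<lambda>s. - q * tau a s q * Ua + t22 a s q * \<Theta>a)"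
  unfolding radial_ode_def
proof (intro ballI conjI)
  fix r assume r: "r \<in> {a<..<b}"
  then have r0: "r \<noteq> 0" "0 < r" using b by auto
  define V where "V = (\<lambda>s. of_real a * Ua * cc q (s - a) + (Ua + \<Theta>a / of_real a) * ss q (s - a))"
  define W where "W = (\<lambda>s. - q * of_real a * Ua * ss q (s - a) + (Ua + \<Theta>a / of_real a) * cc q (s - a))"
  have d: "((\<lambda>r. r - a) has_vector_derivative 1) (at r)" by (auto intro!: derivative_eq_intros)
  have dc: "((\<lambda>s. cc q (s - a)) has_vector_derivative - q * ss q (r - a)) (at r)" 
    using vector_diff_chain_at[OF d cc_derivative[of q "r - a"]] by (simp add: o_def)
  have ds: "((\<lambda>s. ss q (s - a)) has_vector_derivative cc q (r - a)) (at r)"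
    using vector_diff_chain_at[OF d ss_derivative[of q "r - a"]] by (simp add: o_def)
  note ml = bounded_linear.has_vector_derivative[OF bounded_linear_mult_right]
  have dV: "(V has_vector_derivative W r) (at r)"
    using has_vector_derivative_add[OF ml[OF dc, of "of_real a * Ua"] ml[OF ds, of "Ua + \<Theta>a / of_real a"]]
    by (simp add: V_def W_def algebra_simps)
  have dW: "(W has_vector_derivative (- q * V r)) (at r)"
    using has_vector_derivative_add[OF ml[OF ds, of "- q * of_real a * Ua"] ml[OF dc, of "Ua + \<Theta>a / of_real a"]]
    by (simp add: V_def W_def algebra_simps)
  let ?U = "\<lambda>s. V s * of_real (inverse s)" and ?T = "\<lambda>s. of_real s * W s - V s"
  have "((\<lambda>r. inverse r) has_real_derivative - inverse (r ^ 2)) (at r)"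
    using DERIV_inverse[OF r0(1)] by (simp add: numeral_2_eq_2)
  then have di: "((\<lambda>r. complex_of_real (inverse r)) has_vector_derivative of_real (- inverse (r ^ 2))) (at r)"
    by (intro has_vector_derivative_of_real)
  have did: "((\<lambda>r. complex_of_real r) has_vector_derivative 1) (at r)" by (auto intro!: derivative_eq_intros)
  have dU: "(?U has_vector_derivative ?T r / of_real r ^ 2) (at r)"
    using has_vector_derivative_mult[OF dV di] r0 by (simp add: field_simps power2_eq_square)
  have dT: "(?T has_vector_derivative - q * of_real r ^ 2 * ?U r) (at r)"
    using has_vector_derivative_diff[OF has_vector_derivative_mult[OF did dW] dV] r0 by (simp add: field_simps power2_eq_square)
  have eq: "t11 a s q * Ua + t12 a s q * \<Theta>a = ?U s" "- q * tau a s q * Ua + t22 a s q * \<Theta>a = ?T s" if "s \<noteq> 0" for s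
  proof -
    have 1: "of_real s * ?U s = of_real a * Ua * cc q (s - a) + (Ua + \<Theta>a / of_real a) * ss q (s - a)"
      using that by (simp add: V_def)
    have 2: "?U s + ?T s / of_real s = - q * of_real a * Ua * ss q (s - a) + (Ua + \<Theta>a / of_real a) * cc q (s - a)"
      using that unfolding W_def[symmetric, THEN fun_cong] by (simp add: W_def field_simps)
    from transfer_identity[OF that 1 2 b(2)] show "t11 a s q * Ua + t12 a s q * \<Theta>a = ?U s" "- q * tau a s q * Ua + t22 a s q * \<Theta>a = ?T s" by simp_all
  qed
  have ev: "open (- {0::real})" "r \<in> - {0}" using r0 by auto
  show "((\<lambda>s. t11 a s q * Ua + t12 a s q * \<Theta>a) has_vector_derivative (- q * tau a r q * Ua + t22 a r q * \<Theta>a) / of_real r ^ 2) (at r)"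
    unfolding eq(2)[OF r0(1)] by (rule has_vector_derivative_transform_within_open[OF dU ev]) (use eq in auto)
  show "((\<lambda>s. - q * tau a s q * Ua + t22 a s q * \<Theta>a) has_vector_derivative (- q * of_real r ^ 2 * (t11 a r q * Ua + t12 a r q * \<Theta>a))) (at r)"
    unfolding eq(1)[OF r0(1)] by (rule has_vector_derivative_transform_within_open[OF dT ev]) (use eq in auto)
qed

section \<open>The characteristic function of radial resonances\<close>

context nested_shells
begin

text \<open>\<open>layer_start i\<close> is the radius from which the \<open>i\<close>-th host layer (counted from the centre) starts; it is followed by
  the shell \<open>N - i\<close>. A state is the pair of the value \<open>U\<close> and the flux \<open>r\<^sup>2 U'\<close>, the latter divided by \<open>\<delta>\<close> inside of the
  shells, so that states are continuous across the interfaces.\<close>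

definition layer_start :: "nat \<Rightarrow> real" where
  "layer_start i = (if i = 0 then 0 else rp (N - i + 1))"

text \<open>Propagation through a host layer. With \<open>lm\<close> = \<omega>^2 / (\<delta> vr^2)
  and \<open>s0\<close> = vr^2 / v^2, the squared wavenumbers are \<open>s0\<close> \<delta>
  \<open>lm\<close> in the host and \<delta> \<open>lm\<close> in the shells.\<close>

definition mid_state :: "real \<Rightarrow> complex \<Rightarrow> real \<Rightarrow> nat \<Rightarrow> complex \<times> complex \<Rightarrow> complex \<times> complex" where
  "mid_state s0 lm \<delta> i y = (let q = of_real (s0 * \<delta>) * lm; a = layer_start i; b = rm (N - i) in
     (t11 a b q * fst y + t12 a b q * snd y, - q * tau a b q * fst y + t22 a b q * snd y))"

text \<open>Propagation through a shell. The stored flux is the true one divided by \<delta>, hence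
  the factor \<delta> at \<open>t12\<close> and the entry - \<open>lm\<close> \<open>tau\<close>,
  from which \<delta> has cancelled. This entry keeps the shell effective as \<delta> tends to
  0.\<close>

definition end_state :: "complex \<Rightarrow> real \<Rightarrow> nat \<Rightarrow> complex \<times> complex \<Rightarrow> complex \<times> complex" where
  "end_state lm \<delta> i y = (let q = of_real \<delta> * lm; a = rm (N - i); b = rp (N - i) in
     (t11 a b q * fst y + of_real \<delta> * t12 a b q * snd y, - lm * tau a b q * fst y + t22 a b q * snd y))"

text \<open>The regular solution, normalized by the value 1 and flux 0 at the centre, at the start
  of the \<open>i\<close>-th host layer; \<open>yst s0 N\<close> is its state at the outermost
  sphere.\<close>

primrec yst :: "real \<Rightarrow> nat \<Rightarrow> complex \<Rightarrow> real \<Rightarrow> complex \<times> complex" where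
  "yst s0 0 lm \<delta> = (1, 0)"
| "yst s0 (Suc i) lm \<delta> = end_state lm \<delta> i (mid_state s0 lm \<delta> i (yst s0 i lm \<delta>))"

text \<open>The defect in matching the state at r = \<open>rp 1\<close> with e^{ikr} / r, for which
  r^2 U' = (i k r - 1) r U.\<close>

definition char_fun :: "real \<Rightarrow> real \<Rightarrow> complex \<Rightarrow> real \<Rightarrow> complex \<Rightarrow> complex" where
  "char_fun v s0 lm \<delta> \<omega> = snd (yst s0 N lm \<delta>) + of_real (rp 1) * fst (yst s0 N lm \<delta>)
      - \<i> * (\<omega> / of_real v) * of_real (rp 1) ^ 2 * fst (yst s0 N lm \<delta>)"

lemma layer_shell_index: "i < N \<Longrightarrow> N - i \<in> {1..N}"
  by auto

lemma layer_start_lt: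
  assumes "i < N" shows "0 \<le> layer_start i" "layer_start i < rm (N - i)" "i = 0 \<or> 0 < layer_start i"
proof -
  have "layer_start i < rm (N - i) \<and> 0 \<le> layer_start i \<and> (i = 0 \<or> 0 < layer_start i)"
  proof (cases "i = 0")
    case True
    then show ?thesis using radii(1)[of N] N by (simp add: layer_start_def)
  next
    case False
    then have j: "N - i < N - i + 1" "N - i \<in> {1..N}" "N - i + 1 \<in> {1..N}" using assms by auto
    show ?thesis using radii_order[OF j] radii[OF j(3)] False by (simp add: layer_start_def)
  qed
  then show "0 \<le> layer_start i" "layer_start i < rm (N - i)" "i = 0 \<or> 0 < layer_start i" by auto
qed

lemma layer_start_Suc: "i < N \<Longrightarrow> layer_start (Suc i) = rp (N - i)"
  by (simp add: layer_start_def Suc_diff_Suc)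

lemma layer_start_N: "layer_start N = rp 1"
  using N by (simp add: layer_start_def)

lemma radii_mono:
  assumes "i \<le> j" "i \<in> {1..N}" "j \<in> {1..N}"
  shows "rp j \<le> rp i" "rm j \<le> rm i"
  using assms radii_order[of i j] radii[of i] radii[of j] by (cases "i = j"; auto)+

lemma host_gap:
  assumes i: "i < N"
  shows "{layer_start i<..<rm (N - i)} \<inter> interfaces = {}"
    and "r \<in> {layer_start i<..<rm (N - i)} \<Longrightarrow> \<not> in_shell r"
proof -
  have *: "rm (N - i) \<le> rm k \<or> rp k \<le> layer_start i" if k: "k \<in> {1..N}" for k
  proof (cases "k \<le> N - i")
    case True
    then show ?thesis using radii_mono(2)[OF True k layer_shell_index[OF i]] by simp
  next
    case False
    then have i0: "i \<noteq> 0" and le: "N - i + 1 \<le> k" "N - i + 1 \<in> {1..N}" using k i by auto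
    then show ?thesis using radii_mono(1)[OF le k] by (simp add: layer_start_def)
  qed
  show "\<not> in_shell r" if "r \<in> {layer_start i<..<rm (N - i)}"
    using * that by (fastforce simp: in_shell_def)
  show "{layer_start i<..<rm (N - i)} \<inter> interfaces = {}"
  proof (rule ccontr)
    assume "{layer_start i<..<rm (N - i)} \<inter> interfaces \<noteq> {}"
    then obtain r where r: "r \<in> interfaces" "layer_start i < r" "r < rm (N - i)" by auto
    then obtain k where k: "k \<in> {1..N}" "r = rp k \<or> r = rm k" unfolding interfaces_def by blast
    show False using *[OF k(1)] radii[OF k(1)] k(2) r(2,3) by auto
  qed
qed

lemma shell_gap:
  assumes j: "j \<in> {1..N}"
  shows "{rm j<..<rp j} \<inter> interfaces = {}" and "r \<in> {rm j<..<rp j} \<Longrightarrow> in_shell r"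
proof -
  show *: "in_shell r" if "r \<in> {rm j<..<rp j}" for r using j that unfolding in_shell_def by auto
  show "{rm j<..<rp j} \<inter> interfaces = {}" using * not_interface_in_shell by blast
qed

lemma ray_trace:
  assumes "0 < \<rho>"
  shows "outer_trace \<rho> f (\<rho> *\<^sub>R axis 1 1) l \<Longrightarrow> ((\<lambda>r. f (r *\<^sub>R axis 1 1)) \<longlongrightarrow> l) (at_right \<rho>)"
    and "inner_trace \<rho> f (\<rho> *\<^sub>R axis 1 1) l \<Longrightarrow> ((\<lambda>r. f (r *\<^sub>R axis 1 1)) \<longlongrightarrow> l) (at_left \<rho>)"
proof -
  have c: "((\<lambda>r. r *\<^sub>R axis 1 1 :: real^3) \<longlongrightarrow> \<rho> *\<^sub>R axis 1 1) (at \<rho> within A)" for A by (intro tendsto_intros)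
  have ax: "axis 1 1 \<noteq> (0 :: real^3)" by (metis norm_axis_1 norm_zero zero_neq_one)
  show "((\<lambda>r. f (r *\<^sub>R axis 1 1)) \<longlongrightarrow> l) (at_right \<rho>)" if "outer_trace \<rho> f (\<rho> *\<^sub>R axis 1 1) l"
  proof (rule filterlim_compose[OF that[unfolded outer_trace_def]])
    show "filterlim (\<lambda>r. r *\<^sub>R axis 1 1 :: real^3) (at (\<rho> *\<^sub>R axis 1 1) within {x. \<rho> < norm x}) (at_right \<rho>)"
      unfolding filterlim_at using c assms ax by (auto simp: eventually_at_filter)
  qed
  have ev: "\<forall>\<^sub>F r in at_left \<rho>. r \<in> {0<..<\<rho>}" using assms by (simp add: eventually_at_left_field) blast
  show "((\<lambda>r. f (r *\<^sub>R axis 1 1)) \<longlongrightarrow> l) (at_left \<rho>)" if "inner_trace \<rho> f (\<rho> *\<^sub>R axis 1 1) l"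
  proof (rule filterlim_compose[OF that[unfolded inner_trace_def]])
    have "\<forall>\<^sub>F r in at_left \<rho>. r *\<^sub>R axis 1 1 \<in> {x::real^3. norm x < \<rho>} \<and> r *\<^sub>R axis 1 1 \<noteq> (\<rho> *\<^sub>R axis 1 1 :: real^3)"
      using ev by eventually_elim (use ax in auto)
    then show "filterlim (\<lambda>r. r *\<^sub>R axis 1 1 :: real^3) (at (\<rho> *\<^sub>R axis 1 1) within {x. norm x < \<rho>}) (at_left \<rho>)"
      unfolding filterlim_at using c by blast
  qed
qed

lemma hankel0: "spherical_hankel1 0 z = - \<i> * exp (\<i> * z) / z"
  by (simp add: spherical_hankel1_def)

text \<open>A radial function is constant along rotations, so all its angular derivatives
  vanish.\<close>

lemma radial_Lam_zero:
  assumes c: "has_C2 off u g H" and rad: "\<And>x y. x \<in> off \<Longrightarrow> norm x = norm y \<Longrightarrow> u x = u y" and x: "x \<in> off"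
  shows "Lam g H x = 0"
proof -
  have ro: "rot j s x \<in> off" if "x \<in> off" for j s x using that by (simp add: off_def)
  have a: "angL j g x = 0" if x: "x \<in> off" for j x
  proof -
    have "(\<lambda>s. u (rot j s x)) = (\<lambda>s. u x)" by (rule ext, rule rad[OF ro[OF x]]) simp
    with u_rot_derivative[OF c ro[OF x], of j 0] have "((\<lambda>s::real. u x) has_vector_derivative angL j g x) (at 0)" by simp
    then show ?thesis using vector_derivative_unique_at has_vector_derivative_const by metis
  qed
  have "angL2 j g H x = 0" for j
  proof -
    have "(\<lambda>s. angL j g (rot j s x)) = (\<lambda>s. 0)" by (rule ext, rule a[OF ro[OF x]])
    with angL_rot_derivative[OF c ro[OF x], of j 0] have "((\<lambda>s::real. 0::complex) has_vector_derivative angL2 j g H x) (at 0)" by simp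
    then show ?thesis using vector_derivative_unique_at has_vector_derivative_const by metis
  qed
  then show ?thesis by (simp add: Lam_eq_sum_angL2)
qed

text \<open>With \<open>Lam\<close> = 0 the decomposition of the Laplacian into radial and angular
  parts leaves an ordinary differential equation along the first coordinate axis.\<close>

lemma radial_profile_ode:
  assumes u: "piecewise_solution \<delta> kh kd u g H" and rad: "\<And>x y. x \<in> off \<Longrightarrow> norm x = norm y \<Longrightarrow> u x = u y"
    and ab: "0 \<le> a" "{a<..<b} \<inter> interfaces = {}" and q: "\<And>r. r \<in> {a<..<b} \<Longrightarrow> (if in_shell r then kd else kh)\<^sup>2 = q"
  shows "radial_ode a b q (\<lambda>r. u (r *\<^sub>R axis 1 1)) (\<lambda>r. of_real r * rad1 g (r *\<^sub>R axis 1 1))"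
  unfolding radial_ode_def
proof (intro ballI conjI)
  fix r assume r: "r \<in> {a<..<b}"
  then have r0: "r \<noteq> 0" "r > 0" using ab by auto
  have c: "has_C2 off u g H" using u by (simp add: piecewise_solution_def)
  let ?e = "axis 1 1 :: real^3"
  have nx: "norm (r *\<^sub>R ?e) = r" using r0 by simp
  have x: "r *\<^sub>R ?e \<in> off" using r ab(2) r0 by (auto simp: off_def)
  have eq: "(\<Sum>i\<in>UNIV. H i i (r *\<^sub>R ?e)) + q * u (r *\<^sub>R ?e) = 0"
  proof -
    have "(\<Sum>i\<in>UNIV. H i i (r *\<^sub>R ?e)) + (if in_shell (norm (r *\<^sub>R ?e)) then kd else kh)\<^sup>2 * u (r *\<^sub>R ?e) = 0"
      using u x unfolding piecewise_solution_def by blast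
    then show ?thesis unfolding nx q[OF r] .
  qed
  show "((\<lambda>r. u (r *\<^sub>R ?e)) has_vector_derivative of_real r * rad1 g (r *\<^sub>R ?e) / of_real r ^ 2) (at r)"
    using u_radial_derivative[OF c x r0(1)] r0 by (simp add: power2_eq_square)
  have did: "((\<lambda>r. complex_of_real r) has_vector_derivative 1) (at r)" by (auto intro!: derivative_eq_intros)
  have "of_real r * ((rad2 H (r *\<^sub>R ?e) + rad1 g (r *\<^sub>R ?e)) / of_real r) + 1 * rad1 g (r *\<^sub>R ?e) = Lam g H (r *\<^sub>R ?e) + rad2 H (r *\<^sub>R ?e) + 2 * rad1 g (r *\<^sub>R ?e)"
    using radial_Lam_zero[OF c rad x] r0 by simp
  also have "\<dots> = of_real r ^ 2 * (\<Sum>i\<in>UNIV. H i i (r *\<^sub>R ?e))" unfolding rad_eq nx by (simp add: scaleR_conv_of_real)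
  also have "\<dots> = - q * of_real r ^ 2 * u (r *\<^sub>R ?e)" using eq by (simp add: add_eq_0_iff2)
  finally show "((\<lambda>r. of_real r * rad1 g (r *\<^sub>R ?e)) has_vector_derivative - q * of_real r ^ 2 * u (r *\<^sub>R ?e)) (at r)"
    using has_vector_derivative_mult[OF did rad1_radial_derivative[OF c x r0(1)]] by simp
qed

lemma interface_limits:
  assumes c: "has_C2 off u g H" and \<rho>: "\<rho> \<in> interfaces" and t: "transmission \<rho> \<alpha> \<beta> u"
  obtains l p q where "((\<lambda>r. u (r *\<^sub>R axis 1 1)) \<longlongrightarrow> l) (at_right \<rho>)" "((\<lambda>r. u (r *\<^sub>R axis 1 1)) \<longlongrightarrow> l) (at_left \<rho>)"
    "((\<lambda>r. of_real r * rad1 g (r *\<^sub>R axis 1 1)) \<longlongrightarrow> p) (at_right \<rho>)" "((\<lambda>r. of_real r * rad1 g (r *\<^sub>R axis 1 1)) \<longlongrightarrow> q) (at_left \<rho>)"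
    "of_real \<alpha> * p = of_real \<beta> * q"
proof -
  have r0: "0 < \<rho>" using \<rho> interfaces_pos by blast
  let ?e = "axis 1 1 :: real^3"
  have "\<rho> *\<^sub>R ?e \<in> sphere 0 \<rho>" using r0 by simp
  then obtain l p q where 1: "outer_trace \<rho> u (\<rho> *\<^sub>R ?e) l" "inner_trace \<rho> u (\<rho> *\<^sub>R ?e) l"
     "outer_trace \<rho> (normal_deriv u) (\<rho> *\<^sub>R ?e) p" "inner_trace \<rho> (normal_deriv u) (\<rho> *\<^sub>R ?e) q" "complex_of_real \<alpha> * p = complex_of_real \<beta> * q"
    using t unfolding transmission_def by blast
  obtain a b where ab: "0 < a" "a < \<rho>" "\<rho> < b" "{a<..<b} \<inter> interfaces \<subseteq> {\<rho>}" using punctured_gap[OF r0] by blast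
  have e: "of_real r * of_real r * normal_deriv u (r *\<^sub>R ?e) = of_real r * rad1 g (r *\<^sub>R ?e)" if "r \<in> {a<..<b}" "r \<noteq> \<rho>" for r
  proof -
    have "r *\<^sub>R ?e \<in> off" "norm (r *\<^sub>R ?e) = r" using that ab by (auto simp: off_def)
    moreover have "r *\<^sub>R ?e \<noteq> 0" using that ab calculation(2) by auto
    ultimately show ?thesis using normal_deriv_eq[OF c, of "r *\<^sub>R ?e"] by simp
  qed
  have lr: "((\<lambda>r. complex_of_real r) \<longlongrightarrow> of_real \<rho>) (at \<rho> within A)" for A by (intro tendsto_intros)
  have R: "((\<lambda>r. of_real r * rad1 g (r *\<^sub>R ?e)) \<longlongrightarrow> of_real \<rho> * of_real \<rho> * p) (at_right \<rho>)"
  proof (rule Lim_transform_eventually)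
    show "((\<lambda>r. of_real r * of_real r * normal_deriv u (r *\<^sub>R ?e)) \<longlongrightarrow> of_real \<rho> * of_real \<rho> * p) (at_right \<rho>)"
      by (intro tendsto_mult lr ray_trace(1)[OF r0 1(3)])
    have "\<forall>\<^sub>F r in at_right \<rho>. r \<in> {\<rho><..<b}" using ab by (simp add: eventually_at_right_field) blast
    then show "\<forall>\<^sub>F r in at_right \<rho>. of_real r * of_real r * normal_deriv u (r *\<^sub>R ?e) = of_real r * rad1 g (r *\<^sub>R ?e)"
      by eventually_elim (use e ab in auto)
  qed
  have L: "((\<lambda>r. of_real r * rad1 g (r *\<^sub>R ?e)) \<longlongrightarrow> of_real \<rho> * of_real \<rho> * q) (at_left \<rho>)"
  proof (rule Lim_transform_eventually)
    show "((\<lambda>r. of_real r * of_real r * normal_deriv u (r *\<^sub>R ?e)) \<longlongrightarrow> of_real \<rho> * of_real \<rho> * q) (at_left \<rho>)"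
      by (intro tendsto_mult lr ray_trace(2)[OF r0 1(4)])
    have "\<forall>\<^sub>F r in at_left \<rho>. r \<in> {a<..<\<rho>}" using ab by (simp add: eventually_at_left_field) blast
    then show "\<forall>\<^sub>F r in at_left \<rho>. of_real r * of_real r * normal_deriv u (r *\<^sub>R ?e) = of_real r * rad1 g (r *\<^sub>R ?e)"
      by eventually_elim (use e ab in auto)
  qed
  show ?thesis
    by (rule that[OF ray_trace(1)[OF r0 1(1)] ray_trace(2)[OF r0 1(2)] R L]) (use 1(5) in \<open>simp add: mult_ac\<close>)
qed

text \<open>Induction over the layers from the centre: transfer through the host layer,
  transmission, transfer through the shell, transmission. Every state is the normalized one times
  \<open>u 0\<close>; the last clause records that a solution vanishing at the centre vanishes along
  the whole ray.\<close>

lemma profile_states: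
  assumes u: "piecewise_solution \<delta> kh kd u g H" and rad: "\<And>x y. x \<in> off \<Longrightarrow> norm x = norm y \<Longrightarrow> u x = u y" and \<delta>: "0 < \<delta>"
    and kh: "kh\<^sup>2 = of_real (s0 * \<delta>) * lm" and kd: "kd\<^sup>2 = of_real \<delta> * lm" and i: "i \<le> N"
  shows "((\<lambda>r. u (r *\<^sub>R axis 1 1)) \<longlongrightarrow> u 0 * fst (yst s0 i lm \<delta>)) (at_right (layer_start i)) \<and>
     ((\<lambda>r. of_real r * rad1 g (r *\<^sub>R axis 1 1)) \<longlongrightarrow> u 0 * snd (yst s0 i lm \<delta>)) (at_right (layer_start i)) \<and>
     (u 0 = 0 \<longrightarrow> (\<forall>r\<in>{0<..<layer_start i} - interfaces. u (r *\<^sub>R axis 1 1) = 0))"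
  using i
proof (induction i)
  let ?e = "axis 1 1 :: real^3"
  let ?U = "\<lambda>r. u (r *\<^sub>R ?e)" and ?T = "\<lambda>r. of_real r * rad1 g (r *\<^sub>R ?e)"
  have c: "has_C2 off u g H" using u by (simp add: piecewise_solution_def)
  obtain \<rho> where \<rho>: "0 < \<rho>" "\<And>x. norm x \<le> \<rho> \<Longrightarrow> x \<in> off" using min_interface by blast
  have z: "(0::real^3) \<in> off" using \<rho> by simp
  have iu: "isCont u 0" "isCont (rad1 g) 0"
    using has_C2_continuous(1)[OF c] continuous_on_rad1[OF c] z open_off by (auto simp: continuous_on_eq_continuous_at)
  have re: "((\<lambda>r. r *\<^sub>R ?e) \<longlongrightarrow> 0) (at_right 0)"
  proof -
    have "((\<lambda>r. r *\<^sub>R ?e) \<longlongrightarrow> 0 *\<^sub>R ?e) (at_right 0)" by (intro tendsto_intros)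
    then show ?thesis by simp
  qed
  have lU0: "(?U \<longlongrightarrow> u 0) (at_right 0)" by (rule isCont_tendsto_compose[OF iu(1) re])
  have "((\<lambda>r. rad1 g (r *\<^sub>R ?e)) \<longlongrightarrow> rad1 g 0) (at_right 0)" by (rule isCont_tendsto_compose[OF iu(2) re])
  then have lT0: "((\<lambda>r. rad1 g (r *\<^sub>R ?e)) \<longlongrightarrow> 0) (at_right 0)" by (simp add: rad1_def)
  have lT1: "(?T \<longlongrightarrow> 0) (at_right 0)"
  proof -
    have "(?T \<longlongrightarrow> of_real 0 * 0) (at_right 0)" by (intro tendsto_mult lT0 tendsto_intros)
    then show ?thesis by simp
  qed
  { case 0
    show ?case using lU0 lT1 by (simp add: layer_start_def) }
  { case (Suc i)
    then have i: "i < N" by simp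
    let ?a = "layer_start i" and ?j = "N - i"
    let ?b = "rm ?j" and ?d = "rp ?j"
    have j: "?j \<in> {1..N}" by (rule layer_shell_index[OF i])
    define y where "y = yst s0 i lm \<delta>"
    define m where "m = mid_state s0 lm \<delta> i y"
    define qh where "qh = of_real (s0 * \<delta>) * lm"
    define qd where "qd = of_real \<delta> * lm"
    from Suc.IH i have IH: "(?U \<longlongrightarrow> u 0 * fst y) (at_right ?a)" "(?T \<longlongrightarrow> u 0 * snd y) (at_right ?a)"
      and IHz: "u 0 = 0 \<Longrightarrow> r \<in> {0<..<?a} - interfaces \<Longrightarrow> ?U r = 0" for r
      by (auto simp: y_def)
    note ls = layer_start_lt[OF i]
    have o1: "radial_ode ?a ?b qh ?U ?T"
      by (rule radial_profile_ode[OF u rad ls(1) host_gap(1)[OF i]]) (use host_gap(2)[OF i] kh in \<open>auto simp: qh_def\<close>)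
    \<comment> \<open>Only the innermost layer starts at radius 0; there the flux is r
      \<open>rad1\<close>, and \<open>rad1\<close> tends to 0.\<close>
    have a0: "u 0 * snd y = 0 \<and> ((\<lambda>r. ?T r / of_real r) \<longlongrightarrow> 0) (at_right 0)" if "?a = 0"
    proof -
      have i0: "i = 0" using ls(3) that by auto
      have "\<forall>\<^sub>F r in at_right 0. rad1 g (r *\<^sub>R ?e) = ?T r / of_real r" by (simp add: eventually_at_filter)
      then have "((\<lambda>r. ?T r / of_real r) \<longlongrightarrow> 0) (at_right 0)" using lT0 by (rule Lim_transform_eventually[rotated])
      then show ?thesis using i0 by (simp add: y_def)
    qed
    have tr1: "?U s = t11 ?a s qh * (u 0 * fst y) + t12 ?a s qh * (u 0 * snd y)"
       "?T s = - qh * tau ?a s qh * (u 0 * fst y) + t22 ?a s qh * (u 0 * snd y)" if "s \<in> {?a<..<?b}" for s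
      by (rule radial_ode_transfer[OF o1 ls(1,2) IH a0 that]; assumption)+
    have b0: "0 < ?b" "0 < ?d" "?b < ?d" using radii[OF j] by auto
    note e1 = radial_ode_transfer_end[OF o1 ls(1,2) IH a0]
    have U1: "(?U \<longlongrightarrow> u 0 * fst m) (at_left ?b)" and T1: "(?T \<longlongrightarrow> u 0 * snd m) (at_left ?b)"
      using e1 by (simp_all add: m_def mid_state_def Let_def qh_def algebra_simps)
    have tm: "transmission ?b 1 \<delta> u" "transmission ?d \<delta> 1 u" using u j by (auto simp: piecewise_solution_def)
    have ib: "?b \<in> interfaces" "?d \<in> interfaces" using j by (auto simp: interfaces_def)
    obtain l p q where lim: "(?U \<longlongrightarrow> l) (at_right ?b)" "(?U \<longlongrightarrow> l) (at_left ?b)"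
      "(?T \<longlongrightarrow> p) (at_right ?b)" "(?T \<longlongrightarrow> q) (at_left ?b)" "of_real 1 * p = of_real \<delta> * q"
      by (rule interface_limits[OF c ib(1) tm(1)]) blast
    have "l = u 0 * fst m" "q = u 0 * snd m"
      using tendsto_unique[OF _ lim(2) U1] tendsto_unique[OF _ lim(4) T1] by auto
    with lim have U2: "(?U \<longlongrightarrow> u 0 * fst m) (at_right ?b)" and T2: "(?T \<longlongrightarrow> of_real \<delta> * (u 0 * snd m)) (at_right ?b)" by auto
    have o2: "radial_ode ?b ?d qd ?U ?T"
      by (rule radial_profile_ode[OF u rad less_imp_le[OF b0(1)] shell_gap(1)[OF j]]) (use shell_gap(2)[OF j] kd in \<open>auto simp: qd_def\<close>)
    have nb: "?b = 0 \<Longrightarrow> of_real \<delta> * (u 0 * snd m) = 0 \<and> ((\<lambda>r. ?T r / of_real r) \<longlongrightarrow> 0) (at_right 0)" using b0 by simp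
    have tr2: "?U s = t11 ?b s qd * (u 0 * fst m) + t12 ?b s qd * (of_real \<delta> * (u 0 * snd m))"
       "?T s = - qd * tau ?b s qd * (u 0 * fst m) + t22 ?b s qd * (of_real \<delta> * (u 0 * snd m))" if "s \<in> {?b<..<?d}" for s
      by (rule radial_ode_transfer[OF o2 less_imp_le[OF b0(1)] b0(3) U2 T2 nb that]; assumption)+
    define w where "w = end_state lm \<delta> i m"
    have w: "yst s0 (Suc i) lm \<delta> = w" by (simp add: w_def m_def y_def)
    note e2 = radial_ode_transfer_end[OF o2 less_imp_le[OF b0(1)] b0(3) U2 T2 nb]
    have U3: "(?U \<longlongrightarrow> u 0 * fst w) (at_left ?d)" using e2(1) by (simp add: w_def end_state_def Let_def qd_def algebra_simps)
    have "- qd * tau ?b ?d qd * (u 0 * fst m) + t22 ?b ?d qd * (of_real \<delta> * (u 0 * snd m)) = of_real \<delta> * (u 0 * snd w)"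
      by (simp add: w_def end_state_def Let_def qd_def[symmetric]) (simp add: qd_def algebra_simps)
    with e2(2) have T3: "(?T \<longlongrightarrow> of_real \<delta> * (u 0 * snd w)) (at_left ?d)" by (simp only:)
    obtain l' p' q' where lim': "(?U \<longlongrightarrow> l') (at_right ?d)" "(?U \<longlongrightarrow> l') (at_left ?d)"
      "(?T \<longlongrightarrow> p') (at_right ?d)" "(?T \<longlongrightarrow> q') (at_left ?d)" "of_real \<delta> * p' = of_real 1 * q'"
      by (rule interface_limits[OF c ib(2) tm(2)]) blast
    have "l' = u 0 * fst w" "q' = of_real \<delta> * (u 0 * snd w)"
      using tendsto_unique[OF _ lim'(2) U3] tendsto_unique[OF _ lim'(4) T3] by auto
    with lim' \<delta> have 1: "(?U \<longlongrightarrow> u 0 * fst w) (at_right ?d)" "(?T \<longlongrightarrow> u 0 * snd w) (at_right ?d)" by auto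
    have 2: "?U r = 0" if z: "u 0 = 0" and r: "r \<in> {0<..<?d} - interfaces" for r
    proof -
      consider "r < ?a" | "r = ?a" | "r \<in> {?a<..<?b}" | "r = ?b" | "r \<in> {?b<..<?d}" using r by fastforce
      then show ?thesis
      proof cases
        case 1 then show ?thesis using IHz[OF z] r by auto
      next
        case 2
        have "i \<noteq> 0"
        proof
          assume "i = 0"
          then show False using 2 r by (simp add: layer_start_def)
        qed
        then have "?a \<in> interfaces" using i by (auto simp: layer_start_def interfaces_def)
        then show ?thesis using 2 r by auto
      next
        case 3 then show ?thesis using tr1(1)[OF 3] z by simp
      next
        case 4 then show ?thesis using r ib by auto
      next
        case 5 then show ?thesis using tr2(1)[OF 5] z by simp
      qed
    qed
    show ?case unfolding w layer_start_Suc[OF i] using 1 2 by blast }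
qed

text \<open>By \<open>solution_radial\<close> the field is radial and is a monopole outside. The
  state reached from the centre is therefore, up to the factor \<open>u 0\<close>, that of a
  multiple of e^{ikr} / r, and this is the characteristic equation once \<open>u 0\<close> is known
  to be nonzero.\<close>

theorem eigenfrequency_char:
  assumes e: "eigenfrequency N rp rm v vr \<delta> \<omega>" and pos: "0 < v" "0 < vr" "0 < \<delta>"
    and small: "norm \<omega> * (2 * rp 1) \<le> v / 8" "norm \<omega> * (2 * rp 1) \<le> vr / 8"
  shows "char_fun v (vr\<^sup>2 / v\<^sup>2) (\<omega>\<^sup>2 / of_real (\<delta> * vr\<^sup>2)) \<delta> \<omega> = 0"
proof -
  from e obtain u where \<omega>: "\<omega> \<noteq> 0" and sc: "scattering_solution N rp rm v vr \<delta> \<omega> (\<lambda>x. 0) u"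
    and nt: "\<exists>x\<in>off. u x \<noteq> 0" unfolding eigenfrequency_def domain_eq by blast
  obtain g H where u: "piecewise_solution \<delta> (\<omega> / of_real v) (\<omega> / of_real vr) u g H" using piecewise_of_scattering[OF sc] by blast
  note rad = solution_radial(1)[OF sc pos \<omega> small]
  obtain C where C: "\<And>x. rp 1 < norm x \<Longrightarrow> u x = C * spherical_hankel1 0 (\<omega> / of_real v * of_real (norm x))"
    using solution_radial(2)[OF sc pos \<omega> small] by blast
  define lm where "lm = \<omega>\<^sup>2 / of_real (\<delta> * vr\<^sup>2)"
  define s0 where "s0 = vr\<^sup>2 / v\<^sup>2"
  have kh: "(\<omega> / of_real v)\<^sup>2 = of_real (s0 * \<delta>) * lm" and kd: "(\<omega> / of_real vr)\<^sup>2 = of_real \<delta> * lm"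
    using pos by (simp_all add: lm_def s0_def power_divide)
  let ?e = "axis 1 1 :: real^3"
  let ?U = "\<lambda>r. u (r *\<^sub>R ?e)" and ?T = "\<lambda>r. of_real r * rad1 g (r *\<^sub>R ?e)"
  define y where "y = yst s0 N lm \<delta>"
  have st: "(?U \<longlongrightarrow> u 0 * fst y) (at_right (rp 1))" "(?T \<longlongrightarrow> u 0 * snd y) (at_right (rp 1))"
     "u 0 = 0 \<Longrightarrow> r \<in> {0<..<rp 1} - interfaces \<Longrightarrow> ?U r = 0" for r
    using profile_states[OF u rad pos(3) kh kd order_refl] unfolding layer_start_N y_def by blast+
  define k where "k = \<omega> / of_real v"
  have k0: "k \<noteq> 0" using \<omega> pos by (simp add: k_def)
  have Ue: "?U r = C * (- \<i> * exp (\<i> * (k * of_real r)) / (k * of_real r))" if "rp 1 < r" for r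
    using C[of "r *\<^sub>R ?e"] that rp1(2) by (simp add: hankel0 k_def)
  have Te: "?T r = (\<i> * k * of_real r - 1) * of_real r * ?U r" if r: "rp 1 < r" for r
  proof -
    have r0: "r \<noteq> 0" using r rp1(2) by auto
    have "radial_ode (rp 1) (r + 1) (k\<^sup>2) ?U ?T"
      by (rule radial_profile_ode[OF u rad less_imp_le[OF rp1(2)]])
         (use rp1_max in_shell_less_rp1 in \<open>fastforce simp: k_def\<close>)+
    then have 1: "(?U has_vector_derivative ?T r / of_real r ^ 2) (at r)" using r by (simp add: radial_ode_def)
    have "((\<lambda>z. C * (- \<i> * exp (\<i> * (k * z)) / (k * z))) has_field_derivative
        C * ((- \<i> * (exp (\<i> * (k * of_real r)) * (\<i> * k)) * (k * of_real r) - (- \<i> * exp (\<i> * (k * of_real r))) * k) / ((k * of_real r) * (k * of_real r)))) (at (of_real r))"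
    proof (rule DERIV_cmult[OF DERIV_divide[OF DERIV_cmult]])
      show "((\<lambda>z. exp (\<i> * (k * z))) has_field_derivative exp (\<i> * (k * of_real r)) * (\<i> * k)) (at (of_real r))"
        by (auto intro!: derivative_eq_intros)
      show "((\<lambda>z. k * z) has_field_derivative k) (at (of_real r))" by (auto intro!: derivative_eq_intros)
    qed (use k0 r0 in auto)
    from has_vector_derivative_real_field[OF this]
    have "((\<lambda>r. C * (- \<i> * exp (\<i> * (k * of_real r)) / (k * of_real r))) has_vector_derivative
        C * ((- \<i> * (exp (\<i> * (k * of_real r)) * (\<i> * k)) * (k * of_real r) - (- \<i> * exp (\<i> * (k * of_real r))) * k) / ((k * of_real r) * (k * of_real r)))) (at r)" .
    then have 2: "(?U has_vector_derivative
        C * ((- \<i> * (exp (\<i> * (k * of_real r)) * (\<i> * k)) * (k * of_real r) - (- \<i> * exp (\<i> * (k * of_real r))) * k) / ((k * of_real r) * (k * of_real r)))) (at r)"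
      by (rule has_vector_derivative_transform_within_open[where S="{rp 1<..}"]) (use Ue r in auto)
    have "?T r / of_real r ^ 2 = C * ((- \<i> * (exp (\<i> * (k * of_real r)) * (\<i> * k)) * (k * of_real r) - (- \<i> * exp (\<i> * (k * of_real r))) * k) / ((k * of_real r) * (k * of_real r)))"
      by (rule vector_derivative_unique_at[OF 1 2])
    then have "?T r = of_real r ^ 2 * (C * ((- \<i> * (exp (\<i> * (k * of_real r)) * (\<i> * k)) * (k * of_real r) - (- \<i> * exp (\<i> * (k * of_real r))) * k) / ((k * of_real r) * (k * of_real r))))"
      using r0 by (simp add: field_simps)
    also have "\<dots> = (\<i> * k * of_real r - 1) * of_real r * (C * (- \<i> * exp (\<i> * (k * of_real r)) / (k * of_real r)))"
      using r0 k0 by (simp add: field_simps power2_eq_square)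
    finally show ?thesis using Ue[OF r] by simp
  qed
  have ev: "\<forall>\<^sub>F r in at_right (rp 1). rp 1 < r" by (simp add: eventually_at_filter)
  have "((\<lambda>r. (\<i> * k * of_real r - 1) * of_real r * ?U r) \<longlongrightarrow> (\<i> * k * of_real (rp 1) - 1) * of_real (rp 1) * (u 0 * fst y)) (at_right (rp 1))"
    by (intro tendsto_intros st)
  moreover have "\<forall>\<^sub>F r in at_right (rp 1). (\<i> * k * of_real r - 1) * of_real r * ?U r = ?T r"
    using ev by eventually_elim (rule Te[symmetric])
  ultimately have "(?T \<longlongrightarrow> (\<i> * k * of_real (rp 1) - 1) * of_real (rp 1) * (u 0 * fst y)) (at_right (rp 1))"
    by (rule Lim_transform_eventually)
  then have eq: "u 0 * snd y = (\<i> * k * of_real (rp 1) - 1) * of_real (rp 1) * (u 0 * fst y)"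
    using tendsto_unique[OF _ st(2)] by auto
  \<comment> \<open>Otherwise the field vanishes inside, its limit at the outermost sphere forces
    the monopole coefficient to be 0, and the solution would be trivial.\<close>
  have "u 0 \<noteq> 0"
  proof
    assume z: "u 0 = 0"
    have "(?U \<longlongrightarrow> C * (- \<i> * exp (\<i> * (k * of_real (rp 1))) / (k * of_real (rp 1)))) (at_right (rp 1))"
    proof (rule Lim_transform_eventually)
      show "((\<lambda>r. C * (- \<i> * exp (\<i> * (k * of_real r)) / (k * of_real r))) \<longlongrightarrow> C * (- \<i> * exp (\<i> * (k * of_real (rp 1))) / (k * of_real (rp 1)))) (at_right (rp 1))"
        using k0 rp1(2) by (intro tendsto_intros) auto
      show "\<forall>\<^sub>F r in at_right (rp 1). C * (- \<i> * exp (\<i> * (k * of_real r)) / (k * of_real r)) = ?U r"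
        using ev by eventually_elim (rule Ue[symmetric])
    qed
    then have "C * (- \<i> * exp (\<i> * (k * of_real (rp 1))) / (k * of_real (rp 1))) = 0"
      using tendsto_unique[OF _ st(1)] z by fastforce
    then have C0: "C = 0" using k0 rp1(2) by auto
    from nt obtain x where x: "x \<in> off" "u x \<noteq> 0" by blast
    have ux: "u x = ?U (norm x)" by (rule rad[OF x(1)]) simp
    have ni: "norm x \<notin> interfaces" using x(1) by (simp add: off_def)
    consider "x = 0" | "norm x \<in> {0<..<rp 1}" | "norm x = rp 1" | "rp 1 < norm x" by fastforce
    then show False
    proof cases
      case 1 then show False using x z by simp
    next
      case 2 then show False using st(3)[OF z, of "norm x"] ni ux x by auto
    next
      case 3 then show False using ni rp1 by auto
    next
      case 4 then show False using C C0 x by simp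
    qed
  qed
  then have "snd y = (\<i> * k * of_real (rp 1) - 1) * of_real (rp 1) * fst y" using eq by simp
  then have "char_fun v s0 lm \<delta> \<omega> = 0"
    unfolding char_fun_def y_def[symmetric] k_def[symmetric] by (simp add: algebra_simps power2_eq_square)
  then show ?thesis by (simp add: lm_def s0_def)
qed

end

section \<open>Building a resonant state from a zero of the characteristic function\<close>

lemma norm_has_derivative:
  fixes x :: "real^3" assumes "x \<noteq> 0"
  shows "(norm has_derivative (\<lambda>h. \<Sum>i\<in>UNIV. h $ i * (x $ i / norm x))) (at x)"
  using GDERIV_norm[OF assms] unfolding gderiv_def inner_vec_def
  by (simp add: sgn_div_norm divide_inverse mult_ac)

lemma radial_comp_derivative:
  fixes x :: "real^3" and F :: "real \<Rightarrow> complex"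
  assumes "x \<noteq> 0" "(F has_vector_derivative D) (at (norm x))"
  shows "((\<lambda>x. F (norm x)) has_derivative (grad_form (\<lambda>i. ((x $ i / norm x) *\<^sub>R D)))) (at x)"
  using has_derivative_compose[OF norm_has_derivative[OF assms(1)] assms(2)[unfolded has_vector_derivative_def]]
  by (simp add: scaleR_sum_left)

text \<open>The gradient of F(|x|) is x \<open>G\<close>(|x|) with G = F' / r, and the Hessian is
  the identity times G plus x_i x_j / r times \<open>K\<close> = G'. Its trace 3 G + r K equals - q
  F by the radial equation.\<close>

lemma helmholtz_radial_shell:
  assumes o: "radial_ode a b q F T" and a: "0 \<le> a" and k: "k\<^sup>2 = q" and u: "\<And>x. a < norm x \<Longrightarrow> norm x < b \<Longrightarrow> u x = F (norm x)"
  shows "helmholtz_on {x. a < norm x \<and> norm x < b} k u"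
    and "\<And>x. a < norm x \<Longrightarrow> norm x < b \<Longrightarrow> normal_deriv u x = T (norm x) / of_real (norm x) ^ 2"
proof -
  define S where "S = {x::real^3. a < norm x \<and> norm x < b}"
  have oS: "open S" unfolding S_def by (rule open_shell)
  define G where "G = (\<lambda>r. T r / of_real r ^ 3)"
  define K where "K = (\<lambda>r. (- q * of_real r ^ 2 * F r) / of_real r ^ 3 - 3 * T r / of_real r ^ 4)"
  have dF: "(F has_vector_derivative T r / of_real r ^ 2) (at r)" and dT: "(T has_vector_derivative (- q * of_real r ^ 2 * F r)) (at r)"
    if "a < r" "r < b" for r using o that by (auto simp: radial_ode_def)
  have cF: "isCont F r" "isCont T r" if "a < r" "r < b" for r
    using dF[OF that] dT[OF that] has_vector_derivative_continuous by blast+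
  have dG: "(G has_vector_derivative K r) (at r)" if r: "a < r" "r < b" for r
  proof -
    have r0: "r \<noteq> 0" using r a by auto
    have "((\<lambda>r. inverse (r ^ 3)) has_real_derivative - (3 * r ^ 2) * inverse (r ^ 3) ^ 2) (at r)"
      using r0 by (auto intro!: derivative_eq_intros simp: power2_eq_square)
    then have di: "((\<lambda>r. complex_of_real (inverse (r ^ 3))) has_vector_derivative of_real (- (3 * r ^ 2) * inverse (r ^ 3) ^ 2)) (at r)"
      by (intro has_vector_derivative_of_real)
    have e: "T r * of_real (- (3 * r ^ 2) * inverse (r ^ 3) ^ 2) + (- q * of_real r ^ 2 * F r) * of_real (inverse (r ^ 3)) = K r"
      using r0 by (simp add: K_def field_simps power2_eq_square power3_eq_cube power4_eq_xxxx)
    show ?thesis using has_vector_derivative_mult[OF dT[OF r] di] unfolding e by (simp add: G_def divide_inverse)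
  qed
  define g where "g = (\<lambda>i (x::real^3). x $ i *\<^sub>R G (norm x))"
  define H where "H = (\<lambda>i j (x::real^3). (if i = j then G (norm x) else 0) + (x $ i * x $ j / norm x) *\<^sub>R K (norm x))"
  have nz: "x \<noteq> 0" if "x \<in> S" for x using that a by (auto simp: S_def)
  have du: "(u has_derivative (grad_form (\<lambda>i. g i x))) (at x)" if x: "x \<in> S" for x
  proof -
    have r: "a < norm x" "norm x < b" using x by (auto simp: S_def)
    have "(x $ i / norm x) *\<^sub>R (T (norm x) / of_real (norm x) ^ 2) = g i x" for i
      using nz[OF x] by (simp add: g_def G_def scaleR_conv_of_real field_simps power2_eq_square power3_eq_cube)
    with radial_comp_derivative[OF nz[OF x] dF[OF r]]
    have "((\<lambda>x. F (norm x)) has_derivative (grad_form (\<lambda>i. g i x))) (at x)" by simp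
    then show ?thesis by (rule has_derivative_transform_within_open[OF _ oS x]) (use u in \<open>auto simp: S_def\<close>)
  qed
  have dg: "(g i has_derivative (grad_form (\<lambda>j. H i j x))) (at x)" if x: "x \<in> S" for i x
  proof -
    have r: "a < norm x" "norm x < b" using x by (auto simp: S_def)
    have 1: "((\<lambda>x. x $ i) has_derivative (\<lambda>h. h $ i)) (at x)" by (rule bounded_linear_imp_has_derivative[OF bounded_linear_vec_nth])
    have d: "(g i has_derivative (\<lambda>h. x $ i *\<^sub>R (\<Sum>j\<in>UNIV. h $ j *\<^sub>R ((x $ j / norm x) *\<^sub>R K (norm x))) + h $ i *\<^sub>R G (norm x))) (at x)"
      unfolding g_def by (rule has_derivative_scaleR[OF 1 radial_comp_derivative[OF nz[OF x] dG[OF r]]])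
    have "x $ i *\<^sub>R (\<Sum>j\<in>UNIV. h $ j *\<^sub>R ((x $ j / norm x) *\<^sub>R K (norm x))) + h $ i *\<^sub>R G (norm x) = (\<Sum>j\<in>UNIV. h $ j *\<^sub>R H i j x)" for h
    proof -
      have "(\<Sum>j\<in>UNIV. h $ j *\<^sub>R (if i = j then G (norm x) else 0)) = h $ i *\<^sub>R G (norm x)"
        by (simp add: if_distrib[of "\<lambda>t. _ *\<^sub>R t"] cong: if_cong)
      then show ?thesis
        by (simp add: H_def scaleR_add_right sum.distrib scaleR_sum_right mult_ac)
    qed
    then show ?thesis using d by simp
  qed
  have cH: "continuous_on S (H i j)" for i j
  proof -
    have cN: "continuous_on S (\<lambda>x. h (norm x))" if "\<And>r. a < r \<Longrightarrow> r < b \<Longrightarrow> isCont h r" for h :: "real \<Rightarrow> complex"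
      by (rule continuous_on_compose2[of "{a<..<b}" h]) (use that in \<open>auto simp: S_def intro!: continuous_at_imp_continuous_on continuous_intros\<close>)
    have cG: "isCont G r" "isCont K r" if r: "a < r" "r < b" for r
      using cF[OF r] r a unfolding G_def K_def by (auto intro!: continuous_intros)
    show ?thesis unfolding H_def using nz
      by (cases "i = j") (auto intro!: continuous_intros cN cG)
  qed
  have C: "has_C2 S u g H" unfolding has_C2_def using du dg cH by blast
  have "(\<Sum>i\<in>UNIV. H i i x) + k\<^sup>2 * u x = 0" if x: "x \<in> S" for x :: "real^3"
  proof -
    define r where "r = norm x"
    have r0: "r \<noteq> 0" using nz[OF x] by (simp add: r_def)
    have n2: "x $ 1 * x $ 1 + x $ 2 * x $ 2 + x $ 3 * x $ 3 = r * r"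
    proof -
      have "r * r = inner x x" by (simp add: r_def dot_square_norm power2_eq_square)
      then show ?thesis by (simp add: inner_vec_def sum_3)
    qed
    have "(\<Sum>i\<in>UNIV. H i i x) = 3 * G r + ((x $ 1 * x $ 1 + x $ 2 * x $ 2 + x $ 3 * x $ 3) / r) *\<^sub>R K r"
      by (simp add: H_def sum_3 r_def add_divide_distrib scaleR_left.add)
    also have "\<dots> = 3 * G r + of_real r * K r" unfolding n2 using r0 by (simp add: scaleR_conv_of_real)
    also have "\<dots> = - q * F r"
    proof -
      have R: "complex_of_real r \<noteq> 0" using r0 by simp
      have *: "z * ((- q * z ^ 2 * f) / z ^ 3 - 3 * t / z ^ 4) = - q * f - 3 * (t / z ^ 3)" if "z \<noteq> 0" for z f t :: complex
        using that by (simp add: divide_simps power2_eq_square power3_eq_cube power4_eq_xxxx)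
      show ?thesis using *[OF R, of "F r" "T r"] by (simp add: G_def K_def)
    qed
    finally show ?thesis using u[of x] x k by (simp add: S_def r_def)
  qed
  then show "helmholtz_on {x. a < norm x \<and> norm x < b} k u"
    using helmholtz_onI[OF oS C] by (simp add: S_def)
  fix x :: "real^3" assume x: "a < norm x" "norm x < b"
  then have xS: "x \<in> S" by (simp add: S_def)
  have "of_real (norm x) * normal_deriv u x = rad1 g x" using normal_deriv_eq[OF C xS nz[OF xS]] by simp
  also have "\<dots> = of_real (inner x x) * G (norm x)"
    by (simp add: rad1_def g_def inner_vec_def scaleR_sum_left[symmetric] scaleR_conv_of_real sum_distrib_right mult.assoc)
  also have "\<dots> = of_real (norm x) * (T (norm x) / of_real (norm x) ^ 2)"
    using nz[OF xS] by (simp add: G_def dot_square_norm field_simps power2_eq_square power3_eq_cube)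
  finally have "of_real (norm x) * normal_deriv u x = of_real (norm x) * (T (norm x) / of_real (norm x) ^ 2)" .
  then show "normal_deriv u x = T (norm x) / of_real (norm x) ^ 2"
    using nz[OF xS] mult_left_cancel[of "complex_of_real (norm x)"] by (metis norm_eq_zero of_real_eq_0_iff)
qed

text \<open>Near the centre |x| is not differentiable, so the solution is written as an entire
  function of |x|^2; \<open>Sz_ode\<close> is then exactly the Helmholtz equation.\<close>

lemma helmholtz_ball:
  assumes u: "\<And>x. norm x < b \<Longrightarrow> u x = Sz (k\<^sup>2 * of_real (norm x) ^ 2)"
  shows "helmholtz_on (ball 0 b) k u"
proof -
  define q where "q = k\<^sup>2"
  define z where "z = (\<lambda>x::real^3. q * of_real (norm x) ^ 2)"
  have dz: "(z has_derivative (grad_form (\<lambda>i. (2 * q * of_real (x $ i))))) (at x)" for x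
  proof -
    have "((\<lambda>x. inner x x) has_derivative (\<lambda>h. inner x h + inner h x)) (at x)" by (intro derivative_intros)
    from has_derivative_mult_right[OF has_derivative_of_real[OF this], of q]
    have "((\<lambda>x. q * complex_of_real (inner x x)) has_derivative (\<lambda>h. q * of_real (inner x h + inner h x))) (at x)" .
    moreover have "q * complex_of_real (inner x x) = z x" for x by (simp add: z_def power2_norm_eq_inner[symmetric])
    moreover have "q * of_real (inner x h + inner h x) = (\<Sum>i\<in>UNIV. h $ i *\<^sub>R (2 * q * of_real (x $ i)))" for h
      by (simp add: inner_vec_def scaleR_conv_of_real sum_distrib_left sum.distrib[symmetric] algebra_simps)
    ultimately show ?thesis by simp
  qed
  have comp: "((\<lambda>x. f (z x)) has_derivative (grad_form (\<lambda>i. (f' * (2 * q * of_real (x $ i)))))) (at x)"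
    if "(f has_field_derivative f') (at (z x))" for f f' x
    using has_derivative_compose[OF dz that[unfolded has_field_derivative_def]]
    by (simp add: sum_distrib_left)
  define g where "g = (\<lambda>i (x::real^3). (2 * q * S1 (z x)) * of_real (x $ i))"
  define H where "H = (\<lambda>i j (x::real^3). (if i = j then 2 * q * S1 (z x) else 0) + 2 * q * (S2' (z x) * (2 * q * of_real (x $ j))) * of_real (x $ i))"
  have C: "has_C2 (ball 0 b) u g H" unfolding has_C2_def
  proof (intro conjI ballI allI)
    fix x :: "real^3" assume x: "x \<in> ball 0 b"
    have "((\<lambda>x. Sz (z x)) has_derivative (grad_form (\<lambda>i. g i x))) (at x)"
      using comp[OF Sz_derivative, of x] by (simp add: g_def mult_ac)
    then show "(u has_derivative (grad_form (\<lambda>i. g i x))) (at x)"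
      by (rule has_derivative_transform_within_open[OF _ open_ball x]) (simp add: u z_def q_def)
    fix i
    have 1: "((\<lambda>x. complex_of_real (x $ i)) has_derivative (\<lambda>h. of_real (h $ i))) (at x)"
      by (intro has_derivative_of_real bounded_linear_imp_has_derivative[OF bounded_linear_vec_nth])
    have "((\<lambda>x. (2 * q * S1 (z x)) * of_real (x $ i)) has_derivative
        (\<lambda>h. (2 * q * S1 (z x)) * of_real (h $ i) + (2 * q * (\<Sum>j\<in>UNIV. h $ j *\<^sub>R (S2' (z x) * (2 * q * of_real (x $ j))))) * of_real (x $ i))) (at x)"
      by (rule has_derivative_mult[OF has_derivative_mult_right[OF comp[OF S1_derivative]] 1])
    moreover have "(2 * q * S1 (z x)) * of_real (h $ i) + (2 * q * (\<Sum>j\<in>UNIV. h $ j *\<^sub>R (S2' (z x) * (2 * q * of_real (x $ j))))) * of_real (x $ i) 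
       = (\<Sum>j\<in>UNIV. h $ j *\<^sub>R H i j x)" for h
    proof -
      have "(\<Sum>j\<in>UNIV. h $ j *\<^sub>R (if i = j then 2 * q * S1 (z x) else 0)) = (2 * q * S1 (z x)) * of_real (h $ i)"
        by (simp add: if_distrib[of "\<lambda>t. _ *\<^sub>R t"] cong: if_cong) (simp add: scaleR_conv_of_real)
      then show ?thesis
        by (simp add: H_def scaleR_add_right sum.distrib sum_distrib_left sum_distrib_right mult_ac)
    qed
    ultimately show "(g i has_derivative (grad_form (\<lambda>j. H i j x))) (at x)" unfolding g_def by simp
  next
    have cz: "continuous_on A z" for A unfolding z_def by (intro continuous_intros)
    have "continuous_on A (\<lambda>x. S1 (z x))" "continuous_on A (\<lambda>x. S2' (z x))" for A
      by (rule continuous_on_compose2[OF continuous_on_S(2)[of UNIV] cz], simp, rule continuous_on_compose2[OF continuous_on_S(4)[of UNIV] cz], simp)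
    then show "continuous_on (ball 0 b) (H i j)" for i j
      unfolding H_def by (cases "i = j") (auto intro!: continuous_intros)
  qed
  have "(\<Sum>i\<in>UNIV. H i i x) + k\<^sup>2 * u x = 0" if x: "x \<in> ball 0 b" for x
  proof -
    have n2: "of_real (x $ 1) * of_real (x $ 1) + of_real (x $ 2) * of_real (x $ 2) + of_real (x $ 3) * of_real (x $ 3) = (of_real (norm x) ^ 2 :: complex)"
      unfolding of_real_power[symmetric] power2_norm_eq_inner by (simp add: inner_vec_def sum_3)
    have "(\<Sum>i\<in>UNIV. H i i x) = 6 * q * S1 (z x) + 4 * q * S2' (z x) * (q * (of_real (x $ 1) * of_real (x $ 1) + of_real (x $ 2) * of_real (x $ 2) + of_real (x $ 3) * of_real (x $ 3)))"
      by (simp add: H_def sum_3 algebra_simps)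
    also have "\<dots> = q * (6 * S1 (z x) + 4 * z x * S2' (z x) + Sz (z x)) - q * Sz (z x)"
      unfolding n2 by (simp add: z_def algebra_simps)
    also have "\<dots> = - q * Sz (z x)" unfolding Sz_ode by simp
    finally show ?thesis using u[of x] x by (simp add: q_def z_def)
  qed
  then show ?thesis by (rule helmholtz_onI[OF open_ball C])
qed

text \<open>The equation is local, and using the partial derivatives themselves as witnesses makes
  them agree on overlaps.\<close>

lemma helmholtz_on_UN:
  assumes h: "\<And>i. i \<in> I \<Longrightarrow> helmholtz_on (S i) k u" and o: "\<And>i. i \<in> I \<Longrightarrow> open (S i)"
  shows "helmholtz_on (\<Union>i\<in>I. S i) k u"
proof -
  have c: "has_C2 (\<Union>i\<in>I. S i) u (\<lambda>i. partial_deriv (axis i 1) u) (\<lambda>i j. partial_deriv (axis j 1) (partial_deriv (axis i 1) u))"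
    unfolding has_C2_def
  proof (intro conjI allI)
    show "continuous_on (\<Union>i\<in>I. S i) (partial_deriv (axis j 1) (partial_deriv (axis i 1) u))" for i j
      by (rule continuous_on_open_UN) (use o helmholtz_onD(1)[OF h] in \<open>auto simp: has_C2_def\<close>)
  qed (use helmholtz_onD(1)[OF h] in \<open>(fastforce simp: has_C2_def)+\<close>)
  show ?thesis
    by (rule helmholtz_onI[OF _ c]) (use o helmholtz_onD(2)[OF h] in auto)
qed

lemma radial_outer_trace:
  assumes F: "(F \<longlongrightarrow> l) (at_right \<rho>)" and u: "\<And>x. \<rho> < norm x \<Longrightarrow> norm x < b \<Longrightarrow> u x = F (norm x)" and \<rho>: "\<rho> < b" "norm y = \<rho>"
  shows "outer_trace \<rho> u y l"
  unfolding outer_trace_def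
proof (rule Lim_transform_eventually)
  show "((\<lambda>x. F (norm x)) \<longlongrightarrow> l) (at y within {x. \<rho> < norm x})"
  proof (rule filterlim_compose[OF F])
    have "(norm \<longlongrightarrow> norm y) (at y within {x. \<rho> < norm x})" by (intro tendsto_intros)
    then show "filterlim norm (at_right \<rho>) (at y within {x. \<rho> < norm x})"
      unfolding filterlim_at using \<rho> by (auto simp: eventually_at_filter)
  qed
  have "\<forall>\<^sub>F x in nhds y. x \<in> {x. norm x < b}"
    by (rule eventually_nhds_in_open) (use \<rho> in \<open>auto intro!: open_Collect_less continuous_intros\<close>)
  then show "\<forall>\<^sub>F x in at y within {x. \<rho> < norm x}. F (norm x) = u x"
    unfolding eventually_at_filter by eventually_elim (use u in auto)
qed

lemma radial_inner_trace:
  assumes F: "(F \<longlongrightarrow> l) (at_left \<rho>)" and u: "\<And>x. a < norm x \<Longrightarrow> norm x < \<rho> \<Longrightarrow> u x = F (norm x)" and \<rho>: "a < \<rho>" "norm y = \<rho>"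
  shows "inner_trace \<rho> u y l"
  unfolding inner_trace_def
proof (rule Lim_transform_eventually)
  show "((\<lambda>x. F (norm x)) \<longlongrightarrow> l) (at y within {x. norm x < \<rho>})"
  proof (rule filterlim_compose[OF F])
    have "(norm \<longlongrightarrow> norm y) (at y within {x. norm x < \<rho>})" by (intro tendsto_intros)
    then show "filterlim norm (at_left \<rho>) (at y within {x. norm x < \<rho>})"
      unfolding filterlim_at using \<rho> by (auto simp: eventually_at_filter)
  qed
  have "\<forall>\<^sub>F x in nhds y. x \<in> {x. a < norm x}"
    by (rule eventually_nhds_in_open) (use \<rho> in \<open>auto intro!: open_Collect_less continuous_intros\<close>)
  then show "\<forall>\<^sub>F x in at y within {x. norm x < \<rho>}. F (norm x) = u x"
    unfolding eventually_at_filter by eventually_elim (use u in auto)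
qed

lemma transmission_radial:
  assumes ab: "a < \<rho>" "\<rho> < b" "0 < a"
    and o1: "radial_ode a \<rho> q1 F1 T1" and u1: "\<And>x. a < norm x \<Longrightarrow> norm x < \<rho> \<Longrightarrow> u x = F1 (norm x)"
    and o2: "radial_ode \<rho> b q2 F2 T2" and u2: "\<And>x. \<rho> < norm x \<Longrightarrow> norm x < b \<Longrightarrow> u x = F2 (norm x)"
    and l1: "(F1 \<longlongrightarrow> l) (at_left \<rho>)" "(T1 \<longlongrightarrow> q) (at_left \<rho>)" and l2: "(F2 \<longlongrightarrow> l) (at_right \<rho>)" "(T2 \<longlongrightarrow> p) (at_right \<rho>)"
    and pq: "of_real \<alpha> * p = of_real \<beta> * q"
  shows "transmission \<rho> \<alpha> \<beta> u"
  unfolding transmission_def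
proof (intro ballI conjI)
  fix y :: "real^3" assume "y \<in> sphere 0 \<rho>"
  then have y: "norm y = \<rho>" by simp
  obtain k1 where k1: "k1\<^sup>2 = q1" using power2_csqrt by blast
  obtain k2 where k2: "k2\<^sup>2 = q2" using power2_csqrt by blast
  have \<rho>0: "\<rho> \<noteq> 0" using ab by auto
  have a0: "0 \<le> a" "0 \<le> \<rho>" using ab by auto
  have lr: "((\<lambda>r. complex_of_real r) \<longlongrightarrow> of_real \<rho>) (at \<rho> within A)" for A by (intro tendsto_intros)
  show "\<exists>l. outer_trace \<rho> u y l \<and> inner_trace \<rho> u y l"
    using radial_outer_trace[OF l2(1) u2 ab(2) y] radial_inner_trace[OF l1(1) u1 ab(1) y] by blast
  have n1: "((\<lambda>r. T1 r / of_real r ^ 2) \<longlongrightarrow> q / of_real \<rho> ^ 2) (at_left \<rho>)" and n2: "((\<lambda>r. T2 r / of_real r ^ 2) \<longlongrightarrow> p / of_real \<rho> ^ 2) (at_right \<rho>)"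
    using \<rho>0 by (auto intro!: tendsto_intros l1 l2 lr)
  have "outer_trace \<rho> (normal_deriv u) y (p / of_real \<rho> ^ 2)"
    by (rule radial_outer_trace[OF n2 _ ab(2) y]) (rule helmholtz_radial_shell(2)[OF o2 a0(2) k2 u2])
  moreover have "inner_trace \<rho> (normal_deriv u) y (q / of_real \<rho> ^ 2)"
    by (rule radial_inner_trace[OF n1 _ ab(1) y]) (rule helmholtz_radial_shell(2)[OF o1 a0(1) k1 u1])
  moreover have "of_real \<alpha> * (p / of_real \<rho> ^ 2) = of_real \<beta> * (q / of_real \<rho> ^ 2)" using pq by simp
  ultimately show "\<exists>p q. outer_trace \<rho> (normal_deriv u) y p \<and> inner_trace \<rho> (normal_deriv u) y q \<and> complex_of_real \<alpha> * p = complex_of_real \<beta> * q"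
    by blast
qed

lemma exterior_radial_ode:
  assumes "0 \<le> a"
  shows "radial_ode a b (k\<^sup>2) (\<lambda>r. C * exp (\<i> * k * of_real r) / of_real r) (\<lambda>r. (\<i> * k * of_real r - 1) * (C * exp (\<i> * k * of_real r)))"
  unfolding radial_ode_def
proof (intro ballI conjI)
  fix r assume "r \<in> {a<..<b}"
  then have r0: "complex_of_real r \<noteq> 0" using assms by auto
  have de: "((\<lambda>z. C * exp (\<i> * k * z)) has_field_derivative C * (exp (\<i> * k * of_real r) * (\<i> * k))) (at (of_real r))"
    by (auto intro!: derivative_eq_intros)
  have "((\<lambda>z. C * exp (\<i> * k * z) / z) has_field_derivative (C * (exp (\<i> * k * of_real r) * (\<i> * k)) * of_real r - C * exp (\<i> * k * of_real r) * 1) / (of_real r * of_real r)) (at (of_real r))"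
    by (rule DERIV_divide[OF de DERIV_ident r0])
  from has_vector_derivative_real_field[OF this]
  show "((\<lambda>r. C * exp (\<i> * k * of_real r) / of_real r) has_vector_derivative (\<i> * k * of_real r - 1) * (C * exp (\<i> * k * of_real r)) / of_real r ^ 2) (at r)"
    by (simp add: power2_eq_square algebra_simps)
  have "((\<lambda>z. \<i> * k * z - 1) has_field_derivative \<i> * k) (at (of_real r))" by (auto intro!: derivative_eq_intros)
  from has_vector_derivative_real_field[OF DERIV_mult[OF this de]]
  have "((\<lambda>r. (\<i> * k * of_real r - 1) * (C * exp (\<i> * k * of_real r))) has_vector_derivative
     \<i> * k * (C * exp (\<i> * k * of_real r)) + C * (exp (\<i> * k * of_real r) * (\<i> * k)) * (\<i> * k * of_real r - 1)) (at r)" .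
  moreover have "\<i> * k * (C * exp (\<i> * k * of_real r)) + C * (exp (\<i> * k * of_real r) * (\<i> * k)) * (\<i> * k * of_real r - 1)
      = - (k\<^sup>2) * of_real r ^ 2 * (C * exp (\<i> * k * of_real r) / of_real r)"
    using r0 by (simp add: power2_eq_square algebra_simps)
  ultimately show "((\<lambda>r. (\<i> * k * of_real r - 1) * (C * exp (\<i> * k * of_real r))) has_vector_derivative - (k\<^sup>2) * of_real r ^ 2 * (C * exp (\<i> * k * of_real r) / of_real r)) (at r)"
    by simp
qed

lemma outgoing_monopole:
  assumes k: "k \<noteq> 0" and R: "0 < R" and u: "\<And>x. R < norm x \<Longrightarrow> u x = C * exp (\<i> * k * of_real (norm x)) / of_real (norm x)"
  shows "outgoing k R u"
proof -
  define Y where "Y = complex_of_real (sqrt (1 / (4 * pi)))"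
  have Y0: "Y \<noteq> 0" by (simp add: Y_def)
  have Y: "spherical_harmonic 0 0 x = Y" for x
    by (simp add: spherical_harmonic_def legendre_poly_def Y_def)
  \<comment> \<open>A single term: the coefficient undoes the factor 1 / (i k) of h_0 and the
    constant value \<open>Y\<close> of the spherical harmonic of degree 0.\<close>
  define c where "c = (\<lambda>(n::nat) (m::int). if n = 0 \<and> m = 0 then C * k * \<i> / Y else 0)"
  have "uniform_limit K (\<lambda>M x. \<Sum>n<M. \<Sum>m\<in>{- int n..int n}.
            c n m * spherical_hankel1 n (k * complex_of_real (norm x)) * spherical_harmonic n m (x /\<^sub>R norm x)) u sequentially"
    if K: "K \<subseteq> {x. R < norm x}" for K
  proof (rule uniform_limitI)
    fix e :: real assume e: "e > 0"
    have "(\<Sum>n<M. \<Sum>m\<in>{- int n..int n}. c n m * spherical_hankel1 n (k * complex_of_real (norm x)) * spherical_harmonic n m (x /\<^sub>R norm x)) = u x"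
      if M: "M \<ge> 1" and x: "x \<in> K" for M x
    proof -
      have nx: "R < norm x" "norm x \<noteq> 0" using K x R by force+
      have "(\<Sum>n<M. \<Sum>m\<in>{- int n..int n}. c n m * spherical_hankel1 n (k * complex_of_real (norm x)) * spherical_harmonic n m (x /\<^sub>R norm x))
         = (\<Sum>n<M. if n = 0 then (C * k * \<i> / Y) * spherical_hankel1 0 (k * complex_of_real (norm x)) * Y else 0)"
        by (intro sum.cong refl) (simp add: c_def Y)
      also have "\<dots> = (C * k * \<i> / Y) * spherical_hankel1 0 (k * complex_of_real (norm x)) * Y" using M by simp
      also have "\<dots> = u x" using Y0 k nx(2) unfolding u[OF nx(1)] by (simp add: spherical_hankel1_def field_simps)
      finally show ?thesis .
    qed
    then show "\<forall>\<^sub>F M in sequentially. \<forall>x\<in>K. dist (\<Sum>n<M. \<Sum>m\<in>{- int n..int n}.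
            c n m * spherical_hankel1 n (k * complex_of_real (norm x)) * spherical_harmonic n m (x /\<^sub>R norm x)) (u x) < e"
      unfolding eventually_sequentially using e by (intro exI[of _ 1]) auto
  qed
  then show ?thesis unfolding outgoing_def by blast
qed

context nested_shells
begin

text \<open>The profile assembled layer by layer: step \<open>Suc i\<close> adds the host layer
  \<open>i\<close> and the shell that follows it, and leaves smaller radii to the earlier steps.
  Values at the interfaces are arbitrary, since (P) does not see them.\<close>

primrec prof :: "real \<Rightarrow> complex \<Rightarrow> real \<Rightarrow> nat \<Rightarrow> real \<Rightarrow> complex" where
  "prof s0 lm \<delta> 0 r = 0"
| "prof s0 lm \<delta> (Suc i) r = (let y = yst s0 i lm \<delta>; m = mid_state s0 lm \<delta> i y; qh = of_real (s0 * \<delta>) * lm; qd = of_real \<delta> * lm in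
     if r \<le> layer_start i then prof s0 lm \<delta> i r
     else if r < rm (N - i) then t11 (layer_start i) r qh * fst y + t12 (layer_start i) r qh * snd y
     else t11 (rm (N - i)) r qd * fst m + t12 (rm (N - i)) r qd * (of_real \<delta> * snd m))"

lemma layer_start_mono: "i \<le> i' \<Longrightarrow> i' \<le> N \<Longrightarrow> layer_start i \<le> layer_start i'"
proof (induction i' rule: dec_induct)
  case (step n)
  then have "layer_start n < layer_start (Suc n)"
    using layer_start_lt(2)[of n] radii(2)[OF layer_shell_index[of n]] by (simp add: layer_start_Suc)
  then show ?case using step by simp
qed simp

lemma prof_eq:
  assumes i: "i < i'" "i' \<le> N"
  shows "r \<in> {layer_start i<..<rm (N - i)} \<Longrightarrow> prof s0 lm \<delta> i' r =
      t11 (layer_start i) r (of_real (s0 * \<delta>) * lm) * fst (yst s0 i lm \<delta>) + t12 (layer_start i) r (of_real (s0 * \<delta>) * lm) * snd (yst s0 i lm \<delta>)"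
    and "r \<in> {rm (N - i)<..<rp (N - i)} \<Longrightarrow> prof s0 lm \<delta> i' r =
      t11 (rm (N - i)) r (of_real \<delta> * lm) * fst (mid_state s0 lm \<delta> i (yst s0 i lm \<delta>)) + t12 (rm (N - i)) r (of_real \<delta> * lm) * (of_real \<delta> * snd (mid_state s0 lm \<delta> i (yst s0 i lm \<delta>)))"
proof -
  have iN: "i < N" using i by simp
  have *: "prof s0 lm \<delta> i' r = prof s0 lm \<delta> (Suc i) r" if r: "r < rp (N - i)"
    using i(1)[THEN Suc_leI] i(2)
  proof (induction i' rule: dec_induct)
    case (step n)
    have "rp (N - i) \<le> layer_start n" using layer_start_mono[of "Suc i" n] step iN by (simp add: layer_start_Suc)
    then show ?case using step r by (simp add: Let_def)
  qed simp
  have lt: "rm (N - i) < rp (N - i)" "layer_start i < rm (N - i)" using radii(2)[OF layer_shell_index[OF iN]] layer_start_lt[OF iN] by auto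
  show "r \<in> {layer_start i<..<rm (N - i)} \<Longrightarrow> prof s0 lm \<delta> i' r =
      t11 (layer_start i) r (of_real (s0 * \<delta>) * lm) * fst (yst s0 i lm \<delta>) + t12 (layer_start i) r (of_real (s0 * \<delta>) * lm) * snd (yst s0 i lm \<delta>)"
    using * lt by (simp add: Let_def)
  show "r \<in> {rm (N - i)<..<rp (N - i)} \<Longrightarrow> prof s0 lm \<delta> i' r =
      t11 (rm (N - i)) r (of_real \<delta> * lm) * fst (mid_state s0 lm \<delta> i (yst s0 i lm \<delta>)) + t12 (rm (N - i)) r (of_real \<delta> * lm) * (of_real \<delta> * snd (mid_state s0 lm \<delta> i (yst s0 i lm \<delta>)))"
    using * lt by (simp add: Let_def)
qed

lemma off_cases:
  assumes "0 < r" "r \<notin> interfaces"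
  obtains "rp 1 < r" | i where "i < N" "r \<in> {layer_start i<..<rm (N - i)}" | i where "i < N" "r \<in> {rm (N - i)<..<rp (N - i)}"
proof -
  have *: "i \<le> N \<Longrightarrow> r < layer_start i \<Longrightarrow> \<exists>i<N. r \<in> {layer_start i<..<rm (N - i)} \<or> r \<in> {rm (N - i)<..<rp (N - i)}" for i
  proof (induction i)
    case 0
    then show ?case using assms by (simp add: layer_start_def)
  next
    case (Suc i)
    then have i: "i < N" by simp
    have ri: "r < rp (N - i)" using Suc.prems by (simp add: layer_start_Suc[OF i])
    have nm: "r \<noteq> rm (N - i)" using assms layer_shell_index[OF i] by (auto simp: interfaces_def)
    have "r \<noteq> layer_start i"
    proof (cases "i = 0")
      case False
      then have "layer_start i \<in> interfaces" using i unfolding layer_start_def interfaces_def by auto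
      then show ?thesis using assms by auto
    qed (use assms in \<open>simp add: layer_start_def\<close>)
    then consider "r < layer_start i" | "r \<in> {layer_start i<..<rm (N - i)}" | "r \<in> {rm (N - i)<..<rp (N - i)}" using nm ri by fastforce
    then show ?case by cases (use Suc i in auto)
  qed
  show ?thesis
  proof (cases "r < rp 1")
    case True
    then show ?thesis using *[of N] that(2,3) by (auto simp: layer_start_N)
  next
    case False
    then show ?thesis using that(1) assms rp1 by (cases "r = rp 1") auto
  qed
qed

text \<open>The transfer formulas define solutions in all layers whose states match at each
  interface by construction; the characteristic equation is what remains for the match with the
  exterior monopole. The value 1 at the centre makes the field nontrivial.\<close>

theorem char_eigenfrequency:
  assumes pos: "0 < v" "0 < vr" "0 < \<delta>" and \<omega>: "\<omega> \<noteq> 0"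
    and ch: "char_fun v (vr\<^sup>2 / v\<^sup>2) (\<omega>\<^sup>2 / of_real (\<delta> * vr\<^sup>2)) \<delta> \<omega> = 0"
  shows "eigenfrequency N rp rm v vr \<delta> \<omega>"
proof -
  define lm where "lm = \<omega>\<^sup>2 / of_real (\<delta> * vr\<^sup>2)"
  define s0 where "s0 = vr\<^sup>2 / v\<^sup>2"
  define k where "k = \<omega> / of_real v"
  define qh where "qh = of_real (s0 * \<delta>) * lm"
  define qd where "qd = of_real \<delta> * lm"
  have kh: "k\<^sup>2 = qh" and kd: "(\<omega> / of_real vr)\<^sup>2 = qd"
    using pos by (simp_all add: lm_def s0_def power_divide k_def qh_def qd_def)
  have k0: "k \<noteq> 0" using \<omega> pos by (simp add: k_def)
  define Y where "Y = (\<lambda>i. yst s0 i lm \<delta>)"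
  define M where "M = (\<lambda>i. mid_state s0 lm \<delta> i (Y i))"
  have YS: "Y (Suc i) = end_state lm \<delta> i (M i)" for i by (simp add: Y_def M_def)
  define Fh where "Fh = (\<lambda>i r. t11 (layer_start i) r qh * fst (Y i) + t12 (layer_start i) r qh * snd (Y i))"
  define Th where "Th = (\<lambda>i r. - qh * tau (layer_start i) r qh * fst (Y i) + t22 (layer_start i) r qh * snd (Y i))"
  define Fd where "Fd = (\<lambda>i r. t11 (rm (N - i)) r qd * fst (M i) + t12 (rm (N - i)) r qd * (of_real \<delta> * snd (M i)))"
  define Td where "Td = (\<lambda>i r. - qd * tau (rm (N - i)) r qd * fst (M i) + t22 (rm (N - i)) r qd * (of_real \<delta> * snd (M i)))"
  \<comment> \<open>Chosen so that the exterior field has the value \<open>fst (Y N)\<close> at the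
    outermost sphere; the flux then matches by the characteristic equation.\<close>
  define C where "C = fst (Y N) * of_real (rp 1) * exp (- (\<i> * k * of_real (rp 1)))"
  define Fe where "Fe = (\<lambda>r. C * exp (\<i> * k * of_real r) / of_real r)"
  define Te where "Te = (\<lambda>r. (\<i> * k * of_real r - 1) * (C * exp (\<i> * k * of_real r)))"
  \<comment> \<open>At the centre the transfer formulas divide by zero, so the limit value 1 is set
    by hand.\<close>
  define u where "u = (\<lambda>x::real^3. if x = 0 then 1 else if norm x < rp 1 then prof s0 lm \<delta> N (norm x) else Fe (norm x))"
  have Y0: "Y 0 = (1, 0)" by (simp add: Y_def)
  have ls: "0 \<le> layer_start i" "layer_start i < rm (N - i)" "i = 0 \<or> 0 < layer_start i" "0 < rm (N - i)" "rm (N - i) < rp (N - i)" "rp (N - i) \<le> rp 1" if "i < N" for i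
  proof -
    show "0 \<le> layer_start i" "layer_start i < rm (N - i)" "i = 0 \<or> 0 < layer_start i" using layer_start_lt[OF that] by auto
    show "0 < rm (N - i)" "rm (N - i) < rp (N - i)" using radii[OF layer_shell_index[OF that]] by auto
    have "rp (N - i) \<in> interfaces" using layer_shell_index[OF that] by (auto simp: interfaces_def)
    then show "rp (N - i) \<le> rp 1" by (rule rp1_max)
  qed
  have uh: "u x = Fh i (norm x)" if "i < N" "layer_start i < norm x" "norm x < rm (N - i)" for i x
  proof -
    have "x \<noteq> 0" "norm x < rp 1" using ls[OF that(1)] that by auto
    then show ?thesis using that prof_eq(1)[of i N "norm x" s0 lm \<delta>] by (simp add: u_def Fh_def Y_def qh_def)
  qed
  have ud: "u x = Fd i (norm x)" if "i < N" "rm (N - i) < norm x" "norm x < rp (N - i)" for i x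
  proof -
    have "x \<noteq> 0" "norm x < rp 1" using ls[OF that(1)] that by auto
    then show ?thesis using that prof_eq(2)[of i N "norm x" s0 lm \<delta>] by (simp add: u_def Fd_def Y_def M_def qd_def)
  qed
  have ue: "u x = Fe (norm x)" if "rp 1 < norm x" for x using that rp1(2) by (auto simp: u_def)
  have oh: "radial_ode (layer_start i) (rm (N - i)) qh (Fh i) (Th i)" if "i < N" for i
    unfolding Fh_def Th_def by (rule transfer_solves) (use ls[OF that] Y0 in auto)
  have od: "radial_ode (rm (N - i)) (rp (N - i)) qd (Fd i) (Td i)" if "i < N" for i
    unfolding Fd_def Td_def by (rule transfer_solves) (use ls[OF that] in auto)
  have oe: "radial_ode (rp 1) b qh Fe Te" for b
    unfolding Fe_def Te_def kh[symmetric] by (rule exterior_radial_ode) (use rp1 in auto)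
  have N0: "0 < N" "N - 0 = N" using N by auto
  have ub: "u x = Sz (k\<^sup>2 * of_real (norm x) ^ 2)" if "norm x < rm N" for x
  proof (cases "x = 0")
    case True
    then show ?thesis by (simp add: u_def S_at_0)
  next
    case False
    then have "u x = Fh 0 (norm x)" using uh[of 0 x] that N0 by (simp add: layer_start_def)
    also have "\<dots> = Sz (k\<^sup>2 * of_real (norm x) ^ 2)" using False by (simp add: Fh_def Y0 t11_def ss_def layer_start_def kh)
    finally show ?thesis .
  qed
  have host: "helmholtz_on (- closure (resonator N rp rm)) k u"
  proof -
    \<comment> \<open>\<open>Inl\<close> indexes the host layers, the innermost one being a full
      ball. \<open>Inr b\<close> is the exterior cut off at radius \<open>b\<close>, because
      \<open>radial_ode\<close> lives on bounded intervals; the union over all \<open>b\<close>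
      recovers the exterior.\<close>
    define S where "S = (\<lambda>t::nat + real. case t of Inl i \<Rightarrow> (if i = 0 then ball 0 (rm N) else {x::real^3. layer_start i < norm x \<and> norm x < rm (N - i)})
        | Inr b \<Rightarrow> {x. rp 1 < norm x \<and> norm x < b})"
    have "helmholtz_on (\<Union>t\<in>Inl ` {..<N} \<union> range Inr. S t) k u"
    proof (rule helmholtz_on_UN)
      fix t :: "nat + real" assume t: "t \<in> Inl ` {..<N} \<union> range Inr"
      show "open (S t)" unfolding S_def by (cases t) (auto intro: open_shell)
      show "helmholtz_on (S t) k u"
      proof (cases t)
        case (Inl i)
        then have i: "i < N" using t by auto
        show ?thesis
        proof (cases "i = 0")
          case True
          then show ?thesis unfolding S_def Inl using helmholtz_ball[OF ub] by simp
        next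
          case False
          then show ?thesis unfolding S_def Inl using helmholtz_radial_shell(1)[OF oh[OF i] ls(1)[OF i] kh uh[OF i]] by simp
        qed
      next
        case (Inr b)
        show ?thesis unfolding S_def Inr using helmholtz_radial_shell(1)[OF oe less_imp_le[OF rp1(2)] kh ue] by simp
      qed
    qed
    moreover have "(\<Union>t\<in>Inl ` {..<N} \<union> range Inr. S t) = - closure (resonator N rp rm)"
    proof
      show "(\<Union>t\<in>Inl ` {..<N} \<union> range Inr. S t) \<subseteq> - closure (resonator N rp rm)"
      proof
        fix x assume "x \<in> (\<Union>t\<in>Inl ` {..<N} \<union> range Inr. S t)"
        then consider i where "i < N" "x \<in> S (Inl i)" | b where "x \<in> S (Inr b)" by auto
        then have "norm x \<notin> interfaces \<and> \<not> in_shell (norm x)"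
        proof cases
          case 1
          show ?thesis
          proof (cases "x = 0")
            case True
            then show ?thesis using interfaces_pos radii(1) by (fastforce simp: in_shell_def)
          next
            case False
            then have "norm x \<in> {layer_start i<..<rm (N - i)}" using 1 by (auto simp: S_def layer_start_def split: if_splits)
            then show ?thesis using host_gap[OF 1(1)] by blast
          qed
        next
          case 2
          then have "rp 1 < norm x" unfolding S_def by auto
          then show ?thesis using rp1_max[of "norm x"] in_shell_less_rp1[of "norm x"] by auto
        qed
        then show "x \<in> - closure (resonator N rp rm)" unfolding host_eq by (simp add: off_def)
      qed
      show "- closure (resonator N rp rm) \<subseteq> (\<Union>t\<in>Inl ` {..<N} \<union> range Inr. S t)"
      proof
        fix x assume "x \<in> - closure (resonator N rp rm)"
        then have x: "norm x \<notin> interfaces" "\<not> in_shell (norm x)" unfolding host_eq by (auto simp: off_def)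
        show "x \<in> (\<Union>t\<in>Inl ` {..<N} \<union> range Inr. S t)"
        proof (cases "x = 0")
          case True
          then have "x \<in> S (Inl 0)" using radii(1)[of N] N by (simp add: S_def)
          then show ?thesis using N0 by blast
        next
          case False
          then have p: "0 < norm x" by simp
          show ?thesis
          proof (rule off_cases[OF p x(1)], goal_cases)
            case 1
            then have "x \<in> S (Inr (norm x + 1))" by (simp add: S_def)
            then show ?thesis by blast
          next
            case (2 i)
            then have "x \<in> S (Inl i)" by (auto simp: S_def)
            then show ?thesis using 2 by blast
          next
            case (3 i)
            then show ?thesis using x(2) shell_gap(2)[OF layer_shell_index[OF 3(1)]] by blast
          qed
        qed
      qed
    qed
    ultimately show ?thesis by simp
  qed
  have res: "helmholtz_on (resonator N rp rm) (\<omega> / of_real vr) u"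
    unfolding resonator_def
  proof (rule helmholtz_on_UN)
    fix j assume j: "j \<in> {1..N}"
    define i where "i = N - j"
    have i: "i < N" "N - i = j" using j by (auto simp: i_def)
    show "open (shell rp rm j)" unfolding shell_def by (rule open_shell)
    show "helmholtz_on (shell rp rm j) (\<omega> / of_real vr) u"
      using helmholtz_radial_shell(1)[OF od[OF i(1)] less_imp_le[OF ls(4)[OF i(1)]] kd ud[OF i(1)]] by (simp add: shell_def i(2))
  qed
  have chr: "snd (Y N) = (\<i> * k * of_real (rp 1) - 1) * of_real (rp 1) * fst (Y N)"
    using ch unfolding char_fun_def lm_def[symmetric] s0_def[symmetric] Y_def k_def[symmetric] by (simp add: algebra_simps power2_eq_square)
  have tr: "transmission (rp j) \<delta> 1 u \<and> transmission (rm j) 1 \<delta> u" if j: "j \<in> {1..N}" for j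
  proof -
    define i where "i = N - j"
    have i: "i < N" "N - i = j" using j by (auto simp: i_def)
    note l = ls[OF i(1), unfolded i(2)]
    have rj: "0 < rp j" using l by simp
    have limD: "(Fd i \<longlongrightarrow> fst (M i)) (at_right (rm j))" "(Td i \<longlongrightarrow> of_real \<delta> * snd (M i)) (at_right (rm j))"
      unfolding Fd_def Td_def i(2) by (rule transfer_solution_tendsto(3,4)[OF l(4)])+
    have limH: "(Fh i \<longlongrightarrow> fst (M i)) (at_left (rm j))" "(Th i \<longlongrightarrow> snd (M i)) (at_left (rm j))"
      unfolding Fh_def Th_def M_def mid_state_def Let_def qh_def[symmetric] i(2) fst_conv snd_conv
      by (rule transfer_solution_tendsto(1,2)[OF l(4)])+
    have "Fd i (rp j) = fst (Y (Suc i))" by (simp add: Fd_def YS end_state_def Let_def qd_def i(2) mult_ac)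
    moreover have "Td i (rp j) = of_real \<delta> * snd (Y (Suc i))"
      by (simp add: Td_def YS end_state_def Let_def qd_def[symmetric] i(2)) (simp add: qd_def algebra_simps)
    moreover have "(Fd i \<longlongrightarrow> Fd i (rp j)) (at_left (rp j))" "(Td i \<longlongrightarrow> Td i (rp j)) (at_left (rp j))"
      unfolding Fd_def Td_def by (rule transfer_solution_tendsto(1,2)[OF rj])+
    ultimately have limE: "(Fd i \<longlongrightarrow> fst (Y (Suc i))) (at_left (rp j))" "(Td i \<longlongrightarrow> of_real \<delta> * snd (Y (Suc i))) (at_left (rp j))" by (simp_all only:)
    \<comment> \<open>A positive starting radius inside the host layer; \<open>layer_start i\<close>
      itself is 0 for the innermost layer.\<close>
    define a where "a = (layer_start i + rm j) / 2"
    have a: "layer_start i < a" "a < rm j" "0 < a" using l by (auto simp: a_def)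
    have sub: "radial_ode a' b' q F T \<Longrightarrow> a' \<le> a'' \<Longrightarrow> radial_ode a'' b' q F T" for a' a'' b' q F T
      by (auto simp: radial_ode_def)
    have t1: "transmission (rm j) 1 \<delta> u"
    proof (rule transmission_radial[OF a(2) l(5) a(3) sub[OF oh[OF i(1), unfolded i(2)] less_imp_le[OF a(1)]] _ od[OF i(1), unfolded i(2)] _ limH limD])
      show "u x = Fh i (norm x)" if "a < norm x" "norm x < rm j" for x using uh[OF i(1), of x] that a i(2) by simp
      show "u x = Fd i (norm x)" if "rm j < norm x" "norm x < rp j" for x using ud[OF i(1), of x] that i(2) by simp
    qed simp
    have t2: "transmission (rp j) \<delta> 1 u"
    proof (cases "Suc i < N")
      case True
      have st: "layer_start (Suc i) = rp j" using layer_start_Suc[OF i(1)] i(2) by simp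
      have lt: "rp j < rm (N - Suc i)" using ls(2)[OF True] st by simp
      have lim: "(Fh (Suc i) \<longlongrightarrow> fst (Y (Suc i))) (at_right (rp j))" "(Th (Suc i) \<longlongrightarrow> snd (Y (Suc i))) (at_right (rp j))"
        unfolding Fh_def Th_def st by (rule transfer_solution_tendsto(3,4)[OF rj])+
      show ?thesis
      proof (rule transmission_radial[OF l(5) lt l(4) od[OF i(1), unfolded i(2)] _ oh[OF True, unfolded st] _ limE lim])
        show "u x = Fd i (norm x)" if "rm j < norm x" "norm x < rp j" for x using ud[OF i(1), of x] that i(2) by simp
        show "u x = Fh (Suc i) (norm x)" if "rp j < norm x" "norm x < rm (N - Suc i)" for x using uh[OF True, of x] that st by simp
      qed simp
    next
      case False
      then have Si: "Suc i = N" using i by simp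
      have j1: "j = 1" using i Si by auto
      have r0: "complex_of_real (rp 1) \<noteq> 0" using rp1(2) by simp
      have ex: "exp (- (\<i> * k * of_real (rp 1))) * exp (\<i> * k * of_real (rp 1)) = 1" by (simp add: exp_add[symmetric])
      have Ce: "C * exp (\<i> * k * of_real (rp 1)) = of_real (rp 1) * fst (Y N)"
        unfolding C_def using ex by (simp add: mult_ac) 
      have lim: "(Fe \<longlongrightarrow> fst (Y (Suc i))) (at_right (rp j))" "(Te \<longlongrightarrow> snd (Y (Suc i))) (at_right (rp j))"
      proof -
        have "(Fe \<longlongrightarrow> C * exp (\<i> * k * of_real (rp 1)) / of_real (rp 1)) (at_right (rp 1))"
          unfolding Fe_def using r0 by (intro tendsto_intros) auto
        then show "(Fe \<longlongrightarrow> fst (Y (Suc i))) (at_right (rp j))" unfolding Ce Si j1 using r0 by simp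
        have "(Te \<longlongrightarrow> (\<i> * k * of_real (rp 1) - 1) * (C * exp (\<i> * k * of_real (rp 1)))) (at_right (rp 1))"
          unfolding Te_def by (intro tendsto_intros)
        then show "(Te \<longlongrightarrow> snd (Y (Suc i))) (at_right (rp j))" unfolding Ce Si j1 chr by (simp add: mult_ac)
      qed
      have lt: "rp j < rp j + 1" by simp
      show ?thesis
      proof (rule transmission_radial[OF l(5) lt l(4) od[OF i(1), unfolded i(2)] _ oe[of "rp j + 1", folded j1] _ limE lim])
        show "u x = Fd i (norm x)" if "rm j < norm x" "norm x < rp j" for x using ud[OF i(1), of x] that i(2) by simp
        show "u x = Fe (norm x)" if "rp j < norm x" "norm x < rp j + 1" for x using ue[of x] that j1 by simp
      qed simp
    qed
    show ?thesis using t1 t2 by blast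
  qed
  have out: "outgoing k (rp 1) u" by (rule outgoing_monopole[OF k0 rp1(2), where C = C]) (use ue in \<open>simp add: Fe_def\<close>)
  have "scattering_solution N rp rm v vr \<delta> \<omega> (\<lambda>x. 0) u"
    unfolding scattering_solution_def using host res tr out by (simp add: k_def)
  moreover have "\<exists>x\<in>resonator N rp rm \<union> - closure (resonator N rp rm). u x \<noteq> 0"
  proof (rule bexI[of _ 0])
    show "u 0 \<noteq> 0" by (simp add: u_def)
    show "0 \<in> resonator N rp rm \<union> - closure (resonator N rp rm)" unfolding domain_eq off_def using interfaces_pos by force
  qed
  ultimately show ?thesis unfolding eigenfrequency_def using \<omega> by blast
qed

end

section \<open>Dependence on the contrast, and the limit polynomials\<close>

text \<open>The transfer matrices depend on \<open>\<lambda>\<close> and \<open>\<delta>\<close>; such a function is a polynomial in \<open>\<lambda>\<close> up to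
  an error of order \<open>\<delta>\<close>, which is kept explicit because the expansion of the resonances needs it.\<close>

definition poly_perturbation :: "complex poly \<Rightarrow> (complex \<Rightarrow> real \<Rightarrow> complex) \<Rightarrow> bool" where
  "poly_perturbation p f \<longleftrightarrow> (\<exists>f' D. (\<forall>z \<delta>. ((\<lambda>z. f z \<delta>) has_field_derivative f' z \<delta>) (at z)) \<and>
     continuous_on UNIV (\<lambda>x. f' (fst x) (snd x)) \<and> continuous_on UNIV (\<lambda>x. D (fst x) (snd x)) \<and>
     (\<forall>z \<delta>. f z \<delta> = poly p z + of_real \<delta> * D z \<delta>))"

lemma poly_perturbation_const [simp]: "poly_perturbation [:c:] (\<lambda>z \<delta>. c)"
  unfolding poly_perturbation_def by (intro exI[of _ "\<lambda>_ _. 0"]) auto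

lemma poly_perturbation_one [simp]: "poly_perturbation 1 (\<lambda>z \<delta>. 1)"
  using poly_perturbation_const[of 1] by (simp add: one_pCons)

lemma poly_perturbation_zero [simp]: "poly_perturbation 0 (\<lambda>z \<delta>. 0)"
  using poly_perturbation_const[of 0] by simp

lemma poly_perturbation_var: "poly_perturbation [:0, 1:] (\<lambda>z \<delta>. z)"
  unfolding poly_perturbation_def
  by (intro exI[of _ "\<lambda>_ _. 1"] exI[of _ "\<lambda>_ _. 0"]) (auto intro!: derivative_eq_intros)

lemma poly_perturbation_delta: "poly_perturbation 0 (\<lambda>z \<delta>. of_real \<delta>)"
  unfolding poly_perturbation_def
  by (intro exI[of _ "\<lambda>_ _. 0"] exI[of _ "\<lambda>_ _. 1"]) auto

lemma poly_perturbation_add: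
  assumes "poly_perturbation p f" "poly_perturbation q g"
  shows "poly_perturbation (p + q) (\<lambda>z \<delta>. f z \<delta> + g z \<delta>)"
proof -
  obtain f' D where f: "\<And>z \<delta>. ((\<lambda>z. f z \<delta>) has_field_derivative f' z \<delta>) (at z)"
      "continuous_on UNIV (\<lambda>x. f' (fst x) (snd x))" "continuous_on UNIV (\<lambda>x. D (fst x) (snd x))"
      "\<And>z \<delta>. f z \<delta> = poly p z + of_real \<delta> * D z \<delta>"
    using assms(1) unfolding poly_perturbation_def by blast
  obtain g' E where g: "\<And>z \<delta>. ((\<lambda>z. g z \<delta>) has_field_derivative g' z \<delta>) (at z)"
      "continuous_on UNIV (\<lambda>x. g' (fst x) (snd x))" "continuous_on UNIV (\<lambda>x. E (fst x) (snd x))"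
      "\<And>z \<delta>. g z \<delta> = poly q z + of_real \<delta> * E z \<delta>"
    using assms(2) unfolding poly_perturbation_def by blast
  show ?thesis unfolding poly_perturbation_def
    by (intro exI[of _ "\<lambda>z \<delta>. f' z \<delta> + g' z \<delta>"] exI[of _ "\<lambda>z \<delta>. D z \<delta> + E z \<delta>"] conjI allI
        DERIV_add f(1) g(1) continuous_on_add f(2,3) g(2,3)) (simp add: f(4) g(4) algebra_simps)
qed

lemma poly_perturbation_continuous:
  assumes "poly_perturbation p f"
  shows "continuous_on UNIV (\<lambda>x. f (fst x) (snd x))"
proof -
  obtain D where "continuous_on UNIV (\<lambda>x. D (fst x) (snd x))" "f = (\<lambda>z \<delta>. poly p z + of_real \<delta> * D z \<delta>)"
    using assms unfolding poly_perturbation_def by blast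
  then show ?thesis by (auto intro!: continuous_intros)
qed

lemma poly_perturbation_mult:
  assumes "poly_perturbation p f" "poly_perturbation q g"
  shows "poly_perturbation (p * q) (\<lambda>z \<delta>. f z \<delta> * g z \<delta>)"
proof -
  obtain f' D where f: "\<And>z \<delta>. ((\<lambda>z. f z \<delta>) has_field_derivative f' z \<delta>) (at z)"
      "continuous_on UNIV (\<lambda>x. f' (fst x) (snd x))" "continuous_on UNIV (\<lambda>x. D (fst x) (snd x))"
      "\<And>z \<delta>. f z \<delta> = poly p z + of_real \<delta> * D z \<delta>"
    using assms(1) unfolding poly_perturbation_def by blast
  obtain g' E where g: "\<And>z \<delta>. ((\<lambda>z. g z \<delta>) has_field_derivative g' z \<delta>) (at z)"
      "continuous_on UNIV (\<lambda>x. g' (fst x) (snd x))" "continuous_on UNIV (\<lambda>x. E (fst x) (snd x))"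
      "\<And>z \<delta>. g z \<delta> = poly q z + of_real \<delta> * E z \<delta>"
    using assms(2) unfolding poly_perturbation_def by blast
  show ?thesis unfolding poly_perturbation_def
  proof (rule exI[of _ "\<lambda>z \<delta>. f' z \<delta> * g z \<delta> + g' z \<delta> * f z \<delta>"],
      rule exI[of _ "\<lambda>z \<delta>. poly p z * E z \<delta> + D z \<delta> * poly q z + of_real \<delta> * (D z \<delta> * E z \<delta>)"], intro conjI allI)
    show "((\<lambda>z. f z \<delta> * g z \<delta>) has_field_derivative f' z \<delta> * g z \<delta> + g' z \<delta> * f z \<delta>) (at z)" for z \<delta>
      by (rule DERIV_mult[OF f(1) g(1)])
    show "continuous_on UNIV (\<lambda>x. f' (fst x) (snd x) * g (fst x) (snd x) + g' (fst x) (snd x) * f (fst x) (snd x))"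
      by (intro continuous_on_add continuous_on_mult f g assms[THEN poly_perturbation_continuous])
    show "continuous_on UNIV (\<lambda>x. poly p (fst x) * E (fst x) (snd x) + D (fst x) (snd x) * poly q (fst x) +
        complex_of_real (snd x) * (D (fst x) (snd x) * E (fst x) (snd x)))"
      by (intro continuous_intros f g)
    show "f z \<delta> * g z \<delta> = poly (p * q) z + of_real \<delta> * (poly p z * E z \<delta> + D z \<delta> * poly q z + of_real \<delta> * (D z \<delta> * E z \<delta>))" for z \<delta>
      by (simp add: f(4) g(4) algebra_simps)
  qed
qed

lemma poly_perturbation_cmult:
  "poly_perturbation p f \<Longrightarrow> poly_perturbation (Polynomial.smult c p) (\<lambda>z \<delta>. c * f z \<delta>)"
  using poly_perturbation_mult[OF poly_perturbation_const[of c]] by simp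

text \<open>Writing F(z) = F(0) + z E(z) with the difference quotient E, continuous also at 0, shows
  that F(c \<delta> z) differs from F(0) by \<delta> times a jointly continuous function.\<close>

lemma poly_perturbation_entire:
  assumes F: "\<And>z. (F has_field_derivative F' z) (at z)" and F': "continuous_on UNIV F'"
  shows "poly_perturbation [:F 0:] (\<lambda>z \<delta>. F (of_real (c * \<delta>) * z))"
proof -
  define E where "E = (\<lambda>z. if z = 0 then F' 0 else (F z - F 0) / z)"
  have cF: "isCont F z" for z using F DERIV_isCont by blast
  have cE: "isCont E z" for z
  proof (cases "z = 0")
    case True
    have "(\<lambda>h. (F (0 + h) - F 0) / h) \<midarrow>0\<rightarrow> F' 0" using F[of 0] by (simp add: DERIV_def)
    then have "(E \<longlongrightarrow> F' 0) (at 0)"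
      by (rule Lim_transform_eventually) (auto simp: E_def eventually_at_filter)
    then show ?thesis using True by (simp add: isCont_def E_def)
  next
    case False
    have "isCont (\<lambda>z. (F z - F 0) / z) z" using False by (intro continuous_intros cF)
    moreover have "\<forall>\<^sub>F w in nhds z. E w = (F w - F 0) / w"
      using t1_space_nhds[OF False] by (rule eventually_mono) (simp add: E_def)
    ultimately show ?thesis using isCont_cong by force
  qed
  have E: "F z = F 0 + z * E z" for z by (simp add: E_def)
  show ?thesis unfolding poly_perturbation_def
  proof (rule exI[of _ "\<lambda>z \<delta>. F' (of_real (c * \<delta>) * z) * of_real (c * \<delta>)"],
      rule exI[of _ "\<lambda>z \<delta>. of_real c * z * E (of_real (c * \<delta>) * z)"], intro conjI allI)
    show "((\<lambda>z. F (of_real (c * \<delta>) * z)) has_field_derivative F' (of_real (c * \<delta>) * z) * of_real (c * \<delta>)) (at z)" for z \<delta>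
      by (rule DERIV_chain'[OF _ F]) (auto intro!: derivative_eq_intros)
    show "continuous_on UNIV (\<lambda>x. F' (of_real (c * snd x) * fst x) * complex_of_real (c * snd x))"
      by (intro continuous_on_mult continuous_on_compose2[OF F']) (auto intro!: continuous_intros)
    have "continuous_on UNIV E" using cE by (simp add: continuous_at_imp_continuous_on)
    then have "continuous_on UNIV (\<lambda>x. E (complex_of_real (c * snd x) * fst x))"
      by (rule continuous_on_compose2) (auto intro!: continuous_intros)
    then show "continuous_on UNIV (\<lambda>x. of_real c * fst x * E (of_real (c * snd x) * fst x))"
      by (intro continuous_on_mult) (auto intro!: continuous_intros)
    show "F (of_real (c * \<delta>) * z) = poly [:F 0:] z + of_real \<delta> * (of_real c * z * E (of_real (c * \<delta>) * z))" for z \<delta>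
      using E[of "of_real (c * \<delta>) * z"] by simp
  qed
qed

lemma poly_perturbation_cc_ss:
  "poly_perturbation 1 (\<lambda>z \<delta>. cc (of_real (c * \<delta>) * z) t)"
  "poly_perturbation [:of_real t:] (\<lambda>z \<delta>. ss (of_real (c * \<delta>) * z) t)"
  "poly_perturbation [:- 1 / 6:] (\<lambda>z \<delta>. S1 (of_real (c * \<delta>) * z * of_real t ^ 2))"
proof -
  have e: "of_real (c * t ^ 2 * \<delta>) * z = of_real (c * \<delta>) * z * complex_of_real t ^ 2" for z \<delta> by simp
  have 1: "continuous_on UNIV (\<lambda>z. - Sz z / 2)" by (auto intro!: continuous_intros continuous_on_S)
  show "poly_perturbation 1 (\<lambda>z \<delta>. cc (of_real (c * \<delta>) * z) t)"
    using poly_perturbation_entire[OF Cz_derivative 1, of "c * t ^ 2"] unfolding e by (simp add: cc_def S_at_0 one_pCons)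
  show "poly_perturbation [:of_real t:] (\<lambda>z \<delta>. ss (of_real (c * \<delta>) * z) t)"
    using poly_perturbation_cmult[OF poly_perturbation_entire[OF Sz_derivative continuous_on_S(2), of "c * t ^ 2"], of "of_real t"]
    unfolding e by (simp add: ss_def S_at_0)
  show "poly_perturbation [:- 1 / 6:] (\<lambda>z \<delta>. S1 (of_real (c * \<delta>) * z * of_real t ^ 2))"
    using poly_perturbation_entire[OF S1_derivative continuous_on_S(4), of "c * t ^ 2"] unfolding e by (simp add: S_at_0)
qed

text \<open>At wavenumber 0 the radial solutions are 1 and 1 / r, which gives the diagonal 1 and 1 /
  a - 1 / b; the limit of \<open>tau\<close> is the integral of r^2 from a to b.\<close>

lemma poly_perturbation_transfer:
  assumes b: "b \<noteq> 0"
  shows "poly_perturbation 1 (\<lambda>z \<delta>. t11 a b (of_real (c * \<delta>) * z))"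
    and "poly_perturbation [:of_real ((b - a) / (a * b)):] (\<lambda>z \<delta>. t12 a b (of_real (c * \<delta>) * z))"
    and "poly_perturbation [:of_real ((b ^ 3 - a ^ 3) / 3):] (\<lambda>z \<delta>. tau a b (of_real (c * \<delta>) * z))"
    and "a \<noteq> 0 \<Longrightarrow> poly_perturbation 1 (\<lambda>z \<delta>. t22 a b (of_real (c * \<delta>) * z))"
proof -
  note n = poly_perturbation_cc_ss[where t = "b - a" and c = c]
  have "poly_perturbation [:1 / of_real b * (of_real a + of_real (b - a)):] (\<lambda>z \<delta>. 1 / of_real b * (of_real a * cc (of_real (c * \<delta>) * z) (b - a) + ss (of_real (c * \<delta>) * z) (b - a)))"
    using poly_perturbation_cmult[OF poly_perturbation_add[OF poly_perturbation_cmult[OF n(1), of "of_real a"] n(2)], of "1 / of_real b"] by (simp add: one_pCons)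
  then show "poly_perturbation 1 (\<lambda>z \<delta>. t11 a b (of_real (c * \<delta>) * z))"
    using b by (simp add: t11_def one_pCons)
  show "poly_perturbation [:of_real ((b - a) / (a * b)):] (\<lambda>z \<delta>. t12 a b (of_real (c * \<delta>) * z))"
    using poly_perturbation_cmult[OF n(2), of "1 / of_real (a * b)"] by (simp add: t12_def)
  have e: "- 2 * of_real (b - a) ^ 3 * (- 1 / 6) + of_real a * of_real b * of_real (b - a) = (of_real ((b ^ 3 - a ^ 3) / 3) :: complex)"
    by (simp add: field_simps power3_eq_cube)
  show "poly_perturbation [:of_real ((b ^ 3 - a ^ 3) / 3):] (\<lambda>z \<delta>. tau a b (of_real (c * \<delta>) * z))"
    using poly_perturbation_add[OF poly_perturbation_cmult[OF n(3), of "- 2 * of_real (b - a) ^ 3"]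
       poly_perturbation_cmult[OF n(2), of "of_real a * of_real b"]] unfolding e[symmetric] by (simp add: tau_def mult.assoc)
  assume "a \<noteq> 0"
  have "poly_perturbation [:1 / of_real a * (of_real b - of_real (b - a)):] (\<lambda>z \<delta>. 1 / of_real a * (of_real b * cc (of_real (c * \<delta>) * z) (b - a) + (- 1) * ss (of_real (c * \<delta>) * z) (b - a)))"
    using poly_perturbation_cmult[OF poly_perturbation_add[OF poly_perturbation_cmult[OF n(1), of "of_real b"] poly_perturbation_cmult[OF n(2), of "- 1"]], of "1 / of_real a"] by (simp add: one_pCons)
  then show "poly_perturbation 1 (\<lambda>z \<delta>. t22 a b (of_real (c * \<delta>) * z))"
    using \<open>a \<noteq> 0\<close> by (simp add: t22_def one_pCons)
qed

text \<open>A nonzero polynomial of degree at most n has at most n roots, so n known ones are all of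
  them.\<close>

lemma real_poly_roots_exhausted:
  fixes p :: "complex poly"
  assumes "degree p \<le> n" "p \<noteq> 0" "finite S" "card S = n" "\<And>z. z \<in> S \<Longrightarrow> poly p z = 0" "poly p x = 0"
  shows "x \<in> S"
proof -
  have "S \<subseteq> {z. poly p z = 0}" using assms by auto
  moreover have "card {z. poly p z = 0} \<le> card S" using card_poly_roots_bound[OF assms(2)] assms(1,4) by simp
  ultimately have "S = {z. poly p z = 0}" using poly_roots_finite[OF assms(2)] by (simp add: card_seteq)
  then show ?thesis using assms(6) by blast
qed

context nested_shells
begin

text \<open>The volume of the shell divided by 4 pi; it arises as the limit of
  \<open>tau\<close>.\<close>

definition shell_weight :: "nat \<Rightarrow> real" where
  "shell_weight i = (rp (N - i) ^ 3 - rm (N - i) ^ 3) / 3"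

text \<open>At the centre, \<open>layer_start 0 = 0\<close> and the division by zero gives the correct value \<open>0\<close>:
  the flux vanishes there.\<close>
definition gap_weight :: "nat \<Rightarrow> real" where
  "gap_weight i = (rm (N - i) - layer_start i) / (layer_start i * rm (N - i))"

text \<open>The recursion for \<open>yst\<close> at \<delta> = 0, as polynomials in \<lambda>:
  across a host layer the flux is constant and the value changes by \<open>gap_weight\<close> times
  the flux, across a shell the value is constant and the flux drops by \<lambda>
  \<open>shell_weight\<close> times the value.\<close>

primrec limit_polys :: "nat \<Rightarrow> complex poly \<times> complex poly" where
  "limit_polys 0 = (1, 0)"
| "limit_polys (Suc i) = (let u = fst (limit_polys i) + Polynomial.smult (of_real (gap_weight i)) (snd (limit_polys i))
     in (u, snd (limit_polys i) - Polynomial.smult (of_real (shell_weight i)) (pCons 0 u)))"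

lemma limit_polys_1: "gap_weight 0 = 0" "fst (limit_polys 1) = 1"
  by (simp_all add: gap_weight_def layer_start_def Let_def)

lemma poly_perturbation_end_state:
  assumes i: "i < N" and y: "poly_perturbation p (\<lambda>z \<delta>. fst (y z \<delta>))" "poly_perturbation q (\<lambda>z \<delta>. snd (y z \<delta>))"
  shows "poly_perturbation p (\<lambda>z \<delta>. fst (end_state z \<delta> i (y z \<delta>)))"
    and "poly_perturbation (q - Polynomial.smult (of_real (shell_weight i)) (pCons 0 p)) (\<lambda>z \<delta>. snd (end_state z \<delta> i (y z \<delta>)))"
proof -
  let ?a = "rm (N - i)" and ?b = "rp (N - i)"
  have ab: "?a \<noteq> 0" "?b \<noteq> 0" using radii[OF layer_shell_index[OF i]] by auto
  note t = poly_perturbation_transfer[OF ab(2), where a = ?a and c = 1, simplified]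
  have "poly_perturbation (1 * p + 0 * [:of_real ((?b - ?a) / (?a * ?b)):] * q)
      (\<lambda>z \<delta>. t11 ?a ?b (of_real \<delta> * z) * fst (y z \<delta>) + of_real \<delta> * t12 ?a ?b (of_real \<delta> * z) * snd (y z \<delta>))"
    using t(2) by (intro poly_perturbation_add poly_perturbation_mult t(1) y poly_perturbation_delta) simp
  then show "poly_perturbation p (\<lambda>z \<delta>. fst (end_state z \<delta> i (y z \<delta>)))"
    by (simp add: end_state_def Let_def)
  have "poly_perturbation ((Polynomial.smult (- 1) [:0, 1:]) * [:of_real (shell_weight i):] * p + 1 * q)
      (\<lambda>z \<delta>. (- 1 * z) * tau ?a ?b (of_real \<delta> * z) * fst (y z \<delta>) + t22 ?a ?b (of_real \<delta> * z) * snd (y z \<delta>))"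
    using t(3) by (intro poly_perturbation_add poly_perturbation_mult t(4)[OF ab(1)] y poly_perturbation_cmult[OF poly_perturbation_var])
      (simp_all add: shell_weight_def)
  moreover have "(Polynomial.smult (- 1) [:0, 1:]) * [:of_real (shell_weight i):] * p + 1 * q = q - Polynomial.smult (of_real (shell_weight i)) (pCons 0 p)"
    by simp
  ultimately have "poly_perturbation (q - Polynomial.smult (of_real (shell_weight i)) (pCons 0 p))
      (\<lambda>z \<delta>. (- 1 * z) * tau ?a ?b (of_real \<delta> * z) * fst (y z \<delta>) + t22 ?a ?b (of_real \<delta> * z) * snd (y z \<delta>))"
    by (simp only:)
  then show "poly_perturbation (q - Polynomial.smult (of_real (shell_weight i)) (pCons 0 p)) (\<lambda>z \<delta>. snd (end_state z \<delta> i (y z \<delta>)))"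
    by (simp add: end_state_def Let_def)
qed

text \<open>In the host layers the lower left matrix entry carries a factor \<delta> and disappears
  in the limit; in the shells the scaling of the flux has removed it from that entry and moved it to
  \<open>t12\<close>.\<close>

lemma poly_perturbation_yst:
  "i \<le> N \<Longrightarrow> poly_perturbation (fst (limit_polys i)) (\<lambda>z \<delta>. fst (yst s0 i z \<delta>)) \<and>
    poly_perturbation (snd (limit_polys i)) (\<lambda>z \<delta>. snd (yst s0 i z \<delta>))"
proof (induction i)
  case (Suc i)
  then have i: "i < N" and y: "poly_perturbation (fst (limit_polys i)) (\<lambda>z \<delta>. fst (yst s0 i z \<delta>))"
    "poly_perturbation (snd (limit_polys i)) (\<lambda>z \<delta>. snd (yst s0 i z \<delta>))" by auto
  let ?a = "layer_start i" and ?b = "rm (N - i)"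
  have b: "?b \<noteq> 0" using radii(1)[OF layer_shell_index[OF i]] by auto
  note t = poly_perturbation_transfer[OF b, where a = ?a and c = s0]
  have "poly_perturbation (1 * fst (limit_polys i) + [:of_real ((?b - ?a) / (?a * ?b)):] * snd (limit_polys i))
      (\<lambda>z \<delta>. t11 ?a ?b (of_real (s0 * \<delta>) * z) * fst (yst s0 i z \<delta>) + t12 ?a ?b (of_real (s0 * \<delta>) * z) * snd (yst s0 i z \<delta>))"
    by (intro poly_perturbation_add poly_perturbation_mult t(1,2) y)
  then have m1: "poly_perturbation (fst (limit_polys i) + Polynomial.smult (of_real (gap_weight i)) (snd (limit_polys i)))
      (\<lambda>z \<delta>. fst (mid_state s0 z \<delta> i (yst s0 i z \<delta>)))"
    by (simp add: mid_state_def Let_def gap_weight_def)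
  have q: "poly_perturbation 0 (\<lambda>z \<delta>. - (of_real (s0 * \<delta>) * z) * tau ?a ?b (of_real (s0 * \<delta>) * z) * fst (yst s0 i z \<delta>))"
  proof -
    have "poly_perturbation (Polynomial.smult (- of_real s0) 0 * [:0, 1:] * [:of_real ((?b ^ 3 - ?a ^ 3) / 3):] * fst (limit_polys i))
        (\<lambda>z \<delta>. (- of_real s0 * of_real \<delta>) * z * tau ?a ?b (of_real (s0 * \<delta>) * z) * fst (yst s0 i z \<delta>))"
      by (intro poly_perturbation_mult poly_perturbation_cmult poly_perturbation_delta poly_perturbation_var t(3) y)
    then show ?thesis by simp
  qed
  have "poly_perturbation (snd (limit_polys i)) (\<lambda>z \<delta>. t22 ?a ?b (of_real (s0 * \<delta>) * z) * snd (yst s0 i z \<delta>))"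
  \<comment> \<open>In the innermost layer \<open>t22\<close> divides by the starting radius 0, but
    it only multiplies the initial flux 0.\<close>
  proof (cases "i = 0")
    case False
    then have "?a \<noteq> 0" using layer_start_lt(3)[OF i] by simp
    from poly_perturbation_mult[OF t(4)[OF this] y(2)] show ?thesis by simp
  qed simp
  from poly_perturbation_add[OF q this] have m2: "poly_perturbation (snd (limit_polys i))
      (\<lambda>z \<delta>. snd (mid_state s0 z \<delta> i (yst s0 i z \<delta>)))"
    by (simp add: mid_state_def Let_def)
  from poly_perturbation_end_state[OF i m1 m2] show ?case by (simp add: Let_def)
qed simp

lemma limit_polys_degree:
  "degree (fst (limit_polys i)) \<le> i - 1 \<and> degree (snd (limit_polys i)) \<le> i"
proof (induction i)
  case (Suc i)
  define u where "u = fst (limit_polys i) + Polynomial.smult (of_real (gap_weight i)) (snd (limit_polys i))"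
  have u: "degree u \<le> i"
    unfolding u_def using Suc degree_smult_le[of "of_real (gap_weight i)" "snd (limit_polys i)"] by (intro degree_add_le) linarith+
  have "degree (Polynomial.smult (of_real (shell_weight i)) (pCons 0 u)) \<le> Suc i"
    using u degree_pCons_le[of 0 u] degree_smult_le[of "of_real (shell_weight i)" "pCons 0 u"] by linarith
  then have "degree (snd (limit_polys i) - Polynomial.smult (of_real (shell_weight i)) (pCons 0 u)) \<le> Suc i"
    using Suc by (intro degree_diff_le) auto
  then show ?case using u by (simp add: Let_def u_def)
qed simp

text \<open>A discrete Wronskian identity.\<close>
lemma limit_polys_wronskian:
  "poly (fst (limit_polys i)) z * poly (pderiv (snd (limit_polys i))) z - poly (pderiv (fst (limit_polys i))) z * poly (snd (limit_polys i)) z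
     = - (\<Sum>j<i. of_real (shell_weight j) * poly (fst (limit_polys (Suc j))) z ^ 2)"
proof (induction i)
  case (Suc i)
  define u where "u = fst (limit_polys i) + Polynomial.smult (of_real (gap_weight i)) (snd (limit_polys i))"
  have s: "fst (limit_polys (Suc i)) = u" "snd (limit_polys (Suc i)) = snd (limit_polys i) - Polynomial.smult (of_real (shell_weight i)) (pCons 0 u)"
    by (simp_all add: Let_def u_def)
  \<comment> \<open>A host step adds a constant multiple of the flux to the value and so leaves the
    Wronskian unchanged; only the shell step contributes.\<close>
  have "poly u z * poly (pderiv (snd (limit_polys i))) z - poly (pderiv u) z * poly (snd (limit_polys i)) z =
    poly (fst (limit_polys i)) z * poly (pderiv (snd (limit_polys i))) z - poly (pderiv (fst (limit_polys i))) z * poly (snd (limit_polys i)) z"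
    by (simp add: u_def pderiv_add pderiv_smult algebra_simps)
  then show ?case unfolding sum.lessThan_Suc minus_add_distrib Suc.IH[symmetric] s
    by (simp add: pderiv_diff pderiv_smult pderiv_pCons algebra_simps power2_eq_square)
qed simp

text \<open>The limit of \<open>char_fun\<close> as \<delta> and \<omega> tend to 0 with \<lambda>
  fixed. Its roots turn out to be the generalized eigenvalues of the capacitance problem.\<close>

definition char_poly0 :: "complex poly" where
  "char_poly0 = snd (limit_polys N) + Polynomial.smult (of_real (rp 1)) (fst (limit_polys N))"

text \<open>At a root the flux is - \<open>rp 1\<close> times the value, and this turns the
  Wronskian into the derivative times the value.\<close>

lemma char_poly0_derivative:
  assumes "poly char_poly0 z = 0"
  shows "poly (pderiv char_poly0) z * poly (fst (limit_polys N)) z = - (\<Sum>j<N. of_real (shell_weight j) * poly (fst (limit_polys (Suc j))) z ^ 2)"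
proof -
  have "poly (snd (limit_polys N)) z = - of_real (rp 1) * poly (fst (limit_polys N)) z"
    using assms by (simp add: char_poly0_def eq_neg_iff_add_eq_0)
  then show ?thesis unfolding limit_polys_wronskian[symmetric]
    by (simp add: char_poly0_def pderiv_add pderiv_smult algebra_simps)
qed

lemma char_poly0_degree: "degree char_poly0 \<le> N"
proof -
  have "degree (Polynomial.smult (of_real (rp 1)) (fst (limit_polys N))) \<le> N"
    using limit_polys_degree[of N] degree_smult_le[of "of_real (rp 1)" "fst (limit_polys N)"] by linarith
  then show ?thesis unfolding char_poly0_def using limit_polys_degree[of N] by (intro degree_add_le) auto
qed

end

section \<open>Continuation of simple roots with a second-order error\<close>

lemma poly_taylor2:
  fixes P :: "complex poly"
  obtains R where "\<And>h. poly P (z + h) = poly P z + h * poly (pderiv P) z + h ^ 2 * poly R h"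
proof -
  obtain b p where 1: "P \<circ>\<^sub>p [:z, 1:] = pCons b p" by (cases "P \<circ>\<^sub>p [:z, 1:]")
  obtain c R where 2: "p = pCons c R" by (cases p)
  have e: "poly P (z + h) = b + h * (c + h * poly R h)" for h
    using arg_cong[OF 1, of "\<lambda>p. poly p h"] by (simp add: poly_pcompose 2 mult.commute)
  have b: "b = poly P z" using e[of 0] by simp
  have "poly (pderiv (P \<circ>\<^sub>p [:z, 1:])) 0 = c" unfolding 1 2 by (simp add: pderiv_pCons)
  then have c: "c = poly (pderiv P) z" by (simp add: pderiv_pcompose poly_pcompose pderiv_pCons)
  show ?thesis
    by (rule that[of R]) (unfold e b[symmetric] c[symmetric], simp add: algebra_simps power2_eq_square)
qed

text \<open>\<nu> is the first-order correction of the root: it is chosen so that the terms linear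
  in e cancel in the Taylor expansions of P and Q.\<close>

lemma poly_second_order_cancel:
  fixes P Q :: "complex poly"
  assumes root: "poly P \<mu> = 0" and d: "poly (pderiv P) \<mu> \<noteq> 0" and \<nu>: "\<nu> = - poly Q \<mu> / poly (pderiv P) \<mu>"
  obtains R where "\<And>e. poly P (\<mu> + e * \<nu>) + e * poly Q (\<mu> + e * \<nu>) = e ^ 2 * R e" "continuous_on UNIV R"
proof -
  obtain R where R: "\<And>h. poly P (\<mu> + h) = poly P \<mu> + h * poly (pderiv P) \<mu> + h ^ 2 * poly R h"
    using poly_taylor2 by blast
  obtain S where S: "\<And>h. poly Q (\<mu> + h) = poly Q \<mu> + h * poly (pderiv Q) \<mu> + h ^ 2 * poly S h"
    using poly_taylor2 by blast
  have n: "\<nu> * poly (pderiv P) \<mu> = - poly Q \<mu>" using d by (simp add: \<nu>)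
  show ?thesis
  proof (rule that[of "\<lambda>e. \<nu> ^ 2 * poly R (e * \<nu>) + \<nu> * poly (pderiv Q) \<mu> + e * \<nu> ^ 2 * poly S (e * \<nu>)"])
    fix e
    have "poly P (\<mu> + e * \<nu>) + e * poly Q (\<mu> + e * \<nu>) = e * (\<nu> * poly (pderiv P) \<mu> + poly Q \<mu>)
        + e ^ 2 * (\<nu> ^ 2 * poly R (e * \<nu>) + \<nu> * poly (pderiv Q) \<mu> + e * \<nu> ^ 2 * poly S (e * \<nu>))"
      unfolding R S root by (simp add: algebra_simps power2_eq_square)
    then show "poly P (\<mu> + e * \<nu>) + e * poly Q (\<mu> + e * \<nu>) =
        e ^ 2 * (\<nu> ^ 2 * poly R (e * \<nu>) + \<nu> * poly (pderiv Q) \<mu> + e * \<nu> ^ 2 * poly S (e * \<nu>))" unfolding n by simp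
  qed (intro continuous_intros)
qed

text \<open>An implicit function theorem down to the boundary value e = 0. The simplified Newton map
  z - G(z, e) / d, with the fixed slope d = P'(\<mu>), is a contraction on a small disc. This yields
  existence and uniqueness of the root, and the bound |x - y| <= (2 / |d|) |G(x, e) - G(y, e)|
  yields its continuity and the error estimate. The statement holds for all small radii, so that
  finitely many roots can later share one.\<close>

lemma simple_root_branch:
  fixes G G' D :: "complex \<Rightarrow> real \<Rightarrow> complex"
  assumes dG: "\<And>z e. ((\<lambda>z. G z e) has_field_derivative G' z e) (at z)"
    and cG': "continuous_on UNIV (\<lambda>x. G' (fst x) (snd x))" and cD: "continuous_on UNIV (\<lambda>x. D (fst x) (snd x))"
    and rep: "\<And>z e. G z e = poly P z + of_real e * poly Q z + of_real e ^ 2 * D z e"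
    and root: "poly P \<mu> = 0" and d: "poly (pderiv P) \<mu> \<noteq> 0"
  shows "\<forall>\<^sub>F r in at_right 0. \<exists>\<eta>>0. \<exists>m K. continuous_on {0..\<eta>} m \<and>
    (\<forall>e\<in>{0..\<eta>}. m e \<in> ball \<mu> r \<and> G (m e) e = 0 \<and> (\<forall>z\<in>cball \<mu> r. G z e = 0 \<longrightarrow> z = m e) \<and>
       norm (m e - (\<mu> + of_real e * (- poly Q \<mu> / poly (pderiv P) \<mu>))) \<le> K * e ^ 2)"
proof -
  define d where "d = poly (pderiv P) \<mu>"
  define \<nu> where "\<nu> = - poly Q \<mu> / d"
  have d0: "d \<noteq> 0" using assms(6) by (simp add: d_def)
  then have nd: "0 < norm d" by simp
  have cG: "continuous_on UNIV (\<lambda>x. G (fst x) (snd x))"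
    unfolding rep by (intro continuous_intros cD)
  have cGz: "continuous_on UNIV (\<lambda>e. G z e)" for z
    using continuous_on_compose2[OF cG, of UNIV "\<lambda>e. (z, e)"] by (simp add: continuous_on_Pair)
  have "G' \<mu> 0 = d"
  proof (rule DERIV_unique[OF dG])
    show "((\<lambda>z. G z 0) has_field_derivative d) (at \<mu>)" unfolding rep d_def by (simp add: poly_DERIV)
  qed
  then obtain \<rho> where \<rho>: "0 < \<rho>" and r1: "\<And>z e. dist (z, e) (\<mu>, 0) < \<rho> \<Longrightarrow> norm (G' z e - d) < norm d / 2"
    using cG'[unfolded continuous_on_iff, rule_format, of "(\<mu>, 0)" "norm d / 2"] nd by (auto simp: dist_norm)
  have "\<exists>\<eta>>0. \<exists>m K. continuous_on {0..\<eta>} m \<and>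
    (\<forall>e\<in>{0..\<eta>}. m e \<in> ball \<mu> r \<and> G (m e) e = 0 \<and> (\<forall>z\<in>cball \<mu> r. G z e = 0 \<longrightarrow> z = m e) \<and>
       norm (m e - (\<mu> + of_real e * \<nu>)) \<le> K * e ^ 2)" if r: "0 < r" "r < \<rho> / 2" for r
  proof -
    have "G \<mu> 0 = 0" unfolding rep using root by simp
    then obtain \<eta>' where \<eta>': "0 < \<eta>'" "\<And>e. dist e 0 < \<eta>' \<Longrightarrow> norm (G \<mu> e) < norm d * r / 2"
      using cGz[of \<mu>, unfolded continuous_on_iff, rule_format, of 0 "norm d * r / 2"] nd r by (auto simp: dist_norm)
    \<comment> \<open>The three bounds keep (z, e) in the region where the derivative is close to d,
      make G(\<mu>, e) so small that the Newton map sends the disc into itself, and keep the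
      approximation \<mu> + e \<nu> inside the disc.\<close>
    define \<eta> where "\<eta> = Min {\<rho> / 2, \<eta>' / 2, r / (norm \<nu> + 1)}"
    have \<eta>: "0 < \<eta>" "\<eta> \<le> \<rho> / 2" "\<eta> < \<eta>'" "\<eta> \<le> r / (norm \<nu> + 1)"
    proof -
      show "0 < \<eta>" using \<rho> \<eta>'(1) r by (simp add: \<eta>_def add_nonneg_pos)
      have "\<eta> \<le> \<eta>' / 2" unfolding \<eta>_def by (rule Min_le) auto
      then show "\<eta> < \<eta>'" using \<eta>'(1) by simp
      show "\<eta> \<le> \<rho> / 2" "\<eta> \<le> r / (norm \<nu> + 1)" unfolding \<eta>_def by (rule Min_le; simp)+
    qed
    have Tlip: "norm ((x - G x e / d) - (y - G y e / d)) \<le> 1 / 2 * norm (x - y)"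
      if e: "e \<in> {0..\<eta>}" and xy: "x \<in> cball \<mu> r" "y \<in> cball \<mu> r" for e x y
    proof (rule field_differentiable_bound[OF convex_cball[of \<mu> r] _ _ xy])
      fix z assume z: "z \<in> cball \<mu> r"
      have "dist (z, e) (\<mu>, 0) \<le> dist z \<mu> + dist e 0" by (rule dist_Pair_Pair[THEN eq_refl, THEN order_trans]) (rule sqrt_sum_squares_le_sum; simp)
      also have "\<dots> < \<rho>" using z e r \<eta>(2) by (auto simp: dist_commute)
      finally have "norm (G' z e - d) < norm d / 2" by (rule r1)
      then have "norm (- (G' z e - d) / d) \<le> 1 / 2" using nd by (simp add: norm_divide divide_simps norm_minus_commute)
      then show "norm (1 - G' z e / d) \<le> 1 / 2" using d0 by (simp add: diff_divide_distrib)
      show "((\<lambda>z. z - G z e / d) has_field_derivative 1 - G' z e / d) (at z within cball \<mu> r)"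
        by (intro derivative_intros DERIV_cdivide has_field_derivative_at_within[OF dG])
    qed
    \<comment> \<open>Inverting the contraction estimate: distances between points are controlled by
      the difference of their residuals, and the distance to the root by the residual alone.\<close>
    have lip: "norm (x - y) \<le> 2 / norm d * norm (G x e - G y e)"
      if e: "e \<in> {0..\<eta>}" and xy: "x \<in> cball \<mu> r" "y \<in> cball \<mu> r" for e x y
    proof -
      have "norm (x - y) \<le> norm ((x - G x e / d) - (y - G y e / d)) + norm ((G x e - G y e) / d)"
        by (rule order_trans[OF _ norm_triangle_ineq]) (simp add: diff_divide_distrib)
      then have "norm (x - y) \<le> 2 * norm ((G x e - G y e) / d)" using Tlip[OF that] by linarith
      then show ?thesis by (simp add: norm_divide)
    qed
    have Gs: "norm (G \<mu> e) < norm d * r / 2" if "e \<in> {0..\<eta>}" for e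
      using \<eta>'(2)[of e] that \<eta>(3) by simp
    have ex: "\<exists>z. z \<in> cball \<mu> r \<and> G z e = 0" if e: "e \<in> {0..\<eta>}" for e
    proof -
      have "\<exists>!x. x \<in> cball \<mu> r \<and> x - G x e / d = x"
      proof (rule Banach_fix[of _ "1/2"])
        show "(\<lambda>x. x - G x e / d) ` cball \<mu> r \<subseteq> cball \<mu> r"
        proof clarify
          fix x assume x: "x \<in> cball \<mu> r"
          have m: "\<mu> \<in> cball \<mu> r" using r by simp
          have "norm (G \<mu> e / d) \<le> r / 2" using Gs[OF e] nd by (simp add: norm_divide divide_simps mult.commute)
          moreover have "norm ((x - G x e / d) - \<mu>) \<le> norm ((x - G x e / d) - (\<mu> - G \<mu> e / d)) + norm (G \<mu> e / d)"
            using norm_triangle_ineq4[of "(x - G x e / d) - (\<mu> - G \<mu> e / d)" "G \<mu> e / d"] by (simp only: diff_diff_eq diff_add_cancel) (simp add: algebra_simps)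
          ultimately have "norm ((x - G x e / d) - \<mu>) \<le> r"
            using Tlip[OF e x m] x by (simp add: dist_norm norm_minus_commute)
          then show "x - G x e / d \<in> cball \<mu> r" by (simp add: dist_norm norm_minus_commute)
        qed
        show "dist (x - G x e / d) (y - G y e / d) \<le> 1 / 2 * dist x y" if "x \<in> cball \<mu> r" "y \<in> cball \<mu> r" for x y
          using Tlip[OF e that] by (simp add: dist_norm)
      qed (use r in \<open>auto simp: compact_imp_complete\<close>)
      then show ?thesis using d0 by auto
    qed
    define m where "m = (\<lambda>e. SOME z. z \<in> cball \<mu> r \<and> G z e = 0)"
    have m: "m e \<in> cball \<mu> r" "G (m e) e = 0" if "e \<in> {0..\<eta>}" for e
      using someI_ex[OF ex[OF that]] by (auto simp: m_def)
    have mb: "m e \<in> ball \<mu> r" if e: "e \<in> {0..\<eta>}" for e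
    proof -
      have "norm (m e - \<mu>) \<le> 2 / norm d * norm (G \<mu> e)" using lip[OF e m(1)[OF e], of \<mu>] m(2)[OF e] r by simp
      also have "\<dots> < r" using Gs[OF e] nd by (simp add: divide_simps mult.commute)
      finally show ?thesis by (simp add: dist_norm norm_minus_commute)
    qed
    have uniq: "z = m e" if e: "e \<in> {0..\<eta>}" and z: "z \<in> cball \<mu> r" "G z e = 0" for e z
      using lip[OF e z(1) m(1)[OF e]] m(2)[OF e] z(2) by simp
    have cont: "continuous_on {0..\<eta>} m"
      unfolding continuous_on
    proof
      fix e0 assume e0: "e0 \<in> {0..\<eta>}"
      have "((\<lambda>e. G (m e0) e) \<longlongrightarrow> G (m e0) e0) (at e0 within {0..\<eta>})"
        using continuous_on_subset[OF cGz[of "m e0"], of "{0..\<eta>}"] e0 unfolding continuous_on by blast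
      then have "((\<lambda>e. 2 / norm d * norm (G (m e0) e)) \<longlongrightarrow> 2 / norm d * norm (G (m e0) e0)) (at e0 within {0..\<eta>})"
        by (intro tendsto_intros)
      then have "((\<lambda>e. 2 / norm d * norm (G (m e0) e)) \<longlongrightarrow> 0) (at e0 within {0..\<eta>})" using m(2)[OF e0] by simp
      moreover have "\<forall>\<^sub>F e in at e0 within {0..\<eta>}. norm (m e - m e0) \<le> 2 / norm d * norm (G (m e0) e)"
        unfolding eventually_at_filter
        by (intro always_eventually allI impI) (use lip[OF _ m(1) m(1)[OF e0]] m(2) in force)
      ultimately have "((\<lambda>e. m e - m e0) \<longlongrightarrow> 0) (at e0 within {0..\<eta>})" by (rule Lim_null_comparison[rotated])
      then show "(m \<longlongrightarrow> m e0) (at e0 within {0..\<eta>})" by (rule LIM_zero_cancel)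
    qed
    \<comment> \<open>At \<mu> + e \<nu> the residual is of order e^2, and \<open>lip\<close>
      converts this into the distance from the true root.\<close>
    obtain R where R: "\<And>e. poly P (\<mu> + e * \<nu>) + e * poly Q (\<mu> + e * \<nu>) = e ^ 2 * R e" and cR: "continuous_on UNIV R"
      using poly_second_order_cancel[OF root assms(6), of \<nu> Q] by (auto simp: \<nu>_def d_def)
    define E where "E = (\<lambda>e. R (of_real e) + D (\<mu> + of_real e * \<nu>) e)"
    have GE: "G (\<mu> + of_real e * \<nu>) e = of_real e ^ 2 * E e" for e
      unfolding rep R by (simp add: E_def distrib_left)
    have "continuous_on {0..\<eta>} (\<lambda>e. (\<mu> + of_real e * \<nu>, e))" by (intro continuous_intros)
    then have "continuous_on {0..\<eta>} E" unfolding E_def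
      using continuous_on_compose2[OF cD, of "{0..\<eta>}" "\<lambda>e. (\<mu> + of_real e * \<nu>, e)"]
      by (intro continuous_on_add continuous_on_compose2[OF cR]) (auto intro!: continuous_intros)
    then have "bounded (E ` {0..\<eta>})" by (intro compact_imp_bounded compact_continuous_image) auto
    then obtain K where K: "\<And>e. e \<in> {0..\<eta>} \<Longrightarrow> norm (E e) \<le> K" unfolding bounded_iff by blast
    have bd: "norm (m e - (\<mu> + of_real e * \<nu>)) \<le> 2 / norm d * K * e ^ 2" if e: "e \<in> {0..\<eta>}" for e
    proof -
      have "e * norm \<nu> \<le> \<eta> * (norm \<nu> + 1)" using e by (intro mult_mono) auto
      also have "\<dots> \<le> r" using \<eta>(4) by (simp add: divide_simps add_nonneg_pos)
      finally have "\<mu> + of_real e * \<nu> \<in> cball \<mu> r" using e by (simp add: dist_norm norm_mult)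
      from lip[OF e m(1)[OF e] this] m(2)[OF e]
      have "norm (m e - (\<mu> + of_real e * \<nu>)) \<le> 2 / norm d * (e ^ 2 * norm (E e))" by (simp add: GE norm_mult norm_power)
      also have "\<dots> \<le> 2 / norm d * (e ^ 2 * K)" using K[OF e] by (intro mult_left_mono) auto
      finally show ?thesis by (simp add: mult_ac)
    qed
    show ?thesis using \<eta>(1) cont mb m(2) uniq bd
      by (intro exI[of _ \<eta>] conjI exI[of _ m] exI[of _ "2 / norm d * K"]) blast+
  qed
  then show ?thesis unfolding \<nu>_def d_def eventually_at_right_field
    using \<rho> by (intro exI[of _ "\<rho> / 2"]) auto
qed

section \<open>Eigenvectors of the capacitance matrix\<close>

context nested_shells
begin

lemma measure_shell:
  assumes "i < N" shows "measure lborel (shell rp rm (N - i)) = 4 * pi * shell_weight i"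
proof -
  have r: "0 < rm (N - i)" "rm (N - i) < rp (N - i)" using radii[OF layer_shell_index[OF assms]] by auto
  have "shell rp rm (N - i) = ball 0 (rp (N - i)) - cball 0 (rm (N - i))" by (auto simp: shell_def)
  moreover have "measure lborel (ball 0 (rp (N - i)) - cball 0 (rm (N - i)) :: (real^3) set) =
      measure lborel (ball 0 (rp (N - i)) :: (real^3) set) - measure lborel (cball 0 (rm (N - i)) :: (real^3) set)"
    using r by (intro measure_Diff less_imp_neq[OF emeasure_lborel_ball_finite]) auto
  ultimately show ?thesis using r
    by (simp add: content_ball content_cball shell_weight_def unit_ball_vol_numeral field_simps power3_eq_cube)
qed

lemma shell_weight_pos: "i < N \<Longrightarrow> 0 < shell_weight i"
  using radii[OF layer_shell_index[of i]] power_strict_mono[of "rm (N - i)" "rp (N - i)" 3] by (simp add: shell_weight_def)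

text \<open>The tridiagonal row in divergence form, as a balance of the fluxes towards the two
  neighbouring shells. For r = 0 the term c_0 a_0 couples the outermost shell to infinity.\<close>

lemma capacitance_row:
  assumes a: "a \<in> carrier_vec N" and r: "r < N" and cN: "c N = 0" and c: "c = capacitance_coeff N rp rm"
  shows "vec_index (capacitance_matrix N rp rm *\<^sub>v a) r = (if Suc r < N then c (Suc r) * (vec_index a r - vec_index a (Suc r)) else 0)
    + c r * (vec_index a r - (if r = 0 then 0 else vec_index a (r - 1)))"
proof -
  have "vec_index (capacitance_matrix N rp rm *\<^sub>v a) r =
    (\<Sum>s\<in>{0..<N}. (- c s * (if Suc r = s then 1 else 0) + (c s + c (Suc s)) * (if r = s then 1 else 0) - c (Suc s) * (if r = Suc s then 1 else 0)) * vec_index a s)"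
    using a r by (simp add: capacitance_matrix_def Let_def scalar_prod_def c[symmetric])
  also have "\<dots> = (\<Sum>s\<in>{0..<N}. if s = Suc r then - c s * vec_index a s else 0) + (\<Sum>s\<in>{0..<N}. if s = r then (c s + c (Suc s)) * vec_index a s else 0)
      + (\<Sum>s\<in>{0..<N}. if s = r - 1 then (if r = 0 then 0 else - c (Suc s) * vec_index a s) else 0)"
    unfolding sum.distrib[symmetric] by (rule sum.cong) (auto simp: algebra_simps)
  also have "\<dots> = (if Suc r < N then - c (Suc r) * vec_index a (Suc r) else 0) + (c r + c (Suc r)) * vec_index a r
     + (if r = 0 then 0 else - c r * vec_index a (r - 1))"
    using r by (cases r) simp_all
  also have "\<dots> = (if Suc r < N then c (Suc r) * (vec_index a r - vec_index a (Suc r)) else 0)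
    + c r * (vec_index a r - (if r = 0 then 0 else vec_index a (r - 1)))"
  proof (cases "Suc r < N")
    case False
    then have "Suc r = N" using r by simp
    then show ?thesis using cN by (simp add: algebra_simps)
  qed (simp add: algebra_simps)
  finally show ?thesis .
qed

lemma volume_row:
  assumes a: "a \<in> carrier_vec N" and r: "r < N"
  shows "vec_index (volume_matrix N rp rm *\<^sub>v a) r = measure lborel (shell rp rm (Suc r)) * vec_index a r"
proof -
  have "vec_index (volume_matrix N rp rm *\<^sub>v a) r =
    (\<Sum>s\<in>{0..<N}. if s = r then measure lborel (shell rp rm (Suc s)) * vec_index a s else 0)"
    using a r by (simp add: volume_matrix_def scalar_prod_def if_distrib[of "\<lambda>t. t * _"] cong: if_cong)
  then show ?thesis using r by simp
qed

text \<open>An eigenvector solves the three-term recursion of the limit polynomials, read from the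
  innermost shell outwards.\<close>
lemma eigenvector_limit_polys:
  assumes a: "a \<in> carrier_vec N" and ev: "capacitance_matrix N rp rm *\<^sub>v a = l \<cdot>\<^sub>v (volume_matrix N rp rm *\<^sub>v a)"
  defines "\<alpha> \<equiv> complex_of_real (vec_index a (N - 1))"
  shows "\<And>i. i < N \<Longrightarrow> complex_of_real (vec_index a (N - 1 - i)) = \<alpha> * poly (fst (limit_polys (Suc i))) (of_real l)"
    and "\<alpha> * poly char_poly0 (of_real l) = 0"
proof -
  define c where "c = capacitance_coeff N rp rm"
  define b where "b = (\<lambda>i. vec_index a (N - 1 - i))"
  \<comment> \<open>\<open>b i\<close> is the component for the shell N - i, so the order is now
    from the inside outwards. \<open>F i\<close> is the flux through the host layer between the
    shells N - i + 1 and N - i; no flux enters from the centre, in accordance with c_N = 0.\<close>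
  define F where "F = (\<lambda>i. if i = 0 then 0 else c (N - i) * (b i - b (i - 1)))"
  have cN: "c N = 0" using N by (simp add: c_def capacitance_coeff_def)
  have row: "F i + c (N - 1 - i) * (b i - (if Suc i = N then 0 else b (Suc i))) = l * (4 * pi * shell_weight i) * b i" if i: "i < N" for i
  proof -
    have r: "N - 1 - i < N" "Suc (N - 1 - i) = N - i" using i by auto
    have "vec_index (capacitance_matrix N rp rm *\<^sub>v a) (N - 1 - i) = l * vec_index (volume_matrix N rp rm *\<^sub>v a) (N - 1 - i)"
      unfolding ev using r(1) by (subst index_smult_vec) (auto simp: volume_matrix_def)
    moreover have "(if Suc (N - 1 - i) < N then c (Suc (N - 1 - i)) * (vec_index a (N - 1 - i) - vec_index a (Suc (N - 1 - i))) else 0) = F i"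
    proof (cases "i = 0")
      case False
      then have "Suc (N - 1 - i) < N" "N - 1 - (i - 1) = Suc (N - 1 - i)" using i by auto
      then show ?thesis using False r(2) by (simp add: F_def b_def)
    qed (use i in \<open>simp add: F_def\<close>)
    moreover have "(if N - 1 - i = 0 then 0 else vec_index a (N - 1 - i - 1)) = (if Suc i = N then 0 else b (Suc i))"
      using i by (auto simp: b_def)
    ultimately show ?thesis
      using capacitance_row[OF a r(1) cN c_def] volume_row[OF a r(1)] measure_shell[OF i] r(2) by (simp add: b_def)
  qed
  have claim: "complex_of_real (b i) = \<alpha> * poly (fst (limit_polys (Suc i))) (of_real l) \<and>
      complex_of_real (F i) = of_real (4 * pi) * \<alpha> * poly (snd (limit_polys i)) (of_real l)" if "i < N" for i
    using that
  proof (induction i)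
    case 0
    then show ?case using limit_polys_1(2) by (simp add: b_def F_def \<alpha>_def)
  next
    case (Suc i)
    then have i: "i < N" "Suc i < N" and IH: "complex_of_real (b i) = \<alpha> * poly (fst (limit_polys (Suc i))) (of_real l)"
      "complex_of_real (F i) = of_real (4 * pi) * \<alpha> * poly (snd (limit_polys i)) (of_real l)" by auto
    have "F (Suc i) = F i - l * (4 * pi * shell_weight i) * b i"
      using row[OF i(1)] i by (simp add: F_def algebra_simps)
    then have "complex_of_real (F (Suc i)) = of_real (F i) - of_real l * (of_real (4 * pi) * of_real (shell_weight i)) * of_real (b i)" by simp
    also have "\<dots> = of_real (4 * pi) * \<alpha> * poly (snd (limit_polys (Suc i))) (of_real l)"
      unfolding IH by (simp add: Let_def algebra_simps)
    finally have 1: "complex_of_real (F (Suc i)) = of_real (4 * pi) * \<alpha> * poly (snd (limit_polys (Suc i))) (of_real l)" .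
    have ls: "0 < layer_start (Suc i)" "layer_start (Suc i) < rm (N - Suc i)" using layer_start_lt[OF i(2)] by auto
    have g: "0 < gap_weight (Suc i)" using ls by (simp add: gap_weight_def)
    have "c (N - Suc i) = 4 * pi * (rm (N - Suc i) * rp (N - i) / (rm (N - Suc i) - rp (N - i)))"
      using i by (simp add: c_def capacitance_coeff_def Suc_diff_Suc)
    \<comment> \<open>The capacitance coefficient is 4 pi divided by 1 / a - 1 / b, and the gap
      weight is 1 / a - 1 / b. This is what identifies the matrix recursion with the limit of the
      transfer matrices.\<close>
    then have "c (N - Suc i) * gap_weight (Suc i) = 4 * pi"
      using ls i by (simp add: gap_weight_def layer_start_Suc)
    moreover have "gap_weight (Suc i) * F (Suc i) = (c (N - Suc i) * gap_weight (Suc i)) * (b (Suc i) - b i)" by (simp add: F_def)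
    ultimately have "gap_weight (Suc i) * F (Suc i) = 4 * pi * (b (Suc i) - b i)" by simp
    then have "b (Suc i) = b i + gap_weight (Suc i) * F (Suc i) / (4 * pi)" by simp
    then have "complex_of_real (b (Suc i)) = of_real (b i) + of_real (gap_weight (Suc i)) * of_real (F (Suc i)) / of_real (4 * pi)" by simp
    also have "\<dots> = \<alpha> * poly (fst (limit_polys (Suc (Suc i)))) (of_real l)"
    proof -
      have "fst (limit_polys (Suc (Suc i))) = fst (limit_polys (Suc i)) + Polynomial.smult (of_real (gap_weight (Suc i))) (snd (limit_polys (Suc i)))"
        by (simp only: limit_polys.simps(2)[of "Suc i"] Let_def fst_conv)
      then show ?thesis unfolding 1 IH by (simp del: limit_polys.simps add: algebra_simps)
    qed
    finally show ?case using 1 by simp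
  qed
  then show "\<And>i. i < N \<Longrightarrow> complex_of_real (vec_index a (N - 1 - i)) = \<alpha> * poly (fst (limit_polys (Suc i))) (of_real l)"
    by (simp add: b_def)
  \<comment> \<open>The row of the outermost shell closes the recursion: with c_0 = 4 pi
    \<open>rp 1\<close> it becomes the equation flux plus \<open>rp 1\<close> times value equals 0,
    that is, \<open>char_poly0\<close> vanishes.\<close>
  define n where "n = N - 1"
  have n: "n < N" "Suc n = N" "N - 1 - n = 0" using N by (auto simp: n_def)
  have "of_real (F n) + of_real (c 0) * of_real (b n) = of_real l * (of_real (4 * pi) * of_real (shell_weight n)) * complex_of_real (b n)"
    using arg_cong[OF row[OF n(1)], of complex_of_real] n by simp
  moreover have "c 0 = 4 * pi * rp 1" by (simp add: c_def capacitance_coeff_def)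
  ultimately have "complex_of_real (4 * pi) * \<alpha> * (poly (snd (limit_polys n)) (of_real l) - of_real l * of_real (shell_weight n) * poly (fst (limit_polys (Suc n))) (of_real l)
      + of_real (rp 1) * poly (fst (limit_polys (Suc n))) (of_real l)) = 0"
    using claim[OF n(1)] by (simp del: limit_polys.simps add: algebra_simps)
  moreover have "poly (snd (limit_polys (Suc n))) (of_real l) = poly (snd (limit_polys n)) (of_real l) - of_real l * of_real (shell_weight n) * poly (fst (limit_polys (Suc n))) (of_real l)"
    by (simp add: Let_def)
  ultimately show "\<alpha> * poly char_poly0 (of_real l) = 0"
    using n(2) by (simp add: char_poly0_def del: limit_polys.simps)
qed

text \<open>The normalization says that 4 pi \<alpha>^2 times the weighted sum of squares in
  \<open>char_poly0_derivative\<close> is 1. That sum is minus the product of the derivative and the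
  value U at the outermost shell, so neither of them vanishes; and the first component of the
  eigenvector is \<alpha> U, which gives the quotient.\<close>

lemma eigenpair_char_poly0:
  assumes a: "a \<in> carrier_vec N" and ev: "capacitance_matrix N rp rm *\<^sub>v a = l \<cdot>\<^sub>v (volume_matrix N rp rm *\<^sub>v a)"
    and nrm: "a \<bullet> (volume_matrix N rp rm *\<^sub>v a) = 1"
  shows "poly char_poly0 (of_real l) = 0" "poly (pderiv char_poly0) (of_real l) \<noteq> 0"
    and "poly (fst (limit_polys N)) (of_real l) / poly (pderiv char_poly0) (of_real l) = - of_real (4 * pi * (vec_index a 0)\<^sup>2)"
proof -
  define \<alpha> where "\<alpha> = complex_of_real (vec_index a (N - 1))"
  define x where "x = (\<lambda>i. poly (fst (limit_polys (Suc i))) (complex_of_real l))"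
  have e: "complex_of_real (vec_index a (N - 1 - i)) = \<alpha> * x i" if "i < N" for i
    using eigenvector_limit_polys(1)[OF a ev that] by (simp add: \<alpha>_def x_def)
  have "1 = (\<Sum>r\<in>{0..<N}. vec_index a r * (measure lborel (shell rp rm (Suc r)) * vec_index a r))"
  proof -
    have "dim_vec (volume_matrix N rp rm *\<^sub>v a) = N" by (simp add: volume_matrix_def)
    then show ?thesis unfolding nrm[symmetric] scalar_prod_def by (intro sum.cong) (auto simp only: volume_row[OF a] atLeastLessThan_iff)
  qed
  also have "\<dots> = (\<Sum>i<N. vec_index a (N - 1 - i) * (4 * pi * shell_weight i * vec_index a (N - 1 - i)))"
    unfolding atLeast0LessThan
  \<comment> \<open>The eigenvector is indexed from the outside inwards, the recursion from the
    inside outwards.\<close>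
  proof (subst sum.nat_diff_reindex[symmetric], rule sum.cong, simp)
    fix i assume "i \<in> {..<N}"
    then have "i < N" "Suc (N - Suc i) = N - i" by auto
    then show "vec_index a (N - Suc i) * (measure lborel (shell rp rm (Suc (N - Suc i))) * vec_index a (N - Suc i)) =
        vec_index a (N - 1 - i) * (4 * pi * shell_weight i * vec_index a (N - 1 - i))"
      using measure_shell[of i] by simp
  qed
  finally have "complex_of_real 1 = (\<Sum>i<N. complex_of_real (vec_index a (N - 1 - i)) * (of_real (4 * pi * shell_weight i) * complex_of_real (vec_index a (N - 1 - i))))"
    unfolding of_real_mult[symmetric] of_real_sum[symmetric] by (rule arg_cong)
  also have "\<dots> = of_real (4 * pi) * \<alpha> ^ 2 * (\<Sum>i<N. of_real (shell_weight i) * x i ^ 2)"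
    unfolding sum_distrib_left by (rule sum.cong) (auto simp: e[simplified] power2_eq_square)
  finally have one: "of_real (4 * pi) * \<alpha> ^ 2 * (\<Sum>i<N. of_real (shell_weight i) * x i ^ 2) = 1" by simp
  then have \<alpha>0: "\<alpha> \<noteq> 0" and S0: "(\<Sum>i<N. of_real (shell_weight i) * x i ^ 2) \<noteq> 0" by auto
  show root: "poly char_poly0 (of_real l) = 0"
    using eigenvector_limit_polys(2)[OF a ev] \<alpha>0 by (simp add: \<alpha>_def)
  note dd = char_poly0_derivative[OF root, folded x_def]
  define dp where "dp = poly (pderiv char_poly0) (complex_of_real l)"
  define U where "U = poly (fst (limit_polys N)) (complex_of_real l)"
  have dU: "dp * U = - (\<Sum>i<N. of_real (shell_weight i) * x i ^ 2)" using dd by (simp only: dp_def U_def x_def)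
  then have nz: "dp \<noteq> 0" "U \<noteq> 0" using S0 by auto
  show "poly (pderiv char_poly0) (of_real l) \<noteq> 0" using nz by (simp add: dp_def)
  have "complex_of_real (vec_index a 0) = \<alpha> * U"
    using e[of "N - 1"] N by (simp add: x_def U_def del: limit_polys.simps)
  then have "of_real (4 * pi * (vec_index a 0)\<^sup>2) = of_real (4 * pi) * \<alpha> ^ 2 * U ^ 2" by (simp add: power_mult_distrib)
  moreover have "of_real (4 * pi) * \<alpha> ^ 2 * (dp * U) = - 1" using one unfolding dU by simp
  ultimately have "of_real (4 * pi * (vec_index a 0)\<^sup>2) * dp = - U"
    by (simp add: power2_eq_square) (metis (no_types, opaque_lifting) mult.assoc mult.commute mult_minus1)
  then have "U = - of_real (4 * pi * (vec_index a 0)\<^sup>2) * dp" by simp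
  then show "poly (fst (limit_polys N)) (of_real l) / poly (pderiv char_poly0) (of_real l) = - of_real (4 * pi * (vec_index a 0)\<^sup>2)"
    using nz(1) unfolding U_def[symmetric] dp_def[symmetric] by (simp add: divide_eq_eq)
qed

end

section \<open>Excluding large roots\<close>

lemma poly_perturbation_tendsto:
  assumes p: "poly_perturbation p (\<lambda>z \<delta>. f (of_real (1 * \<delta>) * z))" and q: "(q \<longlongrightarrow> 0) F"
  shows "((\<lambda>n. f (q n)) \<longlongrightarrow> poly p 0) F"
proof -
  obtain f' D where f: "\<And>z \<delta>. ((\<lambda>z. f (of_real (1 * \<delta>) * z)) has_field_derivative f' z \<delta>) (at z)"
    and e: "\<And>z \<delta>. f (of_real (1 * \<delta>) * z) = poly p z + of_real \<delta> * D z \<delta>"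
    using p unfolding poly_perturbation_def by blast
  have "isCont f 0" using DERIV_isCont[OF f[of 1 0]] by simp
  moreover have "f 0 = poly p 0" using e[of 0 0] by simp
  ultimately show ?thesis using isCont_tendsto_compose[OF _ q] by metis
qed

lemma transfer_tendsto:
  assumes b: "b \<noteq> 0" and q: "(q \<longlongrightarrow> 0) F"
  shows "((\<lambda>n. t11 a b (q n)) \<longlongrightarrow> 1) F" "((\<lambda>n. t12 a b (q n)) \<longlongrightarrow> of_real ((b - a) / (a * b))) F"
    "((\<lambda>n. tau a b (q n)) \<longlongrightarrow> of_real ((b ^ 3 - a ^ 3) / 3)) F" "a \<noteq> 0 \<Longrightarrow> ((\<lambda>n. t22 a b (q n)) \<longlongrightarrow> 1) F"
  using poly_perturbation_transfer(1-3)[OF b, THEN poly_perturbation_tendsto, OF q]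
    poly_perturbation_tendsto[OF poly_perturbation_transfer(4)[OF b] q] by simp_all

context nested_shells
begin

text \<open>A state in which the flux dominates the value, as opposed to \<open>moderate\<close>,
  where the flux is at most comparable to it. For large \<lambda>, shells produce the former and
  host layers the latter.\<close>

definition steep :: "'b filter \<Rightarrow> ('b \<Rightarrow> complex \<times> complex) \<Rightarrow> bool" where
  "steep F y \<longleftrightarrow> (\<forall>\<^sub>F n in F. snd (y n) \<noteq> 0) \<and> ((\<lambda>n. fst (y n) / snd (y n)) \<longlongrightarrow> 0) F"

definition moderate :: "'b filter \<Rightarrow> ('b \<Rightarrow> complex \<times> complex) \<Rightarrow> bool" where
  "moderate F y \<longleftrightarrow> (\<forall>\<^sub>F n in F. fst (y n) \<noteq> 0) \<and> (\<exists>g. ((\<lambda>n. snd (y n) / fst (y n)) \<longlongrightarrow> g) F)"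

text \<open>The shell adds - \<lambda> \<open>shell_weight\<close> times the value to the flux. For
  large \<lambda> this outgrows the incoming flux, while the value hardly changes because \<delta>
  \<lambda> tends to 0.\<close>

lemma steep_end_state:
  assumes z: "filterlim z at_infinity F" and \<delta>: "(\<delta> \<longlongrightarrow> 0) F" and dz: "((\<lambda>n. of_real (\<delta> n) * z n) \<longlongrightarrow> 0) F"
    and i: "i < N" and y: "moderate F y"
  shows "steep F (\<lambda>n. end_state (z n) (\<delta> n) i (y n))"
proof -
  let ?a = "rm (N - i)" and ?b = "rp (N - i)"
  let ?q = "\<lambda>n. of_real (\<delta> n) * z n"
  have ab: "?a \<noteq> 0" "?b \<noteq> 0" using radii[OF layer_shell_index[OF i]] by auto
  note t = transfer_tendsto[OF ab(2) dz, of ?a]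
  obtain g where u: "\<forall>\<^sub>F n in F. fst (y n) \<noteq> 0" and g: "((\<lambda>n. snd (y n) / fst (y n)) \<longlongrightarrow> g) F"
    using y unfolding moderate_def by blast
  have z0: "\<forall>\<^sub>F n in F. z n \<noteq> 0" by (rule filterlim_at_infinity_imp_eventually_ne[OF z])
  define A where "A = (\<lambda>n. fst (end_state (z n) (\<delta> n) i (y n)) / fst (y n))"
  define B where "B = (\<lambda>n. snd (end_state (z n) (\<delta> n) i (y n)) / (z n * fst (y n)))"
  have "((\<lambda>n. t11 ?a ?b (?q n) + of_real (\<delta> n) * t12 ?a ?b (?q n) * (snd (y n) / fst (y n))) \<longlongrightarrow> 1 + of_real 0 * of_real ((?b - ?a) / (?a * ?b)) * g) F"
    by (intro tendsto_intros t(1,2) g \<delta>)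
  then have "((\<lambda>n. t11 ?a ?b (?q n) + of_real (\<delta> n) * t12 ?a ?b (?q n) * (snd (y n) / fst (y n))) \<longlongrightarrow> 1) F" by simp
  then have A: "(A \<longlongrightarrow> 1) F"
    by (rule Lim_transform_eventually) (use u in \<open>eventually_elim; simp add: A_def end_state_def Let_def field_simps\<close>)
  have "((\<lambda>n. - tau ?a ?b (?q n) + t22 ?a ?b (?q n) * (snd (y n) / fst (y n)) / z n) \<longlongrightarrow> - of_real (shell_weight i) + 0) F"
    using t(3) by (intro tendsto_add tendsto_minus tendsto_divide_0[OF tendsto_mult[OF t(4)[OF ab(1)] g] z]) (simp add: shell_weight_def)
  then have "((\<lambda>n. - tau ?a ?b (?q n) + t22 ?a ?b (?q n) * (snd (y n) / fst (y n)) / z n) \<longlongrightarrow> - of_real (shell_weight i)) F" by simp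
  then have B: "(B \<longlongrightarrow> - of_real (shell_weight i)) F"
    by (rule Lim_transform_eventually) (use u z0 in \<open>eventually_elim; simp add: B_def end_state_def Let_def field_simps\<close>)
  have w: "- complex_of_real (shell_weight i) \<noteq> 0" using shell_weight_pos[OF i] by simp
  have "\<forall>\<^sub>F n in F. B n \<noteq> 0" by (rule tendsto_imp_eventually_ne[OF B w])
  then have 1: "\<forall>\<^sub>F n in F. snd (end_state (z n) (\<delta> n) i (y n)) \<noteq> 0" by eventually_elim (auto simp: B_def)
  have "((\<lambda>n. A n / B n / z n) \<longlongrightarrow> 0) F" by (rule tendsto_divide_0[OF tendsto_divide[OF A B w] z])
  then have "((\<lambda>n. fst (end_state (z n) (\<delta> n) i (y n)) / snd (end_state (z n) (\<delta> n) i (y n))) \<longlongrightarrow> 0) F"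
    by (rule Lim_transform_eventually) (use u z0 in \<open>eventually_elim; simp add: A_def B_def\<close>)
  with 1 show ?thesis unfolding steep_def by blast
qed

text \<open>Across the host layer the dominating flux creates a value close to
  \<open>gap_weight\<close> times the flux, and the gap weight is nonzero except at the
  centre.\<close>

lemma moderate_mid_state:
  assumes q: "((\<lambda>n. of_real (s0 * \<delta> n) * z n) \<longlongrightarrow> 0) F" and i: "0 < i" "i < N" and y: "steep F y"
  shows "moderate F (\<lambda>n. mid_state s0 (z n) (\<delta> n) i (y n))"
proof -
  let ?a = "layer_start i" and ?b = "rm (N - i)"
  let ?q = "\<lambda>n. of_real (s0 * \<delta> n) * z n"
  have ab: "0 < ?a" "?a < ?b" using layer_start_lt[OF i(2)] i(1) by auto
  then have b0: "?b \<noteq> 0" and a0: "?a \<noteq> 0" by auto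
  note t = transfer_tendsto[OF b0 q, of ?a]
  have u: "\<forall>\<^sub>F n in F. snd (y n) \<noteq> 0" and g: "((\<lambda>n. fst (y n) / snd (y n)) \<longlongrightarrow> 0) F"
    using y unfolding steep_def by blast+
  define A where "A = (\<lambda>n. fst (mid_state s0 (z n) (\<delta> n) i (y n)) / snd (y n))"
  define B where "B = (\<lambda>n. snd (mid_state s0 (z n) (\<delta> n) i (y n)) / snd (y n))"
  have "((\<lambda>n. t11 ?a ?b (?q n) * (fst (y n) / snd (y n)) + t12 ?a ?b (?q n)) \<longlongrightarrow> 1 * 0 + of_real (gap_weight i)) F"
    unfolding gap_weight_def by (intro tendsto_add tendsto_mult t(1,2) g)
  then have "((\<lambda>n. t11 ?a ?b (?q n) * (fst (y n) / snd (y n)) + t12 ?a ?b (?q n)) \<longlongrightarrow> of_real (gap_weight i)) F" by simp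
  then have A: "(A \<longlongrightarrow> of_real (gap_weight i)) F"
    by (rule Lim_transform_eventually) (use u in \<open>eventually_elim; simp add: A_def mid_state_def Let_def field_simps\<close>)
  have "((\<lambda>n. - ?q n * tau ?a ?b (?q n) * (fst (y n) / snd (y n)) + t22 ?a ?b (?q n)) \<longlongrightarrow> - 0 * of_real ((?b ^ 3 - ?a ^ 3) / 3) * 0 + 1) F"
    by (intro tendsto_add tendsto_mult tendsto_minus q t(3) t(4)[OF a0] g)
  then have "((\<lambda>n. - ?q n * tau ?a ?b (?q n) * (fst (y n) / snd (y n)) + t22 ?a ?b (?q n)) \<longlongrightarrow> 1) F" by simp
  then have B: "(B \<longlongrightarrow> 1) F"
    by (rule Lim_transform_eventually) (use u in \<open>eventually_elim; simp add: B_def mid_state_def Let_def field_simps\<close>)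
  have w: "complex_of_real (gap_weight i) \<noteq> 0" using ab by (simp add: gap_weight_def)
  have "\<forall>\<^sub>F n in F. A n \<noteq> 0" by (rule tendsto_imp_eventually_ne[OF A w])
  then have 1: "\<forall>\<^sub>F n in F. fst (mid_state s0 (z n) (\<delta> n) i (y n)) \<noteq> 0" by eventually_elim (auto simp: A_def)
  have "((\<lambda>n. B n / A n) \<longlongrightarrow> 1 / of_real (gap_weight i)) F" by (rule tendsto_divide[OF B A w])
  then have "((\<lambda>n. snd (mid_state s0 (z n) (\<delta> n) i (y n)) / fst (mid_state s0 (z n) (\<delta> n) i (y n))) \<longlongrightarrow> 1 / of_real (gap_weight i)) F"
    by (rule Lim_transform_eventually) (use u in \<open>eventually_elim; simp add: A_def B_def\<close>)
  with 1 show ?thesis unfolding moderate_def by blast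
qed

text \<open>The innermost layer is different, since it starts without flux; there the value stays
  near 1 and the flux is of order \<delta> \<lambda>.\<close>

lemma moderate_mid_state_0:
  assumes q: "((\<lambda>n. of_real (s0 * \<delta> n) * z n) \<longlongrightarrow> 0) F"
  shows "moderate F (\<lambda>n. mid_state s0 (z n) (\<delta> n) 0 (1, 0))"
proof -
  let ?q = "\<lambda>n. of_real (s0 * \<delta> n) * z n"
  have b: "rm N \<noteq> 0" using radii(1)[of N] N by auto
  note t = transfer_tendsto[OF b q, of 0]
  have "\<forall>\<^sub>F n in F. t11 0 (rm N) (?q n) \<noteq> 0" by (rule tendsto_imp_eventually_ne[OF t(1)]) simp
  moreover have "((\<lambda>n. - ?q n * tau 0 (rm N) (?q n) / t11 0 (rm N) (?q n)) \<longlongrightarrow> - 0 * of_real ((rm N ^ 3 - 0 ^ 3) / 3) / 1) F"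
    by (intro tendsto_divide tendsto_mult tendsto_minus q t(1,3)) simp
  ultimately show ?thesis unfolding moderate_def by (auto simp: mid_state_def Let_def layer_start_def)
qed

lemma steep_yst:
  assumes z: "filterlim z at_infinity F" and \<delta>: "(\<delta> \<longlongrightarrow> 0) F" and dz: "((\<lambda>n. of_real (\<delta> n) * z n) \<longlongrightarrow> 0) F"
  shows "i < N \<Longrightarrow> steep F (\<lambda>n. yst s0 (Suc i) (z n) (\<delta> n))"
proof (induction i)
  have "((\<lambda>n. of_real s0 * (of_real (\<delta> n) * z n)) \<longlongrightarrow> of_real s0 * 0) F" by (intro tendsto_intros dz)
  then have q: "((\<lambda>n. of_real (s0 * \<delta> n) * z n) \<longlongrightarrow> 0) F" by (simp add: mult.assoc)
  {
    case 0
    show ?case using steep_end_state[OF z \<delta> dz 0 moderate_mid_state_0[OF q]] by simp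
  next
    case (Suc i)
    then have "steep F (\<lambda>n. yst s0 (Suc i) (z n) (\<delta> n))" by simp
    from steep_end_state[OF z \<delta> dz Suc(2) moderate_mid_state[OF q zero_less_Suc Suc(2) this]]
    show ?case by (simp only: yst.simps)
  }
qed

text \<open>The final state comes out of a shell and is therefore steep; divided by its flux, the
  characteristic function tends to 1.\<close>

lemma char_fun_nonzero_at_infinity:
  assumes z: "filterlim z at_infinity F" and \<delta>: "(\<delta> \<longlongrightarrow> 0) F" and dz: "((\<lambda>n. of_real (\<delta> n) * z n) \<longlongrightarrow> 0) F"
    and \<omega>: "(\<omega> \<longlongrightarrow> 0) F"
  shows "\<forall>\<^sub>F n in F. char_fun v s0 (z n) (\<delta> n) (\<omega> n) \<noteq> 0"
proof -
  let ?y = "\<lambda>n. yst s0 N (z n) (\<delta> n)"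
  have "steep F ?y" using steep_yst[OF z \<delta> dz, of "N - 1"] N by simp
  then have u: "\<forall>\<^sub>F n in F. snd (?y n) \<noteq> 0" and g: "((\<lambda>n. fst (?y n) / snd (?y n)) \<longlongrightarrow> 0) F"
    unfolding steep_def by blast+
  have "((\<lambda>n. 1 + of_real (rp 1) * (fst (?y n) / snd (?y n)) - \<i> * (\<omega> n * (1 / of_real v)) * of_real (rp 1) ^ 2 * (fst (?y n) / snd (?y n)))
     \<longlongrightarrow> 1 + of_real (rp 1) * 0 - \<i> * (0 * (1 / of_real v)) * of_real (rp 1) ^ 2 * 0) F"
    by (intro tendsto_intros g \<omega>)
  then have "\<forall>\<^sub>F n in F. 1 + of_real (rp 1) * (fst (?y n) / snd (?y n)) - \<i> * (\<omega> n * (1 / of_real v)) * of_real (rp 1) ^ 2 * (fst (?y n) / snd (?y n)) \<noteq> 0"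
    by (rule tendsto_imp_eventually_ne) simp
  with u show ?thesis
  proof eventually_elim
    case (elim n)
    have "char_fun v s0 (z n) (\<delta> n) (\<omega> n) = snd (?y n) * (1 + of_real (rp 1) * (fst (?y n) / snd (?y n)) - \<i> * (\<omega> n * (1 / of_real v)) * of_real (rp 1) ^ 2 * (fst (?y n) / snd (?y n)))"
      using elim(1) by (simp add: char_fun_def algebra_simps)
    then show ?case using elim by simp
  qed
qed

section \<open>The scaled characteristic equation\<close>

text \<open>The characteristic equation in the scaled unknowns \<open>\<mu> = \<omega> / sqrt \<delta>\<close> and \<open>e = sqrt \<delta>\<close>,
  in which it is regular down to \<open>e = 0\<close>.\<close>
definition scaled_char :: "real \<Rightarrow> real \<Rightarrow> complex \<Rightarrow> real \<Rightarrow> complex" where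
  "scaled_char v vr \<mu> e = char_fun v (vr\<^sup>2 / v\<^sup>2) (\<mu>\<^sup>2 / of_real (vr\<^sup>2)) (e\<^sup>2) (of_real e * \<mu>)"

definition scaled_poly :: "real \<Rightarrow> complex poly" where
  "scaled_poly vr = char_poly0 \<circ>\<^sub>p [:0, 0, 1 / of_real (vr\<^sup>2):]"

text \<open>The coefficient of e in \<open>scaled_char\<close>: it is the radiation term - i k
  \<open>rp 1\<close>^2 times the value, in which \<omega> = e \<mu> supplies the factor e.\<close>

definition radiation_poly :: "real \<Rightarrow> real \<Rightarrow> complex poly" where
  "radiation_poly v vr = [:0, - \<i> * of_real (rp 1) ^ 2 / of_real v:] * (fst (limit_polys N) \<circ>\<^sub>p [:0, 0, 1 / of_real (vr\<^sup>2):])"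

lemma scaled_poly_eval:
  "poly (scaled_poly vr) \<mu> = poly char_poly0 (\<mu>\<^sup>2 / of_real (vr\<^sup>2))"
  "poly (pderiv (scaled_poly vr)) \<mu> = poly (pderiv char_poly0) (\<mu>\<^sup>2 / of_real (vr\<^sup>2)) * (2 * \<mu> / of_real (vr\<^sup>2))"
  "poly (radiation_poly v vr) \<mu> = - \<i> * of_real (rp 1) ^ 2 / of_real v * \<mu> * poly (fst (limit_polys N)) (\<mu>\<^sup>2 / of_real (vr\<^sup>2))"
  by (simp_all add: scaled_poly_def radiation_poly_def poly_pcompose pderiv_pcompose pderiv_pCons power2_eq_square mult_ac)

text \<open>Since \<delta> = e^2, the transfer matrices contribute to the orders 0 and 2 and higher;
  the only term linear in e comes from radiation. Hence the second term of the resonance expansion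
  is purely radiative.\<close>

lemma scaled_char_structure:
  obtains G' D where "\<And>\<mu> e. ((\<lambda>\<mu>. scaled_char v vr \<mu> e) has_field_derivative G' \<mu> e) (at \<mu>)"
    "continuous_on UNIV (\<lambda>x. G' (fst x) (snd x))" "continuous_on UNIV (\<lambda>x. D (fst x) (snd x))"
    "\<And>\<mu> e. scaled_char v vr \<mu> e = poly (scaled_poly vr) \<mu> + of_real e * poly (radiation_poly v vr) \<mu> + of_real e ^ 2 * D \<mu> e"
proof -
  define s0 where "s0 = vr\<^sup>2 / v\<^sup>2"
  define c where "c = - \<i> * of_real (rp 1) ^ 2 / complex_of_real v"
  define A where "A = (\<lambda>z \<delta>. snd (yst s0 N z \<delta>) + of_real (rp 1) * fst (yst s0 N z \<delta>))"
  define B where "B = (\<lambda>z \<delta>. fst (yst s0 N z \<delta>))"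
  note y = poly_perturbation_yst[of N s0, simplified]
  have "poly_perturbation char_poly0 A" unfolding A_def char_poly0_def
    using y by (intro poly_perturbation_add poly_perturbation_cmult) auto
  then obtain A' DA where A: "\<And>z \<delta>. ((\<lambda>z. A z \<delta>) has_field_derivative A' z \<delta>) (at z)"
      "continuous_on UNIV (\<lambda>x. A' (fst x) (snd x))" "continuous_on UNIV (\<lambda>x. DA (fst x) (snd x))"
      "\<And>z \<delta>. A z \<delta> = poly char_poly0 z + of_real \<delta> * DA z \<delta>"
    unfolding poly_perturbation_def by blast
  have Bp: "poly_perturbation (fst (limit_polys N)) B" using y by (simp add: B_def)
  note Bc = poly_perturbation_continuous[OF Bp]
  obtain B' DB where B: "\<And>z \<delta>. ((\<lambda>z. B z \<delta>) has_field_derivative B' z \<delta>) (at z)"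
      "continuous_on UNIV (\<lambda>x. B' (fst x) (snd x))" "continuous_on UNIV (\<lambda>x. DB (fst x) (snd x))"
      "\<And>z \<delta>. B z \<delta> = poly (fst (limit_polys N)) z + of_real \<delta> * DB z \<delta>"
    using Bp unfolding poly_perturbation_def by blast
  define k where "k = 1 / complex_of_real (vr\<^sup>2)"
  have sc: "scaled_char v vr \<mu> e = A (\<mu>\<^sup>2 * k) (e\<^sup>2) + of_real e * c * (\<mu> * B (\<mu>\<^sup>2 * k) (e\<^sup>2))" for \<mu> e
    by (simp add: scaled_char_def char_fun_def A_def B_def s0_def c_def k_def algebra_simps)
  have comp: "continuous_on UNIV (\<lambda>x::complex \<times> real. h ((fst x)\<^sup>2 * k) ((snd x)\<^sup>2))"
    if "continuous_on UNIV (\<lambda>x. h (fst x) (snd x))" for h :: "complex \<Rightarrow> real \<Rightarrow> complex"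
  proof -
    have "continuous_on UNIV (\<lambda>x::complex \<times> real. ((fst x)\<^sup>2 * k, (snd x)\<^sup>2))" by (intro continuous_intros)
    from continuous_on_compose2[OF that this] show ?thesis by simp
  qed
  show ?thesis
  proof (rule that[of "\<lambda>\<mu> e. A' (\<mu>\<^sup>2 * k) (e\<^sup>2) * (2 * \<mu> * k) + of_real e * c * (B (\<mu>\<^sup>2 * k) (e\<^sup>2) + B' (\<mu>\<^sup>2 * k) (e\<^sup>2) * (2 * \<mu> * k) * \<mu>)"
        "\<lambda>\<mu> e. DA (\<mu>\<^sup>2 * k) (e\<^sup>2) + of_real e * c * (\<mu> * DB (\<mu>\<^sup>2 * k) (e\<^sup>2))"])
    fix \<mu> e
    have s: "((\<lambda>\<mu>. \<mu>\<^sup>2 * k) has_field_derivative 2 * \<mu> * k) (at \<mu>)"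
      by (auto intro!: derivative_eq_intros)
    have "((\<lambda>\<mu>. \<mu> * B (\<mu>\<^sup>2 * k) (e\<^sup>2)) has_field_derivative 1 * B (\<mu>\<^sup>2 * k) (e\<^sup>2) + B' (\<mu>\<^sup>2 * k) (e\<^sup>2) * (2 * \<mu> * k) * \<mu>) (at \<mu>)"
      by (intro DERIV_mult DERIV_ident DERIV_chain'[OF s B(1)])
    from DERIV_add[OF DERIV_chain'[OF s A(1)] DERIV_cmult[OF this]]
    show "((\<lambda>\<mu>. scaled_char v vr \<mu> e) has_field_derivative
        A' (\<mu>\<^sup>2 * k) (e\<^sup>2) * (2 * \<mu> * k) + of_real e * c * (B (\<mu>\<^sup>2 * k) (e\<^sup>2) + B' (\<mu>\<^sup>2 * k) (e\<^sup>2) * (2 * \<mu> * k) * \<mu>)) (at \<mu>)"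
      unfolding sc by simp
    show "scaled_char v vr \<mu> e = poly (scaled_poly vr) \<mu> + of_real e * poly (radiation_poly v vr) \<mu> +
        of_real e ^ 2 * (DA (\<mu>\<^sup>2 * k) (e\<^sup>2) + of_real e * c * (\<mu> * DB (\<mu>\<^sup>2 * k) (e\<^sup>2)))"
      unfolding sc A(4) B(4) scaled_poly_eval c_def[symmetric] by (simp add: k_def algebra_simps)
  qed (intro continuous_intros comp A B Bc)+
qed

lemma scaled_char_continuous: "continuous_on UNIV (\<lambda>x. scaled_char v vr (fst x) (snd x))"
  and scaled_char_0: "scaled_char v vr \<mu> 0 = poly (scaled_poly vr) \<mu>"
proof -
  obtain G' D where "continuous_on UNIV (\<lambda>x. D (fst x) (snd x))" and
    r: "\<And>\<mu> e. scaled_char v vr \<mu> e = poly (scaled_poly vr) \<mu> + of_real e * poly (radiation_poly v vr) \<mu> + of_real e ^ 2 * D \<mu> e"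
    by (rule scaled_char_structure[of v vr]) blast
  then show "continuous_on UNIV (\<lambda>x. scaled_char v vr (fst x) (snd x))" unfolding r by (intro continuous_intros)
  show "scaled_char v vr \<mu> 0 = poly (scaled_poly vr) \<mu>" unfolding r by simp
qed

lemma scaled_char_eigenfrequency:
  assumes "0 < v" "0 < vr" "0 < \<delta>" "\<mu> \<noteq> 0" "scaled_char v vr \<mu> (sqrt \<delta>) = 0"
  shows "eigenfrequency N rp rm v vr \<delta> (of_real (sqrt \<delta>) * \<mu>)"
proof (rule char_eigenfrequency[OF assms(1-3)])
  have "of_real (sqrt \<delta>) ^ 2 = complex_of_real \<delta>" using assms(3) by (simp flip: of_real_power)
  then have "(of_real (sqrt \<delta>) * \<mu>)\<^sup>2 / of_real (\<delta> * vr\<^sup>2) = \<mu>\<^sup>2 / of_real (vr\<^sup>2)" using assms(2,3) by (simp add: power_mult_distrib)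
  then show "char_fun v (vr\<^sup>2 / v\<^sup>2) ((of_real (sqrt \<delta>) * \<mu>)\<^sup>2 / of_real (\<delta> * vr\<^sup>2)) \<delta> (of_real (sqrt \<delta>) * \<mu>) = 0"
    using assms(3,5) by (simp add: scaled_char_def)
qed (use assms in simp)

lemma eigenfrequency_scaled_char:
  assumes "0 < v" "0 < vr" "0 < \<delta>" "eigenfrequency N rp rm v vr \<delta> \<omega>"
    "norm \<omega> * (2 * rp 1) \<le> v / 8" "norm \<omega> * (2 * rp 1) \<le> vr / 8"
  shows "scaled_char v vr (\<omega> / of_real (sqrt \<delta>)) (sqrt \<delta>) = 0"
proof -
  have "of_real (sqrt \<delta>) ^ 2 = complex_of_real \<delta>" using assms(3) by (simp flip: of_real_power)
  then have "(\<omega> / of_real (sqrt \<delta>))\<^sup>2 / of_real (vr\<^sup>2) = \<omega>\<^sup>2 / of_real (\<delta> * vr\<^sup>2)" by (simp add: power_divide)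
  then show ?thesis using eigenfrequency_char[OF assms(4,1,2,3,5,6)] assms(3) by (simp add: scaled_char_def)
qed

text \<open>If the roots tend to infinity, then \<lambda> does too while \<delta> \<lambda> tends to
  0, and \<open>char_fun_nonzero_at_infinity\<close> excludes this. Otherwise infinitely many of
  them are bounded, and a limit point is a root at e = 0 by continuity.\<close>

lemma scaled_roots_accumulate:
  assumes vr: "0 < vr" and e: "e \<longlonglongrightarrow> 0" and eX: "(\<lambda>n. of_real (e n) * X n) \<longlonglongrightarrow> 0" and z: "\<And>n. scaled_char v vr (X n) (e n) = 0"
  obtains s l where "strict_mono (s :: nat \<Rightarrow> nat)" "(X \<circ> s) \<longlonglongrightarrow> l" "poly (scaled_poly vr) l = 0"
proof (cases "filterlim X at_infinity sequentially")
  case True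
  have "filterlim (\<lambda>n. X n ^ 2 / of_real (vr\<^sup>2)) at_infinity sequentially"
  proof (rule filterlim_norm_at_top_imp_at_infinity)
    have "filterlim (\<lambda>n. norm (X n)) at_top sequentially" by (rule filterlim_at_infinity_imp_norm_at_top[OF True])
    then have "filterlim (\<lambda>n. (1 / vr\<^sup>2) * norm (X n) ^ 2) at_top sequentially"
      using vr by (intro filterlim_tendsto_pos_mult_at_top[OF tendsto_const] filterlim_pow_at_top) auto
    then show "filterlim (\<lambda>n. norm (X n ^ 2 / complex_of_real (vr\<^sup>2))) at_top sequentially"
      by (simp add: norm_divide norm_power)
  qed
  moreover have "(\<lambda>n. e n ^ 2) \<longlonglongrightarrow> 0" using tendsto_power[OF e, of 2] by simp
  moreover have "(\<lambda>n. of_real (e n ^ 2) * (X n ^ 2 / complex_of_real (vr\<^sup>2))) \<longlonglongrightarrow> 0"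
  proof -
    have "(\<lambda>n. (of_real (e n) * X n) ^ 2 * (1 / complex_of_real (vr\<^sup>2))) \<longlonglongrightarrow> 0 ^ 2 * (1 / complex_of_real (vr\<^sup>2))"
      by (intro tendsto_mult tendsto_power eX tendsto_const)
    then show ?thesis by (simp add: power_mult_distrib)
  qed
  ultimately have "\<forall>\<^sub>F n in sequentially. scaled_char v vr (X n) (e n) \<noteq> 0"
    unfolding scaled_char_def using eX by (rule char_fun_nonzero_at_infinity)
  then have False using z by simp
  then show ?thesis ..
next
  case False
  then obtain K where "\<exists>\<^sub>F n in sequentially. norm (X n) < K"
    unfolding filterlim_at_infinity[OF order_refl] by (auto simp: frequently_def not_less)
  then have "infinite {n. norm (X n) < K}" unfolding INFM_iff_infinite[symmetric] cofinite_eq_sequentially .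
  from infinite_enumerate[OF this] obtain s1 :: "nat \<Rightarrow> nat" where s1: "strict_mono s1" "\<And>n. norm (X (s1 n)) < K" by blast
  have "bounded (range (X \<circ> s1))" by (rule boundedI[of _ K]) (auto intro: less_imp_le[OF s1(2)])
  from bounded_imp_convergent_subsequence[OF this] obtain l s2 where s2: "strict_mono s2" "((X \<circ> s1) \<circ> s2) \<longlonglongrightarrow> l" by blast
  define s where "s = s1 \<circ> s2"
  have s: "strict_mono s" unfolding s_def by (rule strict_mono_o[OF s1(1) s2(1)])
  have X: "(X \<circ> s) \<longlonglongrightarrow> l" using s2(2) by (simp add: s_def o_assoc)
  have "(\<lambda>n. ((X \<circ> s) n, (e \<circ> s) n)) \<longlonglongrightarrow> (l, 0)" by (intro tendsto_Pair X LIMSEQ_subseq_LIMSEQ[OF e s])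
  from continuous_on_tendsto_compose[OF scaled_char_continuous[of v vr] this]
  have "(\<lambda>n. scaled_char v vr (X (s n)) (e (s n))) \<longlonglongrightarrow> scaled_char v vr l 0" by simp
  then have "poly (scaled_poly vr) l = 0" using z by (simp add: scaled_char_0 LIMSEQ_const_iff)
  with s X show ?thesis by (rule that)
qed

end

section \<open>Trapping resonances near the limit roots\<close>

text \<open>The disc containing one value and the union of the other discs are disjoint open sets
  that cover the connected image.\<close>

lemma connected_in_one_ball:
  fixes f :: "real \<Rightarrow> complex"
  assumes c: "continuous_on A f" "connected A" and I: "x0 \<in> A"
    and cov: "\<And>x. x \<in> A \<Longrightarrow> \<exists>k\<in>I. f x \<in> ball (c k) r"
    and sep: "\<And>k k'. k \<in> I \<Longrightarrow> k' \<in> I \<Longrightarrow> k \<noteq> k' \<Longrightarrow> 2 * r < dist (c k) (c k')"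
  shows "\<exists>k\<in>I. \<forall>x\<in>A. f x \<in> ball (c k) r"
proof -
  obtain k where k: "k \<in> I" "f x0 \<in> ball (c k) r" using cov[OF I] by blast
  define W where "W = (\<Union>k'\<in>I - {k}. ball (c k') r)"
  have disj: "ball (c k) r \<inter> W = {}"
  proof -
    have "ball (c k) r \<inter> ball (c k') r = {}" if k': "k' \<in> I - {k}" for k'
      by (rule disjoint_ballI) (use sep[of k k'] k(1) k' in auto)
    then show ?thesis unfolding W_def by blast
  qed
  have "ball (c k) r \<inter> f ` A = {} \<or> W \<inter> f ` A = {}"
  proof (rule connectedD[OF connected_continuous_image[OF c]])
    show "open W" unfolding W_def by auto
    show "f ` A \<subseteq> ball (c k) r \<union> W" unfolding W_def using cov by fast
  qed (use disj in auto)
  then have "W \<inter> f ` A = {}" using k I by blast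
  then have "f x \<in> ball (c k) r" if "x \<in> A" for x using cov[OF that] that unfolding W_def by blast
  then show ?thesis using k(1) by blast
qed

context nested_shells
begin

text \<open>Otherwise there are contrasts tending to 0 whose scaled frequencies stay outside all
  discs, although some subsequence must converge to a limit root. The hypothesis of
  \<open>scaled_roots_accumulate\<close> that e times the scaled root tends to 0 is just the
  subwavelength condition.\<close>

lemma resonances_trapped:
  assumes v: "0 < v" "0 < vr" and r: "0 < r" and roots: "\<And>l. poly (scaled_poly vr) l = 0 \<Longrightarrow> l \<in> c ` I"
    and w: "subwavelength_resonant_frequency N rp rm v vr w"
  shows "\<forall>\<^sub>F \<delta> in at_right 0. scaled_char v vr (w \<delta> / of_real (sqrt \<delta>)) (sqrt \<delta>) = 0 \<and>
    (\<exists>k\<in>I. w \<delta> / of_real (sqrt \<delta>) \<in> ball (c k) r)"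
proof -
  obtain \<delta>0 where \<delta>0: "0 < \<delta>0" "\<And>\<delta>. \<delta> \<in> {0<..<\<delta>0} \<Longrightarrow> eigenfrequency N rp rm v vr \<delta> (w \<delta>)" and w0: "(w \<longlongrightarrow> 0) (at_right 0)"
    using w unfolding subwavelength_resonant_frequency_def by blast
  \<comment> \<open>Frequencies below this bound satisfy both smallness conditions under which
    resonance implies the characteristic equation.\<close>
  define b where "b = min (v / 8) (vr / 8) / (2 * rp 1)"
  have b: "0 < b" "norm z \<le> b \<Longrightarrow> norm z * (2 * rp 1) \<le> v / 8" "norm z \<le> b \<Longrightarrow> norm z * (2 * rp 1) \<le> vr / 8" for z :: complex
    using v rp1(2) by (auto simp: b_def pos_le_divide_eq)
  have "\<forall>\<^sub>F \<delta> in at_right 0. norm (w \<delta>) < b" using tendstoD[OF w0 b(1)] by simp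
  moreover have "\<forall>\<^sub>F \<delta> in at_right 0. \<delta> \<in> {0<..<\<delta>0}" by (rule eventually_at_right_real[OF \<delta>0(1)])
  ultimately have root: "\<forall>\<^sub>F \<delta> in at_right 0. 0 < \<delta> \<and> scaled_char v vr (w \<delta> / of_real (sqrt \<delta>)) (sqrt \<delta>) = 0"
  proof eventually_elim
    case (elim \<delta>)
    then show ?case using eigenfrequency_scaled_char[OF v _ \<delta>0(2)] b(2,3)[of "w \<delta>"] by auto
  qed
  have "\<forall>\<^sub>F \<delta> in at_right 0. \<exists>k\<in>I. w \<delta> / of_real (sqrt \<delta>) \<in> ball (c k) r"
  proof (rule ccontr)
    assume "\<not> ?thesis"
    then have fr: "\<exists>\<^sub>F \<delta> in at_right 0. \<not> (\<exists>k\<in>I. w \<delta> / of_real (sqrt \<delta>) \<in> ball (c k) r)" by (simp add: not_eventually)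
    have "\<exists>\<delta>. (0 < \<delta> \<and> scaled_char v vr (w \<delta> / of_real (sqrt \<delta>)) (sqrt \<delta>) = 0) \<and> \<delta> \<in> {0<..<inverse (Suc n)} \<and>
        \<not> (\<exists>k\<in>I. w \<delta> / of_real (sqrt \<delta>) \<in> ball (c k) r)" for n
    proof -
      have "\<forall>\<^sub>F \<delta>::real in at_right 0. \<delta> \<in> {0<..<inverse (Suc n)}" by (rule eventually_at_right_real) simp
      from frequently_ex[OF frequently_eventually_frequently[OF fr eventually_conj[OF root this]]] show ?thesis by blast
    qed
    then obtain d where d: "\<And>n. 0 < d n" "\<And>n. scaled_char v vr (w (d n) / of_real (sqrt (d n))) (sqrt (d n)) = 0"
      "\<And>n. d n < inverse (Suc n)" "\<And>n. \<not> (\<exists>k\<in>I. w (d n) / of_real (sqrt (d n)) \<in> ball (c k) r)" by (metis greaterThanLessThan_iff)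
    have d0: "d \<longlonglongrightarrow> 0"
      by (rule tendsto_sandwich[OF _ _ tendsto_const LIMSEQ_inverse_real_of_nat]) (use d(1,3) less_imp_le in \<open>auto intro!: always_eventually\<close>)
    moreover have "d n \<noteq> 0" for n using d(1)[of n] by simp
    ultimately have "filterlim d (at_right 0) sequentially" using d(1) by (simp add: filterlim_at)
    from filterlim_compose[OF w0 this] have wd: "(\<lambda>n. w (d n)) \<longlonglongrightarrow> 0" .
    have e: "(\<lambda>n. sqrt (d n)) \<longlonglongrightarrow> 0" using tendsto_real_sqrt[OF d0] by simp
    have eX: "(\<lambda>n. of_real (sqrt (d n)) * (w (d n) / of_real (sqrt (d n)))) \<longlonglongrightarrow> 0"
    proof -
      have "complex_of_real (sqrt (d n)) \<noteq> 0" for n using d(1)[of n] by simp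
      then show ?thesis using wd by simp
    qed
    obtain s l where s: "strict_mono s" "((\<lambda>n. w (d n) / of_real (sqrt (d n))) \<circ> s) \<longlonglongrightarrow> l" "poly (scaled_poly vr) l = 0"
      by (rule scaled_roots_accumulate[OF v(2) e eX d(2)])
    obtain k where k: "k \<in> I" "l = c k" using roots[OF s(3)] by blast
    have "\<forall>\<^sub>F n in sequentially. ((\<lambda>n. w (d n) / of_real (sqrt (d n))) \<circ> s) n \<in> ball (c k) r"
      by (rule topological_tendstoD[OF s(2)]) (use k r in auto)
    then obtain n where "((\<lambda>n. w (d n) / of_real (sqrt (d n))) \<circ> s) n \<in> ball (c k) r" by (meson eventually_happens' sequentially_bot)
    then show False using d(4)[of "s n"] k(1) by auto
  qed
  with root show ?thesis by eventually_elim blast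
qed

end

section \<open>Assembling the branches and their expansion\<close>

lemma E1_quadratic_form:
  assumes "x \<in> carrier_vec N" "1 \<le> N"
  shows "x \<bullet> (E1_matrix N *\<^sub>v x) = (vec_index x 0)\<^sup>2"
proof -
  have "vec_index (E1_matrix N *\<^sub>v x) r = (if r = 0 then vec_index x 0 else 0)" if "r < N" for r
    using assms that by (cases "r = 0") (simp_all add: E1_matrix_def scalar_prod_def if_distrib[of "\<lambda>t. t * _"] cong: if_cong)
  then have "x \<bullet> (E1_matrix N *\<^sub>v x) = (\<Sum>r\<in>{0..<N}. vec_index x r * (if r = 0 then vec_index x 0 else 0))"
    unfolding scalar_prod_def using assms by (simp add: E1_matrix_def)
  also have "\<dots> = (vec_index x 0)\<^sup>2" using assms(2) by (simp add: power2_eq_square if_distrib[of "\<lambda>t. _ * t"] cong: if_cong)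
  finally show ?thesis .
qed

theorem theorem3p6:
  fixes N :: nat
    and rp rm :: "nat \<Rightarrow> real"
    and v vr :: real
    and lam :: "nat \<Rightarrow> real"
    and a :: "nat \<Rightarrow> real Matrix.vec"
  assumes "1 \<le> N"
    and "nested_radii N rp rm"
    and "0 < v" and "0 < vr"
    and "\<And>i. i \<in> {1..N} \<Longrightarrow> 0 < lam i"
    and "strict_mono_on {1..N} lam"
    and "\<And>i. i \<in> {1..N} \<Longrightarrow> a i \<in> carrier_vec N"
    and "\<And>i. i \<in> {1..N} \<Longrightarrow>
           capacitance_matrix N rp rm *\<^sub>v a i = lam i \<cdot>\<^sub>v (volume_matrix N rp rm *\<^sub>v a i)"
    and "\<And>i j. i \<in> {1..N} \<Longrightarrow> j \<in> {1..N} \<Longrightarrow>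
           a i \<bullet> (volume_matrix N rp rm *\<^sub>v a j) = (if i = j then 1 else 0)"
  shows "\<exists>\<omega> :: nat \<Rightarrow> real \<Rightarrow> real \<Rightarrow> complex.
    (\<forall>i\<in>{1..N}. \<forall>s\<in>{1, - 1}.
       subwavelength_resonant_frequency N rp rm v vr (\<omega> i s)) \<and>
    (\<forall>\<^sub>F \<delta> in at_right 0. card {\<omega> i s \<delta> | i s. i \<in> {1..N} \<and> s \<in> {1, - 1}} = 2 * N) \<and>
    (\<forall>w. subwavelength_resonant_frequency N rp rm v vr w \<longrightarrow>
       (\<exists>i\<in>{1..N}. \<exists>s\<in>{1, - 1}. \<forall>\<^sub>F \<delta> in at_right 0. w \<delta> = \<omega> i s \<delta>)) \<and>
    (\<forall>i\<in>{1..N}. \<forall>s\<in>{1, - 1}.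
       (\<lambda>\<delta>. \<omega> i s \<delta> -
          (complex_of_real (s * sqrt \<delta> * sqrt (lam i) * vr)
           - 2 * pi * (rp 1)\<^sup>2 * (\<i> * \<delta> * vr\<^sup>2 / v) * (a i \<bullet> (E1_matrix N *\<^sub>v a i))))
       \<in> O[at_right 0](\<lambda>\<delta>. complex_of_real (\<delta> powr (3 / 2))))"
proof -
  interpret nested_shells N rp rm by unfold_locales fact+
  have q: "a i \<bullet> (volume_matrix N rp rm *\<^sub>v a i) = 1" if "i \<in> {1..N}" for i using assms(9)[OF that that] by simp
  have E: "(vec_index (a i) 0)\<^sup>2 = a i \<bullet> (E1_matrix N *\<^sub>v a i)" if "i \<in> {1..N}" for i
    using E1_quadratic_form[OF assms(7)[OF that] assms(1)] by simp
  note ep = eigenpair_char_poly0[OF assms(7) assms(8) q]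
  define \<beta> where "\<beta> = (\<lambda>i. a i \<bullet> (E1_matrix N *\<^sub>v a i))"
  note v = assms(3,4) and lam = assms(5)
  have inj: "inj_on lam {1..N}" by (rule strict_mono_on_imp_inj_on[OF assms(6)])
  have root: "poly char_poly0 (of_real (lam i)) = 0" and simple: "poly (pderiv char_poly0) (of_real (lam i)) \<noteq> 0"
    and ratio: "poly (fst (limit_polys N)) (of_real (lam i)) / poly (pderiv char_poly0) (of_real (lam i)) = - of_real (4 * pi * \<beta> i)"
    if "i \<in> {1..N}" for i
    using ep[OF that that that] E[OF that] by (simp_all add: \<beta>_def)
  \<comment> \<open>Pairs of an eigenvalue index and a sign. \<open>c\<close> gives the limit roots
    \<plusminus> sqrt \<lambda>_i vr of the scaled equation, and \<open>\<nu>\<close> the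
    first-order corrections, which do not depend on the sign.\<close>
  define I where "I = {1..N} \<times> {1, - 1 :: real}"
  define c where "c = (\<lambda>k. complex_of_real (snd k * sqrt (lam (fst k)) * vr))"
  define \<nu> where "\<nu> = (\<lambda>k :: nat \<times> real. - (2 * complex_of_real pi * (of_real (rp 1))\<^sup>2 * (\<i> * (of_real vr)\<^sup>2 / of_real v) * of_real (\<beta> (fst k))))"
  have I: "finite I" "card I = 2 * N" by (simp_all add: I_def card_cartesian_product)
  have sq: "c k ^ 2 / of_real (vr\<^sup>2) = of_real (lam (fst k))" if "k \<in> I" for k
  proof -
    have "(snd k * sqrt (lam (fst k)) * vr) ^ 2 = lam (fst k) * vr\<^sup>2"
      using that lam[of "fst k"] by (auto simp: I_def power_mult_distrib)
    then have "c k ^ 2 = of_real (lam (fst k) * vr\<^sup>2)" unfolding c_def by (metis of_real_power)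
    then show ?thesis using v by simp
  qed
  have c0: "c k \<noteq> 0" if "k \<in> I" for k using that lam[of "fst k"] v by (auto simp: I_def c_def)
  have injc: "k = k'" if k: "k \<in> I" "k' \<in> I" "c k = c k'" for k k'
  proof -
    have "lam (fst k) = lam (fst k')" using sq[OF k(1)] sq[OF k(2)] k(3) by (metis of_real_eq_iff)
    then have f: "fst k = fst k'" by (rule inj_onD[OF inj]) (use k(1,2) in \<open>simp_all add: I_def mem_Times_iff\<close>)
    have "0 < lam (fst k)" using lam k(1) by (auto simp: I_def)
    then have "snd k = snd k'" using k(3) f v by (simp add: c_def)
    then show ?thesis using f by (simp add: prod_eq_iff)
  qed
  have croot: "poly (scaled_poly vr) (c k) = 0" and csimple: "poly (pderiv (scaled_poly vr)) (c k) \<noteq> 0"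
    and cnu: "- poly (radiation_poly v vr) (c k) / poly (pderiv (scaled_poly vr)) (c k) = \<nu> k" if k: "k \<in> I" for k
  proof -
    have i: "fst k \<in> {1..N}" using k by (auto simp: I_def)
    show "poly (scaled_poly vr) (c k) = 0" using root[OF i] unfolding scaled_poly_eval sq[OF k] .
    show "poly (pderiv (scaled_poly vr)) (c k) \<noteq> 0" using simple[OF i] c0[OF k] v unfolding scaled_poly_eval sq[OF k] by simp
    \<comment> \<open>The root \<mu> occurs once in the radiation term and once in the derivative of
      the composition with \<mu>^2 / vr^2. It cancels, and this is why the correction is the same
      for both signs.\<close>
    have *: "- (J / V * \<mu> * U) / (p * (2 * \<mu> / W)) = - J / V * (W / 2) * (U / p)"
      if "\<mu> \<noteq> 0" "W \<noteq> 0" for J V \<mu> U p W :: complex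
    proof -
      have 1: "- (J / V * \<mu> * U) = (- (J / V) * U) * \<mu>" "p * (2 * \<mu> / W) = (2 * p / W) * \<mu>" by simp_all
      show ?thesis unfolding 1 mult_divide_mult_cancel_right[OF that(1)] by (simp only: divide_inverse inverse_mult_distrib inverse_inverse_eq mult_minus_left mult_minus_right mult_ac)
    qed
    have w: "complex_of_real (vr\<^sup>2) \<noteq> 0" using v by simp
    have "- poly (radiation_poly v vr) (c k) / poly (pderiv (scaled_poly vr)) (c k) =
        - (- \<i> * of_real (rp 1) ^ 2) / of_real v * (of_real (vr\<^sup>2) / 2) * (- of_real (4 * pi * \<beta> (fst k)))"
      unfolding scaled_poly_eval sq[OF k] *[OF c0[OF k] w] ratio[OF i] ..
    then show "- poly (radiation_poly v vr) (c k) / poly (pderiv (scaled_poly vr)) (c k) = \<nu> k"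
      by (simp add: \<nu>_def mult_ac)
  qed
  \<comment> \<open>\<open>char_poly0\<close> has degree at most N and the N distinct eigenvalues as
    roots, so there are no others; each of them has two square roots in the scaled variable.\<close>
  have roots: "l \<in> c ` I" if l: "poly (scaled_poly vr) l = 0" for l
  proof -
    have "char_poly0 \<noteq> 0" using simple[of 1] N by auto
    then have "l\<^sup>2 / of_real (vr\<^sup>2) \<in> (\<lambda>i. complex_of_real (lam i)) ` {1..N}"
    proof (rule real_poly_roots_exhausted[OF char_poly0_degree])
      have "inj_on (\<lambda>i. complex_of_real (lam i)) {1..N}"
        by (rule inj_onI) (metis inj_onD[OF inj] of_real_eq_iff)
      then show "card ((\<lambda>i. complex_of_real (lam i)) ` {1..N}) = N" by (simp add: card_image)
      show "poly char_poly0 z = 0" if "z \<in> (\<lambda>i. complex_of_real (lam i)) ` {1..N}" for z using that root by blast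
      show "poly char_poly0 (l\<^sup>2 / of_real (vr\<^sup>2)) = 0" using l unfolding scaled_poly_eval .
    qed (use \<open>char_poly0 \<noteq> 0\<close> in simp_all)
    then obtain i where i: "i \<in> {1..N}" "l\<^sup>2 / of_real (vr\<^sup>2) = complex_of_real (lam i)" by blast
    have "(i, 1) \<in> I" "(i, - 1) \<in> I" using i by (auto simp: I_def)
    moreover have "l\<^sup>2 = c (i, 1) ^ 2" using sq[OF \<open>(i, 1) \<in> I\<close>] i(2) v unfolding fst_conv by (metis divide_cancel_right of_real_eq_0_iff less_irrefl power_eq_0_iff)
    then have "l = c (i, 1) \<or> l = c (i, - 1)" by (auto simp: power2_eq_iff c_def)
    ultimately show ?thesis by blast
  qed
  define G where "G = scaled_char v vr"
  define br where "br = (\<lambda>k r \<eta> m K. continuous_on {0..\<eta>} m \<and>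
      (\<forall>e\<in>{0..\<eta>}. m e \<in> ball (c k) r \<and> G (m e) e = 0 \<and> (\<forall>z\<in>cball (c k) r. G z e = 0 \<longrightarrow> z = m e) \<and>
        norm (m e - (c k + of_real e * \<nu> k)) \<le> K * e ^ 2))"
  have "\<forall>\<^sub>F r in at_right 0. \<exists>\<eta>>0. \<exists>m K. br k r \<eta> m K" if k: "k \<in> I" for k
  proof -
    obtain G' D where "\<And>\<mu> e. ((\<lambda>\<mu>. scaled_char v vr \<mu> e) has_field_derivative G' \<mu> e) (at \<mu>)"
      "continuous_on UNIV (\<lambda>x. G' (fst x) (snd x))" "continuous_on UNIV (\<lambda>x. D (fst x) (snd x))"
      "\<And>\<mu> e. scaled_char v vr \<mu> e = poly (scaled_poly vr) \<mu> + of_real e * poly (radiation_poly v vr) \<mu> + of_real e ^ 2 * D \<mu> e"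
      by (rule scaled_char_structure[of v vr]) blast
    from simple_root_branch[OF this croot[OF k] csimple[OF k]] show ?thesis unfolding br_def G_def cnu[OF k] .
  qed
  \<comment> \<open>One radius \<open>r\<close> is sought for all 2 N roots at once: each disc
    carries a unique branch, avoids 0 so that the frequencies are nonzero, and is disjoint from the
    others so that they are distinct.\<close>
  then have "\<forall>\<^sub>F r in at_right 0. \<forall>k\<in>I. \<exists>\<eta>>0. \<exists>m K. br k r \<eta> m K" using I(1) by (simp add: eventually_ball_finite)
  moreover have "\<forall>\<^sub>F r in at_right 0. \<forall>k\<in>I. r < norm (c k)"
  proof (intro eventually_ball_finite I(1) ballI)
    fix k assume "k \<in> I"
    then have "0 < norm (c k)" using c0 by simp
    from eventually_at_right_real[OF this] show "\<forall>\<^sub>F r in at_right 0. r < norm (c k)" by (rule eventually_mono) auto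
  qed
  moreover have "\<forall>\<^sub>F r in at_right 0. \<forall>k\<in>I. \<forall>k'\<in>I. k \<noteq> k' \<longrightarrow> 2 * r < dist (c k) (c k')"
  proof (intro eventually_ball_finite I(1) ballI)
    fix k k' assume k: "k \<in> I" "k' \<in> I"
    show "\<forall>\<^sub>F r in at_right 0. k \<noteq> k' \<longrightarrow> 2 * r < dist (c k) (c k')"
    proof (cases "k = k'")
      case False
      then have "0 < dist (c k) (c k') / 2" using injc[OF k] by auto
      from eventually_at_right_real[OF this] show ?thesis by (rule eventually_mono) auto
    qed simp
  qed
  moreover have "\<forall>\<^sub>F r::real in at_right 0. 0 < r" by (rule eventually_at_right_less)
  ultimately have "\<forall>\<^sub>F r in at_right 0. (\<forall>k\<in>I. \<exists>\<eta>>0. \<exists>m K. br k r \<eta> m K) \<and> (\<forall>k\<in>I. r < norm (c k)) \<and>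
      (\<forall>k\<in>I. \<forall>k'\<in>I. k \<noteq> k' \<longrightarrow> 2 * r < dist (c k) (c k')) \<and> 0 < r" by (intro eventually_conj)
  from eventually_happens'[OF trivial_limit_at_right_real this] obtain r where
      "(\<forall>k\<in>I. \<exists>\<eta>>0. \<exists>m K. br k r \<eta> m K) \<and> (\<forall>k\<in>I. r < norm (c k)) \<and>
      (\<forall>k\<in>I. \<forall>k'\<in>I. k \<noteq> k' \<longrightarrow> 2 * r < dist (c k) (c k')) \<and> 0 < r" by (rule exE)
  then have r: "\<And>k. k \<in> I \<Longrightarrow> \<exists>\<eta>>0. \<exists>m K. br k r \<eta> m K" "\<And>k. k \<in> I \<Longrightarrow> r < norm (c k)"
      "\<And>k k'. k \<in> I \<Longrightarrow> k' \<in> I \<Longrightarrow> k \<noteq> k' \<Longrightarrow> 2 * r < dist (c k) (c k')" "0 < r"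
    by (elim conjE; simp)+
  from r(1) have "\<forall>k\<in>I. \<exists>t. 0 < fst t \<and> br k r (fst t) (fst (snd t)) (snd (snd t))" by (metis fst_conv snd_conv)
  then obtain t where t: "\<forall>k\<in>I. 0 < fst (t k) \<and> br k r (fst (t k)) (fst (snd (t k))) (snd (snd (t k)))" by (rule bchoice[elim_format]) blast
  define \<eta> m K where "\<eta> = (\<lambda>k. fst (t k))" and "m = (\<lambda>k. fst (snd (t k)))" and "K = (\<lambda>k. snd (snd (t k)))"
  have br: "0 < \<eta> k \<and> br k r (\<eta> k) (m k) (K k)" if "k \<in> I" for k using t that unfolding \<eta>_def m_def K_def by blast
  define \<eta>0 where "\<eta>0 = Min (insert 1 (\<eta> ` I))"
  have \<eta>0: "0 < \<eta>0" "\<And>k. k \<in> I \<Longrightarrow> \<eta>0 \<le> \<eta> k" using I(1) br by (auto simp: \<eta>0_def)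
  have mc: "continuous_on {0..\<eta>0} (m k)" and mb: "e \<in> {0..\<eta>0} \<Longrightarrow> m k e \<in> ball (c k) r"
    and mG: "e \<in> {0..\<eta>0} \<Longrightarrow> G (m k e) e = 0"
    and mu: "e \<in> {0..\<eta>0} \<Longrightarrow> z \<in> ball (c k) r \<Longrightarrow> G z e = 0 \<Longrightarrow> z = m k e"
    and mK: "e \<in> {0..\<eta>0} \<Longrightarrow> norm (m k e - (c k + of_real e * \<nu> k)) \<le> K k * e ^ 2" if k: "k \<in> I" for k e z
  proof -
    have b: "br k r (\<eta> k) (m k) (K k)" and sub: "{0..\<eta>0} \<subseteq> {0..\<eta> k}" using br[OF k] \<eta>0(2)[OF k] by auto
    show "continuous_on {0..\<eta>0} (m k)" using b continuous_on_subset[OF _ sub] unfolding br_def by blast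
    assume "e \<in> {0..\<eta>0}"
    then have "e \<in> {0..\<eta> k}" using sub by blast
    then have *: "m k e \<in> ball (c k) r" "G (m k e) e = 0" "\<And>z. z \<in> cball (c k) r \<Longrightarrow> G z e = 0 \<Longrightarrow> z = m k e"
      "norm (m k e - (c k + of_real e * \<nu> k)) \<le> K k * e ^ 2" using b unfolding br_def by blast+
    show "m k e \<in> ball (c k) r" "G (m k e) e = 0" by fact+
    show "z \<in> ball (c k) r \<Longrightarrow> G z e = 0 \<Longrightarrow> z = m k e" using *(3)[of z] by simp
    show "norm (m k e - (c k + of_real e * \<nu> k)) \<le> K k * e ^ 2" by fact
  qed
  \<comment> \<open>The common range of the branches, \<eta>0 in the variable e = sqrt \<delta>,
    translated back to \<delta>.\<close>
  define \<delta>0 where "\<delta>0 = \<eta>0 ^ 2"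
  have \<delta>0: "0 < \<delta>0" using \<eta>0(1) by (simp add: \<delta>0_def)
  have sqr: "sqrt \<delta> \<in> {0..\<eta>0}" if "\<delta> \<in> {0<..<\<delta>0}" for \<delta>
    using that \<eta>0(1) real_sqrt_le_mono[of \<delta> "\<eta>0 ^ 2"] by (auto simp: \<delta>0_def)
  have ev: "\<forall>\<^sub>F \<delta> in at_right 0. \<delta> \<in> {0<..<\<delta>0}" by (rule eventually_at_right_real[OF \<delta>0])
  define \<omega> where "\<omega> = (\<lambda>i s \<delta>. of_real (sqrt \<delta>) * m (i, s) (sqrt \<delta>))"
  have ms: "continuous_on {0<..<\<delta>0} (\<lambda>\<delta>. m k (sqrt \<delta>))" if "k \<in> I" for k
    by (rule continuous_on_compose2[OF mc[OF that]]) (use sqr in \<open>auto intro!: continuous_intros\<close>)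
  have res: "subwavelength_resonant_frequency N rp rm v vr (\<omega> i s)" if ij: "i \<in> {1..N}" "s \<in> {1, - 1}" for i s
    unfolding subwavelength_resonant_frequency_def
  proof (intro conjI exI[of _ \<delta>0] ballI \<delta>0)
    have k: "(i, s) \<in> I" using ij by (auto simp: I_def)
    show "continuous_on {0<..<\<delta>0} (\<omega> i s)" unfolding \<omega>_def by (intro continuous_intros ms[OF k])
    show "eigenfrequency N rp rm v vr \<delta> (\<omega> i s \<delta>)" if \<delta>: "\<delta> \<in> {0<..<\<delta>0}" for \<delta>
      unfolding \<omega>_def
    proof (rule scaled_char_eigenfrequency[OF v])
      show "m (i, s) (sqrt \<delta>) \<noteq> 0" using mb[OF k sqr[OF \<delta>]] r(2)[OF k] by (auto simp: dist_norm)
      show "scaled_char v vr (m (i, s) (sqrt \<delta>)) (sqrt \<delta>) = 0" using mG[OF k sqr[OF \<delta>]] by (simp add: G_def)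
    qed (use \<delta> in auto)
    have "\<forall>\<^sub>F \<delta> in at_right 0. norm (\<omega> i s \<delta>) \<le> sqrt \<delta> * (norm (c (i, s)) + r)"
      using ev
    proof eventually_elim
      case (elim \<delta>)
      have "norm (m (i, s) (sqrt \<delta>)) \<le> norm (c (i, s)) + r"
        using mb[OF k sqr[OF elim]] norm_triangle_ineq2[of "m (i, s) (sqrt \<delta>)" "c (i, s)"] by (simp add: dist_norm norm_minus_commute)
      then show ?case using elim by (simp add: \<omega>_def norm_mult mult_left_mono)
    qed
    moreover have "((\<lambda>\<delta>. sqrt \<delta> * (norm (c (i, s)) + r)) \<longlongrightarrow> sqrt 0 * (norm (c (i, s)) + r)) (at_right 0)"
      by (intro tendsto_intros)
    then have "((\<lambda>\<delta>. sqrt \<delta> * (norm (c (i, s)) + r)) \<longlongrightarrow> 0) (at_right 0)" by simp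
    ultimately show "(\<omega> i s \<longlongrightarrow> 0) (at_right 0)" by (rule Lim_null_comparison)
  qed
  have card: "\<forall>\<^sub>F \<delta> in at_right 0. card {\<omega> i s \<delta> | i s. i \<in> {1..N} \<and> s \<in> {1, - 1}} = 2 * N"
    using ev
  proof eventually_elim
    case (elim \<delta>)
    have "{\<omega> i s \<delta> | i s. i \<in> {1..N} \<and> s \<in> {1, - 1}} = (\<lambda>k. of_real (sqrt \<delta>) * m k (sqrt \<delta>)) ` I"
      unfolding \<omega>_def I_def by (auto simp: image_iff Bex_def) blast+
    moreover have "inj_on (\<lambda>k. complex_of_real (sqrt \<delta>) * m k (sqrt \<delta>)) I"
    proof (rule inj_onI, rule ccontr)
      fix k k' assume k: "k \<in> I" "k' \<in> I" "of_real (sqrt \<delta>) * m k (sqrt \<delta>) = of_real (sqrt \<delta>) * m k' (sqrt \<delta>)" "k \<noteq> k'"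
      then have "m k (sqrt \<delta>) = m k' (sqrt \<delta>)" using elim by simp
      then have "dist (c k) (c k') \<le> r + r"
        using mb[OF k(1) sqr[OF elim]] mb[OF k(2) sqr[OF elim]] dist_triangle_le[of "c k" "m k (sqrt \<delta>)" "c k'" "r + r"]
        by (simp add: dist_commute)
      then show False using r(3)[OF k(1,2,4)] by simp
    qed
    ultimately show ?case using card_image I(2) by metis
  qed
  have uni: "\<exists>i\<in>{1..N}. \<exists>s\<in>{1, - 1}. \<forall>\<^sub>F \<delta> in at_right 0. w \<delta> = \<omega> i s \<delta>"
    if w: "subwavelength_resonant_frequency N rp rm v vr w" for w
  proof -
    obtain \<delta>1 where \<delta>1: "0 < \<delta>1" "continuous_on {0<..<\<delta>1} w" using w unfolding subwavelength_resonant_frequency_def by blast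
    obtain \<delta>2 where \<delta>2: "0 < \<delta>2" "\<And>\<delta>. 0 < \<delta> \<Longrightarrow> \<delta> < \<delta>2 \<Longrightarrow> G (w \<delta> / of_real (sqrt \<delta>)) (sqrt \<delta>) = 0 \<and> (\<exists>k\<in>I. w \<delta> / of_real (sqrt \<delta>) \<in> ball (c k) r)"
      using resonances_trapped[OF v r(4) roots w] unfolding eventually_at_right_field G_def by blast
    define t where "t = min (min \<delta>0 \<delta>1) \<delta>2"
    have t: "0 < t" "t \<le> \<delta>0" "t \<le> \<delta>1" "t \<le> \<delta>2" using \<delta>0 \<delta>1(1) \<delta>2(1) by (auto simp: t_def)
    \<comment> \<open>The disc could a priori depend on \<delta>; connectedness of the interval and
      separation of the discs fix it, and uniqueness of the root inside identifies the
      branch.\<close>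
    have "\<exists>k\<in>I. \<forall>\<delta>\<in>{0<..<t}. w \<delta> / of_real (sqrt \<delta>) \<in> ball (c k) r"
    proof (rule connected_in_one_ball)
      show "continuous_on {0<..<t} (\<lambda>\<delta>. w \<delta> / of_real (sqrt \<delta>))"
        by (intro continuous_intros continuous_on_subset[OF \<delta>1(2)]) (use t in auto)
      show "t / 2 \<in> {0<..<t}" using t by simp
    qed (use \<delta>2(2) t r(3) in auto)
    then obtain k where k: "k \<in> I" "\<And>\<delta>. \<delta> \<in> {0<..<t} \<Longrightarrow> w \<delta> / of_real (sqrt \<delta>) \<in> ball (c k) r" by blast
    have "\<forall>\<^sub>F \<delta> in at_right 0. w \<delta> = \<omega> (fst k) (snd k) \<delta>"
      using eventually_at_right_real[OF t(1)]
    proof eventually_elim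
      case (elim \<delta>)
      then have "w \<delta> / of_real (sqrt \<delta>) = m k (sqrt \<delta>)" using t \<delta>2(2)[of \<delta>] by (intro mu[OF k(1)] sqr k(2)) auto
      then show ?case using elim by (simp add: \<omega>_def field_simps)
    qed
    moreover have "fst k \<in> {1..N}" "snd k \<in> {1, - 1}" using k(1) by (auto simp: I_def)
    ultimately show ?thesis by blast
  qed
  have exp: "(\<lambda>\<delta>. \<omega> i s \<delta> - (complex_of_real (s * sqrt \<delta> * sqrt (lam i) * vr)
           - complex_of_real (2 * pi * (rp 1)\<^sup>2) * (\<i> * complex_of_real \<delta> * complex_of_real (vr\<^sup>2) / complex_of_real v) * complex_of_real (\<beta> i)))
       \<in> O[at_right 0](\<lambda>\<delta>. complex_of_real (\<delta> powr (3 / 2)))" if ij: "i \<in> {1..N}" "s \<in> {1, - 1}" for i s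
  \<comment> \<open>With e = sqrt \<delta> the frequency is e times the branch, so an error K e^2 of
    the branch becomes K e^3, that is, K \<delta> powr (3 / 2).\<close>
  proof (rule bigoI[of _ "K (i, s)"])
    have k: "(i, s) \<in> I" using ij by (auto simp: I_def)
    show "\<forall>\<^sub>F \<delta> in at_right 0. norm (\<omega> i s \<delta> - (complex_of_real (s * sqrt \<delta> * sqrt (lam i) * vr)
           - complex_of_real (2 * pi * (rp 1)\<^sup>2) * (\<i> * complex_of_real \<delta> * complex_of_real (vr\<^sup>2) / complex_of_real v) * complex_of_real (\<beta> i))) \<le> K (i, s) * norm (complex_of_real (\<delta> powr (3 / 2)))"
      using ev
    proof eventually_elim
      case (elim \<delta>)
      define e where "e = sqrt \<delta>"
      have e: "0 < e" "\<delta> = e ^ 2" "e \<in> {0..\<eta>0}" using elim sqr[OF elim] by (auto simp: e_def)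
      have "\<delta> powr (3 / 2) = e ^ 3"
      proof -
        have "\<delta> powr (3 / 2) = (e powr 2) powr (3 / 2)" using e by simp
        also have "\<dots> = e powr 3" by (simp only: powr_powr) simp
        finally show ?thesis using e by simp
      qed
      moreover have "\<omega> i s \<delta> - (complex_of_real (s * sqrt \<delta> * sqrt (lam i) * vr) - complex_of_real (2 * pi * (rp 1)\<^sup>2) * (\<i> * complex_of_real \<delta> * complex_of_real (vr\<^sup>2) / complex_of_real v) * complex_of_real (\<beta> i))
          = of_real e * (m (i, s) e - (c (i, s) + of_real e * \<nu> (i, s)))"
        unfolding \<omega>_def e_def[symmetric] unfolding e(2) by (simp add: c_def \<nu>_def algebra_simps power2_eq_square)
      moreover have "e * norm (m (i, s) e - (c (i, s) + of_real e * \<nu> (i, s))) \<le> e * (K (i, s) * e ^ 2)"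
        using mK[OF k e(3)] e(1) by (intro mult_left_mono) auto
      ultimately show ?case using e(1) by (simp add: norm_mult power2_eq_square power3_eq_cube mult_ac)
    qed
  qed
  show ?thesis
  proof (rule exI[of _ \<omega>], intro conjI ballI allI impI, goal_cases)
    case 1 then show ?case by (rule res)
  next
    case 2 show ?case by (rule card)
  next
    case 3 then show ?case by (rule uni)
  next
    case 4 then show ?case by (rule exp[unfolded \<beta>_def])
  qed
qed

end
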